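(* Let $m$ be a positive integer, let $K$ be a simplicial complex with vertex set $[m]=\{1,\dots,m\}$, let $\mathbb{R}\mathcal{Z}_K\subset (D^1)^m$ be the polyhedral product of $K$ with respect to the pair $(D^1,S^0)$, and let $(R/\mathcal{I}_K;\mathrm{d})$ and $\lambda$ be as defined in the context. Then for all integers $p\ge 0$ there are isomorphisms \[ \bigoplus_{\omega\subset[m]}\widetilde{H}^{p-1}(K_\omega)\;\xrightarrow[\;\lambda^{-1}\;]{\cong}\; H^p(R/\mathcal{I}_K;\mathrm{d})\;\xrightarrow{\;\cong\;}\; H^p(\mathbb{R}\mathcal{Z}_K). \] Moreover, after endowing $\bigoplus_{p\ge 0}\bigoplus_{\omega\subset[m]}\widetilde{H}^{p-1}(K_\omega)$ with the product structure induced by $\lambda$, these are isomorphisms of $\mathbb{Z}$-algebras (where $H^*(\mathbb{R}\mathcal{Z}_K)$ carries the cup product).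
   Context: All coefficients are in $\mathbb{Z}$; $H^*(\mathbb{R}\mathcal{Z}_K)$ is singular cohomology. **Simplicial complex.** A simplicial complex $K$ on $[m]$ is a family of subsets of $[m]$, closed under taking subsets, containing the empty set, and whose vertex set is $[m]$ (so $\{i\}\in K$ for all $i\in[m]$). For $\omega\subset[m]$ (possibly empty), $K_\omega=\{\sigma\cap\omega\mid\sigma\in K\}$ is the full subcomplex of $K$ on $\omega$. **Polyhedral product.** With $D^1$ a closed interval (identified with $[0,1]$) and $S^0$ its two endpoints, \[ \mathbb{R}\mathcal{Z}_K=\bigcup_{\sigma\in K}\{(x_1,\dots,x_m)\in (D^1)^m \mid x_i\in S^0 \text{ whenever } i\notin\sigma\}, \] with the subspace topology from $(D^1)^m$. **The differential graded ring $R$.** Let $\mathbb{Z}[u_1,\dots,u_m;t_1,\dots,t_m]$ denote the free (noncommutative, unital, associative) graded $\mathbb{Z}$-algebra on $2m$ generators with $\deg u_i=1$, $\deg t_i=0$, with the differential $\mathrm{d}$ determined by $\mathrm{d}u_i=0$, $\mathrm{d}t_i=u_i$ and the graded Leibniz rule $\mathrm{d}(ab)=\mathrm{d}(a)\,b+(-1)^{\deg a}a\,\mathrm{d}(b)$. Let $R$ be its quotient by the two-sided ideal generated by the relations \[ u_it_i=u_i,\quad t_iu_i=0,\quad u_it_j=t_ju_i,\quad t_it_i=t_i,\quad u_iu_i=0,\quad u_iu_j=-u_ju_i,\quad t_it_j=t_jt_i \] for all $i,j\in[m]$ with $i\neq j$. These relations are compatible with $\mathrm{d}$, so $R$ inherits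 the differential. **Stanley–Reisner ideal.** For $\sigma=\{i_0<\dots<i_p\}\subset[m]$ write $u_\sigma=u_{i_0}\cdots u_{i_p}$ and $t_\sigma=t_{i_0}\cdots t_{i_p}$ (with $u_\emptyset=t_\emptyset=1$). $\mathcal{I}_K\subset R$ is the two-sided ideal generated by all $u_\sigma$ with $\sigma\subset[m]$, $\sigma\notin K$. It is closed under $\mathrm{d}$, so $R/\mathcal{I}_K$ is a differential graded ring, additively generated by the monomials $u_\sigma t_\tau$ with $\sigma\in K$, $\tau\subset[m]$, $\sigma\cap\tau=\emptyset$. **The map $\lambda$.** For $\omega\subset[m]$ let $R/\mathcal{I}_K|_\omega$ be the subgroup of $R/\mathcal{I}_K$ generated by all $u_\sigma t_\tau$ with $\sigma\in K$, $\sigma\cap\tau=\emptyset$, $\sigma\cup\tau=\omega$. Each $R/\mathcal{I}_K|_\omega$ is closed under $\mathrm{d}$, and $R/\mathcal{I}_K=\bigoplus_{\omega\subset[m]}R/\mathcal{I}_K|_\omega$. Let $C^*(K_\omega)$ be the augmented simplicial cochain complex of $K_\omega$ (with the empty simplex in degree $-1$, simplices oriented by the increasing order of vertices, and the usual simplicial coboundary), whose cohomology is $\widetilde{H}^*(K_\omega)$; in particular $\widetilde{H}^{-1}(K_\emptyset)=\mathbb{Z}$. The map \[ \lambda_\omega: R/\mathcal{I}_K|_\omega\to C^*(K_\omega),\qquad u_\sigma t_\tau\mapsto\sigma^* \] ($\sigma^*$ the cochain dual to $\sigma$) is a bijective cochain map lowering degree by one, so it induces isomorphisms $H^p(R/\mathcal{I}_K|_\omega;\mathrm{d})\cong\widetilde{H}^{p-1}(K_\omega)$.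 Let $\lambda=\bigoplus_{\omega\subset[m]}\lambda_\omega$, as well as the induced map in cohomology. The product structure induced by $\lambda$ on $\bigoplus_{p}\bigoplus_{\omega}\widetilde{H}^{p-1}(K_\omega)$ is induced from the product on cochains in $\bigoplus_\omega C^*(K_\omega)$ given by $a\cdot b=\lambda(\lambda^{-1}(a)\,\lambda^{-1}(b))$, the multiplication on the right being that of $R/\mathcal{I}_K$. *)

theory Defs
  imports "HOL-Homology.Homology" "HOL-Algebra.QuotRing"
begin

section \<open>Simplicial complexes and real moment-angle complexes\<close>

definition simplicial_complex_on :: "nat \<Rightarrow> nat set set \<Rightarrow> bool" where
  "simplicial_complex_on m K \<longleftrightarrow>
     {} \<in> K \<and> (\<forall>\<sigma>\<in>K. \<sigma> \<subseteq> {1..m}) \<and> (\<forall>\<sigma>\<in>K. \<forall>\<tau>. \<tau> \<subseteq> \<sigma> \<longrightarrow> \<tau> \<in> K) \<and> (\<forall>i\<in>{1..m}. {i} \<in> K)"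

definition full_subcomplex :: "nat set set \<Rightarrow> nat set \<Rightarrow> nat set set" where
  "full_subcomplex K \<omega> = {\<sigma> \<inter> \<omega> |\<sigma>. \<sigma> \<in> K}"

text \<open>The cube \<open>(D\<^sup>1)\<^sup>m\<close> is the product topology on the extensional functions
  \<open>{1..m} \<rightarrow> {0..1}\<close>, with \<open>S\<^sup>0 = {0, 1}\<close>.\<close>

definition unit_cube :: "nat \<Rightarrow> (nat \<Rightarrow> real) topology" where
  "unit_cube m = product_topology (\<lambda>_. top_of_set {0..1}) {1..m}"

definition real_moment_angle :: "nat \<Rightarrow> nat set set \<Rightarrow> (nat \<Rightarrow> real) topology" where
  "real_moment_angle m K =
     subtopology (unit_cube m)
       (\<Union>\<sigma>\<in>K. {x \<in> topspace (unit_cube m). \<forall>i\<in>{1..m}. i \<notin> \<sigma> \<longrightarrow> x i \<in> {0, 1}})"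


section \<open>Cohomology of cochain complexes\<close>

text \<open>Abelian groups are written multiplicatively, as \<^typ>\<open>'a monoid\<close> records. A cochain complex
  is a family of groups \<open>C p\<close> with differentials \<open>d p : C p \<rightarrow> C (p + 1)\<close>, indexed by all integers.\<close>

definition cocycles :: "(int \<Rightarrow> 'a monoid) \<Rightarrow> (int \<Rightarrow> 'a \<Rightarrow> 'a) \<Rightarrow> int \<Rightarrow> 'a set" where
  "cocycles C d p = kernel (C p) (C (p + 1)) (d p)"

definition coboundaries :: "(int \<Rightarrow> 'a monoid) \<Rightarrow> (int \<Rightarrow> 'a \<Rightarrow> 'a) \<Rightarrow> int \<Rightarrow> 'a set" where
  "coboundaries C d p = d (p - 1) ` carrier (C (p - 1))"

definition cohomology :: "(int \<Rightarrow> 'a monoid) \<Rightarrow> (int \<Rightarrow> 'a \<Rightarrow> 'a) \<Rightarrow> int \<Rightarrow> 'a set monoid" where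
  "cohomology C d p = (C p)\<lparr>carrier := cocycles C d p\<rparr> Mod coboundaries C d p"

text \<open>Induced map on quotients, in the style of \<^const>\<open>rcoset_mult\<close>: if \<open>f\<close> maps a coset \<open>A\<close> into a
  single coset of \<open>N\<close>, then the union below is that coset.\<close>

definition coset_map :: "('b, 'c) monoid_scheme \<Rightarrow> 'b set \<Rightarrow> ('a \<Rightarrow> 'b) \<Rightarrow> 'a set \<Rightarrow> 'b set" where
  "coset_map G N f A = (\<Union>a\<in>A. N #>\<^bsub>G\<^esub> f a)"

definition cohomology_mult ::
  "(int \<Rightarrow> 'a monoid) \<Rightarrow> (int \<Rightarrow> 'a \<Rightarrow> 'a) \<Rightarrow> (int \<Rightarrow> int \<Rightarrow> 'a \<Rightarrow> 'a \<Rightarrow> 'a) \<Rightarrow>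
   int \<Rightarrow> int \<Rightarrow> 'a set \<Rightarrow> 'a set \<Rightarrow> 'a set" where
  "cohomology_mult C d mul p q X Y =
     (\<Union>x\<in>X. \<Union>y\<in>Y. coboundaries C d (p + q) #>\<^bsub>C (p + q)\<^esub> mul p q x y)"

text \<open>The ring with underlying group \<open>\<Oplus>\<^sub>p H p\<close>, \<open>p \<ge> 0\<close>, and multiplication determined by the
  pairings \<open>M p q : H p \<times> H q \<rightarrow> H (p + q)\<close>; the unit \<open>e\<close> lies in \<open>H 0\<close>.\<close>

definition graded_ring ::
  "(int \<Rightarrow> 'a monoid) \<Rightarrow> (int \<Rightarrow> int \<Rightarrow> 'a \<Rightarrow> 'a \<Rightarrow> 'a) \<Rightarrow> 'a \<Rightarrow> (int \<Rightarrow> 'a) ring" where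
  "graded_ring H M e =
     \<lparr>carrier = carrier (sum_group {0..} H),
      mult = (\<lambda>x y. \<lambda>n\<in>{0..}. finprod (H n) (\<lambda>i. M i (n - i) (x i) (y (n - i))) {0..n}),
      one = (\<lambda>n\<in>{0..}. if n = 0 then e else \<one>\<^bsub>H n\<^esub>),
      zero = \<one>\<^bsub>sum_group {0..} H\<^esub>,
      add = (\<lambda>x y. x \<otimes>\<^bsub>sum_group {0..} H\<^esub> y)\<rparr>"

definition cohomology_ring ::
  "(int \<Rightarrow> 'a monoid) \<Rightarrow> (int \<Rightarrow> 'a \<Rightarrow> 'a) \<Rightarrow> (int \<Rightarrow> int \<Rightarrow> 'a \<Rightarrow> 'a \<Rightarrow> 'a) \<Rightarrow> 'a \<Rightarrow>
   (int \<Rightarrow> 'a set) ring" where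
  "cohomology_ring C d mul e =
     graded_ring (cohomology C d) (cohomology_mult C d mul) (coboundaries C d 0 #>\<^bsub>C 0\<^esub> e)"

text \<open>The map \<open>\<Oplus>\<^sub>p f p\<close> on graded rings.\<close>

definition graded_map :: "(int \<Rightarrow> 'a \<Rightarrow> 'b) \<Rightarrow> (int \<Rightarrow> 'a) \<Rightarrow> int \<Rightarrow> 'b" where
  "graded_map f x = (\<lambda>p\<in>{0..}. f p (x p))"


section \<open>Singular cohomology with the cup product\<close>

text \<open>A \<open>p\<close>-cochain is an integer-valued function on the singular \<open>p\<close>-simplices, extended by \<open>0\<close> to
  everything else; in negative degrees only the zero cochain remains.\<close>

type_synonym 'a cochain = "((nat \<Rightarrow> real) \<Rightarrow> 'a) \<Rightarrow> int"

definition singular_cochain_group :: "'a topology \<Rightarrow> int \<Rightarrow> 'a cochain monoid" where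
  "singular_cochain_group X p =
     \<lparr>carrier = {\<phi>. \<forall>\<sigma>. \<phi> \<sigma> \<noteq> 0 \<longrightarrow> 0 \<le> p \<and> singular_simplex (nat p) X \<sigma>},
      monoid.mult = (\<lambda>\<phi> \<psi> \<sigma>. \<phi> \<sigma> + \<psi> \<sigma>), one = (\<lambda>_. 0)\<rparr>"

definition evaluate :: "'a cochain \<Rightarrow> 'a chain \<Rightarrow> int" where
  "evaluate \<phi> c = (\<Sum>\<sigma>\<in>Poly_Mapping.keys c. Poly_Mapping.lookup c \<sigma> * \<phi> \<sigma>)"

definition singular_coboundary :: "'a topology \<Rightarrow> int \<Rightarrow> 'a cochain \<Rightarrow> 'a cochain" where
  "singular_coboundary X p \<phi> =
     (\<lambda>\<sigma>. if singular_simplex (nat (p + 1)) X \<sigma>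
          then evaluate \<phi> (chain_boundary (nat (p + 1)) (frag_of \<sigma>)) else 0)"

text \<open>Restrictions of a singular \<open>(p + q)\<close>-simplex to the face spanned by the vertices
  \<open>0, \<dots>, p\<close> and to the one spanned by \<open>p, \<dots>, p + q\<close>.\<close>

definition front_face :: "nat \<Rightarrow> ((nat \<Rightarrow> real) \<Rightarrow> 'a) \<Rightarrow> (nat \<Rightarrow> real) \<Rightarrow> 'a" where
  "front_face p \<sigma> = restrict \<sigma> (standard_simplex p)"

definition back_face :: "nat \<Rightarrow> nat \<Rightarrow> ((nat \<Rightarrow> real) \<Rightarrow> 'a) \<Rightarrow> (nat \<Rightarrow> real) \<Rightarrow> 'a" where
  "back_face p q \<sigma> = restrict (\<lambda>x. \<sigma> (\<lambda>i. if i < p then 0 else x (i - p))) (standard_simplex q)"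

definition cup :: "'a topology \<Rightarrow> int \<Rightarrow> int \<Rightarrow> 'a cochain \<Rightarrow> 'a cochain \<Rightarrow> 'a cochain" where
  "cup X p q \<phi> \<psi> =
     (\<lambda>\<sigma>. if 0 \<le> p \<and> 0 \<le> q \<and> singular_simplex (nat (p + q)) X \<sigma>
          then \<phi> (front_face (nat p) \<sigma>) * \<psi> (back_face (nat p) (nat q) \<sigma>) else 0)"

definition unit_cochain :: "'a topology \<Rightarrow> 'a cochain" where
  "unit_cochain X = (\<lambda>\<sigma>. if singular_simplex 0 X \<sigma> then 1 else 0)"

definition singular_cohomology :: "'a topology \<Rightarrow> int \<Rightarrow> 'a cochain set monoid" where
  "singular_cohomology X p = cohomology (singular_cochain_group X) (singular_coboundary X) p"

definition singular_cohomology_ring :: "'a topology \<Rightarrow> (int \<Rightarrow> 'a cochain set) ring" where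
  "singular_cohomology_ring X =
     cohomology_ring (singular_cochain_group X) (singular_coboundary X) (cup X) (unit_cochain X)"


section \<open>Augmented simplicial cochains\<close>

text \<open>For a finite complex \<open>L\<close>, the total group \<open>C\<^sup>*(L)\<close> consists of the integer-valued functions on
  \<open>L\<close>, extended by \<open>0\<close>; those of degree \<open>q \<ge> -1\<close> are supported on the simplices with
  \<open>q + 1\<close> vertices.\<close>

definition simplicial_cochains :: "nat set set \<Rightarrow> (nat set \<Rightarrow> int) monoid" where
  "simplicial_cochains L =
     \<lparr>carrier = {c. \<forall>\<sigma>. c \<sigma> \<noteq> 0 \<longrightarrow> \<sigma> \<in> L}, monoid.mult = (\<lambda>a b \<sigma>. a \<sigma> + b \<sigma>), one = (\<lambda>_. 0)\<rparr>"

definition simplicial_cochain_group :: "nat set set \<Rightarrow> int \<Rightarrow> (nat set \<Rightarrow> int) monoid" where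
  "simplicial_cochain_group L q =
     (simplicial_cochains L)
       \<lparr>carrier := {c \<in> carrier (simplicial_cochains L). \<forall>\<sigma>. c \<sigma> \<noteq> 0 \<longrightarrow> int (card \<sigma>) = q + 1}\<rparr>"

definition dual_cochain :: "nat set \<Rightarrow> nat set \<Rightarrow> int" where
  "dual_cochain \<sigma> = (\<lambda>\<rho>. if \<rho> = \<sigma> then 1 else 0)"

text \<open>The exponent is the position of the vertex \<open>v\<close> in the increasing enumeration of \<open>\<sigma>\<close>.\<close>

definition simplicial_coboundary :: "nat set set \<Rightarrow> (nat set \<Rightarrow> int) \<Rightarrow> nat set \<Rightarrow> int" where
  "simplicial_coboundary L c =
     (\<lambda>\<sigma>. if \<sigma> \<in> L then \<Sum>v\<in>\<sigma>. (-1) ^ card {w \<in> \<sigma>. w < v} * c (\<sigma> - {v}) else 0)"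

definition reduced_cohomology :: "nat set set \<Rightarrow> int \<Rightarrow> (nat set \<Rightarrow> int) set monoid" where
  "reduced_cohomology L q =
     cohomology (simplicial_cochain_group L) (\<lambda>_. simplicial_coboundary L) q"


section \<open>The differential graded ring \<open>R\<close>\<close>

subsection \<open>The free graded algebra and its differential\<close>

text \<open>\<open>U i\<close> and \<open>T i\<close> stand for \<open>u\<^sub>i\<close> and \<open>t\<^sub>i\<close>. The free algebra is spanned by the words in the
  generators, multiplied by concatenation.\<close>

datatype gen = U nat | T nat

definition gens :: "nat \<Rightarrow> gen set" where
  "gens m = U ` {1..m} \<union> T ` {1..m}"

definition free_mult :: "('x list \<Rightarrow>\<^sub>0 int) \<Rightarrow> ('x list \<Rightarrow>\<^sub>0 int) \<Rightarrow> 'x list \<Rightarrow>\<^sub>0 int" where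
  "free_mult a b = frag_extend (\<lambda>v. frag_extend (\<lambda>w. frag_of (v @ w)) b) a"

definition free_algebra :: "'x set \<Rightarrow> ('x list \<Rightarrow>\<^sub>0 int) ring" where
  "free_algebra S =
     \<lparr>carrier = {a. Poly_Mapping.keys a \<subseteq> lists S}, mult = free_mult, one = frag_of [],
      zero = 0, add = (+)\<rparr>"

fun gen_deg :: "gen \<Rightarrow> nat" where
  "gen_deg (U i) = 1"
| "gen_deg (T i) = 0"

definition word_deg :: "gen list \<Rightarrow> nat" where
  "word_deg w = sum_list (map gen_deg w)"

fun diff_gen :: "gen \<Rightarrow> gen list \<Rightarrow>\<^sub>0 int" where
  "diff_gen (U i) = 0"
| "diff_gen (T i) = frag_of [U i]"

text \<open>The recursion is the graded Leibniz rule for the product of a generator and a word.\<close>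

fun diff_word :: "gen list \<Rightarrow> gen list \<Rightarrow>\<^sub>0 int" where
  "diff_word [] = 0"
| "diff_word (x # w) =
     free_mult (diff_gen x) (frag_of w)
     + frag_cmul ((-1) ^ gen_deg x) (free_mult (frag_of [x]) (diff_word w))"

definition diff_free :: "(gen list \<Rightarrow>\<^sub>0 int) \<Rightarrow> gen list \<Rightarrow>\<^sub>0 int" where
  "diff_free = frag_extend diff_word"

subsection \<open>The quotients \<open>R\<close> and \<open>R/I\<^sub>K\<close>\<close>

text \<open>An equation \<open>a = b\<close> is represented by the element \<open>a - b\<close>.\<close>

definition relations :: "nat \<Rightarrow> (gen list \<Rightarrow>\<^sub>0 int) set" where
  "relations m =
     (\<Union>i\<in>{1..m}. {frag_of [U i, T i] - frag_of [U i],
                   frag_of [T i, U i],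
                   frag_of [T i, T i] - frag_of [T i],
                   frag_of [U i, U i]}) \<union>
     (\<Union>i\<in>{1..m}. \<Union>j\<in>{1..m} - {i}.
                  {frag_of [U i, T j] - frag_of [T j, U i],
                   frag_of [U i, U j] + frag_of [U j, U i],
                   frag_of [T i, T j] - frag_of [T j, T i]})"

definition relation_ideal :: "nat \<Rightarrow> (gen list \<Rightarrow>\<^sub>0 int) set" where
  "relation_ideal m = genideal (free_algebra (gens m)) (relations m)"

type_synonym R_elem = "(gen list \<Rightarrow>\<^sub>0 int) set"

definition R_ring :: "nat \<Rightarrow> R_elem ring" where
  "R_ring m = free_algebra (gens m) Quot relation_ideal m"

definition R_proj :: "nat \<Rightarrow> (gen list \<Rightarrow>\<^sub>0 int) \<Rightarrow> R_elem" where
  "R_proj m a = relation_ideal m +>\<^bsub>free_algebra (gens m)\<^esub> a"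

definition R_diff :: "nat \<Rightarrow> R_elem \<Rightarrow> R_elem" where
  "R_diff m = coset_map (add_monoid (free_algebra (gens m))) (relation_ideal m) diff_free"

definition u_word :: "nat set \<Rightarrow> gen list" where
  "u_word \<sigma> = map U (sorted_list_of_set \<sigma>)"

definition t_word :: "nat set \<Rightarrow> gen list" where
  "t_word \<tau> = map T (sorted_list_of_set \<tau>)"

definition SR_ideal :: "nat \<Rightarrow> nat set set \<Rightarrow> R_elem set" where
  "SR_ideal m K =
     genideal (R_ring m) {R_proj m (frag_of (u_word \<sigma>)) |\<sigma>. \<sigma> \<subseteq> {1..m} \<and> \<sigma> \<notin> K}"

text \<open>From here on the prefix \<open>SR\<close> refers to \<open>R/I\<^sub>K\<close>.\<close>

type_synonym SR_elem = "R_elem set"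

definition SR_ring :: "nat \<Rightarrow> nat set set \<Rightarrow> SR_elem ring" where
  "SR_ring m K = R_ring m Quot SR_ideal m K"

definition SR_proj :: "nat \<Rightarrow> nat set set \<Rightarrow> (gen list \<Rightarrow>\<^sub>0 int) \<Rightarrow> SR_elem" where
  "SR_proj m K a = SR_ideal m K +>\<^bsub>R_ring m\<^esub> R_proj m a"

definition SR_diff :: "nat \<Rightarrow> nat set set \<Rightarrow> SR_elem \<Rightarrow> SR_elem" where
  "SR_diff m K = coset_map (add_monoid (R_ring m)) (SR_ideal m K) (R_diff m)"

definition SR_part :: "nat \<Rightarrow> nat set set \<Rightarrow> int \<Rightarrow> SR_elem monoid" where
  "SR_part m K p =
     (add_monoid (SR_ring m K))
       \<lparr>carrier := SR_proj m K ` {a \<in> carrier (free_algebra (gens m)).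
                                   \<forall>w\<in>Poly_Mapping.keys a. int (word_deg w) = p}\<rparr>"

definition SR_cohomology :: "nat \<Rightarrow> nat set set \<Rightarrow> int \<Rightarrow> SR_elem set monoid" where
  "SR_cohomology m K p = cohomology (SR_part m K) (\<lambda>_. SR_diff m K) p"

definition SR_cohomology_ring :: "nat \<Rightarrow> nat set set \<Rightarrow> (int \<Rightarrow> SR_elem set) ring" where
  "SR_cohomology_ring m K =
     cohomology_ring (SR_part m K) (\<lambda>_. SR_diff m K)
       (\<lambda>_ _ x y. x \<otimes>\<^bsub>SR_ring m K\<^esub> y) \<one>\<^bsub>SR_ring m K\<^esub>"


section \<open>The map \<open>\<lambda>\<close>\<close>

definition SR_monomial :: "nat \<Rightarrow> nat set set \<Rightarrow> nat set \<Rightarrow> nat set \<Rightarrow> SR_elem" where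
  "SR_monomial m K \<sigma> \<tau> = SR_proj m K (frag_of (u_word \<sigma> @ t_word \<tau>))"

definition SR_restrict :: "nat \<Rightarrow> nat set set \<Rightarrow> nat set \<Rightarrow> SR_elem monoid" where
  "SR_restrict m K \<omega> =
     subgroup_generated (add_monoid (SR_ring m K))
       {SR_monomial m K \<sigma> \<tau> |\<sigma> \<tau>. \<sigma> \<in> K \<and> \<sigma> \<inter> \<tau> = {} \<and> \<sigma> \<union> \<tau> = \<omega>}"

text \<open>\<open>\<lambda>\<^sub>\<omega>\<close> is the homomorphism with the prescribed values on the generators of \<open>R/I\<^sub>K|\<^sub>\<omega>\<close>, and
  \<open>\<lambda> = \<Oplus>\<^sub>\<omega> \<lambda>\<^sub>\<omega>\<close> is the homomorphism on \<open>R/I\<^sub>K\<close> that restricts to \<open>\<lambda>\<^sub>\<omega>\<close> on each direct summand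
  \<open>R/I\<^sub>K|\<^sub>\<omega>\<close>. Both are normalised to be \<^term>\<open>undefined\<close> outside their domain.\<close>

definition lambda_on :: "nat \<Rightarrow> nat set set \<Rightarrow> nat set \<Rightarrow> SR_elem \<Rightarrow> nat set \<Rightarrow> int" where
  "lambda_on m K \<omega> =
     (THE f. f \<in> extensional (carrier (SR_restrict m K \<omega>)) \<and>
             f \<in> hom (SR_restrict m K \<omega>) (simplicial_cochains (full_subcomplex K \<omega>)) \<and>
             (\<forall>\<sigma> \<tau>. \<sigma> \<in> K \<longrightarrow> \<sigma> \<inter> \<tau> = {} \<longrightarrow> \<sigma> \<union> \<tau> = \<omega> \<longrightarrow>
                f (SR_monomial m K \<sigma> \<tau>) = dual_cochain \<sigma>))"

definition lambda_target :: "nat \<Rightarrow> nat set set \<Rightarrow> (nat set \<Rightarrow> nat set \<Rightarrow> int) monoid" where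
  "lambda_target m K =
     sum_group (Pow {1..m}) (\<lambda>\<omega>. simplicial_cochains (full_subcomplex K \<omega>))"

definition lambda_map :: "nat \<Rightarrow> nat set set \<Rightarrow> SR_elem \<Rightarrow> nat set \<Rightarrow> nat set \<Rightarrow> int" where
  "lambda_map m K =
     (THE f. f \<in> extensional (carrier (SR_ring m K)) \<and>
             f \<in> hom (add_monoid (SR_ring m K)) (lambda_target m K) \<and>
             (\<forall>\<omega>\<in>Pow {1..m}. \<forall>x\<in>carrier (SR_restrict m K \<omega>).
                f x = (\<lambda>\<eta>\<in>Pow {1..m}. if \<eta> = \<omega> then lambda_on m K \<omega> x else (\<lambda>_. 0))))"

definition lambda_inv :: "nat \<Rightarrow> nat set set \<Rightarrow> (nat set \<Rightarrow> nat set \<Rightarrow> int) \<Rightarrow> SR_elem" where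
  "lambda_inv m K = inv_into (carrier (SR_ring m K)) (lambda_map m K)"


section \<open>The sum of the reduced cohomology groups\<close>

definition reduced_sum ::
  "nat \<Rightarrow> nat set set \<Rightarrow> int \<Rightarrow> (nat set \<Rightarrow> (nat set \<Rightarrow> int) set) monoid" where
  "reduced_sum m K p =
     sum_group (Pow {1..m}) (\<lambda>\<omega>. reduced_cohomology (full_subcomplex K \<omega>) (p - 1))"

text \<open>The class in \<open>\<Oplus>\<^sub>\<omega> H\<^sup>p\<^sup>-\<^sup>1(K\<^sub>\<omega>)\<close> (reduced cohomology) of a family of cochains.\<close>

definition reduced_class ::
  "nat \<Rightarrow> nat set set \<Rightarrow> int \<Rightarrow> (nat set \<Rightarrow> nat set \<Rightarrow> int) \<Rightarrow> nat set \<Rightarrow> (nat set \<Rightarrow> int) set" where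
  "reduced_class m K p a =
     (\<lambda>\<omega>\<in>Pow {1..m}.
        coboundaries (simplicial_cochain_group (full_subcomplex K \<omega>))
            (\<lambda>_. simplicial_coboundary (full_subcomplex K \<omega>)) (p - 1)
          #>\<^bsub>simplicial_cochain_group (full_subcomplex K \<omega>) (p - 1)\<^esub> a \<omega>)"

text \<open>The map induced by \<open>\<lambda>\<close> in degree \<open>p\<close> cohomology, as in \<^const>\<open>coset_map\<close>, component by
  component.\<close>

definition lambda_cohomology ::
  "nat \<Rightarrow> nat set set \<Rightarrow> int \<Rightarrow> SR_elem set \<Rightarrow> nat set \<Rightarrow> (nat set \<Rightarrow> int) set" where
  "lambda_cohomology m K p X =
     (\<lambda>\<omega>\<in>Pow {1..m}. \<Union>x\<in>X. reduced_class m K p (lambda_map m K x) \<omega>)"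

definition lambda_cohomology_inv ::
  "nat \<Rightarrow> nat set set \<Rightarrow> int \<Rightarrow> (nat set \<Rightarrow> (nat set \<Rightarrow> int) set) \<Rightarrow> SR_elem set" where
  "lambda_cohomology_inv m K p =
     inv_into (carrier (SR_cohomology m K p)) (lambda_cohomology m K p)"

text \<open>The product induced by \<open>\<lambda>\<close>, first on families of cochains and then on cohomology; the elements
  of \<open>PiE (Pow {1..m}) X\<close> are the families of cochains representing \<open>X\<close>.\<close>

definition lambda_mult ::
  "nat \<Rightarrow> nat set set \<Rightarrow> (nat set \<Rightarrow> nat set \<Rightarrow> int) \<Rightarrow> (nat set \<Rightarrow> nat set \<Rightarrow> int) \<Rightarrow>
   nat set \<Rightarrow> nat set \<Rightarrow> int" where
  "lambda_mult m K a b =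
     lambda_map m K (lambda_inv m K a \<otimes>\<^bsub>SR_ring m K\<^esub> lambda_inv m K b)"

definition reduced_mult ::
  "nat \<Rightarrow> nat set set \<Rightarrow> int \<Rightarrow> int \<Rightarrow> (nat set \<Rightarrow> (nat set \<Rightarrow> int) set) \<Rightarrow>
   (nat set \<Rightarrow> (nat set \<Rightarrow> int) set) \<Rightarrow> nat set \<Rightarrow> (nat set \<Rightarrow> int) set" where
  "reduced_mult m K p q X Y =
     (\<lambda>\<omega>\<in>Pow {1..m}. \<Union>a\<in>PiE (Pow {1..m}) X. \<Union>b\<in>PiE (Pow {1..m}) Y.
        reduced_class m K (p + q) (lambda_mult m K a b) \<omega>)"

definition reduced_sum_ring ::
  "nat \<Rightarrow> nat set set \<Rightarrow> (int \<Rightarrow> nat set \<Rightarrow> (nat set \<Rightarrow> int) set) ring" where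
  "reduced_sum_ring m K =
     graded_ring (reduced_sum m K) (reduced_mult m K)
       (reduced_class m K 0 (lambda_map m K \<one>\<^bsub>SR_ring m K\<^esub>))"

end

theory Submission
  imports Defs
begin

text \<open>The complex \<open>\<real>Z\<^sub>K\<close> is the union of the faces \<open>(\<sigma>, E)\<close>, \<open>\<sigma> \<in> K\<close>, of the cube, where \<open>\<sigma>\<close> is the set of free
  coordinates and \<open>E\<close> the set of coordinates fixed at \<open>1\<close>. Cubical cochains form a differential graded
  ring under the Serre product. Sending \<open>t\<^sub>i\<close> to the indicator function of the vertices with
  \<open>x\<^sub>i = 1\<close> and \<open>u\<^sub>i\<close> to its coboundary identifies \<open>R / I\<^sub>K\<close> with this ring; the coefficient of \<open>u\<^sub>\<sigma> t\<^sub>\<tau>\<close>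
  is recovered from the values on the faces \<open>(\<sigma>, E)\<close>, \<open>E \<subseteq> \<tau>\<close>, by Moebius inversion, which makes \<open>\<lambda>\<close>
  explicit.

  The shuffle triangulation of the faces maps cubical chains to singular chains. It turns the
  Alexander--Whitney diagonal into the Serre diagonal, so restriction of singular cochains to
  triangulated faces is strictly multiplicative. It is a quasi-isomorphism: after iterated
  barycentric subdivision a singular simplex is so small that rounding its points to vertices
  yields the vertices of a single face of \<open>\<real>Z\<^sub>K\<close>, and these faces are acyclic carriers for a homotopy inverse.\<close>

section \<open>Graded rings\<close>

text \<open>A quasi-isomorphism by itself says nothing about products, so the comparison is set up
  on cochains, where it can be strictly multiplicative. This dictates its direction: singular
  cochains restrict to cells, and the isomorphism out of the cohomology of \<open>R / I_K\<close> is
  obtained as an inverse in cohomology, without a formula on cochains. \<open>R\<close> and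
  \<open>I_K\<close> are given by generators and relations, so not even the additive structure of
  the quotient is visible. Rewriting of words shows that the monomials span; evaluation on cells,
  followed by Moebius inversion, shows that they are independent. For the full simplex the same
  argument identifies the relation ideal with a kernel of evaluation, so the differential descends
  because it commutes with evaluation. The product on reduced cohomology is defined through
  \<lambda>. Its ring laws are therefore transported along \<lambda>, once the cochain families
  representing a class are seen to be the images of the representatives in
  \<open>R / I_K\<close>.\<close>

lemma (in comm_group) finprod_Sigma:
  assumes "finite A" "\<And>i. i \<in> A \<Longrightarrow> finite (B i)"
    and "\<And>i j. i \<in> A \<Longrightarrow> j \<in> B i \<Longrightarrow> f i j \<in> carrier G"
  shows "finprod G (\<lambda>i. finprod G (f i) (B i)) A = finprod G (\<lambda>(i, j). f i j) (Sigma A B)"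
  using assms
proof (induction A rule: finite_induct)
  case empty
  then show ?case by simp
next
  case (insert a A)
  have S: "Sigma (insert a A) B = Pair a ` B a \<union> Sigma A B"
    by auto
  have "finprod G (\<lambda>(i, j). f i j) (Sigma (insert a A) B)
      = finprod G (\<lambda>(i, j). f i j) (Pair a ` B a) \<otimes> finprod G (\<lambda>(i, j). f i j) (Sigma A B)"
    unfolding S using insert by (intro finprod_Un_disjoint) auto
  also have "finprod G (\<lambda>(i, j). f i j) (Pair a ` B a) = finprod G (f a) (B a)"
    using insert by (subst finprod_reindex) (auto simp: inj_on_def Pi_def)
  also have "finprod G (\<lambda>(i, j). f i j) (Sigma A B) = finprod G (\<lambda>i. finprod G (f i) (B i)) A"
    using insert by simp
  finally show ?case
    using insert by (subst finprod_insert) (auto simp: Pi_def)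
qed

lemma hom_finprod:
  assumes "comm_group G" "comm_group H" "h \<in> hom G H" "finite A" "f \<in> A \<rightarrow> carrier G"
  shows "h (finprod G f A) = finprod H (\<lambda>i. h (f i)) A"
proof -
  interpret G: comm_group G by fact
  interpret H: comm_group H by fact
  interpret h: group_hom G H h by unfold_locales fact
  from assms(4,5) show ?thesis
  proof (induction A rule: finite_induct)
    case (insert a A)
    then have "f a \<in> carrier G" "f \<in> A \<rightarrow> carrier G" by auto
    with insert show ?case
      by (subst G.finprod_insert, simp, simp, simp, simp, subst H.finprod_insert) (auto simp: Pi_def)
  qed simp
qed

text \<open>These are laws for homogeneous elements in the nonnegative degrees, over which
  \<open>graded_ring\<close> takes its sum; the convolution product on the direct sum inherits
  them.\<close>

locale graded_algebra =
  fixes H :: "int \<Rightarrow> 'a monoid" and M :: "int \<Rightarrow> int \<Rightarrow> 'a \<Rightarrow> 'a \<Rightarrow> 'a" and e :: 'a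
  assumes cg: "0 \<le> p \<Longrightarrow> comm_group (H p)"
    and M_closed: "\<lbrakk>0 \<le> p; 0 \<le> q; x \<in> carrier (H p); y \<in> carrier (H q)\<rbrakk> \<Longrightarrow> M p q x y \<in> carrier (H (p + q))"
    and M_add_left: "\<lbrakk>0 \<le> p; 0 \<le> q; x \<in> carrier (H p); x' \<in> carrier (H p); y \<in> carrier (H q)\<rbrakk>
      \<Longrightarrow> M p q (x \<otimes>\<^bsub>H p\<^esub> x') y = M p q x y \<otimes>\<^bsub>H (p + q)\<^esub> M p q x' y"
    and M_add_right: "\<lbrakk>0 \<le> p; 0 \<le> q; x \<in> carrier (H p); y \<in> carrier (H q); y' \<in> carrier (H q)\<rbrakk>
      \<Longrightarrow> M p q x (y \<otimes>\<^bsub>H q\<^esub> y') = M p q x y \<otimes>\<^bsub>H (p + q)\<^esub> M p q x y'"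
    and M_assoc: "\<lbrakk>0 \<le> p; 0 \<le> q; 0 \<le> r; x \<in> carrier (H p); y \<in> carrier (H q); z \<in> carrier (H r)\<rbrakk>
      \<Longrightarrow> M (p + q) r (M p q x y) z = M p (q + r) x (M q r y z)"
    and e_closed: "e \<in> carrier (H 0)"
    and M_e_left: "\<lbrakk>0 \<le> p; x \<in> carrier (H p)\<rbrakk> \<Longrightarrow> M 0 p e x = x"
    and M_e_right: "\<lbrakk>0 \<le> p; x \<in> carrier (H p)\<rbrakk> \<Longrightarrow> M p 0 x e = x"
begin

lemma hom_left: "\<lbrakk>0 \<le> p; 0 \<le> q; y \<in> carrier (H q)\<rbrakk> \<Longrightarrow> (\<lambda>x. M p q x y) \<in> hom (H p) (H (p + q))"
  by (rule homI) (auto simp: M_closed M_add_left)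

lemma hom_right: "\<lbrakk>0 \<le> p; 0 \<le> q; x \<in> carrier (H p)\<rbrakk> \<Longrightarrow> M p q x \<in> hom (H q) (H (p + q))"
  by (rule homI) (auto simp: M_closed M_add_right)

lemma M_one_left: "\<lbrakk>0 \<le> p; 0 \<le> q; y \<in> carrier (H q)\<rbrakk> \<Longrightarrow> M p q \<one>\<^bsub>H p\<^esub> y = \<one>\<^bsub>H (p + q)\<^esub>"
  using hom_one[OF hom_left[of p q y]] cg[of p] cg[of "p + q"] by (simp add: comm_group_def)

lemma M_one_right: "\<lbrakk>0 \<le> p; 0 \<le> q; x \<in> carrier (H p)\<rbrakk> \<Longrightarrow> M p q x \<one>\<^bsub>H q\<^esub> = \<one>\<^bsub>H (p + q)\<^esub>"
  using hom_one[OF hom_right[of p q x]] cg[of q] cg[of "p + q"] by (simp add: comm_group_def)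

lemma group: "0 \<le> p \<Longrightarrow> group (H p)"
  using cg by (simp add: comm_group_def)

lemma carrier_eq: "carrier (graded_ring H M e) =
    {x \<in> \<Pi>\<^sub>E p\<in>{0..}. carrier (H p). finite {p \<in> {0..}. x p \<noteq> \<one>\<^bsub>H p\<^esub>}}"
proof -
  have "carrier (graded_ring H M e) = carrier (sum_group {0..} H)"
    by (simp add: graded_ring_def)
  also have "\<dots> = {x \<in> \<Pi>\<^sub>E p\<in>{0..}. carrier (H p). finite {p \<in> {0..}. x p \<noteq> \<one>\<^bsub>H p\<^esub>}}"
    by (rule carrier_sum_group) (simp add: group)
  finally show ?thesis .
qed

lemma in_carrier: "x \<in> carrier (graded_ring H M e) \<Longrightarrow> 0 \<le> p \<Longrightarrow> x p \<in> carrier (H p)"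
  by (auto simp: carrier_eq)

definition conv where "conv x y n = finprod (H n) (\<lambda>i. M i (n - i) (x i) (y (n - i))) {0..n}"

lemma mult_eq: "x \<otimes>\<^bsub>graded_ring H M e\<^esub> y = (\<lambda>n\<in>{0..}. conv x y n)"
  by (simp add: graded_ring_def conv_def)

lemma add_eq: "x \<oplus>\<^bsub>graded_ring H M e\<^esub> y = (\<lambda>n\<in>{0..}. x n \<otimes>\<^bsub>H n\<^esub> y n)"
  by (simp add: graded_ring_def)

lemma term_closed:
  assumes "x \<in> carrier (graded_ring H M e)" "y \<in> carrier (graded_ring H M e)" "0 \<le> i" "i \<le> n"
  shows "M i (n - i) (x i) (y (n - i)) \<in> carrier (H n)"
  using M_closed[of i "n - i" "x i" "y (n - i)"] assms by (simp add: in_carrier)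

lemma conv_closed:
  assumes "x \<in> carrier (graded_ring H M e)" "y \<in> carrier (graded_ring H M e)" "0 \<le> n"
  shows "conv x y n \<in> carrier (H n)"
proof -
  interpret comm_group "H n" using assms(3) by (rule cg)
  show ?thesis
    unfolding conv_def by (intro finprod_closed) (use assms in \<open>auto intro: term_closed\<close>)
qed

text \<open>The support of a convolution lies in the set of sums i + j of degrees from the two
  supports, hence stays finite: a product with a neutral factor is neutral.\<close>

lemma mult_closed:
  assumes x: "x \<in> carrier (graded_ring H M e)" and y: "y \<in> carrier (graded_ring H M e)"
  shows "x \<otimes>\<^bsub>graded_ring H M e\<^esub> y \<in> carrier (graded_ring H M e)"
proof -
  let ?X = "{p \<in> {0..}. x p \<noteq> \<one>\<^bsub>H p\<^esub>}" and ?Y = "{p \<in> {0..}. y p \<noteq> \<one>\<^bsub>H p\<^esub>}"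
  have fin: "finite ((\<lambda>(i, j). i + j) ` (?X \<times> ?Y))"
    using x y by (simp add: carrier_eq)
  have "{n \<in> {0..}. conv x y n \<noteq> \<one>\<^bsub>H n\<^esub>} \<subseteq> (\<lambda>(i, j). i + j) ` (?X \<times> ?Y)"
  proof
    fix n assume "n \<in> {n \<in> {0..}. conv x y n \<noteq> \<one>\<^bsub>H n\<^esub>}"
    then have n: "n \<in> {0..}" and ne: "conv x y n \<noteq> \<one>\<^bsub>H n\<^esub>" by auto
    interpret comm_group "H n" using n by (simp add: cg)
    have "\<exists>i\<in>{0..n}. M i (n - i) (x i) (y (n - i)) \<noteq> \<one>\<^bsub>H n\<^esub>"
      using ne unfolding conv_def by (meson finprod_one_eqI)
    then obtain i where i: "i \<in> {0..n}" "M i (n - i) (x i) (y (n - i)) \<noteq> \<one>\<^bsub>H n\<^esub>"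
      by blast
    have "x i \<noteq> \<one>\<^bsub>H i\<^esub>"
      using i M_one_left[of i "n - i" "y (n - i)"] in_carrier[OF y, of "n - i"] by auto
    moreover have "y (n - i) \<noteq> \<one>\<^bsub>H (n - i)\<^esub>"
      using i M_one_right[of i "n - i" "x i"] in_carrier[OF x, of i] by auto
    ultimately show "n \<in> (\<lambda>(i, j). i + j) ` (?X \<times> ?Y)"
      using i(1) by (intro image_eqI[of _ _ "(i, n - i)"]) auto
  qed
  then have "finite {n \<in> {0..}. conv x y n \<noteq> \<one>\<^bsub>H n\<^esub>}"
    using fin finite_subset by blast
  moreover have "{p \<in> {0..}. (\<lambda>n\<in>{0..}. conv x y n) p \<noteq> \<one>\<^bsub>H p\<^esub>} = {n \<in> {0..}. conv x y n \<noteq> \<one>\<^bsub>H n\<^esub>}"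
    by auto
  ultimately show ?thesis
    unfolding mult_eq carrier_eq using conv_closed[OF x y] by (simp add: conj_commute)
qed

text \<open>Both bracketings expand to the product of the terms \<open>?t j k\<close> over the
  triangle j + k \<le> n. On the left the triangle is described by pairs (i, j) with i = j + k, and
  a reindexing passes from one description to the other.\<close>

lemma conv_assoc:
  assumes x: "x \<in> carrier (graded_ring H M e)" and y: "y \<in> carrier (graded_ring H M e)"
    and z: "z \<in> carrier (graded_ring H M e)" and n: "0 \<le> n"
  shows "conv (\<lambda>n\<in>{0..}. conv x y n) z n = conv x (\<lambda>n\<in>{0..}. conv y z n) n"
proof -
  interpret comm_group "H n" using n by (rule cg)
  let ?t = "\<lambda>j k. M j (n - j) (x j) (M k (n - j - k) (y k) (z (n - j - k)))"
  have cl: "M j k (x j) (y k) \<in> carrier (H (j + k))" "M j k (y j) (z k) \<in> carrier (H (j + k))"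
    if "0 \<le> j" "0 \<le> k" for j k
    using that by (simp_all add: M_closed in_carrier[OF x] in_carrier[OF y] in_carrier[OF z])
  have tc: "?t j k \<in> carrier (H n)" if "0 \<le> j" "0 \<le> k" "j + k \<le> n" for j k
    using M_closed[of j "n - j" "x j" "M k (n - j - k) (y k) (z (n - j - k))"] that cl(2)[of k "n - j - k"] in_carrier[OF x, of j]
    by auto
  have L: "M i (n - i) (conv x y i) (z (n - i)) = finprod (H n) (\<lambda>j. ?t j (i - j)) {0..i}"
    if i: "0 \<le> i" "i \<le> n" for i
  proof -
    have tc': "?t j (i - j) \<in> carrier (H n)" if "j \<in> {0..i}" for j
      using tc[of j "i - j"] that i by simp
    have h: "(\<lambda>x. M i (n - i) x (z (n - i))) \<in> hom (H i) (H n)"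
      using hom_left[of i "n - i" "z (n - i)"] i in_carrier[OF z] by simp
    have "M i (n - i) (conv x y i) (z (n - i))
        = finprod (H n) (\<lambda>j. M i (n - i) (M j (i - j) (x j) (y (i - j))) (z (n - i))) {0..i}"
      unfolding conv_def using i term_closed[OF x y]
      by (subst hom_finprod[OF cg cg h]) auto
    also have "\<dots> = finprod (H n) (\<lambda>j. ?t j (i - j)) {0..i}"
    proof (rule finprod_cong')
      fix j assume "j \<in> {0..i}"
      then show "M i (n - i) (M j (i - j) (x j) (y (i - j))) (z (n - i)) = ?t j (i - j)"
        using M_assoc[of j "i - j" "n - i" "x j" "y (i - j)" "z (n - i)"] i in_carrier[OF x] in_carrier[OF y] in_carrier[OF z]
        by simp
    qed (use tc' in auto)
    finally show ?thesis .
  qed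
  have R: "M j (n - j) (x j) (conv y z (n - j)) = finprod (H n) (?t j) {0..n - j}"
    if j: "0 \<le> j" "j \<le> n" for j
  proof -
    have h: "M j (n - j) (x j) \<in> hom (H (n - j)) (H n)"
      using hom_right[of j "n - j" "x j"] j in_carrier[OF x] by simp
    show ?thesis
      unfolding conv_def using j term_closed[OF y z]
      by (subst hom_finprod[OF cg cg h]) auto
  qed
  have tc': "?t j (i - j) \<in> carrier (H n)" if "j \<in> {0..i}" "i \<in> {0..n}" for i j
    using tc[of j "i - j"] that by simp
  have "conv (\<lambda>n\<in>{0..}. conv x y n) z n = finprod (H n) (\<lambda>i. finprod (H n) (\<lambda>j. ?t j (i - j)) {0..i}) {0..n}"
    unfolding conv_def[of "\<lambda>n\<in>{0..}. conv x y n"]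
  proof (rule finprod_cong')
    show "(\<lambda>i. finprod (H n) (\<lambda>j. ?t j (i - j)) {0..i}) \<in> {0..n} \<rightarrow> carrier (H n)"
    proof (intro Pi_I finprod_closed)
      fix i j assume "i \<in> {0..n}" "j \<in> {0..i}"
      then show "?t j (i - j) \<in> carrier (H n)" using tc' by simp
    qed
  qed (auto simp: L)
  also have "\<dots> = finprod (H n) (\<lambda>(i, j). ?t j (i - j)) (SIGMA i:{0..n}. {0..i})"
    using tc' by (subst finprod_Sigma) auto
  also have "(SIGMA i:{0..n}. {0..i}) = (\<lambda>(j, k). (j + k, j)) ` (SIGMA j:{0..n}. {0..n - j})"
  proof (auto simp: image_iff)
    fix a b :: int assume "a \<le> n" "0 \<le> b" "b \<le> a"
    then show "\<exists>y\<in>{0..n - b}. a = b + y" by (intro bexI[of _ "a - b"]) auto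
  qed
  also have "finprod (H n) (\<lambda>(i, j). ?t j (i - j)) \<dots> = finprod (H n) (\<lambda>(j, k). ?t j k) (SIGMA j:{0..n}. {0..n - j})"
    using tc by (subst finprod_reindex) (auto simp: inj_on_def split_def diff_diff_eq)
  also have "\<dots> = finprod (H n) (\<lambda>j. finprod (H n) (?t j) {0..n - j}) {0..n}"
    using tc by (subst finprod_Sigma) auto
  also have "\<dots> = conv x (\<lambda>n\<in>{0..}. conv y z n) n"
    unfolding conv_def[of x] using tc
    by (intro finprod_cong') (auto simp: R)
  finally show ?thesis .
qed

lemma conv_add_left:
  assumes x: "x \<in> carrier (graded_ring H M e)" and y: "y \<in> carrier (graded_ring H M e)"
    and z: "z \<in> carrier (graded_ring H M e)" and n: "0 \<le> n"
  shows "conv (\<lambda>n\<in>{0..}. x n \<otimes>\<^bsub>H n\<^esub> y n) z n = conv x z n \<otimes>\<^bsub>H n\<^esub> conv y z n"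
proof -
  interpret comm_group "H n" using n by (rule cg)
  have "conv (\<lambda>n\<in>{0..}. x n \<otimes>\<^bsub>H n\<^esub> y n) z n
      = finprod (H n) (\<lambda>i. M i (n - i) (x i) (z (n - i)) \<otimes>\<^bsub>H n\<^esub> M i (n - i) (y i) (z (n - i))) {0..n}"
    unfolding conv_def
  proof (rule finprod_cong')
    fix i assume "i \<in> {0..n}"
    then show "M i (n - i) ((\<lambda>n\<in>{0..}. x n \<otimes>\<^bsub>H n\<^esub> y n) i) (z (n - i))
        = M i (n - i) (x i) (z (n - i)) \<otimes>\<^bsub>H n\<^esub> M i (n - i) (y i) (z (n - i))"
      using M_add_left[of i "n - i" "x i" "y i" "z (n - i)"] x y z by (simp add: in_carrier)
  qed (use term_closed x y z in auto)
  also have "\<dots> = conv x z n \<otimes>\<^bsub>H n\<^esub> conv y z n"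
    unfolding conv_def using term_closed[OF x z] term_closed[OF y z] by (intro finprod_multf) auto
  finally show ?thesis .
qed

lemma conv_add_right:
  assumes x: "x \<in> carrier (graded_ring H M e)" and y: "y \<in> carrier (graded_ring H M e)"
    and z: "z \<in> carrier (graded_ring H M e)" and n: "0 \<le> n"
  shows "conv z (\<lambda>n\<in>{0..}. x n \<otimes>\<^bsub>H n\<^esub> y n) n = conv z x n \<otimes>\<^bsub>H n\<^esub> conv z y n"
proof -
  interpret comm_group "H n" using n by (rule cg)
  have "conv z (\<lambda>n\<in>{0..}. x n \<otimes>\<^bsub>H n\<^esub> y n) n
      = finprod (H n) (\<lambda>i. M i (n - i) (z i) (x (n - i)) \<otimes>\<^bsub>H n\<^esub> M i (n - i) (z i) (y (n - i))) {0..n}"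
    unfolding conv_def
  proof (rule finprod_cong')
    fix i assume "i \<in> {0..n}"
    then show "M i (n - i) (z i) ((\<lambda>n\<in>{0..}. x n \<otimes>\<^bsub>H n\<^esub> y n) (n - i))
        = M i (n - i) (z i) (x (n - i)) \<otimes>\<^bsub>H n\<^esub> M i (n - i) (z i) (y (n - i))"
      using M_add_right[of i "n - i" "z i" "x (n - i)" "y (n - i)"] x y z by (simp add: in_carrier)
  qed (use term_closed x y z in auto)
  also have "\<dots> = conv z x n \<otimes>\<^bsub>H n\<^esub> conv z y n"
    unfolding conv_def using term_closed[OF z x] term_closed[OF z y] by (intro finprod_multf) auto
  finally show ?thesis .
qed

lemma one_in: "\<one>\<^bsub>graded_ring H M e\<^esub> \<in> carrier (graded_ring H M e)"
proof -
  have "finite {p \<in> {0..}. (\<lambda>n\<in>{0..}. if n = 0 then e else \<one>\<^bsub>H n\<^esub>) p \<noteq> \<one>\<^bsub>H p\<^esub>}"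
    by (rule finite_subset[of _ "{0}"]) auto
  then show ?thesis
    unfolding carrier_eq using e_closed group
    by (auto simp: graded_ring_def group.is_monoid monoid.one_closed conj_commute split: if_splits)
qed

lemma l_one:
  assumes x: "x \<in> carrier (graded_ring H M e)"
  shows "\<one>\<^bsub>graded_ring H M e\<^esub> \<otimes>\<^bsub>graded_ring H M e\<^esub> x = x"
proof -
  have "conv (\<lambda>n\<in>{0..}. if n = 0 then e else \<one>\<^bsub>H n\<^esub>) x n = x n" if n: "0 \<le> n" for n
  proof -
    interpret comm_group "H n" using n by (rule cg)
    have "conv (\<lambda>n\<in>{0..}. if n = 0 then e else \<one>\<^bsub>H n\<^esub>) x n
        = finprod (H n) (\<lambda>i. if 0 = i then x n else \<one>\<^bsub>H n\<^esub>) {0..n}"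
      unfolding conv_def
    proof (rule finprod_cong')
      fix i assume "i \<in> {0..n}"
      then show "M i (n - i) ((\<lambda>n\<in>{0..}. if n = 0 then e else \<one>\<^bsub>H n\<^esub>) i) (x (n - i))
          = (if 0 = i then x n else \<one>\<^bsub>H n\<^esub>)"
        using M_one_left[of i "n - i" "x (n - i)"] in_carrier[OF x] by (auto simp: M_e_left)
    qed (use in_carrier[OF x] n in auto)
    also have "\<dots> = x n"
      using finprod_singleton[of 0 "{0..n}" "\<lambda>_. x n"] in_carrier[OF x] n by auto
    finally show ?thesis .
  qed
  moreover have "\<one>\<^bsub>graded_ring H M e\<^esub> = (\<lambda>n\<in>{0..}. if n = 0 then e else \<one>\<^bsub>H n\<^esub>)"
    by (simp add: graded_ring_def)
  moreover have "x \<in> extensional {0..}"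
    using x by (auto simp: carrier_eq PiE_def)
  ultimately show ?thesis
    by (auto simp: mult_eq extensional_def)
qed

lemma r_one:
  assumes x: "x \<in> carrier (graded_ring H M e)"
  shows "x \<otimes>\<^bsub>graded_ring H M e\<^esub> \<one>\<^bsub>graded_ring H M e\<^esub> = x"
proof -
  have "conv x (\<lambda>n\<in>{0..}. if n = 0 then e else \<one>\<^bsub>H n\<^esub>) n = x n" if n: "0 \<le> n" for n
  proof -
    interpret comm_group "H n" using n by (rule cg)
    have "conv x (\<lambda>n\<in>{0..}. if n = 0 then e else \<one>\<^bsub>H n\<^esub>) n
        = finprod (H n) (\<lambda>i. if n = i then x n else \<one>\<^bsub>H n\<^esub>) {0..n}"
      unfolding conv_def
    proof (rule finprod_cong')
      fix i assume "i \<in> {0..n}"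
      then show "M i (n - i) (x i) ((\<lambda>n\<in>{0..}. if n = 0 then e else \<one>\<^bsub>H n\<^esub>) (n - i))
          = (if n = i then x n else \<one>\<^bsub>H n\<^esub>)"
        using M_one_right[of i "n - i" "x i"] in_carrier[OF x] by (auto simp: M_e_right)
    qed (use in_carrier[OF x] n in auto)
    also have "\<dots> = x n"
      using finprod_singleton[of n "{0..n}" "\<lambda>_. x n"] in_carrier[OF x] n by auto
    finally show ?thesis .
  qed
  moreover have "\<one>\<^bsub>graded_ring H M e\<^esub> = (\<lambda>n\<in>{0..}. if n = 0 then e else \<one>\<^bsub>H n\<^esub>)"
    by (simp add: graded_ring_def)
  moreover have "x \<in> extensional {0..}"
    using x by (auto simp: carrier_eq PiE_def)
  ultimately show ?thesis
    by (auto simp: mult_eq extensional_def)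
qed

theorem ring_graded_ring: "ring (graded_ring H M e)"
proof (rule ringI)
  let ?R = "graded_ring H M e"
  have add: "add_monoid ?R = sum_group {0..} H"
    by (simp add: graded_ring_def)
  have "comm_group (sum_group {0..} H)"
  proof (rule group.group_comm_groupI)
    show "group (sum_group {0..} H)" by (rule sum_group) (simp add: group)
    fix x y assume "x \<in> carrier (sum_group {0..} H)" "y \<in> carrier (sum_group {0..} H)"
    then have "x p \<in> carrier (H p)" "y p \<in> carrier (H p)" if "p \<ge> 0" for p
      using that in_carrier[of _ p] by (simp_all add: graded_ring_def)
    then show "x \<otimes>\<^bsub>sum_group {0..} H\<^esub> y = y \<otimes>\<^bsub>sum_group {0..} H\<^esub> x"
      using cg by (auto simp: fun_eq_iff comm_group_def comm_monoid.m_comm)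
  qed
  then show "abelian_group ?R"
    by (intro abelian_group.intro abelian_monoid.intro abelian_group_axioms.intro)
       (simp_all only: add comm_group_def)
  show "monoid ?R"
  proof (rule monoidI)
    fix x y z assume xyz: "x \<in> carrier ?R" "y \<in> carrier ?R" "z \<in> carrier ?R"
    show "x \<otimes>\<^bsub>?R\<^esub> y \<otimes>\<^bsub>?R\<^esub> z = x \<otimes>\<^bsub>?R\<^esub> (y \<otimes>\<^bsub>?R\<^esub> z)"
      unfolding mult_eq by (rule restrict_ext) (use conv_assoc[OF xyz] in auto)
  qed (use mult_closed one_in l_one r_one in auto)
  fix x y z assume xyz: "x \<in> carrier ?R" "y \<in> carrier ?R" "z \<in> carrier ?R"
  show "(x \<oplus>\<^bsub>?R\<^esub> y) \<otimes>\<^bsub>?R\<^esub> z = x \<otimes>\<^bsub>?R\<^esub> z \<oplus>\<^bsub>?R\<^esub> y \<otimes>\<^bsub>?R\<^esub> z"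
    unfolding mult_eq add_eq by (rule restrict_ext) (use conv_add_left[OF xyz] in auto)
  show "z \<otimes>\<^bsub>?R\<^esub> (x \<oplus>\<^bsub>?R\<^esub> y) = z \<otimes>\<^bsub>?R\<^esub> x \<oplus>\<^bsub>?R\<^esub> z \<otimes>\<^bsub>?R\<^esub> y"
    unfolding mult_eq add_eq by (rule restrict_ext) (use conv_add_right[OF xyz] in auto)
qed

end

text \<open>Each law is an equation in some \<open>H p\<close>, so it may be checked after applying
  the injective map \<open>f p\<close>. A product that is known only through such maps becomes a
  graded ring without any work with representatives.\<close>

lemma graded_algebra_transport:
  assumes H': "graded_algebra H' M' e'"
    and cg: "\<And>p. 0 \<le> p \<Longrightarrow> comm_group (H p)"
    and f: "\<And>p. 0 \<le> p \<Longrightarrow> f p \<in> iso (H p) (H' p)"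
    and M: "\<And>p q x y. \<lbrakk>0 \<le> p; 0 \<le> q; x \<in> carrier (H p); y \<in> carrier (H q)\<rbrakk>
       \<Longrightarrow> M p q x y \<in> carrier (H (p + q)) \<and> f (p + q) (M p q x y) = M' p q (f p x) (f q y)"
    and e: "e \<in> carrier (H 0)" "f 0 e = e'"
  shows "graded_algebra H M e"
proof -
  interpret H': graded_algebra H' M' e' by fact
  have fc: "f p x \<in> carrier (H' p)" if "0 \<le> p" "x \<in> carrier (H p)" for p x
    using f[OF that(1)] that(2) by (auto simp: iso_def bij_betw_def)
  have fm: "f p (x \<otimes>\<^bsub>H p\<^esub> y) = f p x \<otimes>\<^bsub>H' p\<^esub> f p y" if "0 \<le> p" "x \<in> carrier (H p)" "y \<in> carrier (H p)" for p x y
    using f[OF that(1)] that(2,3) by (auto simp: iso_def hom_def)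
  have inj: "x = y" if "0 \<le> p" "f p x = f p y" "x \<in> carrier (H p)" "y \<in> carrier (H p)" for p x y
    using f[OF that(1)] that(2-4) by (auto simp: iso_def bij_betw_def inj_on_def)
  have mc: "x \<otimes>\<^bsub>H p\<^esub> y \<in> carrier (H p)" if "0 \<le> p" "x \<in> carrier (H p)" "y \<in> carrier (H p)" for p x y
    using cg[OF that(1)] that(2,3) by (simp add: comm_group_def group.is_monoid monoid.m_closed)
  note MM = M[THEN conjunct1] M[THEN conjunct2]
  show ?thesis
  proof (rule graded_algebra.intro)
    fix p q x x' y assume *: "0 \<le> p" "0 \<le> q" "x \<in> carrier (H p)" "x' \<in> carrier (H p)" "y \<in> carrier (H q)"
    show "M p q (x \<otimes>\<^bsub>H p\<^esub> x') y = M p q x y \<otimes>\<^bsub>H (p + q)\<^esub> M p q x' y"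
      by (rule inj[of "p + q"]) (use * in \<open>simp_all add: mc MM fm fc H'.M_add_left\<close>)
  next
    fix p q x y y' assume *: "0 \<le> p" "0 \<le> q" "x \<in> carrier (H p)" "y \<in> carrier (H q)" "y' \<in> carrier (H q)"
    show "M p q x (y \<otimes>\<^bsub>H q\<^esub> y') = M p q x y \<otimes>\<^bsub>H (p + q)\<^esub> M p q x y'"
      by (rule inj[of "p + q"]) (use * in \<open>simp_all add: mc MM fm fc H'.M_add_right\<close>)
  next
    fix p q r x y z assume *: "0 \<le> p" "0 \<le> q" "0 \<le> r" "x \<in> carrier (H p)" "y \<in> carrier (H q)" "z \<in> carrier (H r)"
    have "M p (q + r) x (M q r y z) \<in> carrier (H (p + q + r))"
      using MM(1)[of p "q + r" x "M q r y z"] * by (simp add: MM add.assoc)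
    moreover have "f (p + q + r) (M p (q + r) x (M q r y z)) = M' p (q + r) (f p x) (f (q + r) (M q r y z))"
      using MM(2)[of p "q + r" x "M q r y z"] * by (simp add: MM(1) add.assoc)
    ultimately show "M (p + q) r (M p q x y) z = M p (q + r) x (M q r y z)"
      by (intro inj[of "p + q + r"]) (use * in \<open>simp_all add: MM fc H'.M_assoc\<close>)
  next
    fix p x assume *: "0 \<le> p" "x \<in> carrier (H p)"
    show "M 0 p e x = x"
      by (rule inj[of p]) (use * MM[of 0 p e x] e in \<open>simp_all add: fc H'.M_e_left\<close>)
    show "M p 0 x e = x"
      by (rule inj[of p]) (use * MM[of p 0 x e] e in \<open>simp_all add: fc H'.M_e_right\<close>)
  next
    show "comm_group (H p)" if "0 \<le> p" for p using that by (rule cg)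
    show "M p q x y \<in> carrier (H (p + q))" if "0 \<le> p" "0 \<le> q" "x \<in> carrier (H p)" "y \<in> carrier (H q)" for p q x y
      using that by (rule MM(1))
    show "e \<in> carrier (H 0)" by (rule e)
  qed
qed

text \<open>Multiplicativity on homogeneous elements suffices, since each \<open>f n\<close> is a
  homomorphism and commutes with the finite sums in the convolution. Finite support is preserved in
  both directions because only the neutral element goes to the neutral element.\<close>

lemma graded_map_ring_iso:
  assumes "graded_algebra H M e" and "graded_algebra H' M' e'"
    and f: "\<And>p. 0 \<le> p \<Longrightarrow> f p \<in> iso (H p) (H' p)"
    and M: "\<And>p q x y. \<lbrakk>0 \<le> p; 0 \<le> q; x \<in> carrier (H p); y \<in> carrier (H q)\<rbrakk>
       \<Longrightarrow> f (p + q) (M p q x y) = M' p q (f p x) (f q y)"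
    and e: "f 0 e = e'"
  shows "graded_map f \<in> ring_iso (graded_ring H M e) (graded_ring H' M' e')"
proof -
  interpret H: graded_algebra H M e by fact
  interpret H': graded_algebra H' M' e' by fact
  let ?R = "graded_ring H M e" and ?R' = "graded_ring H' M' e'"
  have fc: "f p x \<in> carrier (H' p)" if "0 \<le> p" "x \<in> carrier (H p)" for p x
    using f[OF that(1)] that(2) by (auto simp: iso_def bij_betw_def)
  have fm: "f p (x \<otimes>\<^bsub>H p\<^esub> y) = f p x \<otimes>\<^bsub>H' p\<^esub> f p y" if "0 \<le> p" "x \<in> carrier (H p)" "y \<in> carrier (H p)" for p x y
    using f[OF that(1)] that(2,3) by (auto simp: iso_def hom_def)
  have inj: "x = y" if "0 \<le> p" "f p x = f p y" "x \<in> carrier (H p)" "y \<in> carrier (H p)" for p x y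
    using f[OF that(1)] that(2-4) by (auto simp: iso_def bij_betw_def inj_on_def)
  have f1: "f p \<one>\<^bsub>H p\<^esub> = \<one>\<^bsub>H' p\<^esub>" if "0 \<le> p" for p
    using f[OF that] H.group[OF that] H'.group[OF that] by (auto simp: iso_def intro: hom_one)
  have f1': "f p x = \<one>\<^bsub>H' p\<^esub> \<longleftrightarrow> x = \<one>\<^bsub>H p\<^esub>" if "0 \<le> p" "x \<in> carrier (H p)" for p x
    using f1[OF that(1)] inj[OF that(1), of x "\<one>\<^bsub>H p\<^esub>"] that H.group[OF that(1)]
    by (metis group.is_monoid monoid.one_closed)
  have cl: "graded_map f x \<in> carrier ?R'" if x: "x \<in> carrier ?R" for x
  proof -
    have "{p \<in> {0..}. graded_map f x p \<noteq> \<one>\<^bsub>H' p\<^esub>} = {p \<in> {0..}. x p \<noteq> \<one>\<^bsub>H p\<^esub>}"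
      using H.in_carrier[OF x] f1' by (auto simp: graded_map_def)
    then show ?thesis
      using x H.in_carrier[OF x] fc unfolding H'.carrier_eq H.carrier_eq by (auto simp: graded_map_def)
  qed
  show ?thesis
  proof (rule ring_iso_memI)
    fix x y assume x: "x \<in> carrier ?R" and y: "y \<in> carrier ?R"
    show "graded_map f (x \<oplus>\<^bsub>?R\<^esub> y) = graded_map f x \<oplus>\<^bsub>?R'\<^esub> graded_map f y"
      unfolding H.add_eq H'.add_eq using fm H.in_carrier[OF x] H.in_carrier[OF y]
      by (auto simp: graded_map_def fun_eq_iff)
    have "f n (H.conv x y n) = H'.conv (graded_map f x) (graded_map f y) n" if n: "0 \<le> n" for n
    proof -
      have h: "f n \<in> hom (H n) (H' n)" using f[OF n] by (simp add: iso_def)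
      interpret n': comm_group "H' n" using n by (rule H'.cg)
      show ?thesis
        unfolding H.conv_def H'.conv_def
        apply (subst hom_finprod[OF H.cg[OF n] H'.cg[OF n] h])
        subgoal by simp
        subgoal using H.term_closed[OF x y] by auto
        apply (rule n'.finprod_cong')
        using M[of i "n - i" "x i" "y (n - i)" for i] H.in_carrier[OF x] H.in_carrier[OF y]
          H'.term_closed[OF cl[OF x] cl[OF y]]
        by (auto simp: graded_map_def)
    qed
    then show "graded_map f (x \<otimes>\<^bsub>?R\<^esub> y) = graded_map f x \<otimes>\<^bsub>?R'\<^esub> graded_map f y"
      unfolding H.mult_eq H'.mult_eq by (auto simp: graded_map_def[of f "restrict (H.conv x y) _"])
  next
    show "graded_map f \<one>\<^bsub>?R\<^esub> = \<one>\<^bsub>?R'\<^esub>"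
      using f1 e by (auto simp: graded_map_def graded_ring_def fun_eq_iff)
    show "bij_betw (graded_map f) (carrier ?R) (carrier ?R')"
    proof (rule bij_betw_imageI)
      show "inj_on (graded_map f) (carrier ?R)"
      proof (rule inj_onI)
        fix x y assume x: "x \<in> carrier ?R" and y: "y \<in> carrier ?R" and eq: "graded_map f x = graded_map f y"
        show "x = y"
        proof (rule extensionalityI[of _ "{0..}"])
          fix p :: int assume p: "p \<in> {0..}"
          show "x p = y p"
            using fun_cong[OF eq, of p] p inj[of p "x p" "y p"] H.in_carrier[OF x] H.in_carrier[OF y]
            by (simp add: graded_map_def)
        qed (use x y in \<open>auto simp: H.carrier_eq PiE_def\<close>)
      qed
      show "graded_map f ` carrier ?R = carrier ?R'"
      proof (intro equalityI subsetI)
        fix z assume z: "z \<in> carrier ?R'"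
        have ex: "\<exists>x\<in>carrier (H p). f p x = z p" if "0 \<le> p" for p
          using f[OF that] H'.in_carrier[OF z that] by (force simp: iso_def bij_betw_def)
        \<comment> \<open>Preimages are chosen degree by degree; the support of the choice is that
          of \<open>z\<close>, so it lies in the direct sum.\<close>
        define x where "x = (\<lambda>p\<in>{0..}. SOME x. x \<in> carrier (H p) \<and> f p x = z p)"
        have x: "x p \<in> carrier (H p)" "f p (x p) = z p" if "0 \<le> p" for p
          using someI_ex[OF ex[OF that, unfolded Bex_def]] that by (simp_all add: x_def)
        have "{p \<in> {0..}. x p \<noteq> \<one>\<^bsub>H p\<^esub>} = {p \<in> {0..}. z p \<noteq> \<one>\<^bsub>H' p\<^esub>}"
          using x f1'[OF _ x(1)] by auto
        moreover have "x \<in> extensional {0..}" by (simp add: x_def)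
        ultimately have xc: "x \<in> carrier ?R"
          using x z unfolding H.carrier_eq H'.carrier_eq by (auto simp: PiE_def)
        have "graded_map f x = z"
          using x z by (auto simp: graded_map_def H'.carrier_eq PiE_def extensional_def fun_eq_iff)
        with xc show "z \<in> graded_map f ` carrier ?R" by blast
      qed (use cl in auto)
    qed
  qed (use cl in auto)
qed

section \<open>Cohomology rings\<close>

locale cochain_complex =
  fixes C :: "int \<Rightarrow> 'a monoid" and d :: "int \<Rightarrow> 'a \<Rightarrow> 'a"
  assumes comm_group_C: "comm_group (C p)"
    and d_hom: "d p \<in> hom (C p) (C (p + 1))"
    and d_d: "x \<in> carrier (C p) \<Longrightarrow> d (p + 1) (d p x) = \<one>\<^bsub>C (p + 1 + 1)\<^esub>"
begin

abbreviation Z where "Z \<equiv> cocycles C d"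
abbreviation B where "B \<equiv> coboundaries C d"

definition cls where "cls p x = B p #>\<^bsub>C p\<^esub> x"

lemma group_C: "group (C p)"
  using comm_group_C by (rule comm_group.axioms)

lemma Z_iff: "x \<in> Z p \<longleftrightarrow> x \<in> carrier (C p) \<and> d p x = \<one>\<^bsub>C (p + 1)\<^esub>"
  by (auto simp: cocycles_def kernel_def)

lemma B_iff: "x \<in> B p \<longleftrightarrow> (\<exists>y\<in>carrier (C (p - 1)). x = d (p - 1) y)"
  by (auto simp: coboundaries_def)

lemma group_hom_d: "group_hom (C p) (C (p + 1)) (d p)"
  by (intro group_hom.intro group_C group_hom_axioms.intro d_hom)

lemma subgroup_Z: "subgroup (Z p) (C p)"
  unfolding cocycles_def by (rule group_hom.subgroup_kernel[OF group_hom_d])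

lemma subgroup_B: "subgroup (B p) (C p)"
  unfolding coboundaries_def
  using group_hom.img_is_subgroup[OF group_hom_d[of "p - 1"]] by simp

lemma B_subset_Z: "B p \<subseteq> Z p"
proof
  fix x assume "x \<in> B p"
  then obtain y where y: "y \<in> carrier (C (p - 1))" "x = d (p - 1) y" by (auto simp: B_iff)
  then show "x \<in> Z p"
    using d_d[OF y(1)] hom_in_carrier[OF d_hom y(1)] by (simp add: Z_iff)
qed

lemma Z_carrier: "x \<in> Z p \<Longrightarrow> x \<in> carrier (C p)"
  by (simp add: Z_iff)

lemma Z_mult: "x \<in> Z p \<Longrightarrow> y \<in> Z p \<Longrightarrow> x \<otimes>\<^bsub>C p\<^esub> y \<in> Z p"
  using subgroup_Z by (rule subgroup.m_closed)

lemma comm_group_Z: "comm_group ((C p)\<lparr>carrier := Z p\<rparr>)"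
proof (rule group.group_comm_groupI)
  show "group ((C p)\<lparr>carrier := Z p\<rparr>)"
    using subgroup_Z group_C by (rule subgroup.subgroup_is_group)
next
  interpret comm_group "C p" by (rule comm_group_C)
  fix x y assume "x \<in> carrier ((C p)\<lparr>carrier := Z p\<rparr>)" "y \<in> carrier ((C p)\<lparr>carrier := Z p\<rparr>)"
  then show "x \<otimes>\<^bsub>(C p)\<lparr>carrier := Z p\<rparr>\<^esub> y = y \<otimes>\<^bsub>(C p)\<lparr>carrier := Z p\<rparr>\<^esub> x"
    by (simp add: Z_iff m_comm)
qed

lemma normal_B: "B p \<lhd> (C p)\<lparr>carrier := Z p\<rparr>"
proof -
  have "subgroup (B p) ((C p)\<lparr>carrier := Z p\<rparr>)"
    using group.subgroup_incl[OF group_C subgroup_B subgroup_Z B_subset_Z] .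
  then show ?thesis by (simp add: comm_group.normal_iff_subgroup[OF comm_group_Z])
qed

lemma comm_group_cohomology: "comm_group (cohomology C d p)"
proof -
  show ?thesis
    unfolding cohomology_def by (intro comm_group.abelian_FactGroup[OF comm_group_Z] normal_imp_subgroup normal_B)
qed

lemma cls_alt: "cls p x = B p #>\<^bsub>(C p)\<lparr>carrier := Z p\<rparr>\<^esub> x"
  by (simp add: cls_def r_coset_def)

lemma carrier_cohomology: "carrier (cohomology C d p) = cls p ` Z p"
  by (auto simp: cohomology_def FactGroup_def RCOSETS_def cls_alt)

lemma cls_in: "x \<in> Z p \<Longrightarrow> cls p x \<in> carrier (cohomology C d p)"
  by (simp add: carrier_cohomology)

lemma cls_mult: "x \<in> Z p \<Longrightarrow> y \<in> Z p \<Longrightarrow> cls p x \<otimes>\<^bsub>cohomology C d p\<^esub> cls p y = cls p (x \<otimes>\<^bsub>C p\<^esub> y)"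
  using normal.rcos_sum[OF normal_B, of x p y] by (simp add: cohomology_def FactGroup_def cls_alt)

lemma one_cohomology: "\<one>\<^bsub>cohomology C d p\<^esub> = B p"
  by (simp add: cohomology_def FactGroup_def)

lemma cls_one: "cls p \<one>\<^bsub>C p\<^esub> = B p"
  unfolding cls_def
  by (meson group.coset_mult_one group_C subgroup.subset subgroup_B)

lemma cls_mem: "x \<in> Z p \<Longrightarrow> x \<in> cls p x"
  unfolding cls_def by (meson Z_carrier group.rcos_self group_C subgroup_B)

lemma in_cls_iff: "z \<in> cls p x \<longleftrightarrow> (\<exists>b\<in>B p. z = b \<otimes>\<^bsub>C p\<^esub> x)"
  by (auto simp: cls_def r_coset_def)

lemma cls_sub_Z: "x \<in> Z p \<Longrightarrow> z \<in> cls p x \<Longrightarrow> z \<in> Z p"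
  using B_subset_Z Z_mult by (fastforce simp: in_cls_iff)

lemma cls_eqI: "x \<in> Z p \<Longrightarrow> z \<in> cls p x \<Longrightarrow> cls p z = cls p x"
  unfolding cls_def by (metis Z_carrier group.repr_independence group_C subgroup_B)

lemma cls_eq_iff: "x \<in> Z p \<Longrightarrow> z \<in> Z p \<Longrightarrow> cls p z = cls p x \<longleftrightarrow> (\<exists>b\<in>B p. z = b \<otimes>\<^bsub>C p\<^esub> x)"
  by (metis cls_eqI cls_mem in_cls_iff)

lemma cls_eq_one_iff: "x \<in> Z p \<Longrightarrow> cls p x = B p \<longleftrightarrow> x \<in> B p"
  by (metis B_subset_Z cls_eqI cls_mem cls_one group.is_monoid group_C monoid.one_closed subgroup.one_closed subgroup_Z)

end

text \<open>Formulated in a single degree, without asking that \<open>f\<close> belong to a map of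
  complexes. The forward half of \<open>fB\<close> makes the map on classes well defined, the
  backward half makes it injective, and \<open>surj\<close> is surjectivity up to a
  coboundary.\<close>

lemma cohomology_iso:
  assumes C: "cochain_complex C d" and C': "cochain_complex C' d'"
    and f: "\<And>x. x \<in> carrier (C p) \<Longrightarrow> f x \<in> carrier (C' p)"
    and f_mult: "\<And>x y. x \<in> carrier (C p) \<Longrightarrow> y \<in> carrier (C p) \<Longrightarrow> f (x \<otimes>\<^bsub>C p\<^esub> y) = f x \<otimes>\<^bsub>C' p\<^esub> f y"
    and fZ: "\<And>x. x \<in> cocycles C d p \<Longrightarrow> f x \<in> cocycles C' d' p"
    and fB: "\<And>x. x \<in> cocycles C d p \<Longrightarrow> f x \<in> coboundaries C' d' p \<longleftrightarrow> x \<in> coboundaries C d p"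
    and surj: "\<And>y. y \<in> cocycles C' d' p \<Longrightarrow> \<exists>x\<in>cocycles C d p. \<exists>b\<in>coboundaries C' d' p. y = b \<otimes>\<^bsub>C' p\<^esub> f x"
  defines "F \<equiv> coset_map (C' p) (coboundaries C' d' p) f"
  shows "F \<in> iso (cohomology C d p) (cohomology C' d' p)"
    and "\<And>x. x \<in> cocycles C d p \<Longrightarrow> F (coboundaries C d p #>\<^bsub>C p\<^esub> x) = coboundaries C' d' p #>\<^bsub>C' p\<^esub> f x"
proof -
  interpret C: cochain_complex C d by fact
  interpret C': cochain_complex C' d' by fact
  have F: "F (C.cls p x) = C'.cls p (f x)" if x: "x \<in> C.Z p" for x
  proof -
    have "C'.cls p (f z) = C'.cls p (f x)" if z: "z \<in> C.cls p x" for z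
    proof -
      obtain b where b: "b \<in> C.B p" "z = b \<otimes>\<^bsub>C p\<^esub> x" using z by (auto simp: C.in_cls_iff)
      have bz: "b \<in> C.Z p" using b C.B_subset_Z by blast
      have "f z = f b \<otimes>\<^bsub>C' p\<^esub> f x" using b bz x by (simp add: f_mult C.Z_carrier)
      moreover have "f b \<in> C'.B p" using fB bz b by blast
      ultimately have "f z \<in> C'.cls p (f x)" by (auto simp: C'.in_cls_iff)
      then show ?thesis using fZ[OF x] by (rule C'.cls_eqI[rotated])
    qed
    then have "F (C.cls p x) = (\<Union>a\<in>C.cls p x. C'.cls p (f x))"
      unfolding F_def coset_map_def C'.cls_def[symmetric] by (intro SUP_cong) auto
    then show ?thesis
      using C.cls_mem[OF x] by auto
  qed
  then show "\<And>x. x \<in> C.Z p \<Longrightarrow> F (C.B p #>\<^bsub>C p\<^esub> x) = C'.B p #>\<^bsub>C' p\<^esub> f x"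
    by (simp add: C.cls_def C'.cls_def)
  have hom: "F \<in> hom (cohomology C d p) (cohomology C' d' p)"
    by (rule homI)
       (auto simp: C.carrier_cohomology F C.cls_mult C'.cls_mult fZ f_mult C.Z_mult C.Z_carrier intro!: C'.cls_in)
  have G: "group (cohomology C d p)" "group (cohomology C' d' p)"
    using C.comm_group_cohomology C'.comm_group_cohomology by (simp_all add: comm_group_def)
  interpret group_hom "cohomology C d p" "cohomology C' d' p" F
    using G hom by (simp add: group_hom_def group_hom_axioms_def)
  have "inj_on F (carrier (cohomology C d p))"
  proof (rule iffD2[OF inj_on_one_iff], intro allI impI)
    fix X assume "X \<in> carrier (cohomology C d p)" and 1: "F X = \<one>\<^bsub>cohomology C' d' p\<^esub>"
    then obtain x where x: "x \<in> C.Z p" "X = C.cls p x" by (auto simp: C.carrier_cohomology)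
    have "x \<in> C.B p"
      using 1 x by (simp add: F C'.one_cohomology C'.cls_eq_one_iff fZ fB)
    then show "X = \<one>\<^bsub>cohomology C d p\<^esub>"
      using x C.cls_eq_one_iff C.one_cohomology by simp
  qed
  moreover have "F ` carrier (cohomology C d p) = carrier (cohomology C' d' p)"
  proof (intro equalityI subsetI)
    fix X assume "X \<in> carrier (cohomology C' d' p)"
    then obtain y where y: "y \<in> C'.Z p" "X = C'.cls p y" by (auto simp: C'.carrier_cohomology)
    then obtain x b where xb: "x \<in> C.Z p" "b \<in> C'.B p" "y = b \<otimes>\<^bsub>C' p\<^esub> f x" using surj by blast
    then have "X = F (C.cls p x)" using y by (auto simp: F C'.cls_eq_iff fZ)
    then show "X \<in> F ` carrier (cohomology C d p)" using xb C.cls_in by blast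
  qed auto
  ultimately show "F \<in> iso (cohomology C d p) (cohomology C' d' p)"
    using hom by (simp add: iso_def bij_betw_def)
qed

text \<open>The Leibniz rule enters through the three facts that let a product descend to cohomology
  (\<open>mul_Z\<close>, \<open>mul_B_left\<close>, \<open>mul_B_right\<close>), so that signs
  remain a matter of each instance.\<close>

locale dg_ring = cochain_complex +
  fixes mul :: "int \<Rightarrow> int \<Rightarrow> 'a \<Rightarrow> 'a \<Rightarrow> 'a" and e :: 'a
  assumes mul_Z: "\<lbrakk>0 \<le> p; 0 \<le> q; x \<in> Z p; y \<in> Z q\<rbrakk> \<Longrightarrow> mul p q x y \<in> Z (p + q)"
    and mul_B_left: "\<lbrakk>0 \<le> p; 0 \<le> q; x \<in> B p; y \<in> Z q\<rbrakk> \<Longrightarrow> mul p q x y \<in> B (p + q)"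
    and mul_B_right: "\<lbrakk>0 \<le> p; 0 \<le> q; x \<in> Z p; y \<in> B q\<rbrakk> \<Longrightarrow> mul p q x y \<in> B (p + q)"
    and mul_add_left: "\<lbrakk>0 \<le> p; 0 \<le> q; x \<in> carrier (C p); x' \<in> carrier (C p); y \<in> carrier (C q)\<rbrakk>
      \<Longrightarrow> mul p q (x \<otimes>\<^bsub>C p\<^esub> x') y = mul p q x y \<otimes>\<^bsub>C (p + q)\<^esub> mul p q x' y"
    and mul_add_right: "\<lbrakk>0 \<le> p; 0 \<le> q; x \<in> carrier (C p); y \<in> carrier (C q); y' \<in> carrier (C q)\<rbrakk>
      \<Longrightarrow> mul p q x (y \<otimes>\<^bsub>C q\<^esub> y') = mul p q x y \<otimes>\<^bsub>C (p + q)\<^esub> mul p q x y'"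
    and mul_assoc: "\<lbrakk>0 \<le> p; 0 \<le> q; 0 \<le> r; x \<in> carrier (C p); y \<in> carrier (C q); z \<in> carrier (C r)\<rbrakk>
      \<Longrightarrow> mul (p + q) r (mul p q x y) z = mul p (q + r) x (mul q r y z)"
    and e_Z: "e \<in> Z 0"
    and mul_e_left: "\<lbrakk>0 \<le> p; x \<in> carrier (C p)\<rbrakk> \<Longrightarrow> mul 0 p e x = x"
    and mul_e_right: "\<lbrakk>0 \<le> p; x \<in> carrier (C p)\<rbrakk> \<Longrightarrow> mul p 0 x e = x"
begin

lemma cohomology_mult_cls:
  assumes pq: "0 \<le> p" "0 \<le> q" and x: "x \<in> Z p" and y: "y \<in> Z q"
  shows "cohomology_mult C d mul p q (cls p x) (cls q y) = cls (p + q) (mul p q x y)"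
proof -
  have "cls (p + q) (mul p q x' y') = cls (p + q) (mul p q x y)"
    if x': "x' \<in> cls p x" and y': "y' \<in> cls q y" for x' y'
  proof -
    obtain b where b: "b \<in> B p" "x' = b \<otimes>\<^bsub>C p\<^esub> x" using x' by (auto simp: in_cls_iff)
    obtain c where c: "c \<in> B q" "y' = c \<otimes>\<^bsub>C q\<^esub> y" using y' by (auto simp: in_cls_iff)
    have bc: "b \<in> Z p" "c \<in> Z q" using b c B_subset_Z by auto
    have y'Z: "y' \<in> Z q" using cls_sub_Z y y' by blast
    \<comment> \<open>The representatives are changed one factor at a time: here the left one moves
      by a coboundary while \<open>y'\<close> stays.\<close>
    have "mul p q x' y' = mul p q b y' \<otimes>\<^bsub>C (p + q)\<^esub> mul p q x y'"
      unfolding b(2) using pq x y'Z bc by (simp add: mul_add_left Z_carrier)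
    then have 1: "cls (p + q) (mul p q x' y') = cls (p + q) (mul p q x y')"
      by (intro cls_eqI mul_Z pq x y'Z) (auto simp: in_cls_iff intro!: bexI mul_B_left pq b(1) y'Z)
    have "mul p q x y' = mul p q x c \<otimes>\<^bsub>C (p + q)\<^esub> mul p q x y"
      unfolding c(2) using pq x y bc by (simp add: mul_add_right Z_carrier)
    then have 2: "cls (p + q) (mul p q x y') = cls (p + q) (mul p q x y)"
      by (intro cls_eqI mul_Z pq x y) (auto simp: in_cls_iff intro!: bexI mul_B_right pq c(1) x)
    show ?thesis using 1 2 by simp
  qed
  then have "cohomology_mult C d mul p q (cls p x) (cls q y)
      = (\<Union>x'\<in>cls p x. \<Union>y'\<in>cls q y. cls (p + q) (mul p q x y))"
    unfolding cohomology_mult_def cls_def[symmetric] by (intro SUP_cong) auto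
  then show ?thesis
    using cls_mem[OF x] cls_mem[OF y] by auto
qed

lemma graded_algebra_cohomology:
  "graded_algebra (cohomology C d) (cohomology_mult C d mul) (B 0 #>\<^bsub>C 0\<^esub> e)"
  unfolding cls_def[symmetric]
proof (rule graded_algebra.intro)
  fix p q r :: int and X X' Y Y' W
  show "comm_group (cohomology C d p)" by (rule comm_group_cohomology)
  show "cls 0 e \<in> carrier (cohomology C d 0)" by (intro cls_in e_Z)
  show "cohomology_mult C d mul p q X Y \<in> carrier (cohomology C d (p + q))"
    if "0 \<le> p" "0 \<le> q" "X \<in> carrier (cohomology C d p)" "Y \<in> carrier (cohomology C d q)"
    using that by (auto simp: carrier_cohomology cohomology_mult_cls mul_Z)
  show "cohomology_mult C d mul p q (X \<otimes>\<^bsub>cohomology C d p\<^esub> X') Y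
      = cohomology_mult C d mul p q X Y \<otimes>\<^bsub>cohomology C d (p + q)\<^esub> cohomology_mult C d mul p q X' Y"
    if "0 \<le> p" "0 \<le> q" "X \<in> carrier (cohomology C d p)" "X' \<in> carrier (cohomology C d p)" "Y \<in> carrier (cohomology C d q)"
    using that by (auto simp: carrier_cohomology cohomology_mult_cls mul_Z cls_mult Z_mult mul_add_left Z_carrier)
  show "cohomology_mult C d mul p q X (Y \<otimes>\<^bsub>cohomology C d q\<^esub> Y')
      = cohomology_mult C d mul p q X Y \<otimes>\<^bsub>cohomology C d (p + q)\<^esub> cohomology_mult C d mul p q X Y'"
    if "0 \<le> p" "0 \<le> q" "X \<in> carrier (cohomology C d p)" "Y \<in> carrier (cohomology C d q)" "Y' \<in> carrier (cohomology C d q)"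
    using that by (auto simp: carrier_cohomology cohomology_mult_cls mul_Z cls_mult Z_mult mul_add_right Z_carrier)
  show "cohomology_mult C d mul (p + q) r (cohomology_mult C d mul p q X Y) W
      = cohomology_mult C d mul p (q + r) X (cohomology_mult C d mul q r Y W)"
    if pqr: "0 \<le> p" "0 \<le> q" "0 \<le> r" and XYW: "X \<in> carrier (cohomology C d p)" "Y \<in> carrier (cohomology C d q)" "W \<in> carrier (cohomology C d r)"
  proof -
    obtain x y w where xyw: "x \<in> Z p" "X = cls p x" "y \<in> Z q" "Y = cls q y" "w \<in> Z r" "W = cls r w"
      using XYW unfolding carrier_cohomology image_iff by blast
    then show ?thesis
      using pqr by (simp add: cohomology_mult_cls mul_Z mul_assoc Z_carrier add.assoc)
  qed
  show "cohomology_mult C d mul 0 p (cls 0 e) X = X" if "0 \<le> p" "X \<in> carrier (cohomology C d p)"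
    using that cohomology_mult_cls[of 0 p e] by (auto simp: carrier_cohomology e_Z mul_e_left Z_carrier)
  show "cohomology_mult C d mul p 0 X (cls 0 e) = X" if "0 \<le> p" "X \<in> carrier (cohomology C d p)"
    using that cohomology_mult_cls[of p 0 _ e] by (auto simp: carrier_cohomology e_Z mul_e_right Z_carrier)
qed

end

section \<open>Free chain complexes\<close>

lemma frag_extend_zero_fun [simp]: "frag_extend (\<lambda>_. 0) c = 0"
  by (simp add: frag_extend_def)

lemma frag_extend_frag_of [simp]: "frag_extend frag_of c = c"
  by (metis frag_expansion)

lemma frag_extend_frag_extend:
  "frag_extend f (frag_extend g c) = frag_extend (\<lambda>x. frag_extend f (g x)) c"
  using subset_UNIV
  by (induction c rule: frag_induction) (auto simp: frag_extend_diff)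

lemma frag_extend_add_fun: "frag_extend (\<lambda>x. f x + g x) c = frag_extend f c + frag_extend g c"
  by (simp add: frag_extend_def frag_cmul_distrib2 sum.distrib)

lemma frag_extend_uminus_fun: "frag_extend (\<lambda>x. - g x) c = - frag_extend g c"
  using subset_UNIV
  by (induction c rule: frag_induction) (auto simp: frag_extend_diff)

lemma frag_extend_diff_fun: "frag_extend (\<lambda>x. f x - g x) c = frag_extend f c - frag_extend g c"
  using frag_extend_add_fun[of f "\<lambda>x. - g x"] by (simp add: frag_extend_uminus_fun)

lemma frag_extend_sum': "frag_extend f (sum g I) = (\<Sum>i\<in>I. frag_extend f (g i))"
  by (induction I rule: infinite_finite_induct) (simp_all add: frag_extend_add)

lemma frag_extend_cong_keys:
  "Poly_Mapping.keys c \<subseteq> S \<Longrightarrow> (\<And>x. x \<in> S \<Longrightarrow> f x = g x) \<Longrightarrow> frag_extend f c = frag_extend g c"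
  by (rule frag_extend_eq) auto

lemma keys_frag_extend_subset:
  "Poly_Mapping.keys c \<subseteq> S \<Longrightarrow> (\<And>x. x \<in> S \<Longrightarrow> Poly_Mapping.keys (f x) \<subseteq> V)
    \<Longrightarrow> Poly_Mapping.keys (frag_extend f c) \<subseteq> V"
  using keys_frag_extend[of f c] by blast

lemma keys_add_subset:
  "Poly_Mapping.keys a \<subseteq> S \<Longrightarrow> Poly_Mapping.keys b \<subseteq> S \<Longrightarrow> Poly_Mapping.keys (a + b) \<subseteq> S"
  using keys_add[of a b] by blast

lemma keys_diff_subset:
  "Poly_Mapping.keys a \<subseteq> S \<Longrightarrow> Poly_Mapping.keys b \<subseteq> S \<Longrightarrow> Poly_Mapping.keys (a - b) \<subseteq> S"
  using keys_diff[of a b] by blast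

lemma keys_sum_subset:
  "(\<And>i. i \<in> I \<Longrightarrow> Poly_Mapping.keys (f i) \<subseteq> S) \<Longrightarrow> Poly_Mapping.keys (sum f I) \<subseteq> S"
  using keys_sum[of f I] by blast

lemma keys_cmul_subset: "Poly_Mapping.keys a \<subseteq> S \<Longrightarrow> Poly_Mapping.keys (frag_cmul k a) \<subseteq> S"
  using keys_cmul[of k a] by blast

text \<open>The Kronecker pairing for an arbitrary free abelian group; on singular chains it is
  \<open>evaluate\<close>. The function may have infinite support, as cochains do.\<close>

definition pairing :: "('a \<Rightarrow> int) \<Rightarrow> ('a \<Rightarrow>\<^sub>0 int) \<Rightarrow> int" where
  "pairing f c = (\<Sum>x\<in>Poly_Mapping.keys c. Poly_Mapping.lookup c x * f x)"

text \<open>Presents the pairing as a linear extension into the free group on one point, so that its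
  linearity in the chain follows from the laws of \<open>frag_extend\<close>.\<close>

lemma pairing_alt: "pairing f c = Poly_Mapping.lookup (frag_extend (\<lambda>x. frag_cmul (f x) (frag_of ())) c) ()"
proof -
  have "Poly_Mapping.lookup (sum g I) y = (\<Sum>i\<in>I. Poly_Mapping.lookup (g i) y)"
    for g :: "'a \<Rightarrow> unit \<Rightarrow>\<^sub>0 int" and I y
    by (induction I rule: infinite_finite_induct) (simp_all add: lookup_add)
  then show ?thesis by (simp add: pairing_def frag_extend_def)
qed

lemma pairing_0 [simp]: "pairing f 0 = 0"
  by (simp add: pairing_def)

lemma pairing_zero_fun [simp]: "pairing (\<lambda>_. 0) c = 0"
  by (simp add: pairing_def)

lemma pairing_of [simp]: "pairing f (frag_of x) = f x"
  by (simp add: pairing_alt)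

lemma pairing_add: "pairing f (a + b) = pairing f a + pairing f b"
  by (simp add: pairing_alt frag_extend_add lookup_add)

lemma pairing_diff: "pairing f (a - b) = pairing f a - pairing f b"
  by (simp add: pairing_alt frag_extend_diff lookup_minus)

lemma pairing_cmul: "pairing f (frag_cmul k a) = k * pairing f a"
  by (simp add: pairing_alt frag_extend_cmul)

lemma pairing_sum: "pairing f (sum g I) = (\<Sum>i\<in>I. pairing f (g i))"
  by (induction I rule: infinite_finite_induct) (simp_all add: pairing_add)

lemma pairing_add_fun: "pairing (\<lambda>x. f x + g x) c = pairing f c + pairing g c"
  by (simp add: pairing_def sum.distrib distrib_left)

lemma pairing_uminus_fun: "pairing (\<lambda>x. - f x) c = - pairing f c"
  by (simp add: pairing_def sum_negf)

lemma pairing_diff_fun: "pairing (\<lambda>x. f x - g x) c = pairing f c - pairing g c"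
  by (simp add: pairing_def sum_subtractf right_diff_distrib)

lemma pairing_cmul_fun: "pairing (\<lambda>x. k * f x) c = k * pairing f c"
  by (simp add: pairing_def sum_distrib_left mult.left_commute)

lemma pairing_frag_extend: "pairing f (frag_extend g c) = pairing (\<lambda>x. pairing f (g x)) c"
  using subset_UNIV
  by (induction c rule: frag_induction) (auto simp: frag_extend_diff pairing_diff)

lemma pairing_cong: "(\<And>x. x \<in> Poly_Mapping.keys c \<Longrightarrow> f x = g x) \<Longrightarrow> pairing f c = pairing g c"
  by (simp add: pairing_def)

lemma pairing_cong_keys:
  "Poly_Mapping.keys c \<subseteq> S \<Longrightarrow> (\<And>x. x \<in> S \<Longrightarrow> f x = g x) \<Longrightarrow> pairing f c = pairing g c"
  by (rule pairing_cong) auto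

text \<open>There is no augmentation: \<open>d 0\<close> vanishes, so exactness in degree 0 means
  that every 0-chain bounds. The cone of a quasi-isomorphism has this property.\<close>

locale free_complex =
  fixes S :: "nat \<Rightarrow> 'a set" and d :: "nat \<Rightarrow> 'a \<Rightarrow> 'a \<Rightarrow>\<^sub>0 int"
  assumes d_0: "d 0 x = 0"
    and keys_d: "x \<in> S (Suc n) \<Longrightarrow> Poly_Mapping.keys (d (Suc n) x) \<subseteq> S n"
    and d_d: "x \<in> S (Suc n) \<Longrightarrow> frag_extend (d n) (d (Suc n) x) = 0"
begin

abbreviation bd where "bd n \<equiv> frag_extend (d n)"
abbreviation chains where "chains n \<equiv> {c. Poly_Mapping.keys c \<subseteq> S n}"

lemma bd_0: "bd 0 c = 0"
  by (rule frag_extend_eq_0) (simp add: d_0)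

text \<open>An exact complex of free groups that is bounded below is contractible. The contraction
  is chosen on basis elements by recursion on the degree. The recursion carries along that
  \<open>h\<close> fills every cycle of its degree, which makes \<open>frag_of x - h (d x)\<close> a
  cycle in the next degree, so that exactness supplies the next value.\<close>

lemma contraction_exists:
  assumes exact: "\<And>n c. c \<in> chains n \<Longrightarrow> bd n c = 0 \<Longrightarrow> \<exists>w\<in>chains (Suc n). bd (Suc n) w = c"
  obtains h where "\<And>n x. x \<in> S n \<Longrightarrow> h n x \<in> chains (Suc n)"
    "\<And>x. x \<in> S 0 \<Longrightarrow> bd (Suc 0) (h 0 x) = frag_of x"
    "\<And>n x. x \<in> S (Suc n) \<Longrightarrow> bd (Suc (Suc n)) (h (Suc n) x) + frag_extend (h n) (d (Suc n) x) = frag_of x"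
proof -
  let ?P = "\<lambda>n h. (\<forall>x\<in>S n. h x \<in> chains (Suc n)) \<and> (\<forall>c\<in>chains n. bd n c = 0 \<longrightarrow> bd (Suc n) (frag_extend h c) = c)
      \<and> (n = 0 \<longrightarrow> (\<forall>x\<in>S 0. bd (Suc 0) (h x) = frag_of x))"
  let ?Q = "\<lambda>n h h'. \<forall>x\<in>S (Suc n). bd (Suc (Suc n)) (h' x) + frag_extend h (d (Suc n) x) = frag_of x"
  have "\<exists>h. \<forall>n. ?P n (h n) \<and> ?Q n (h n) (h (Suc n))"
  proof (rule dependent_nat_choice)
    have "\<exists>w\<in>chains (Suc 0). bd (Suc 0) w = frag_of x" if "x \<in> S 0" for x
      by (rule exact[of "frag_of x" 0]) (use that in \<open>simp_all add: d_0\<close>)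
    then have "\<forall>x\<in>S 0. \<exists>w. w \<in> chains (Suc 0) \<and> bd (Suc 0) w = frag_of x"
      by blast
    then obtain h where h: "\<forall>x\<in>S 0. h x \<in> chains (Suc 0) \<and> bd (Suc 0) (h x) = frag_of x"
      by metis
    have "bd (Suc 0) (frag_extend h c) = c" if "c \<in> chains 0" for c
      using frag_extend_cong_keys[of c "S 0" "\<lambda>x. bd (Suc 0) (h x)" frag_of] that h
      by (auto simp: frag_extend_frag_extend)
    with h show "\<exists>h. ?P 0 h" by blast
  next
    fix h n assume P: "?P n h"
    have "\<exists>w. w \<in> chains (Suc (Suc n)) \<and> bd (Suc (Suc n)) w = frag_of x - frag_extend h (d (Suc n) x)"
      if x: "x \<in> S (Suc n)" for x
    proof -
      have dx: "d (Suc n) x \<in> chains n" using keys_d[OF x] by simp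
      then have "bd (Suc n) (frag_extend h (d (Suc n) x)) = d (Suc n) x"
        using P d_d[OF x] by blast
      then have 1: "bd (Suc n) (frag_of x - frag_extend h (d (Suc n) x)) = 0"
        by (simp add: frag_extend_diff)
      have "Poly_Mapping.keys (frag_extend h (d (Suc n) x)) \<subseteq> S (Suc n)"
        using dx P by (intro keys_frag_extend_subset) auto
      then have "frag_of x - frag_extend h (d (Suc n) x) \<in> chains (Suc n)"
        unfolding mem_Collect_eq using x by (intro keys_diff_subset) auto
      with 1 exact show ?thesis by blast
    qed
    then obtain h' where h': "\<And>x. x \<in> S (Suc n) \<Longrightarrow> h' x \<in> chains (Suc (Suc n)) \<and>
        bd (Suc (Suc n)) (h' x) = frag_of x - frag_extend h (d (Suc n) x)"
      by metis
    have "bd (Suc (Suc n)) (frag_extend h' c) = c" if c: "c \<in> chains (Suc n)" "bd (Suc n) c = 0" for c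
    proof -
      have "bd (Suc (Suc n)) (frag_extend h' c)
          = frag_extend (\<lambda>x. frag_of x - frag_extend h (d (Suc n) x)) c"
        unfolding frag_extend_frag_extend using c h' by (intro frag_extend_cong_keys[of c "S (Suc n)"]) auto
      also have "\<dots> = c - frag_extend h (bd (Suc n) c)"
        by (simp add: frag_extend_diff_fun frag_extend_frag_extend)
      finally show ?thesis using c by simp
    qed
    with h' show "\<exists>h'. ?P (Suc n) h' \<and> ?Q n h h'"
      by (intro exI[of _ h']) auto
  qed
  then obtain h where h: "\<forall>n. ?P n (h n) \<and> ?Q n (h n) (h (Suc n))" ..
  show thesis
  proof (rule that[of h])
    show "h n x \<in> chains (Suc n)" if "x \<in> S n" for n x
      using h[rule_format, of n] that by blast
    show "bd (Suc 0) (h 0 x) = frag_of x" if "x \<in> S 0" for x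
      using h[rule_format, of 0] that by blast
    show "bd (Suc (Suc n)) (h (Suc n) x) + frag_extend (h n) (d (Suc n) x) = frag_of x" if "x \<in> S (Suc n)" for n x
      using h[rule_format, of n] that by blast
  qed
qed

text \<open>A contraction gives x = d h x + h d x. A cocycle \<phi> vanishes on the first summand,
  so \<phi> x is the value of \<phi> after h on d x. In degree 0, where d x = 0, the conclusion says
  that \<phi> vanishes on \<open>S 0\<close>.\<close>

lemma dual_exact:
  assumes exact: "\<And>n c. c \<in> chains n \<Longrightarrow> bd n c = 0 \<Longrightarrow> \<exists>w\<in>chains (Suc n). bd (Suc n) w = c"
    and cocycle: "\<And>x. x \<in> S (Suc n) \<Longrightarrow> pairing \<phi> (d (Suc n) x) = 0"
  shows "\<exists>\<beta>. \<forall>x\<in>S n. \<phi> x = pairing \<beta> (d n x)"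
proof -
  obtain h where hk: "\<And>n x. x \<in> S n \<Longrightarrow> h n x \<in> chains (Suc n)" and h:
    "\<And>x. x \<in> S 0 \<Longrightarrow> bd (Suc 0) (h 0 x) = frag_of x"
    "\<And>n x. x \<in> S (Suc n) \<Longrightarrow> bd (Suc (Suc n)) (h (Suc n) x) + frag_extend (h n) (d (Suc n) x) = frag_of x"
    using contraction_exists[OF exact] by blast
  have z: "pairing \<phi> (bd (Suc n) c) = 0" if "c \<in> chains (Suc n)" for c
    unfolding pairing_frag_extend using that cocycle
    by (subst pairing_cong_keys[of c "S (Suc n)" _ "\<lambda>_. 0"]) auto
  show ?thesis
  proof (cases n)
    case 0
    then have "\<phi> x = 0" if "x \<in> S n" for x
      using z[OF hk[OF that]] h(1)[of x] that by simp
    then show ?thesis using 0 by (simp add: d_0)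
  next
    case (Suc k)
    have "\<phi> x = pairing (\<lambda>y. pairing \<phi> (h k y)) (d n x)" if x: "x \<in> S n" for x
    proof -
      have "\<phi> x = pairing \<phi> (bd (Suc n) (h n x)) + pairing \<phi> (frag_extend (h k) (d n x))"
        using h(2)[of x k] x Suc by (metis pairing_add pairing_of)
      then show ?thesis using z[OF hk[OF x]] by (simp add: pairing_frag_extend)
    qed
    then show ?thesis by blast
  qed
qed

end

lemma keys_imageE:
  assumes "Poly_Mapping.keys c \<subseteq> f ` S"
  obtains b where "Poly_Mapping.keys b \<subseteq> S" "c = frag_extend (frag_of \<circ> f) b"
proof
  let ?b = "frag_extend (frag_of \<circ> inv_into S f) c"
  show "Poly_Mapping.keys ?b \<subseteq> S"
    using assms by (intro keys_frag_extend_subset[of c "f ` S"]) (auto intro: inv_into_into)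
  have "frag_extend (frag_of \<circ> f) ?b = frag_extend frag_of c"
    unfolding frag_extend_compose using assms
    by (intro frag_extend_cong_keys[of c "f ` S"]) (auto simp: f_inv_into_f)
  then show "c = frag_extend (frag_of \<circ> f) ?b" by simp
qed

text \<open>The mapping cone is an acyclic bounded below complex of free groups, hence contractible, and a
  contraction dualises. This avoids any structure theory of subgroups of free abelian groups.\<close>

locale free_chain_map = A: free_complex SA dA + B: free_complex SB dB
  for SA :: "nat \<Rightarrow> 'a set" and dA and SB :: "nat \<Rightarrow> 'b set" and dB +
  fixes \<theta> :: "nat \<Rightarrow> 'a \<Rightarrow> 'b \<Rightarrow>\<^sub>0 int"
  assumes keys_\<theta>: "x \<in> SA n \<Longrightarrow> Poly_Mapping.keys (\<theta> n x) \<subseteq> SB n"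
    and d_\<theta>: "x \<in> SA (Suc n) \<Longrightarrow> frag_extend (dB (Suc n)) (\<theta> (Suc n) x) = frag_extend (\<theta> n) (dA (Suc n) x)"
begin

lemma bd_\<theta>: "c \<in> A.chains (Suc n) \<Longrightarrow> B.bd (Suc n) (frag_extend (\<theta> (Suc n)) c) = frag_extend (\<theta> n) (A.bd (Suc n) c)"
  unfolding frag_extend_frag_extend by (rule frag_extend_cong_keys[of c "SA (Suc n)"]) (auto intro: d_\<theta>)

lemma \<theta>_chains: "c \<in> A.chains n \<Longrightarrow> frag_extend (\<theta> n) c \<in> B.chains n"
  unfolding mem_Collect_eq by (rule keys_frag_extend_subset) (auto dest: keys_\<theta>)

abbreviation inl :: "('b \<Rightarrow>\<^sub>0 int) \<Rightarrow> 'b + 'a \<Rightarrow>\<^sub>0 int" where "inl \<equiv> frag_extend (frag_of \<circ> Inl)"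
abbreviation inr :: "('a \<Rightarrow>\<^sub>0 int) \<Rightarrow> 'b + 'a \<Rightarrow>\<^sub>0 int" where "inr \<equiv> frag_extend (frag_of \<circ> Inr)"

definition cone :: "nat \<Rightarrow> ('b + 'a) set" where
  "cone n = Inl ` SB n \<union> (case n of 0 \<Rightarrow> {} | Suc k \<Rightarrow> Inr ` SA k)"

text \<open>The mapping cone with differential (b, a) to (d b + \<theta> a, - d a). The chains of
  the source are shifted up by one degree, hence \<open>cone 0\<close> contains none of
  them.\<close>

definition dcone :: "nat \<Rightarrow> 'b + 'a \<Rightarrow> 'b + 'a \<Rightarrow>\<^sub>0 int" where
  "dcone n x = (case x of Inl b \<Rightarrow> inl (dB n b)
     | Inr a \<Rightarrow> (case n of 0 \<Rightarrow> 0 | Suc k \<Rightarrow> inl (\<theta> k a) - inr (dA k a)))"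

lemma dcone_inl: "frag_extend (dcone n) (inl b) = inl (B.bd n b)"
  by (simp add: frag_extend_frag_extend dcone_def comp_def)

lemma dcone_inr: "frag_extend (dcone (Suc n)) (inr a) = inl (frag_extend (\<theta> n) a) - inr (A.bd n a)"
  by (simp add: frag_extend_frag_extend dcone_def comp_def frag_extend_diff_fun)

lemma inl_inr_eq_0: "inl b + inr a = 0 \<Longrightarrow> b = 0 \<and> a = 0"
proof -
  let ?L = "frag_extend (\<lambda>x. case x of Inl b \<Rightarrow> frag_of b | Inr a \<Rightarrow> 0)"
  let ?R = "frag_extend (\<lambda>x. case x of Inl b \<Rightarrow> 0 | Inr a \<Rightarrow> frag_of a)"
  assume 0: "inl b + inr a = 0"
  have "?L (inl b + inr a) = b" "?R (inl b + inr a) = a"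
    by (simp_all add: frag_extend_add frag_extend_frag_extend)
  then show ?thesis unfolding 0 by simp
qed

lemma keys_inl: "Poly_Mapping.keys b \<subseteq> V \<Longrightarrow> Poly_Mapping.keys (inl b) \<subseteq> Inl ` V"
  by (rule keys_frag_extend_subset[of _ V]) auto

lemma keys_inr: "Poly_Mapping.keys b \<subseteq> V \<Longrightarrow> Poly_Mapping.keys (inr b) \<subseteq> Inr ` V"
  by (rule keys_frag_extend_subset[of _ V]) auto

lemma cone_complex: "free_complex cone dcone"
proof
  show "dcone 0 x = 0" for x
    by (simp add: dcone_def B.d_0 split: sum.split)
next
  fix x n assume x: "x \<in> cone (Suc n)"
  then consider b where "x = Inl b" "b \<in> SB (Suc n)" | a where "x = Inr a" "a \<in> SA n"
    by (auto simp: cone_def)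
  then show "Poly_Mapping.keys (dcone (Suc n) x) \<subseteq> cone n"
  proof cases
    case 1
    then show ?thesis using keys_inl[OF B.keys_d[of b n]] by (auto simp: dcone_def cone_def)
  next
    case 2
    have "Poly_Mapping.keys (inr (dA n a)) \<subseteq> cone n"
      using keys_inr[OF A.keys_d] 2 by (cases n) (auto simp: A.d_0 cone_def)
    moreover have "Poly_Mapping.keys (inl (\<theta> n a)) \<subseteq> cone n"
      using keys_inl[OF keys_\<theta>[of a n]] 2 by (auto simp: cone_def)
    ultimately show ?thesis using 2 by (simp add: dcone_def keys_diff_subset)
  qed
  from x consider b where "x = Inl b" "b \<in> SB (Suc n)" | a where "x = Inr a" "a \<in> SA n"
    by (auto simp: cone_def)
  then show "frag_extend (dcone n) (dcone (Suc n) x) = 0"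
  proof cases
    case 1
    then show ?thesis by (simp add: dcone_def dcone_inl[unfolded comp_def, simplified] dcone_inl B.d_d)
  next
    case 2
    then have "dcone (Suc n) x = inl (\<theta> n a) - inr (dA n a)" by (simp add: dcone_def)
    then show ?thesis
      using 2 by (cases n) (simp_all add: frag_extend_diff dcone_inl dcone_inr B.bd_0 A.d_0 d_\<theta> A.d_d)
  qed
qed

text \<open>\<open>inj\<close> and \<open>surj\<close> say that \<theta> is bijective on homology;
  together they make the cone exact. The two conclusions are dual exactness of the cone, applied to
  the cocycle (\<phi>, \<alpha>) in degree n and to the cocycle (0, \<alpha>) in degree n + 1. They
  express injectivity and surjectivity on cohomology.\<close>

lemma quasi_iso_dual:
  assumes inj: "\<And>n z w. \<lbrakk>z \<in> A.chains n; A.bd n z = 0; w \<in> B.chains (Suc n); frag_extend (\<theta> n) z = B.bd (Suc n) w\<rbrakk>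
      \<Longrightarrow> \<exists>v\<in>A.chains (Suc n). A.bd (Suc n) v = z"
    and surj: "\<And>n z. \<lbrakk>z \<in> B.chains n; B.bd n z = 0\<rbrakk>
      \<Longrightarrow> \<exists>a\<in>A.chains n. \<exists>w\<in>B.chains (Suc n). A.bd n a = 0 \<and> z = frag_extend (\<theta> n) a + B.bd (Suc n) w"
  shows quasi_iso_dual_inj: "\<lbrakk>\<And>x. x \<in> SB (Suc n) \<Longrightarrow> pairing \<phi> (dB (Suc n) x) = 0;
        \<And>a. a \<in> SA n \<Longrightarrow> pairing \<phi> (\<theta> n a) = pairing \<alpha> (dA n a)\<rbrakk>
      \<Longrightarrow> \<exists>\<beta>. \<forall>b\<in>SB n. \<phi> b = pairing \<beta> (dB n b)"
    and quasi_iso_dual_surj: "(\<And>x. x \<in> SA (Suc n) \<Longrightarrow> pairing \<alpha> (dA (Suc n) x) = 0)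
      \<Longrightarrow> \<exists>\<beta> \<gamma>. (\<forall>b\<in>SB (Suc n). pairing \<beta> (dB (Suc n) b) = 0) \<and>
              (\<forall>a\<in>SA n. \<alpha> a = pairing \<beta> (\<theta> n a) + pairing \<gamma> (dA n a))"
proof -
  interpret cone: free_complex cone dcone by (rule cone_complex)
  have ex: "\<exists>w\<in>cone.chains (Suc n). cone.bd (Suc n) w = c" if c: "c \<in> cone.chains n" "cone.bd n c = 0" for n c
  proof -
    define SA' where "SA' = (case n of 0 \<Rightarrow> {} | Suc k \<Rightarrow> SA k)"
    have "Poly_Mapping.keys c \<subseteq> Inl ` SB n \<union> Inr ` SA'"
      using c(1) by (auto simp: cone_def SA'_def split: nat.splits)
    then obtain c1 c2 where c12: "Poly_Mapping.keys c1 \<subseteq> Inl ` SB n" "Poly_Mapping.keys c2 \<subseteq> Inr ` SA'" "c1 + c2 = c"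
      using frag_split by metis
    obtain b where b: "Poly_Mapping.keys b \<subseteq> SB n" "c1 = inl b"
      using keys_imageE[OF c12(1)] .
    obtain a where a: "Poly_Mapping.keys a \<subseteq> SA'" "c2 = inr a"
      using keys_imageE[OF c12(2)] .
    have c_eq: "c = inl b + inr a" using c12 a b by simp
    \<comment> \<open>It suffices to find v with d v = a for which b + \<theta> v is a cycle:
      \<open>surj\<close> writes this cycle as \<theta> z + d w, and (w, z - v) fills (b,
      a).\<close>
    have fill: ?thesis if v: "v \<in> A.chains n" and bv: "b + frag_extend (\<theta> n) v \<in> B.chains n"
        "B.bd n (b + frag_extend (\<theta> n) v) = 0" and av: "A.bd n v = a" for v
    proof -
      obtain z w where zw: "z \<in> A.chains n" "w \<in> B.chains (Suc n)" "A.bd n z = 0"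
          "b + frag_extend (\<theta> n) v = frag_extend (\<theta> n) z + B.bd (Suc n) w"
        using surj[OF bv] by blast
      let ?w = "inl w + inr (z - v)"
      have "cone.bd (Suc n) ?w = inl (B.bd (Suc n) w + frag_extend (\<theta> n) (z - v)) - inr (A.bd n (z - v))"
        by (simp only: frag_extend_add dcone_inl dcone_inr) simp
      also have "\<dots> = inl b + inr a"
      proof -
        have "B.bd (Suc n) w + frag_extend (\<theta> n) (z - v) = b"
          using zw(4) by (simp add: frag_extend_diff algebra_simps)
        moreover have "A.bd n (z - v) = - a" by (simp add: frag_extend_diff zw av)
        ultimately show ?thesis by (simp add: frag_extend_minus)
      qed
      finally have "cone.bd (Suc n) ?w = c" using c_eq by simp
      moreover have "Poly_Mapping.keys (inl w) \<subseteq> cone (Suc n)" "Poly_Mapping.keys (inr (z - v)) \<subseteq> cone (Suc n)"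
        using keys_inl[of w] zw(2) keys_inr[OF keys_diff_subset[of z "SA n" v]] zw(1) v by (auto simp: cone_def)
      then have "?w \<in> cone.chains (Suc n)" using keys_add_subset by blast
      ultimately show ?thesis by blast
    qed
    show ?thesis
    proof (cases n)
      case 0
      then have "a = 0" using a by (simp add: SA'_def)
      then show ?thesis by (intro fill[of 0]) (use b 0 in \<open>auto simp: B.bd_0\<close>)
    next
      case (Suc k)
      have "cone.bd n c = inl (B.bd n b + frag_extend (\<theta> k) a) + inr (- A.bd k a)"
        unfolding c_eq Suc frag_extend_add dcone_inl dcone_inr by (simp add: frag_extend_minus)
      then have z: "B.bd n b + frag_extend (\<theta> k) a = 0" "A.bd k a = 0"
        using c(2) inl_inr_eq_0 by (metis, metis neg_equal_0_iff_equal)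
      have ac: "a \<in> A.chains k" using a Suc by (simp add: SA'_def)
      \<comment> \<open>The cone cycle condition says that the cycle a becomes a boundary under
        \<theta>, so \<open>inj\<close> provides v with d v = a.\<close>
      have "frag_extend (\<theta> k) a = B.bd (Suc k) (- b)"
        using z(1) Suc by (metis add.commute add_eq_0_iff frag_extend_minus)
      then obtain v where v: "v \<in> A.chains (Suc k)" "A.bd (Suc k) v = a"
        using inj[OF ac z(2), of "- b"] b Suc by auto
      show ?thesis
      proof (rule fill[of v])
        show "b + frag_extend (\<theta> n) v \<in> B.chains n"
          unfolding mem_Collect_eq using \<theta>_chains[of v n] v b Suc by (intro keys_add_subset) auto
        show "B.bd n (b + frag_extend (\<theta> n) v) = 0"
          using z(1) bd_\<theta>[OF v(1)] v(2) Suc by (simp add: frag_extend_add)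
      qed (use v Suc in auto)
    qed
  qed
  have dual: "\<exists>\<beta>. \<forall>x\<in>cone n. \<Phi> x = pairing \<beta> (dcone n x)"
    if "\<And>x. x \<in> cone (Suc n) \<Longrightarrow> pairing \<Phi> (dcone (Suc n) x) = 0" for n \<Phi>
    using cone.dual_exact[OF ex that] by blast
  {
    assume 1: "\<And>x. x \<in> SB (Suc n) \<Longrightarrow> pairing \<phi> (dB (Suc n) x) = 0"
      and 2: "\<And>a. a \<in> SA n \<Longrightarrow> pairing \<phi> (\<theta> n a) = pairing \<alpha> (dA n a)"
    have "pairing (case_sum \<phi> \<alpha>) (dcone (Suc n) x) = 0" if "x \<in> cone (Suc n)" for x
      using that 1 2 by (auto simp: cone_def dcone_def pairing_diff pairing_frag_extend)
    then obtain \<beta> where \<beta>: "\<forall>x\<in>cone n. case_sum \<phi> \<alpha> x = pairing \<beta> (dcone n x)"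
      using dual by blast
    have "\<phi> b = pairing (\<beta> \<circ> Inl) (dB n b)" if "b \<in> SB n" for b
      using \<beta>[rule_format, of "Inl b"] that by (simp add: cone_def dcone_def pairing_frag_extend comp_def)
    then show "\<exists>\<beta>. \<forall>b\<in>SB n. \<phi> b = pairing \<beta> (dB n b)" by blast
  }
  {
    assume 1: "\<And>x. x \<in> SA (Suc n) \<Longrightarrow> pairing \<alpha> (dA (Suc n) x) = 0"
    have "pairing (case_sum (\<lambda>_. 0) \<alpha>) (dcone (Suc (Suc n)) x) = 0" if "x \<in> cone (Suc (Suc n))" for x
      using that 1 by (auto simp: cone_def dcone_def pairing_diff pairing_frag_extend)
    then obtain \<beta> where \<beta>: "\<forall>x\<in>cone (Suc n). case_sum (\<lambda>_. 0) \<alpha> x = pairing \<beta> (dcone (Suc n) x)"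
      using dual by blast
    have b: "pairing (\<beta> \<circ> Inl) (dB (Suc n) b) = 0" if "b \<in> SB (Suc n)" for b
      using \<beta>[rule_format, of "Inl b"] that by (simp add: cone_def dcone_def pairing_frag_extend comp_def)
    have a: "\<alpha> a = pairing (\<beta> \<circ> Inl) (\<theta> n a) + pairing (\<lambda>a. - \<beta> (Inr a)) (dA n a)" if "a \<in> SA n" for a
      using \<beta>[rule_format, of "Inr a"] that
      by (simp add: cone_def dcone_def pairing_frag_extend pairing_diff pairing_uminus_fun comp_def)
    show "\<exists>\<beta> \<gamma>. (\<forall>b\<in>SB (Suc n). pairing \<beta> (dB (Suc n) b) = 0) \<and>
              (\<forall>a\<in>SA n. \<alpha> a = pairing \<beta> (\<theta> n a) + pairing \<gamma> (dA n a))"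
      using a b by blast
  }
qed

end

section \<open>Cubical chains\<close>

lemma frag_cmul_diff_distrib2: "frag_cmul c (a - b) = frag_cmul c a - frag_cmul c b"
  by (rule poly_mapping_eqI) (simp add: lookup_minus right_diff_distrib)

lemma diff_diff_swap: "a - b - (c - d) = a - c - (b - d)" for a :: "'a::ab_group_add"
  by simp

text \<open>The sign of moving the coordinate i past the smaller elements of \<sigma>. It is used
  both for i in \<sigma> and for i outside \<sigma>; adding or removing i itself does not change
  it.\<close>

definition sg :: "nat \<Rightarrow> nat set \<Rightarrow> int" where
  "sg i \<sigma> = (-1) ^ card {j \<in> \<sigma>. j < i}"

lemma sg_square [simp]: "sg i \<sigma> * sg i \<sigma> = 1"
  by (simp add: sg_def flip: power_mult_distrib)

lemma sg_insert:
  assumes "finite \<sigma>" "j \<notin> \<sigma>"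
  shows "sg i (insert j \<sigma>) = (if j < i then - sg i \<sigma> else sg i \<sigma>)"
proof -
  have "{k \<in> insert j \<sigma>. k < i} = (if j < i then insert j {k \<in> \<sigma>. k < i} else {k \<in> \<sigma>. k < i})"
    by auto
  then show ?thesis using assms by (simp add: sg_def)
qed

lemma sg_remove:
  assumes "finite \<sigma>" "j \<in> \<sigma>"
  shows "sg i (\<sigma> - {j}) = (if j < i then - sg i \<sigma> else sg i \<sigma>)"
  using sg_insert[of "\<sigma> - {j}" j i] assms by (auto simp: insert_absorb)

lemma sg_insert_self [simp]: "sg i (insert i \<sigma>) = sg i \<sigma>"
  by (simp add: sg_def) (metis (lifting) nat_neq_iff)

lemma sg_remove_self [simp]: "sg i (\<sigma> - {i}) = sg i \<sigma>"
  by (metis insert_Diff_single sg_insert_self)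

lemma sg_antisym:
  assumes "finite \<sigma>" "i \<in> \<sigma>" "j \<in> \<sigma>" "i \<noteq> j"
  shows "sg i \<sigma> * sg j (\<sigma> - {i}) = - (sg j \<sigma> * sg i (\<sigma> - {j}))"
  using assms by (auto simp: sg_remove)

text \<open>The terms for (i, j) and (j, i) cancel. Exchanging the two sums would only show that the
  total equals its own negative, which is inconclusive in a group with 2-torsion; hence the
  induction on \<sigma>.\<close>

lemma sum_antisymmetric:
  fixes f :: "'a \<Rightarrow> 'a \<Rightarrow> 'b::ab_group_add"
  assumes "finite \<sigma>" "\<And>i j. \<lbrakk>i \<in> \<sigma>; j \<in> \<sigma>; i \<noteq> j\<rbrakk> \<Longrightarrow> f i j = - f j i"
  shows "(\<Sum>i\<in>\<sigma>. \<Sum>j\<in>\<sigma> - {i}. f i j) = 0"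
  using assms
proof (induction \<sigma> rule: finite_induct)
  case (insert a \<sigma>)
  have "(\<Sum>i\<in>insert a \<sigma>. \<Sum>j\<in>insert a \<sigma> - {i}. f i j)
      = (\<Sum>j\<in>insert a \<sigma> - {a}. f a j) + (\<Sum>i\<in>\<sigma>. \<Sum>j\<in>insert a \<sigma> - {i}. f i j)"
    by (rule sum.insert[OF insert(1,2)])
  also have "insert a \<sigma> - {a} = \<sigma>" using insert(2) by blast
  also have "(\<Sum>i\<in>\<sigma>. \<Sum>j\<in>insert a \<sigma> - {i}. f i j) = (\<Sum>i\<in>\<sigma>. \<Sum>j\<in>insert a (\<sigma> - {i}). f i j)"
    using insert(2) by (intro sum.cong refl) blast+
  also have "(\<Sum>i\<in>\<sigma>. \<Sum>j\<in>insert a (\<sigma> - {i}). f i j) = (\<Sum>i\<in>\<sigma>. - f a i) + (\<Sum>i\<in>\<sigma>. \<Sum>j\<in>\<sigma> - {i}. f i j)"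
    unfolding sum.distrib[symmetric]
  proof (rule sum.cong[OF refl])
    fix i assume i: "i \<in> \<sigma>"
    then have "f i a = - f a i" by (intro insert.prems) (use insert(2) in auto)
    then show "(\<Sum>j\<in>insert a (\<sigma> - {i}). f i j) = - f a i + (\<Sum>j\<in>\<sigma> - {i}. f i j)"
      using insert(1,2) by simp
  qed
  also have "(\<Sum>i\<in>\<sigma>. \<Sum>j\<in>\<sigma> - {i}. f i j) = 0"
    by (rule insert.IH) (rule insert.prems; simp)
  finally show ?case by (simp only: sum_negf) simp
qed simp

lemma sum_swap_distinct:
  "finite \<sigma> \<Longrightarrow> (\<Sum>i\<in>\<sigma>. \<Sum>j\<in>\<sigma> - {i}. f i j) = (\<Sum>j\<in>\<sigma>. \<Sum>i\<in>\<sigma> - {j}. f i j)"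
proof -
  assume fin: "finite \<sigma>"
  have "(\<Sum>i\<in>\<sigma>. \<Sum>j\<in>\<sigma> - {i}. f i j) = (\<Sum>i\<in>\<sigma>. \<Sum>j\<in>{j\<in>\<sigma>. i \<noteq> j}. f i j)"
    by (intro sum.cong) auto
  also have "\<dots> = (\<Sum>j\<in>\<sigma>. \<Sum>i\<in>{i\<in>\<sigma>. i \<noteq> j}. f i j)"
    by (rule sum.swap_restrict[OF fin fin])
  also have "\<dots> = (\<Sum>j\<in>\<sigma>. \<Sum>i\<in>\<sigma> - {j}. f i j)"
    by (intro sum.cong) auto
  finally show ?thesis .
qed

text \<open>The pair \<open>(\<sigma>, E)\<close> stands for the face of the cube whose free coordinates are those in \<open>\<sigma>\<close> and
  whose fixed coordinates are \<open>1\<close> on \<open>E\<close> and \<open>0\<close> elsewhere.\<close>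

type_synonym cell = "nat set \<times> nat set"

definition cube_bd :: "cell \<Rightarrow> cell \<Rightarrow>\<^sub>0 int" where
  "cube_bd = (\<lambda>(\<sigma>, E). \<Sum>i\<in>\<sigma>. frag_cmul (sg i \<sigma>) (frag_of (\<sigma> - {i}, insert i E) - frag_of (\<sigma> - {i}, E)))"

lemma cube_bd_bd: "frag_extend cube_bd (cube_bd (\<sigma>, E)) = 0"
proof (cases "finite \<sigma>")
  case True
  let ?b = "\<lambda>i j. frag_of (\<sigma> - {i} - {j}, insert j (insert i E)) - frag_of (\<sigma> - {i} - {j}, insert i E)
       - (frag_of (\<sigma> - {i} - {j}, insert j E) - frag_of (\<sigma> - {i} - {j}, E))"
  have "frag_extend cube_bd (cube_bd (\<sigma>, E))
      = (\<Sum>i\<in>\<sigma>. \<Sum>j\<in>\<sigma> - {i}. frag_cmul (sg i \<sigma> * sg j (\<sigma> - {i})) (?b i j))"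
    unfolding cube_bd_def case_prod_conv frag_extend_sum' frag_extend_cmul frag_extend_diff frag_extend_of
    by (simp only: frag_cmul_cmul frag_cmul_sum flip: sum_subtractf frag_cmul_diff_distrib2 frag_cmul_cmul)
  also have "\<dots> = 0"
  proof (rule sum_antisymmetric[OF True])
    fix i j assume ij: "i \<in> \<sigma>" "j \<in> \<sigma>" "i \<noteq> j"
    have e: "\<sigma> - {i} - {j} = \<sigma> - {j} - {i}" "insert j (insert i E) = insert i (insert j E)" by auto
    have "?b i j = ?b j i"
      unfolding e by (rule diff_diff_swap)
    then show "frag_cmul (sg i \<sigma> * sg j (\<sigma> - {i})) (?b i j) = - frag_cmul (sg j \<sigma> * sg i (\<sigma> - {j})) (?b j i)"
      using sg_antisym[OF True ij] by simp
  qed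
  finally show ?thesis .
qed (simp add: cube_bd_def)

text \<open>The chain map of the projection onto the face x_i = 0. A cell with free coordinate i
  becomes degenerate under it, hence 0.\<close>

definition collapse :: "nat \<Rightarrow> cell \<Rightarrow> cell \<Rightarrow>\<^sub>0 int" where
  "collapse i = (\<lambda>(\<sigma>, E). if i \<in> \<sigma> then 0 else frag_of (\<sigma>, E - {i}))"

text \<open>The prism operator of the straight line homotopy to that projection: a cell in x_i = 1
  sweeps out the cell in which i is free as well.\<close>

definition collapse_homotopy :: "nat \<Rightarrow> cell \<Rightarrow> cell \<Rightarrow>\<^sub>0 int" where
  "collapse_homotopy i = (\<lambda>(\<sigma>, E). if i \<in> E then frag_cmul (sg i \<sigma>) (frag_of (insert i \<sigma>, E - {i})) else 0)"

text \<open>The cases are: i free, x_i = 0, x_i = 1. If i is free, the face x_i = 1 sweeps out the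
  cell itself. If x_i = 1, the two ends of the prism give the cell minus its projection, and the
  remaining faces of the prism cancel against the prisms over the boundary.\<close>

lemma collapse_homotopy:
  assumes "finite \<sigma>" "\<sigma> \<inter> E = {}"
  shows "frag_extend cube_bd (collapse_homotopy i (\<sigma>, E)) + frag_extend (collapse_homotopy i) (cube_bd (\<sigma>, E))
    = frag_of (\<sigma>, E) - collapse i (\<sigma>, E)"
proof -
  have hb: "frag_extend (collapse_homotopy i) (cube_bd (\<sigma>, E)) = (\<Sum>j\<in>\<sigma>. frag_cmul (sg j \<sigma>)
      (collapse_homotopy i (\<sigma> - {j}, insert j E) - collapse_homotopy i (\<sigma> - {j}, E)))"
    by (simp add: cube_bd_def frag_extend_sum' frag_extend_cmul frag_extend_diff)
  consider "i \<in> \<sigma>" | "i \<notin> \<sigma>" "i \<notin> E" | "i \<notin> \<sigma>" "i \<in> E" by blast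
  then show ?thesis
  proof cases
    case 1
    then have iE: "i \<notin> E" using assms by auto
    have "frag_extend (collapse_homotopy i) (cube_bd (\<sigma>, E)) = (\<Sum>j\<in>\<sigma>. if j = i then frag_of (\<sigma>, E) else 0)"
      unfolding hb using 1 iE by (intro sum.cong) (auto simp: collapse_homotopy_def insert_absorb)
    then show ?thesis using 1 iE assms by (simp add: collapse_homotopy_def collapse_def)
  next
    case 2
    have "frag_extend (collapse_homotopy i) (cube_bd (\<sigma>, E)) = (\<Sum>j\<in>\<sigma>. 0)"
      unfolding hb using 2 by (intro sum.cong) (auto simp: collapse_homotopy_def)
    then show ?thesis using 2 by (simp add: collapse_homotopy_def collapse_def)
  next
    case 3
    let ?r = "\<lambda>j. frag_of (insert i \<sigma> - {j}, insert j (E - {i})) - frag_of (insert i \<sigma> - {j}, E - {i})"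
    have "frag_extend cube_bd (collapse_homotopy i (\<sigma>, E))
        = frag_cmul (sg i \<sigma>) (\<Sum>j\<in>insert i \<sigma>. frag_cmul (sg j (insert i \<sigma>)) (?r j))"
      using 3 by (simp add: collapse_homotopy_def frag_extend_cmul cube_bd_def)
    also have "\<dots> = ?r i + (\<Sum>j\<in>\<sigma>. frag_cmul (sg i \<sigma> * sg j (insert i \<sigma>)) (?r j))"
      using 3 assms(1) by (simp add: frag_cmul_distrib2 frag_cmul_sum)
    also have "?r i = frag_of (\<sigma>, E) - collapse i (\<sigma>, E)"
      using 3 by (simp add: collapse_def insert_absorb)
    finally have 1: "frag_extend cube_bd (collapse_homotopy i (\<sigma>, E)) = frag_of (\<sigma>, E) - collapse i (\<sigma>, E)
        + (\<Sum>j\<in>\<sigma>. frag_cmul (sg i \<sigma> * sg j (insert i \<sigma>)) (?r j))" .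
    have "frag_extend (collapse_homotopy i) (cube_bd (\<sigma>, E))
        = (\<Sum>j\<in>\<sigma>. - frag_cmul (sg i \<sigma> * sg j (insert i \<sigma>)) (?r j))"
      unfolding hb
    proof (rule sum.cong[OF refl])
      fix j assume j: "j \<in> \<sigma>"
      with 3 have ij: "i \<noteq> j" by auto
      have "collapse_homotopy i (\<sigma> - {j}, insert j E) - collapse_homotopy i (\<sigma> - {j}, E)
          = frag_cmul (sg i (\<sigma> - {j})) (?r j)"
        using 3 ij by (simp add: collapse_homotopy_def insert_Diff_if frag_cmul_diff_distrib2)
      moreover have "sg j \<sigma> * sg i (\<sigma> - {j}) = - (sg i \<sigma> * sg j (insert i \<sigma>))"
        using ij j 3 assms(1) by (auto simp: sg_insert sg_remove)
      ultimately show "frag_cmul (sg j \<sigma>) (collapse_homotopy i (\<sigma> - {j}, insert j E) - collapse_homotopy i (\<sigma> - {j}, E))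
          = - frag_cmul (sg i \<sigma> * sg j (insert i \<sigma>)) (?r j)"
        by simp
    qed
    then have "frag_extend (collapse_homotopy i) (cube_bd (\<sigma>, E))
        = - (\<Sum>j\<in>\<sigma>. frag_cmul (sg i \<sigma> * sg j (insert i \<sigma>)) (?r j))"
      by (simp only: sum_negf)
    then show ?thesis unfolding 1 by (simp only:) simp
  qed
qed

text \<open>The n-cells of the closed face of the cube whose vertices are the sets between A and
  B.\<close>

definition face_box :: "nat set \<Rightarrow> nat set \<Rightarrow> nat \<Rightarrow> cell set" where
  "face_box A B n = {(\<sigma>, E). \<sigma> \<subseteq> B \<and> A \<subseteq> E \<and> E \<subseteq> B \<and> \<sigma> \<inter> E = {} \<and> card \<sigma> = n}"

lemma keys_cube_bd:
  assumes "finite \<sigma>" "\<sigma> \<inter> E = {}"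
  shows "Poly_Mapping.keys (cube_bd (\<sigma>, E)) \<subseteq> {(\<sigma> - {i}, F) |i F. i \<in> \<sigma> \<and> (F = E \<or> F = insert i E)}"
  unfolding cube_bd_def case_prod_conv
  by (intro keys_sum_subset keys_cmul_subset keys_diff_subset) auto

lemma keys_cube_bd_box:
  assumes "finite B" "c \<in> face_box A B (Suc n)"
  shows "Poly_Mapping.keys (cube_bd c) \<subseteq> face_box A B n"
proof -
  obtain \<sigma> E where c: "c = (\<sigma>, E)" by fastforce
  then have "finite \<sigma>" "\<sigma> \<inter> E = {}" using assms by (auto simp: face_box_def intro: finite_subset)
  note keys = keys_cube_bd[OF this]
  have "(\<sigma> - {i}, F) \<in> face_box A B n" if "i \<in> \<sigma>" "F = E \<or> F = insert i E" for i F
    using assms(2) that \<open>finite \<sigma>\<close> by (auto simp: face_box_def c)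
  with keys show ?thesis unfolding c by blast
qed

text \<open>The coordinates in D are collapsed one after the other. Each collapse changes the cycle
  by a boundary inside the box, and in the end only the vertex A is left.\<close>

lemma box_reduce:
  assumes "finite D" "finite A" "A \<inter> D = {}"
    and "Poly_Mapping.keys c \<subseteq> face_box A (A \<union> D) n" "frag_extend cube_bd c = 0"
  shows "\<exists>w. Poly_Mapping.keys w \<subseteq> face_box A (A \<union> D) (Suc n)
    \<and> Poly_Mapping.keys (c - frag_extend cube_bd w) \<subseteq> face_box A A n"
  using assms
proof (induction D arbitrary: c rule: finite_induct)
  case empty
  then show ?case by (intro exI[of _ 0]) simp
next
  case (insert i D)
  let ?B = "A \<union> insert i D"
  have fB: "finite ?B" using insert by auto
  let ?h = "frag_extend (collapse_homotopy i)" and ?p = "frag_extend (collapse i)" and ?d = "frag_extend cube_bd"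
  have hp: "?d (?h c) + ?h (?d c) = c - ?p c"
  proof -
    have "?d (?h c) + ?h (?d c) = frag_extend (\<lambda>x. frag_of x - collapse i x) c"
      unfolding frag_extend_frag_extend frag_extend_add_fun[symmetric]
    proof (rule frag_extend_cong_keys[OF insert.prems(3)])
      fix x assume "x \<in> face_box A ?B n"
      then show "?d (collapse_homotopy i x) + ?h (cube_bd x) = frag_of x - collapse i x"
        using collapse_homotopy[of "fst x" "snd x" i] finite_subset[OF _ fB, of "fst x"] by (auto simp: face_box_def)
    qed
    then show ?thesis by (simp add: frag_extend_diff_fun)
  qed
  then have pc: "?p c = c - ?d (?h c)" using insert.prems(4) by (simp add: algebra_simps)
  have kp: "Poly_Mapping.keys (?p c) \<subseteq> face_box A (A \<union> D) n"
  proof (rule keys_frag_extend_subset[OF insert.prems(3)])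
    fix x assume "x \<in> face_box A ?B n"
    then show "Poly_Mapping.keys (collapse i x) \<subseteq> face_box A (A \<union> D) n"
      using insert.prems(2) by (cases "i \<in> fst x") (auto simp: face_box_def collapse_def)
  qed
  have dd: "?d (?d v) = 0" for v
    unfolding frag_extend_frag_extend by (rule frag_extend_eq_0) (metis cube_bd_bd surj_pair)
  have "?d (?p c) = 0"
    unfolding pc frag_extend_diff by (simp add: dd insert.prems(4))
  then obtain w where w: "Poly_Mapping.keys w \<subseteq> face_box A (A \<union> D) (Suc n)" "Poly_Mapping.keys (?p c - ?d w) \<subseteq> face_box A A n"
    using insert.IH[OF insert.prems(1) _ kp] insert.prems(2) by auto
  have "Poly_Mapping.keys (?h c) \<subseteq> face_box A ?B (Suc n)"
  proof (rule keys_frag_extend_subset[OF insert.prems(3)])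
    fix x assume x: "x \<in> face_box A ?B n"
    then have "finite (fst x)" using finite_subset[OF _ fB, of "fst x"] by (auto simp: face_box_def)
    with x show "Poly_Mapping.keys (collapse_homotopy i x) \<subseteq> face_box A ?B (Suc n)"
      using insert.prems(2)
      by (auto simp: face_box_def collapse_homotopy_def card_insert_if split: if_splits)
  qed
  moreover have "Poly_Mapping.keys w \<subseteq> face_box A ?B (Suc n)" using w(1) by (auto simp: face_box_def)
  ultimately have "Poly_Mapping.keys (?h c + w) \<subseteq> face_box A ?B (Suc n)" by (rule keys_add_subset)
  moreover have "c - ?d (?h c + w) = ?p c - ?d w" using pc by (simp add: frag_extend_add algebra_simps)
  ultimately show ?case using w(2) by metis
qed

lemma pairing_cube_bd_const: "pairing (\<lambda>_. k) (cube_bd c) = 0"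
  by (cases c) (simp add: cube_bd_def pairing_sum pairing_cmul pairing_diff)

lemma pairing_singleton:
  assumes "Poly_Mapping.keys c \<subseteq> {a}"
  shows "pairing f c = Poly_Mapping.lookup c a * f a"
proof (cases "a \<in> Poly_Mapping.keys c")
  case True
  then have "Poly_Mapping.keys c = {a}" using assms by blast
  then show ?thesis by (simp add: pairing_def)
next
  case False
  then have "Poly_Mapping.keys c = {}" using assms by blast
  with False show ?thesis by (simp add: pairing_def in_keys_iff)
qed

text \<open>After \<open>box_reduce\<close> the remainder is a multiple of the vertex A. In positive
  degree there is no cell it could be supported on; in degree 0 its coefficient is the augmentation
  of \<open>c\<close>, because boundaries have augmentation 0.\<close>

lemma box_acyclic:
  assumes "finite B" "A \<subseteq> B" "Poly_Mapping.keys c \<subseteq> face_box A B n" "frag_extend cube_bd c = 0"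
    and "n = 0 \<Longrightarrow> pairing (\<lambda>_. 1) c = 0"
  shows "\<exists>w. Poly_Mapping.keys w \<subseteq> face_box A B (Suc n) \<and> frag_extend cube_bd w = c"
proof -
  have B: "A \<union> (B - A) = B" using assms by auto
  obtain w where w: "Poly_Mapping.keys w \<subseteq> face_box A B (Suc n)" "Poly_Mapping.keys (c - frag_extend cube_bd w) \<subseteq> face_box A A n"
    using box_reduce[of "B - A" A c n] assms B by (auto intro: finite_subset)
  have sub: "face_box A A n \<subseteq> {({}, A)}" by (auto simp: face_box_def)
  have "c - frag_extend cube_bd w = 0"
  proof (cases n)
    case 0
    let ?r = "c - frag_extend cube_bd w"
    have "pairing (\<lambda>_. 1) ?r = 0"
      using assms(5)[OF 0] by (simp add: pairing_diff pairing_frag_extend pairing_cube_bd_const)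
    moreover have "pairing (\<lambda>_. 1) ?r = Poly_Mapping.lookup ?r ({}, A)"
      using pairing_singleton[OF order_trans[OF w(2) sub]] by simp
    ultimately have "({}, A) \<notin> Poly_Mapping.keys ?r" by (simp add: in_keys_iff)
    then have "Poly_Mapping.keys ?r = {}" using w(2) sub by blast
    then show ?thesis by simp
  next
    case (Suc k)
    have "face_box A A n = {}"
    proof (rule equals0I)
      fix x assume x: "x \<in> face_box A A n"
      with sub have "x = ({}, A)" by blast
      with x Suc show False by (simp add: face_box_def)
    qed
    then show ?thesis using w(2) by simp
  qed
  then show ?thesis using w(1) by auto
qed

section \<open>The singular cochain ring\<close>

lemma evaluate_eq_pairing: "evaluate \<phi> c = pairing \<phi> c"
  by (simp add: evaluate_def pairing_def)

definition sing_bd :: "nat \<Rightarrow> ((nat \<Rightarrow> real) \<Rightarrow> 'a) \<Rightarrow> 'a chain" where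
  "sing_bd n f = chain_boundary n (frag_of f)"

lemma chain_boundary_eq: "chain_boundary n c = frag_extend (sing_bd n) c"
  by (cases "n = 0") (simp_all add: chain_boundary_def sing_bd_def[abs_def])

lemma free_complex_singular: "free_complex (\<lambda>n. singular_simplex_set n X) sing_bd"
proof
  show "sing_bd 0 x = 0" for x :: "(nat \<Rightarrow> real) \<Rightarrow> 'a" by (simp add: sing_bd_def chain_boundary_def)
  fix x n assume "x \<in> singular_simplex_set (Suc n) X"
  then have x: "singular_chain (Suc n) X (frag_of x)" by (simp add: singular_chain_of)
  show "Poly_Mapping.keys (sing_bd (Suc n) x) \<subseteq> singular_simplex_set n X"
    using singular_chain_boundary_alt[OF x] by (simp add: sing_bd_def singular_chain_def)
  show "frag_extend (sing_bd n) (sing_bd (Suc n) x) = 0"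
    using chain_boundary_boundary[OF x] by (simp add: sing_bd_def[of "Suc n"] chain_boundary_eq[of n])
qed

lemma pairing_sing_bd:
  "pairing \<phi> (sing_bd (Suc n) \<sigma>) = (\<Sum>k\<le>Suc n. (-1) ^ k * \<phi> (singular_face (Suc n) k \<sigma>))"
  by (simp add: sing_bd_def chain_boundary_of pairing_sum pairing_cmul del: sum.atMost_Suc)

section \<open>Front and back faces of singular simplices\<close>

definition shift :: "nat \<Rightarrow> (nat \<Rightarrow> real) \<Rightarrow> nat \<Rightarrow> real" where
  "shift p x = (\<lambda>i. if i < p then 0 else x (i - p))"

lemma back_face_shift: "back_face p q \<sigma> = restrict (\<sigma> \<circ> shift p) (standard_simplex q)"
  by (simp add: back_face_def shift_def comp_def)

lemma shift_in_standard_simplex: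
  assumes "x \<in> standard_simplex q"
  shows "shift p x \<in> standard_simplex (p + q)"
proof -
  have "(\<Sum>i\<le>p + q. shift p x i) = (\<Sum>i\<in>{p..p + q}. x (i - p))"
    by (rule sum.mono_neutral_cong_right) (auto simp: shift_def)
  also have "\<dots> = (\<Sum>i\<in>{0..q}. x i)"
    using sum.shift_bounds_cl_nat_ivl[of "\<lambda>i. x (i - p)" 0 p q] by (simp add: add.commute)
  also have "\<dots> = 1" using assms by (simp add: standard_simplex_def atMost_atLeast0)
  finally show ?thesis
    using assms by (auto simp: standard_simplex_def shift_def)
qed

lemma singular_simplex_front_face:
  assumes "singular_simplex (p + q) X \<sigma>"
  shows "singular_simplex p X (front_face p \<sigma>)"
proof -
  have "continuous_map (subtopology (powertop_real UNIV) (standard_simplex p)) X \<sigma>"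
    using assms standard_simplex_mono[of p "p + q"]
    by (auto simp: singular_simplex_def intro: continuous_map_from_subtopology_mono)
  then show ?thesis
    by (auto simp: singular_simplex_def front_face_def intro: continuous_map_eq)
qed

lemma singular_simplex_back_face:
  assumes "singular_simplex (p + q) X \<sigma>"
  shows "singular_simplex q X (back_face p q \<sigma>)"
proof -
  let ?PT = "powertop_real UNIV"
  have "continuous_map ?PT euclideanreal (\<lambda>x. shift p x i)" for i
    by (cases "i < p") (auto simp: shift_def intro: continuous_map_product_projection)
  then have "continuous_map (subtopology ?PT (standard_simplex q)) (subtopology ?PT (standard_simplex (p + q))) (shift p)"
    by (auto simp: continuous_map_in_subtopology continuous_map_componentwise shift_in_standard_simplex
        intro: continuous_map_from_subtopology)
  then have "continuous_map (subtopology ?PT (standard_simplex q)) X (\<sigma> \<circ> shift p)"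
    using assms by (auto simp: singular_simplex_def intro: continuous_map_compose)
  then show ?thesis
    unfolding singular_simplex_def back_face_shift by (auto intro: continuous_map_eq)
qed

lemma standard_simplex_vanish: "x \<in> standard_simplex p \<Longrightarrow> p < i \<Longrightarrow> x i = 0"
  by (simp add: standard_simplex_def)

lemma face_closed: "x \<in> standard_simplex p \<Longrightarrow> k \<le> Suc p \<Longrightarrow> simplical_face k x \<in> standard_simplex (Suc p)"
  using simplical_face_in_standard_simplex[of "Suc p" k x] by simp

lemma mono_simplex: "x \<in> standard_simplex p \<Longrightarrow> p \<le> q \<Longrightarrow> x \<in> standard_simplex q"
  using standard_simplex_mono by blast

text \<open>The range of k overlaps with that of the next lemma at k = p + 1. Comparing the two
  there shows that the last face of the front (p + 1)-face is the front p-face, which is one of the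
  two terms cancelling in the Leibniz rule. The lemmas on back faces overlap at k = p in the same
  way.\<close>

lemma front_face_singular_face_low:
  assumes "k \<le> Suc p"
  shows "front_face p (singular_face (Suc (p + q)) k \<sigma>) = singular_face (Suc p) k (front_face (Suc p) \<sigma>)"
  using assms by (auto simp: front_face_def singular_face_def fun_eq_iff mono_simplex face_closed)

lemma front_face_singular_face_high:
  assumes "p < k"
  shows "front_face p (singular_face (Suc (p + q)) k \<sigma>) = front_face p \<sigma>"
proof -
  have "simplical_face k x = x" if "x \<in> standard_simplex p" for x
    using assms standard_simplex_vanish[OF that] by (auto simp: simplical_face_def fun_eq_iff)
  then show ?thesis by (intro ext) (auto simp: front_face_def singular_face_def mono_simplex)
qed

lemma back_face_singular_face_low:
  assumes "k \<le> p"
  shows "back_face p q (singular_face (Suc (p + q)) k \<sigma>) = back_face (Suc p) q \<sigma>"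
proof -
  have "simplical_face k (shift p x) = shift (Suc p) x" for x
    using assms by (auto simp: simplical_face_def shift_def fun_eq_iff)
  then show ?thesis
    by (intro ext) (auto simp: back_face_shift singular_face_def shift_in_standard_simplex)
qed

lemma back_face_singular_face_high:
  assumes "j \<le> Suc q"
  shows "back_face p q (singular_face (Suc (p + q)) (p + j) \<sigma>) = singular_face (Suc q) j (back_face p (Suc q) \<sigma>)"
proof -
  have "simplical_face (p + j) (shift p x) = shift p (simplical_face j x)" for x
    by (auto simp: simplical_face_def shift_def fun_eq_iff)
  then show ?thesis
    using assms
    by (intro ext) (auto simp: back_face_shift singular_face_def shift_in_standard_simplex face_closed)
qed

lemma front_face_front_face: "front_face p (front_face (p + q) \<sigma>) = front_face p \<sigma>"
  by (auto simp: front_face_def fun_eq_iff mono_simplex)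

lemma back_face_front_face: "back_face p q (front_face (p + q) \<sigma>) = front_face q (back_face p (q + r) \<sigma>)"
  by (auto simp: front_face_def back_face_shift fun_eq_iff mono_simplex shift_in_standard_simplex)

lemma back_face_back_face: "back_face q r (back_face p (q + r) \<sigma>) = back_face (p + q) r \<sigma>"
proof -
  have "shift p (shift q x) = shift (p + q) x" for x
    by (auto simp: shift_def fun_eq_iff)
  then show ?thesis
    by (intro ext) (auto simp: back_face_shift shift_in_standard_simplex)
qed

lemma front_face_self: "singular_simplex p X \<sigma> \<Longrightarrow> front_face p \<sigma> = \<sigma>"
  by (auto simp: singular_simplex_def front_face_def extensional_restrict)

lemma back_face_self: "singular_simplex p X \<sigma> \<Longrightarrow> back_face 0 p \<sigma> = \<sigma>"
  by (simp add: singular_simplex_def back_face_def extensional_restrict)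

text \<open>The faces with k \<le> p act on the front factor, the others on the back factor.
  Completing both groups to full boundaries adds the product of \<phi> on the front p-face with
  \<psi> on the back q-face twice, with opposite signs.\<close>

lemma cup_pairing_bd:
  shows "pairing (\<lambda>\<tau>. \<phi> (front_face p \<tau>) * \<psi> (back_face p q \<tau>)) (sing_bd (Suc (p + q)) \<sigma>)
    = pairing \<phi> (sing_bd (Suc p) (front_face (Suc p) \<sigma>)) * \<psi> (back_face (Suc p) q \<sigma>)
    + (-1) ^ p * (\<phi> (front_face p \<sigma>) * pairing \<psi> (sing_bd (Suc q) (back_face p (Suc q) \<sigma>)))"
proof -
  let ?t = "\<lambda>k. (-1) ^ k * (\<phi> (front_face p (singular_face (Suc (p + q)) k \<sigma>)) * \<psi> (back_face p q (singular_face (Suc (p + q)) k \<sigma>)))"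
  let ?f = "\<lambda>k. (-1) ^ k * \<phi> (singular_face (Suc p) k (front_face (Suc p) \<sigma>))"
  let ?b = "\<lambda>j. (-1) ^ j * \<psi> (singular_face (Suc q) j (back_face p (Suc q) \<sigma>))"
  have split: "{..Suc (p + q)} = {..p} \<union> (+) p ` {Suc 0..Suc q}"
    unfolding image_add_atLeastAtMost by auto
  have "pairing (\<lambda>\<tau>. \<phi> (front_face p \<tau>) * \<psi> (back_face p q \<tau>)) (sing_bd (Suc (p + q)) \<sigma>) = (\<Sum>k\<le>Suc (p + q). ?t k)"
    by (rule pairing_sing_bd)
  also have "\<dots> = (\<Sum>k\<le>p. ?t k) + (\<Sum>k\<in>(+) p ` {Suc 0..Suc q}. ?t k)"
    unfolding split by (rule sum.union_disjoint) auto
  also have "(\<Sum>k\<le>p. ?t k) = (\<Sum>k\<le>p. ?f k) * \<psi> (back_face (Suc p) q \<sigma>)"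
    unfolding sum_distrib_right
    by (rule sum.cong) (simp_all add: front_face_singular_face_low back_face_singular_face_low)
  also have "(\<Sum>k\<in>(+) p ` {Suc 0..Suc q}. ?t k) = (-1) ^ p * (\<phi> (front_face p \<sigma>) * (\<Sum>j\<in>{Suc 0..Suc q}. ?b j))"
  proof -
    have "(\<Sum>k\<in>(+) p ` {Suc 0..Suc q}. ?t k) = (\<Sum>j\<in>{Suc 0..Suc q}. ?t (p + j))"
      by (subst sum.reindex) auto
    also have "\<dots> = (\<Sum>j\<in>{Suc 0..Suc q}. (-1) ^ p * (\<phi> (front_face p \<sigma>) * ?b j))"
    proof (rule sum.cong[OF refl])
      fix j assume "j \<in> {Suc 0..Suc q}"
      then have "front_face p (singular_face (Suc (p + q)) (p + j) \<sigma>) = front_face p \<sigma>"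
          "back_face p q (singular_face (Suc (p + q)) (p + j) \<sigma>) = singular_face (Suc q) j (back_face p (Suc q) \<sigma>)"
        by (simp_all add: front_face_singular_face_high back_face_singular_face_high)
      then show "?t (p + j) = (-1) ^ p * (\<phi> (front_face p \<sigma>) * ?b j)"
        by (simp only: power_add) simp
    qed
    finally show ?thesis by (simp only: sum_distrib_left)
  qed
  finally have L: "pairing (\<lambda>\<tau>. \<phi> (front_face p \<tau>) * \<psi> (back_face p q \<tau>)) (sing_bd (Suc (p + q)) \<sigma>)
    = (\<Sum>k\<le>p. ?f k) * \<psi> (back_face (Suc p) q \<sigma>) + (-1) ^ p * (\<phi> (front_face p \<sigma>) * (\<Sum>j\<in>{Suc 0..Suc q}. ?b j))" .
  have f: "pairing \<phi> (sing_bd (Suc p) (front_face (Suc p) \<sigma>)) = (\<Sum>k\<le>p. ?f k) - (-1) ^ p * \<phi> (front_face p \<sigma>)"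
  proof -
    have "singular_face (Suc p) (Suc p) (front_face (Suc p) \<sigma>) = front_face p \<sigma>"
      using front_face_singular_face_low[of "Suc p" p q \<sigma>] front_face_singular_face_high[of p "Suc p" q \<sigma>] by simp
    then show ?thesis by (simp add: pairing_sing_bd)
  qed
  have b: "pairing \<psi> (sing_bd (Suc q) (back_face p (Suc q) \<sigma>)) = \<psi> (back_face (Suc p) q \<sigma>) + (\<Sum>j\<in>{Suc 0..Suc q}. ?b j)"
  proof -
    have "singular_face (Suc q) 0 (back_face p (Suc q) \<sigma>) = back_face (Suc p) q \<sigma>"
      using back_face_singular_face_high[of 0 q p \<sigma>] back_face_singular_face_low[of p p q \<sigma>] by simp
    moreover have "{..Suc q} = insert 0 {Suc 0..Suc q}" by auto
    ultimately show ?thesis unfolding pairing_sing_bd by simp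
  qed
  show ?thesis unfolding L f b by (simp add: algebra_simps)
qed

section \<open>The cochains of a fixed space as a differential graded ring\<close>

context
  fixes X :: "'a topology"
begin

abbreviation SC where "SC \<equiv> singular_cochain_group X"
abbreviation \<delta> where "\<delta> \<equiv> singular_coboundary X"

lemma SC_carrier: "\<phi> \<in> carrier (SC p) \<longleftrightarrow> (\<forall>\<sigma>. \<phi> \<sigma> \<noteq> 0 \<longrightarrow> 0 \<le> p \<and> singular_simplex (nat p) X \<sigma>)"
  by (simp add: singular_cochain_group_def)

lemma SC_mult [simp]: "\<phi> \<otimes>\<^bsub>SC p\<^esub> \<psi> = (\<lambda>\<sigma>. \<phi> \<sigma> + \<psi> \<sigma>)"
  by (simp add: singular_cochain_group_def)

lemma SC_one [simp]: "\<one>\<^bsub>SC p\<^esub> = (\<lambda>_. 0)"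
  by (simp add: singular_cochain_group_def)

lemma SC_neg: "p < 0 \<Longrightarrow> \<phi> \<in> carrier (SC p) \<Longrightarrow> \<phi> = (\<lambda>_. 0)"
  by (force simp: SC_carrier)

lemma \<delta>_eq: "\<delta> p \<phi> \<sigma> = (if singular_simplex (nat (p + 1)) X \<sigma> then pairing \<phi> (sing_bd (nat (p + 1)) \<sigma>) else 0)"
  by (simp add: singular_coboundary_def evaluate_eq_pairing sing_bd_def)

lemma \<delta>_zero: "\<delta> p (\<lambda>_. 0) = (\<lambda>_. 0)"
  by (simp add: \<delta>_eq fun_eq_iff)

lemma \<delta>_carrier: "\<phi> \<in> carrier (SC p) \<Longrightarrow> \<delta> p \<phi> \<in> carrier (SC (p + 1))"
proof (cases "p < 0")
  case True
  then show "\<phi> \<in> carrier (SC p) \<Longrightarrow> ?thesis" using SC_neg[of p \<phi>] by (simp add: \<delta>_zero) (simp add: SC_carrier)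
next
  case False
  then show ?thesis by (auto simp: SC_carrier \<delta>_eq)
qed

lemma \<delta>_\<delta>: "\<phi> \<in> carrier (SC p) \<Longrightarrow> \<delta> (p + 1) (\<delta> p \<phi>) = (\<lambda>_. 0)"
proof (cases "p < 0")
  case True
  then show "\<phi> \<in> carrier (SC p) \<Longrightarrow> ?thesis" using SC_neg[of p \<phi>] by (simp add: \<delta>_zero)
next
  case False
  then obtain n where n: "p = int n" by (metis nonneg_int_cases not_le)
  interpret free_complex "\<lambda>n. singular_simplex_set n X" sing_bd by (rule free_complex_singular)
  have "pairing (\<delta> p \<phi>) (sing_bd (Suc (Suc n)) \<sigma>) = 0" if \<sigma>: "singular_simplex (Suc (Suc n)) X \<sigma>" for \<sigma>
  proof -
    have "pairing (\<delta> p \<phi>) (sing_bd (Suc (Suc n)) \<sigma>) = pairing (\<lambda>\<tau>. pairing \<phi> (sing_bd (Suc n) \<tau>)) (sing_bd (Suc (Suc n)) \<sigma>)"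
      by (rule pairing_cong_keys[OF keys_d]) (use \<sigma> n in \<open>auto simp: \<delta>_eq nat_add_distrib\<close>)
    also have "\<dots> = pairing \<phi> (frag_extend (sing_bd (Suc n)) (sing_bd (Suc (Suc n)) \<sigma>))"
      by (simp add: pairing_frag_extend)
    finally show ?thesis using d_d[of \<sigma> "Suc n"] \<sigma> by simp
  qed
  moreover have "nat (p + 1 + 1) = Suc (Suc n)" using n by simp
  ultimately show ?thesis by (intro ext) (simp add: \<delta>_eq[of "p + 1"])
qed

lemma comm_group_SC: "comm_group (SC p)"
proof (rule comm_groupI)
  fix \<phi> assume "\<phi> \<in> carrier (SC p)"
  then show "\<exists>\<psi>\<in>carrier (SC p). \<psi> \<otimes>\<^bsub>SC p\<^esub> \<phi> = \<one>\<^bsub>SC p\<^esub>"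
    by (intro bexI[of _ "\<lambda>\<sigma>. - \<phi> \<sigma>"]) (auto simp: SC_carrier)
qed (auto simp: SC_carrier, (metis add.right_neutral)+)

lemma cochain_complex_singular: "cochain_complex SC \<delta>"
proof (rule cochain_complex.intro)
  show "comm_group (SC p)" for p by (rule comm_group_SC)
  show "\<delta> p \<in> hom (SC p) (SC (p + 1))" for p
    by (rule homI) (auto simp: \<delta>_carrier \<delta>_eq pairing_add_fun fun_eq_iff)
  show "\<delta> (p + 1) (\<delta> p \<phi>) = \<one>\<^bsub>SC (p + 1 + 1)\<^esub>" if "\<phi> \<in> carrier (SC p)" for p \<phi>
    using \<delta>_\<delta>[OF that] by simp
qed

lemma cup_carrier: "0 \<le> p \<Longrightarrow> 0 \<le> q \<Longrightarrow> cup X p q \<phi> \<psi> \<in> carrier (SC (p + q))"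
  by (simp add: SC_carrier cup_def)

lemma cup_leibniz:
  assumes "0 \<le> p" "0 \<le> q" "\<phi> \<in> carrier (SC p)" "\<psi> \<in> carrier (SC q)"
  shows "\<delta> (p + q) (cup X p q \<phi> \<psi>) = (\<lambda>\<sigma>. cup X (p + 1) q (\<delta> p \<phi>) \<psi> \<sigma> + (-1) ^ nat p * cup X p (q + 1) \<phi> (\<delta> q \<psi>) \<sigma>)"
proof
  fix \<sigma>
  interpret free_complex "\<lambda>n. singular_simplex_set n X" sing_bd by (rule free_complex_singular)
  obtain m n where mn: "p = int m" "q = int n" using assms nonneg_int_cases by metis
  have nat: "nat (int m + int n) = m + n" "nat (1 + int m) = Suc m" "nat (1 + int n) = Suc n"
      "nat (1 + (int m + int n)) = Suc (m + n)"
    by auto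
  show "\<delta> (p + q) (cup X p q \<phi> \<psi>) \<sigma> = cup X (p + 1) q (\<delta> p \<phi>) \<psi> \<sigma> + (-1) ^ nat p * cup X p (q + 1) \<phi> (\<delta> q \<psi>) \<sigma>"
  proof (cases "singular_simplex (Suc (m + n)) X \<sigma>")
    case True
    have "pairing (cup X p q \<phi> \<psi>) (sing_bd (Suc (m + n)) \<sigma>)
        = pairing (\<lambda>\<tau>. \<phi> (front_face m \<tau>) * \<psi> (back_face m n \<tau>)) (sing_bd (Suc (m + n)) \<sigma>)"
      by (rule pairing_cong_keys[OF keys_d]) (use True mn nat in \<open>auto simp: cup_def\<close>)
    moreover have "singular_simplex (Suc m) X (front_face (Suc m) \<sigma>)" "singular_simplex (Suc n) X (back_face m (Suc n) \<sigma>)"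
      using singular_simplex_front_face[of "Suc m" n X \<sigma>] singular_simplex_back_face[of m "Suc n" X \<sigma>] True by simp_all
    ultimately show ?thesis
      using True by (simp add: \<delta>_eq cup_def mn nat ac_simps cup_pairing_bd)
  next
    case False
    then show ?thesis by (simp add: \<delta>_eq cup_def mn nat ac_simps)
  qed
qed

lemma cup_zero: "cup X p q (\<lambda>_. 0) \<psi> = (\<lambda>_. 0)" "cup X p q \<phi> (\<lambda>_. 0) = (\<lambda>_. 0)"
  by (simp_all add: cup_def fun_eq_iff)

lemma unit_cochain_Z: "unit_cochain X \<in> cocycles SC \<delta> 0"
proof -
  have "pairing (unit_cochain X) (sing_bd (Suc 0) \<sigma>) = 0" if "singular_simplex (Suc 0) X \<sigma>" for \<sigma>
    using singular_simplex_singular_face[OF that, of 0] singular_simplex_singular_face[OF that, of "Suc 0"]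
    by (simp add: pairing_sing_bd unit_cochain_def)
  then show ?thesis
    by (auto simp: cochain_complex.Z_iff[OF cochain_complex_singular] \<delta>_eq SC_carrier unit_cochain_def[of X] fun_eq_iff
        simp del: One_nat_def split: if_splits)
qed

lemma dg_ring_singular: "dg_ring SC \<delta> (cup X) (unit_cochain X)"
proof -
  interpret cochain_complex SC \<delta> by (rule cochain_complex_singular)
  show ?thesis
  proof
    fix p q :: int and \<phi> \<psi> assume pq: "0 \<le> p" "0 \<le> q"
    show "cup X p q \<phi> \<psi> \<in> Z (p + q)" if "\<phi> \<in> Z p" "\<psi> \<in> Z q"
      using that cup_leibniz[of p q \<phi> \<psi>] pq by (auto simp: Z_iff cup_carrier cup_zero)
    show "cup X p q \<phi> \<psi> \<in> B (p + q)" if \<phi>: "\<phi> \<in> B p" and \<psi>: "\<psi> \<in> Z q"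
    proof -
      obtain \<alpha> where \<alpha>: "\<alpha> \<in> carrier (SC (p - 1))" "\<phi> = \<delta> (p - 1) \<alpha>" using \<phi> by (auto simp: B_iff)
      show ?thesis
      proof (cases "p = 0")
        case True
        \<comment> \<open>The only cochain of degree -1 is 0, so a coboundary of degree 0
          vanishes.\<close>
        then have "cup X p q \<phi> \<psi> = \<one>\<^bsub>SC (p + q)\<^esub>"
          using \<alpha> SC_neg[of "p - 1" \<alpha>] by (simp add: \<delta>_zero cup_zero)
        then show ?thesis using subgroup.one_closed[OF subgroup_B] by metis
      next
        case False
        then have "cup X p q \<phi> \<psi> = \<delta> (p + q - 1) (cup X (p - 1) q \<alpha> \<psi>)"
          using cup_leibniz[of "p - 1" q \<alpha> \<psi>] pq \<alpha> \<psi> by (simp add: Z_iff cup_zero algebra_simps)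
        moreover have "cup X (p - 1) q \<alpha> \<psi> \<in> carrier (SC (p + q - 1))"
          using cup_carrier[of "p - 1" q] pq False by (simp add: algebra_simps)
        ultimately show ?thesis by (auto simp: B_iff)
      qed
    qed
    show "cup X p q \<phi> \<psi> \<in> B (p + q)" if \<phi>: "\<phi> \<in> Z p" and \<psi>: "\<psi> \<in> B q"
    proof -
      obtain \<alpha> where \<alpha>: "\<alpha> \<in> carrier (SC (q - 1))" "\<psi> = \<delta> (q - 1) \<alpha>" using \<psi> by (auto simp: B_iff)
      show ?thesis
      proof (cases "q = 0")
        case True
        then have "cup X p q \<phi> \<psi> = \<one>\<^bsub>SC (p + q)\<^esub>"
          using \<alpha> SC_neg[of "q - 1" \<alpha>] by (simp add: \<delta>_zero cup_zero)
        then show ?thesis using subgroup.one_closed[OF subgroup_B] by metis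
      next
        case False
        \<comment> \<open>For a cocycle \<phi> the Leibniz rule reads d (\<phi> \<alpha>) = (-1)^p
          \<phi> (d \<alpha>), which explains the sign of the primitive.\<close>
        let ?\<beta> = "\<lambda>\<sigma>. (-1) ^ nat p * cup X p (q - 1) \<phi> \<alpha> \<sigma>"
        have "\<delta> (p + q - 1) ?\<beta> = (\<lambda>\<sigma>. (-1) ^ nat p * \<delta> (p + q - 1) (cup X p (q - 1) \<phi> \<alpha>) \<sigma>)"
          by (auto simp: \<delta>_eq pairing_cmul_fun)
        also have "\<dots> = cup X p q \<phi> \<psi>"
          using cup_leibniz[of p "q - 1" \<phi> \<alpha>] pq False \<alpha> \<phi>
          by (simp add: Z_iff cup_zero algebra_simps flip: power_mult_distrib mult.assoc)
        finally have "cup X p q \<phi> \<psi> = \<delta> (p + q - 1) ?\<beta>" ..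
        moreover have "?\<beta> \<in> carrier (SC (p + q - 1))"
          using cup_carrier[of p "q - 1" \<phi> \<alpha>] pq False by (simp add: algebra_simps SC_carrier)
        ultimately show ?thesis by (auto simp: B_iff)
      qed
    qed
    show "cup X p q (\<phi> \<otimes>\<^bsub>SC p\<^esub> \<phi>') \<psi> = cup X p q \<phi> \<psi> \<otimes>\<^bsub>SC (p + q)\<^esub> cup X p q \<phi>' \<psi>" for \<phi>'
      by (auto simp: cup_def distrib_right)
    show "cup X p q \<phi> (\<psi> \<otimes>\<^bsub>SC q\<^esub> \<psi>') = cup X p q \<phi> \<psi> \<otimes>\<^bsub>SC (p + q)\<^esub> cup X p q \<phi> \<psi>'" for \<psi>'
      by (auto simp: cup_def distrib_left)
  next
    fix p q r :: int and \<phi> \<psi> \<xi> assume pqr: "0 \<le> p" "0 \<le> q" "0 \<le> r"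
    obtain l m n where lmn: "p = int l" "q = int m" "r = int n" using pqr nonneg_int_cases by metis
    have nat: "nat (int l + int m) = l + m" "nat (int m + int n) = m + n" "nat (int l + (int m + int n)) = l + (m + n)"
      by auto
    show "cup X (p + q) r (cup X p q \<phi> \<psi>) \<xi> = cup X p (q + r) \<phi> (cup X q r \<psi> \<xi>)"
    proof
      fix \<sigma>
      show "cup X (p + q) r (cup X p q \<phi> \<psi>) \<xi> \<sigma> = cup X p (q + r) \<phi> (cup X q r \<psi> \<xi>) \<sigma>"
      proof (cases "singular_simplex (l + (m + n)) X \<sigma>")
        case True
        have "singular_simplex (l + m) X (front_face (l + m) \<sigma>)" "singular_simplex (m + n) X (back_face l (m + n) \<sigma>)"
          using singular_simplex_front_face[of "l + m" n X \<sigma>] singular_simplex_back_face[of l "m + n" X \<sigma>] True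
          by (simp_all add: add.assoc)
        then show ?thesis using True
          by (simp add: cup_def lmn nat add.assoc front_face_front_face back_face_front_face[of _ _ _ n] back_face_back_face)
      next
        case False
        then show ?thesis by (simp add: cup_def lmn nat add.assoc)
      qed
    qed
  next
    show "unit_cochain X \<in> Z 0" by (rule unit_cochain_Z)
    fix p :: int and \<phi> assume p: "0 \<le> p" and \<phi>: "\<phi> \<in> carrier (SC p)"
    show "cup X 0 p (unit_cochain X) \<phi> = \<phi>"
      using p \<phi> singular_simplex_front_face[of 0 "nat p" X] back_face_self[of "nat p" X]
      by (intro ext) (auto simp: cup_def unit_cochain_def SC_carrier)
    show "cup X p 0 \<phi> (unit_cochain X) = \<phi>"
      using p \<phi> singular_simplex_back_face[of "nat p" 0 X] front_face_self[of "nat p" X]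
      by (intro ext) (auto simp: cup_def unit_cochain_def SC_carrier)
  qed
qed

end

section \<open>Triangulated cubes\<close>

text \<open>A vertex of the cube \<open>{0,1}\<^sup>m\<close> is identified with its set of coordinates equal to \<open>1\<close>;
  a list of vertices spans an affine singular simplex. The lists in \<open>ez\<close> are the monotone edge paths
  from \<open>E\<close> to \<open>E \<union> \<sigma>\<close>, so \<open>ez\<close> is the iterated Eilenberg--Zilber shuffle product of edges.\<close>

definition realise :: "nat \<Rightarrow> nat set list \<Rightarrow> (nat \<Rightarrow> real) \<Rightarrow> nat \<Rightarrow> real" where
  "realise m l = (\<lambda>x\<in>standard_simplex (length l - 1). \<lambda>i\<in>{1..m}. \<Sum>j<length l. x j * of_bool (i \<in> l ! j))"

fun ez :: "nat \<Rightarrow> nat set \<Rightarrow> nat set \<Rightarrow> nat set list \<Rightarrow>\<^sub>0 int" where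
  "ez 0 \<sigma> E = frag_of [E]"
| "ez (Suc n) \<sigma> E = (\<Sum>i\<in>\<sigma>. frag_cmul (sg i \<sigma>) (frag_extend (\<lambda>l. frag_of (E # l)) (ez n (\<sigma> - {i}) (insert i E))))"

definition cube_chain :: "nat \<Rightarrow> cell \<Rightarrow> (nat \<Rightarrow> real) chain" where
  "cube_chain m = (\<lambda>(\<sigma>, E). frag_extend (\<lambda>l. frag_of (realise m l)) (ez (card \<sigma>) \<sigma> E))"

lemma keys_ez: "Poly_Mapping.keys (ez n \<sigma> E) \<subseteq> {l. length l = Suc n \<and> l \<noteq> [] \<and> hd l = E \<and> (\<forall>v\<in>set l. E \<subseteq> v \<and> v \<subseteq> E \<union> \<sigma>)}"
proof (induction n arbitrary: \<sigma> E)
  case (Suc n)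
  show ?case
    unfolding ez.simps
  proof (intro keys_sum_subset keys_cmul_subset)
    fix i assume i: "i \<in> \<sigma>"
    show "Poly_Mapping.keys (frag_extend (\<lambda>l. frag_of (E # l)) (ez n (\<sigma> - {i}) (insert i E)))
        \<subseteq> {l. length l = Suc (Suc n) \<and> l \<noteq> [] \<and> hd l = E \<and> (\<forall>v\<in>set l. E \<subseteq> v \<and> v \<subseteq> E \<union> \<sigma>)}"
    proof (rule keys_frag_extend_subset[OF Suc.IH])
      fix l assume "l \<in> {l. length l = Suc n \<and> l \<noteq> [] \<and> hd l = insert i E \<and>
          (\<forall>v\<in>set l. insert i E \<subseteq> v \<and> v \<subseteq> insert i E \<union> (\<sigma> - {i}))}"
      then show "Poly_Mapping.keys (frag_of (E # l)) \<subseteq> {l. length l = Suc (Suc n) \<and> l \<noteq> [] \<and> hd l = E \<and> (\<forall>v\<in>set l. E \<subseteq> v \<and> v \<subseteq> E \<union> \<sigma>)}"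
        using i by (simp add: keys_frag_of) blast
    qed
  qed
qed simp

definition del_nth :: "nat \<Rightarrow> 'a list \<Rightarrow> 'a list" where
  "del_nth k l = take k l @ drop (Suc k) l"

definition list_bd :: "'a list \<Rightarrow> 'a list \<Rightarrow>\<^sub>0 int" where
  "list_bd l = (\<Sum>k<length l. frag_cmul ((-1) ^ k) (frag_of (del_nth k l)))"

text \<open>The boundary of a one-element list is \<open>frag_of []\<close>, the simplex of degree
  -1, so the formula holds without a case distinction.\<close>

lemma list_bd_Cons: "list_bd (E # l) = frag_of l - frag_extend (\<lambda>l. frag_of (E # l)) (list_bd l)"
  by (simp add: list_bd_def sum.lessThan_Suc_shift del_nth_def frag_extend_sum' frag_extend_cmul sum_negf[symmetric]
      del: sum.lessThan_Suc)

text \<open>Deleting an interior vertex of a monotone path forgets the order of two consecutive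
  steps, so these faces cancel in pairs. Deleting the initial vertex gives the paths in the faces
  x_i = 1, deleting the final vertex those in the faces x_i = 0.\<close>

lemma list_bd_ez:
  "finite \<sigma> \<Longrightarrow> card \<sigma> = Suc n \<Longrightarrow> frag_extend list_bd (ez (Suc n) \<sigma> E)
    = (\<Sum>i\<in>\<sigma>. frag_cmul (sg i \<sigma>) (ez n (\<sigma> - {i}) (insert i E) - ez n (\<sigma> - {i}) E))"
proof (induction n arbitrary: \<sigma> E)
  case 0
  then obtain i where "\<sigma> = {i}" by (auto simp: card_1_singleton_iff)
  then show ?case
    by (simp add: frag_extend_cmul list_bd_Cons) (simp add: list_bd_def del_nth_def)
next
  case (Suc n)
  let ?c = "frag_extend (\<lambda>l. frag_of (E # l))"
  have 1: "frag_extend list_bd (ez (Suc (Suc n)) \<sigma> E)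
      = (\<Sum>i\<in>\<sigma>. frag_cmul (sg i \<sigma>) (ez (Suc n) (\<sigma> - {i}) (insert i E)))
        - (\<Sum>i\<in>\<sigma>. frag_cmul (sg i \<sigma>) (?c (frag_extend list_bd (ez (Suc n) (\<sigma> - {i}) (insert i E)))))"
    unfolding ez.simps(2)[of "Suc n"] frag_extend_sum' sum_subtractf[symmetric] frag_extend_cmul
      frag_cmul_diff_distrib2[symmetric] frag_extend_frag_extend frag_extend_of list_bd_Cons
      frag_extend_diff_fun by simp
  have "(\<Sum>i\<in>\<sigma>. frag_cmul (sg i \<sigma>) (?c (frag_extend list_bd (ez (Suc n) (\<sigma> - {i}) (insert i E)))))
      = (\<Sum>i\<in>\<sigma>. \<Sum>j\<in>\<sigma> - {i}. frag_cmul (sg i \<sigma> * sg j (\<sigma> - {i}))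
          (?c (ez n (\<sigma> - {i} - {j}) (insert j (insert i E))) - ?c (ez n (\<sigma> - {i} - {j}) (insert i E))))"
  proof (rule sum.cong[OF refl])
    fix i assume i: "i \<in> \<sigma>"
    then have IH: "frag_extend list_bd (ez (Suc n) (\<sigma> - {i}) (insert i E)) = (\<Sum>j\<in>\<sigma> - {i}.
        frag_cmul (sg j (\<sigma> - {i})) (ez n (\<sigma> - {i} - {j}) (insert j (insert i E)) - ez n (\<sigma> - {i} - {j}) (insert i E)))"
      using Suc.prems by (intro Suc.IH) auto
    show "frag_cmul (sg i \<sigma>) (?c (frag_extend list_bd (ez (Suc n) (\<sigma> - {i}) (insert i E))))
      = (\<Sum>j\<in>\<sigma> - {i}. frag_cmul (sg i \<sigma> * sg j (\<sigma> - {i}))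
          (?c (ez n (\<sigma> - {i} - {j}) (insert j (insert i E))) - ?c (ez n (\<sigma> - {i} - {j}) (insert i E))))"
      unfolding IH frag_extend_sum' frag_cmul_sum frag_extend_cmul frag_extend_diff frag_cmul_cmul ..
  qed
  also have "\<dots> = (\<Sum>i\<in>\<sigma>. \<Sum>j\<in>\<sigma> - {i}. frag_cmul (sg i \<sigma> * sg j (\<sigma> - {i})) (?c (ez n (\<sigma> - {i} - {j}) (insert j (insert i E)))))
      - (\<Sum>i\<in>\<sigma>. \<Sum>j\<in>\<sigma> - {i}. frag_cmul (sg i \<sigma> * sg j (\<sigma> - {i})) (?c (ez n (\<sigma> - {i} - {j}) (insert i E))))"
    unfolding sum_subtractf[symmetric] frag_cmul_diff_distrib2[symmetric] ..
  \<comment> \<open>The paths beginning with the steps i, j and those beginning with j, i share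
    these faces, with opposite signs.\<close>
  also have "(\<Sum>i\<in>\<sigma>. \<Sum>j\<in>\<sigma> - {i}. frag_cmul (sg i \<sigma> * sg j (\<sigma> - {i})) (?c (ez n (\<sigma> - {i} - {j}) (insert j (insert i E))))) = 0"
  proof (rule sum_antisymmetric[OF Suc.prems(1)])
    fix i j assume ij: "i \<in> \<sigma>" "j \<in> \<sigma>" "i \<noteq> j"
    have e: "\<sigma> - {i} - {j} = \<sigma> - {j} - {i}" "insert j (insert i E) = insert i (insert j E)" by auto
    show "frag_cmul (sg i \<sigma> * sg j (\<sigma> - {i})) (?c (ez n (\<sigma> - {i} - {j}) (insert j (insert i E))))
        = - frag_cmul (sg j \<sigma> * sg i (\<sigma> - {j})) (?c (ez n (\<sigma> - {j} - {i}) (insert i (insert j E))))"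
      unfolding e sg_antisym[OF Suc.prems(1) ij] by simp
  qed
  also have "(\<Sum>i\<in>\<sigma>. \<Sum>j\<in>\<sigma> - {i}. frag_cmul (sg i \<sigma> * sg j (\<sigma> - {i})) (?c (ez n (\<sigma> - {i} - {j}) (insert i E))))
      = (\<Sum>j\<in>\<sigma>. \<Sum>i\<in>\<sigma> - {j}. frag_cmul (sg i \<sigma> * sg j (\<sigma> - {i})) (?c (ez n (\<sigma> - {i} - {j}) (insert i E))))"
    by (rule sum_swap_distinct[OF Suc.prems(1)])
  \<comment> \<open>For fixed j the sum over the first step i is the recursion of \<open>ez\<close>
    on \<open>\<sigma> - {j}\<close>; the minus sign comes from exchanging the order in which i and
    j are removed.\<close>
  also have "\<dots> = - (\<Sum>j\<in>\<sigma>. frag_cmul (sg j \<sigma>) (ez (Suc n) (\<sigma> - {j}) E))"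
    unfolding sum_negf[symmetric]
  proof (rule sum.cong[OF refl])
    fix j assume j: "j \<in> \<sigma>"
    have "frag_cmul (sg i \<sigma> * sg j (\<sigma> - {i})) (?c (ez n (\<sigma> - {i} - {j}) (insert i E)))
        = - frag_cmul (sg j \<sigma>) (frag_cmul (sg i (\<sigma> - {j})) (?c (ez n (\<sigma> - {j} - {i}) (insert i E))))" if i: "i \<in> \<sigma> - {j}" for i
    proof -
      have e: "\<sigma> - {i} - {j} = \<sigma> - {j} - {i}" by auto
      show ?thesis using sg_antisym[OF Suc.prems(1), of i j] i j unfolding e by simp
    qed
    then have "(\<Sum>i\<in>\<sigma> - {j}. frag_cmul (sg i \<sigma> * sg j (\<sigma> - {i})) (?c (ez n (\<sigma> - {i} - {j}) (insert i E))))
      = (\<Sum>i\<in>\<sigma> - {j}. - frag_cmul (sg j \<sigma>) (frag_cmul (sg i (\<sigma> - {j})) (?c (ez n (\<sigma> - {j} - {i}) (insert i E)))))"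
      by (intro sum.cong refl)
    also have "\<dots> = - frag_cmul (sg j \<sigma>) (ez (Suc n) (\<sigma> - {j}) E)"
      unfolding ez.simps sum_negf frag_cmul_sum ..
    finally show "(\<Sum>i\<in>\<sigma> - {j}. frag_cmul (sg i \<sigma> * sg j (\<sigma> - {i})) (?c (ez n (\<sigma> - {i} - {j}) (insert i E))))
      = - frag_cmul (sg j \<sigma>) (ez (Suc n) (\<sigma> - {j}) E)" .
  qed
  finally show ?case
    unfolding 1 by (simp add: frag_cmul_diff_distrib2 sum_subtractf del: ez.simps)
qed

section \<open>Faces of the affine simplex on a list of vertices\<close>

lemma length_del_nth: "k < length l \<Longrightarrow> length (del_nth k l) = length l - 1"
  by (simp add: del_nth_def)

lemma nth_del_nth: "k < length l \<Longrightarrow> j < length l - 1 \<Longrightarrow> del_nth k l ! j = (if j < k then l ! j else l ! Suc j)"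
  by (auto simp: del_nth_def nth_append)

lemma realise_apply:
  "length l = Suc n \<Longrightarrow> x \<in> standard_simplex n \<Longrightarrow> realise m l x = (\<lambda>i\<in>{1..m}. \<Sum>j<Suc n. x j * of_bool (i \<in> l ! j))"
  by (simp only: realise_def) simp

text \<open>\<open>simplical_face k\<close> inserts a zero barycentric coordinate at position k,
  which drops the vertex \<open>l ! k\<close> from the convex combination.\<close>

lemma singular_face_realise:
  assumes "length l = Suc (Suc n)" "k \<le> Suc n"
  shows "singular_face (Suc n) k (realise m l) = realise m (del_nth k l)"
proof -
  have len: "length (del_nth k l) = Suc n" using assms by (simp add: length_del_nth)
  have eq: "(\<Sum>j<Suc (Suc n). simplical_face k x j * g (l ! j)) = (\<Sum>j<Suc n. x j * g (del_nth k l ! j))" for x and g :: "nat set \<Rightarrow> real"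
  proof -
    have "{..<Suc (Suc n)} = insert k ({..<k} \<union> Suc ` {k..<Suc n})" unfolding image_Suc_atLeastLessThan using assms by auto
    then have "(\<Sum>j<Suc (Suc n). simplical_face k x j * g (l ! j)) = (\<Sum>j\<in>{..<k} \<union> Suc ` {k..<Suc n}. simplical_face k x j * g (l ! j))"
      by (simp add: simplical_face_def)
    also have "\<dots> = (\<Sum>j<k. simplical_face k x j * g (l ! j)) + (\<Sum>j\<in>Suc ` {k..<Suc n}. simplical_face k x j * g (l ! j))"
      by (rule sum.union_disjoint) auto
    also have "(\<Sum>j<k. simplical_face k x j * g (l ! j)) = (\<Sum>j<k. x j * g (del_nth k l ! j))"
      using assms by (intro sum.cong) (auto simp: simplical_face_def nth_del_nth)
    also have "(\<Sum>j\<in>Suc ` {k..<Suc n}. simplical_face k x j * g (l ! j)) = (\<Sum>j\<in>{k..<Suc n}. x j * g (del_nth k l ! j))"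
      using assms by (subst sum.reindex) (auto simp: simplical_face_def nth_del_nth intro!: sum.cong)
    also have "(\<Sum>j<k. x j * g (del_nth k l ! j)) + \<dots> = (\<Sum>j\<in>{..<k} \<union> {k..<Suc n}. x j * g (del_nth k l ! j))"
      by (rule sum.union_disjoint[symmetric]) auto
    also have "{..<k} \<union> {k..<Suc n} = {..<Suc n}" using assms by auto
    finally show ?thesis .
  qed
  have "realise m l (simplical_face k x) = realise m (del_nth k l) x" if x: "x \<in> standard_simplex n" for x
    unfolding realise_apply[OF len x] realise_apply[OF assms(1) face_closed[OF x assms(2)]]
    by (intro restrict_ext) (rule eq)
  moreover have "realise m (del_nth k l) \<in> extensional (standard_simplex n)"
    by (simp add: realise_def len)
  ultimately show ?thesis
    by (intro ext) (auto simp: singular_face_def extensional_def)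
qed

lemma sing_bd_realise:
  assumes "length l = Suc (Suc n)"
  shows "sing_bd (Suc n) (realise m l) = frag_extend (\<lambda>l. frag_of (realise m l)) (list_bd l)"
proof -
  have "sing_bd (Suc n) (realise m l) = (\<Sum>k\<le>Suc n. frag_cmul ((-1) ^ k) (frag_of (realise m (del_nth k l))))"
    using assms by (simp add: sing_bd_def chain_boundary_of singular_face_realise del: sum.atMost_Suc)
  also have "{..Suc n} = {..<length l}" using assms by auto
  finally show ?thesis by (simp add: list_bd_def frag_extend_sum' frag_extend_cmul)
qed

lemma sing_bd_cube_chain:
  assumes "finite \<sigma>" "card \<sigma> = Suc n"
  shows "frag_extend (sing_bd (Suc n)) (cube_chain m (\<sigma>, E)) = frag_extend (cube_chain m) (cube_bd (\<sigma>, E))"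
proof -
  have "frag_extend (sing_bd (Suc n)) (cube_chain m (\<sigma>, E))
      = frag_extend (\<lambda>l. sing_bd (Suc n) (realise m l)) (ez (Suc n) \<sigma> E)"
    by (simp add: cube_chain_def assms frag_extend_frag_extend del: ez.simps)
  also have "\<dots> = frag_extend (\<lambda>l. frag_extend (\<lambda>l. frag_of (realise m l)) (list_bd l)) (ez (Suc n) \<sigma> E)"
    by (rule frag_extend_cong_keys[OF keys_ez]) (auto intro: sing_bd_realise)
  also have "\<dots> = frag_extend (\<lambda>l. frag_of (realise m l)) (frag_extend list_bd (ez (Suc n) \<sigma> E))"
    by (simp only: frag_extend_frag_extend)
  also have "\<dots> = frag_extend (cube_chain m) (cube_bd (\<sigma>, E))"
    unfolding list_bd_ez[OF assms] cube_bd_def case_prod_conv frag_extend_sum' frag_extend_cmul frag_extend_diff frag_extend_of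
    using assms by (intro sum.cong refl) (simp add: cube_chain_def)
  finally show ?thesis .
qed

lemma front_face_realise:
  assumes "length l = Suc (p + q)"
  shows "front_face p (realise m l) = realise m (take (Suc p) l)"
proof -
  have len: "length (take (Suc p) l) = Suc p" using assms by simp
  have "(\<Sum>j<Suc (p + q). x j * of_bool (i \<in> l ! j)) = (\<Sum>j<Suc p. x j * of_bool (i \<in> take (Suc p) l ! j))"
    if "x \<in> standard_simplex p" for x :: "nat \<Rightarrow> real" and i
    by (rule sum.mono_neutral_cong_right) (auto simp: standard_simplex_vanish[OF that])
  then show ?thesis
    using assms unfolding front_face_def realise_def len by (intro ext) (auto simp: mono_simplex)
qed

lemma back_face_realise:
  assumes "length l = Suc (p + q)"
  shows "back_face p q (realise m l) = realise m (drop p l)"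
proof -
  have len: "length (drop p l) = Suc q" using assms by simp
  have "(\<Sum>j<Suc (p + q). shift p x j * of_bool (i \<in> l ! j)) = (\<Sum>j<Suc q. x j * of_bool (i \<in> drop p l ! j))"
    for x :: "nat \<Rightarrow> real" and i
  proof -
    have "(\<Sum>j<Suc (p + q). shift p x j * of_bool (i \<in> l ! j)) = (\<Sum>j\<in>(+) p ` {..<Suc q}. shift p x j * of_bool (i \<in> l ! j))"
    proof (rule sum.mono_neutral_right)
      show "\<forall>j\<in>{..<Suc (p + q)} - (+) p ` {..<Suc q}. shift p x j * of_bool (i \<in> l ! j) = 0"
      proof
        fix j assume j: "j \<in> {..<Suc (p + q)} - (+) p ` {..<Suc q}"
        have "j < p"
        proof (rule ccontr)
          assume "\<not> j < p"
          then have "j = p + (j - p)" "j - p \<in> {..<Suc q}" using j by auto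
          with j show False by blast
        qed
        then show "shift p x j * of_bool (i \<in> l ! j) = 0" by (simp add: shift_def)
      qed
    qed auto
    also have "\<dots> = (\<Sum>j<Suc q. x j * of_bool (i \<in> drop p l ! j))"
      using assms by (subst sum.reindex) (auto simp: shift_def intro!: sum.cong)
    finally show ?thesis .
  qed
  then show ?thesis
    using assms unfolding back_face_shift realise_def len by (intro ext) (auto simp: shift_in_standard_simplex)
qed

text \<open>The sign of the shuffle that sorts S followed by V: one factor -1 for each element of S
  together with a smaller element of V.\<close>

definition sg2 :: "nat set \<Rightarrow> nat set \<Rightarrow> int" where
  "sg2 S V = (\<Prod>i\<in>S. sg i V)"

lemma sg_union_disjoint:
  assumes "finite S" "finite V" "S \<inter> V = {}"
  shows "sg i (S \<union> V) = sg i S * sg i V"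
proof -
  have "{j \<in> S \<union> V. j < i} = {j \<in> S. j < i} \<union> {j \<in> V. j < i}" by auto
  moreover have "card \<dots> = card {j \<in> S. j < i} + card {j \<in> V. j < i}"
    using assms by (intro card_Un_disjoint) auto
  ultimately show ?thesis by (simp add: sg_def power_add)
qed

text \<open>Splits the element i off S: the elements of \<sigma> below i lie in S or in its
  complement. This is the sign bookkeeping when the first step of a path joins the front
  part.\<close>

lemma sg2_shuffle:
  assumes "finite \<sigma>" "S \<subseteq> \<sigma>" "i \<in> S"
  shows "sg2 S (\<sigma> - S) * sg i S = sg i \<sigma> * sg2 (S - {i}) (\<sigma> - S)"
proof -
  have fS: "finite S" using assms finite_subset by blast
  have "sg2 S (\<sigma> - S) = sg i (\<sigma> - S) * sg2 (S - {i}) (\<sigma> - S)"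
    unfolding sg2_def using fS assms(3) by (rule prod.remove)
  moreover have "sg i \<sigma> = sg i S * sg i (\<sigma> - S)"
    using sg_union_disjoint[of S "\<sigma> - S" i] assms fS by (simp add: Un_absorb1)
  ultimately show ?thesis by simp
qed

text \<open>A first step i together with the set S of the other steps of the front part is the same
  as the set \<open>insert i S\<close> with a marked element.\<close>

lemma sum_pairs_subset:
  fixes f :: "nat \<Rightarrow> nat set \<Rightarrow> 'a::comm_monoid_add"
  assumes "finite \<sigma>"
  shows "(\<Sum>i\<in>\<sigma>. \<Sum>S\<in>{S. S \<subseteq> \<sigma> - {i} \<and> card S = p}. f i (insert i S)) = (\<Sum>S\<in>{S. S \<subseteq> \<sigma> \<and> card S = Suc p}. \<Sum>i\<in>S. f i S)"
proof -
  have fin: "finite {S. S \<subseteq> \<sigma> - {i} \<and> card S = p}" "finite {S. S \<subseteq> \<sigma> \<and> card S = Suc p}" for i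
    using assms by (auto intro: finite_subset[of _ "Pow \<sigma>"])
  have "(\<Sum>i\<in>\<sigma>. \<Sum>S\<in>{S. S \<subseteq> \<sigma> - {i} \<and> card S = p}. f i (insert i S))
      = (\<Sum>(i, S)\<in>(SIGMA i:\<sigma>. {S. S \<subseteq> \<sigma> - {i} \<and> card S = p}). f i (insert i S))"
    using assms fin by (intro sum.Sigma) auto
  also have "\<dots> = (\<Sum>(S, i)\<in>(SIGMA S:{S. S \<subseteq> \<sigma> \<and> card S = Suc p}. S). f i S)"
  proof (rule sum.reindex_bij_witness[where i = "\<lambda>(S, i). (i, S - {i})" and j = "\<lambda>(i, S). (insert i S, i)"])
    fix x assume "x \<in> (SIGMA i:\<sigma>. {S. S \<subseteq> \<sigma> - {i} \<and> card S = p})"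
    then obtain i S where x: "x = (i, S)" "i \<in> \<sigma>" "S \<subseteq> \<sigma> - {i}" "card S = p" by auto
    have "finite S" using x assms finite_subset by blast
    then show "(case x of (i, S) \<Rightarrow> (insert i S, i)) \<in> (SIGMA S:{S. S \<subseteq> \<sigma> \<and> card S = Suc p}. S)"
      using x by (auto simp: card_insert_if)
    show "(case case x of (i, S) \<Rightarrow> (insert i S, i) of (S, i) \<Rightarrow> (i, S - {i})) = x"
      using x by auto
  qed auto
  also have "\<dots> = (\<Sum>S\<in>{S. S \<subseteq> \<sigma> \<and> card S = Suc p}. \<Sum>i\<in>S. f i S)"
    using assms fin by (intro sum.Sigma[symmetric]) (auto intro: finite_subset)
  finally show ?thesis .
qed

text \<open>The shuffle map is a map of coalgebras: on \<open>ez\<close> the Alexander--Whitney diagonal is the Serre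
  diagonal of the cube, on the nose.\<close>

lemma pairing_ez_split:
  assumes "finite \<sigma>" "card \<sigma> = p + q"
  shows "pairing (\<lambda>l. f (take (Suc p) l) * g (drop p l)) (ez (p + q) \<sigma> E)
    = (\<Sum>S\<in>{S. S \<subseteq> \<sigma> \<and> card S = p}. sg2 S (\<sigma> - S) * (pairing f (ez p S E) * pairing g (ez q (\<sigma> - S) (E \<union> S))))"
  using assms
proof (induction p arbitrary: \<sigma> E f)
  case 0
  have "{S. S \<subseteq> \<sigma> \<and> card S = 0} = {{}}" using 0 by (auto dest: finite_subset)
  moreover have "pairing (\<lambda>l. f (take (Suc 0) l) * g (drop 0 l)) (ez (0 + q) \<sigma> E) = pairing (\<lambda>l. f [E] * g l) (ez q \<sigma> E)"
    unfolding add_0 by (rule pairing_cong_keys[OF keys_ez]) (auto simp: take_Suc)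
  ultimately show ?case by (simp add: sg2_def pairing_cmul_fun)
next
  case (Suc p)
  let ?P = "\<lambda>S. pairing (\<lambda>l. f (E # l)) S" and ?Q = "\<lambda>S. pairing g (ez q (\<sigma> - S) (E \<union> S))"
  have "pairing (\<lambda>l. f (take (Suc (Suc p)) l) * g (drop (Suc p) l)) (ez (Suc p + q) \<sigma> E)
      = (\<Sum>i\<in>\<sigma>. sg i \<sigma> * pairing (\<lambda>l. f (E # take (Suc p) l) * g (drop p l)) (ez (p + q) (\<sigma> - {i}) (insert i E)))"
    by (simp add: pairing_sum pairing_cmul pairing_frag_extend)
  also have "\<dots> = (\<Sum>i\<in>\<sigma>. \<Sum>S\<in>{S. S \<subseteq> \<sigma> - {i} \<and> card S = p}.
      sg i \<sigma> * (sg2 (insert i S - {i}) (\<sigma> - insert i S) * (?P (ez p (insert i S - {i}) (insert i E)) * ?Q (insert i S))))"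
  proof (rule sum.cong[OF refl])
    fix i assume i: "i \<in> \<sigma>"
    have "pairing (\<lambda>l. f (E # take (Suc p) l) * g (drop p l)) (ez (p + q) (\<sigma> - {i}) (insert i E))
      = (\<Sum>S\<in>{S. S \<subseteq> \<sigma> - {i} \<and> card S = p}. sg2 S (\<sigma> - {i} - S) * (?P (ez p S (insert i E)) * pairing g (ez q (\<sigma> - {i} - S) (insert i E \<union> S))))"
      using i Suc.prems by (intro Suc.IH[of "\<sigma> - {i}" "\<lambda>l. f (E # l)"]) auto
    also have "\<dots> = (\<Sum>S\<in>{S. S \<subseteq> \<sigma> - {i} \<and> card S = p}.
      sg2 (insert i S - {i}) (\<sigma> - insert i S) * (?P (ez p (insert i S - {i}) (insert i E)) * ?Q (insert i S)))"
    proof (rule sum.cong[OF refl])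
      fix S assume "S \<in> {S. S \<subseteq> \<sigma> - {i} \<and> card S = p}"
      then have e: "insert i S - {i} = S" "\<sigma> - {i} - S = \<sigma> - insert i S" "insert i E \<union> S = E \<union> insert i S" by auto
      show "sg2 S (\<sigma> - {i} - S) * (?P (ez p S (insert i E)) * pairing g (ez q (\<sigma> - {i} - S) (insert i E \<union> S)))
        = sg2 (insert i S - {i}) (\<sigma> - insert i S) * (?P (ez p (insert i S - {i}) (insert i E)) * ?Q (insert i S))"
        unfolding e ..
    qed
    finally show "sg i \<sigma> * pairing (\<lambda>l. f (E # take (Suc p) l) * g (drop p l)) (ez (p + q) (\<sigma> - {i}) (insert i E))
      = (\<Sum>S\<in>{S. S \<subseteq> \<sigma> - {i} \<and> card S = p}.
      sg i \<sigma> * (sg2 (insert i S - {i}) (\<sigma> - insert i S) * (?P (ez p (insert i S - {i}) (insert i E)) * ?Q (insert i S))))"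
      by (simp only: sum_distrib_left)
  qed
  also have "\<dots> = (\<Sum>S\<in>{S. S \<subseteq> \<sigma> \<and> card S = Suc p}. \<Sum>i\<in>S.
      sg i \<sigma> * (sg2 (S - {i}) (\<sigma> - S) * (?P (ez p (S - {i}) (insert i E)) * ?Q S)))"
    by (rule sum_pairs_subset[OF Suc.prems(1)])
  also have "\<dots> = (\<Sum>S\<in>{S. S \<subseteq> \<sigma> \<and> card S = Suc p}. sg2 S (\<sigma> - S) * (pairing f (ez (Suc p) S E) * ?Q S))"
  proof (rule sum.cong[OF refl])
    fix S assume S: "S \<in> {S. S \<subseteq> \<sigma> \<and> card S = Suc p}"
    have "sg2 S (\<sigma> - S) * (pairing f (ez (Suc p) S E) * ?Q S)
        = (\<Sum>i\<in>S. (sg2 S (\<sigma> - S) * sg i S) * (?P (ez p (S - {i}) (insert i E)) * ?Q S))"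
      by (simp add: pairing_sum pairing_cmul pairing_frag_extend sum_distrib_left sum_distrib_right mult.assoc)
    also have "\<dots> = (\<Sum>i\<in>S. sg i \<sigma> * (sg2 (S - {i}) (\<sigma> - S) * (?P (ez p (S - {i}) (insert i E)) * ?Q S)))"
    proof (rule sum.cong[OF refl])
      fix i assume "i \<in> S"
      then show "(sg2 S (\<sigma> - S) * sg i S) * (?P (ez p (S - {i}) (insert i E)) * ?Q S)
          = sg i \<sigma> * (sg2 (S - {i}) (\<sigma> - S) * (?P (ez p (S - {i}) (insert i E)) * ?Q S))"
        using sg2_shuffle[OF Suc.prems(1), of S i] S by (simp only: mult.assoc mem_Collect_eq simp_thms)
    qed
    finally show "(\<Sum>i\<in>S. sg i \<sigma> * (sg2 (S - {i}) (\<sigma> - S) * (?P (ez p (S - {i}) (insert i E)) * ?Q S)))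
        = sg2 S (\<sigma> - S) * (pairing f (ez (Suc p) S E) * ?Q S)" ..
  qed
  finally show ?case .
qed

section \<open>The homology of the real moment-angle complex\<close>

definition free_coords :: "nat \<Rightarrow> (nat \<Rightarrow> real) \<Rightarrow> nat set" where
  "free_coords m x = {i \<in> {1..m}. x i \<noteq> 0 \<and> x i \<noteq> 1}"

lemma topspace_unit_cube: "topspace (unit_cube m) = (\<Pi>\<^sub>E i\<in>{1..m}. {0..1})"
  by (simp add: unit_cube_def)

lemma in_unit_cube: "x \<in> topspace (unit_cube m) \<longleftrightarrow> x \<in> extensional {1..m} \<and> (\<forall>i\<in>{1..m}. 0 \<le> x i \<and> x i \<le> 1)"
  by (auto simp: topspace_unit_cube PiE_iff)

lemma Pi_unit_cube:
  "s \<in> V \<rightarrow> topspace (unit_cube m) \<Longrightarrow> x \<in> V \<Longrightarrow> \<forall>i\<in>{1..m}. 0 \<le> s x i \<and> s x i \<le> 1"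
  by (drule (1) funcset_mem, unfold in_unit_cube) blast

lemma continuous_map_unit_cube:
  "continuous_map Y (unit_cube m) f \<longleftrightarrow> f \<in> topspace Y \<rightarrow> topspace (unit_cube m)
    \<and> (\<forall>i\<in>{1..m}. continuous_map Y euclideanreal (\<lambda>x. f x i))"
  unfolding unit_cube_def continuous_map_componentwise continuous_map_in_subtopology topspace_product_topology
  by (auto simp: PiE_iff Pi_iff)

lemma homotopic_star_shaped:
  assumes T: "V \<subseteq> topspace (unit_cube m)" and a: "a \<in> V"
    and star: "\<And>y t. y \<in> V \<Longrightarrow> 0 \<le> t \<Longrightarrow> t \<le> 1 \<Longrightarrow> (\<lambda>i\<in>{1..m}. (1 - t) * y i + t * a i) \<in> V"
  shows "homotopic_with (\<lambda>_. True) (subtopology (unit_cube m) V) (subtopology (unit_cube m) V) id (\<lambda>_. a)"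
proof -
  let ?Y = "subtopology (unit_cube m) V"
  let ?h = "\<lambda>(t, y). (\<lambda>i\<in>{1..m}. (1 - t) * y i + t * a i)"
  let ?P = "prod_topology (top_of_set {0..1::real}) ?Y"
  have c1: "continuous_map ?P euclideanreal fst"
    using continuous_map_fst[of "top_of_set {0..1::real}" ?Y] by (rule continuous_map_into_fulltopology)
  have c2: "continuous_map ?P euclideanreal (\<lambda>p. snd p i)" if i: "i \<in> {1..m}" for i
  proof -
    have "continuous_map (unit_cube m) (unit_cube m) id" by simp
    then have "continuous_map (unit_cube m) euclideanreal (\<lambda>y. y i)"
      using i unfolding continuous_map_unit_cube by auto
    then have "continuous_map ?Y euclideanreal (\<lambda>y. y i)" by (rule continuous_map_from_subtopology)
    then show ?thesis
      using continuous_map_compose[OF continuous_map_snd] by (force simp: comp_def)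
  qed
  have cont: "continuous_map ?P ?Y ?h"
    unfolding continuous_map_in_subtopology continuous_map_unit_cube
  proof (intro conjI ballI)
    show *: "?h \<in> topspace ?P \<rightarrow> V" using star T by auto
    then show "?h \<in> topspace ?P \<rightarrow> topspace (unit_cube m)" using T by blast
    fix i assume i: "i \<in> {1..m}"
    have "continuous_map ?P euclideanreal (\<lambda>p. (1 - fst p) * snd p i + fst p * a i)"
      by (intro continuous_map_add continuous_map_real_mult continuous_map_diff c1 c2[OF i]) auto
    then show "continuous_map ?P euclideanreal (\<lambda>x. ?h x i)"
      using i by (simp add: case_prod_unfold)
  qed
  have "\<exists>h. continuous_map ?P ?Y h \<and> (\<forall>x\<in>topspace ?Y. h (0, x) = id x) \<and>
      (\<forall>x\<in>topspace ?Y. h (1, x) = a) \<and> (\<forall>t\<in>{0..1}. True)"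
  proof (intro exI[of _ ?h] conjI ballI)
    show "continuous_map ?P ?Y ?h" by (rule cont)
    fix x assume x: "x \<in> topspace ?Y"
    then have "x \<in> extensional {1..m}" using T by (auto simp: in_unit_cube)
    then show "?h (0, x) = id x" by (auto simp: extensional_def)
    have "a \<in> extensional {1..m}" using T a by (auto simp: in_unit_cube)
    then show "?h (1, x) = a" by (auto simp: extensional_def)
  qed simp
  then show ?thesis by (subst homotopic_with) auto
qed

text \<open>The straight line homotopy makes a cycle homologous to its image under the constant map
  to \<open>a\<close>. In positive degree this image is a cycle in a one-point space and bounds
  there.\<close>

lemma star_shaped_acyclic:
  assumes T: "V \<subseteq> topspace (unit_cube m)" and a: "a \<in> V"
    and star: "\<And>y t. y \<in> V \<Longrightarrow> 0 \<le> t \<Longrightarrow> t \<le> 1 \<Longrightarrow> (\<lambda>i\<in>{1..m}. (1 - t) * y i + t * a i) \<in> V"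
    and c: "singular_chain n (subtopology (unit_cube m) V) c" "chain_boundary n c = 0"
    and n: "n = 0 \<Longrightarrow> pairing (\<lambda>_. 1) c = 0"
  shows "\<exists>w. singular_chain (Suc n) (subtopology (unit_cube m) V) w \<and> chain_boundary (Suc n) w = c"
proof -
  let ?Y = "subtopology (unit_cube m) V"
  let ?g = "\<lambda>_::nat \<Rightarrow> real. a"
  let ?A = "subtopology (unit_cube m) {a}"
  have cyc: "singular_relcycle n ?Y {} c" using c by (simp add: singular_cycle)
  have "homologous_rel n ?Y {} (chain_map n id c) (chain_map n ?g c)"
    using homotopic_imp_homologous_rel_chain_maps[of "{}" "{}" ?Y ?Y id ?g n c] homotopic_star_shaped[OF T a star] cyc
    by (simp add: Pi_def)
  then have "homologous_rel n ?Y {} c (chain_map n ?g c)"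
    using c(1) by (simp add: chain_map_ident)
  moreover have "singular_relboundary n ?Y {} (chain_map n ?g c)"
  proof (cases "n = 0")
    case True
    \<comment> \<open>All 0-simplices go to the same point, so the image is that point with the
      augmentation of \<open>c\<close> as coefficient, which is 0 by hypothesis.\<close>
    have "chain_map 0 ?g c = frag_extend (\<lambda>_. frag_of (\<lambda>x\<in>standard_simplex 0. a)) c"
      by (simp add: chain_map_def simplex_map_def comp_def)
    also have "\<dots> = frag_cmul (pairing (\<lambda>_. 1) c) (frag_of (\<lambda>x\<in>standard_simplex 0. a))"
      using subset_UNIV
      by (induction c rule: frag_induction) (auto simp: frag_extend_diff pairing_diff frag_cmul_diff_distrib)
    finally show ?thesis using True n by simp
  next
    case False
    have ta: "topspace ?A = {a}" using T a by auto
    have "continuous_map ?Y ?A ?g" using T a by auto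
    then have "singular_relcycle n ?A {} (chain_map n ?g c)"
      using cyc by (intro singular_relcycle_chain_map[where S = "{}" and X = ?Y]) auto
    then have "singular_relboundary n ?A {} (chain_map n ?g c)"
      using singular_boundary_eq_cycle_singleton[OF ta] False by simp
    then show ?thesis using a by (intro singular_boundary_mono[of "{a}" V]) auto
  qed
  ultimately have "singular_relboundary n ?Y {} c"
    by (metis homologous_rel_def diff_zero homologous_rel_trans singular_relboundary_def)
  then show ?thesis by (simp add: singular_boundary)
qed

text \<open>An acyclic carrier \<open>Cr\<close> makes a chain map null-homotopic; only the effect on cycles is recorded.\<close>

lemma (in free_complex) carrier_null_homotopy:
  fixes Cr :: "nat \<Rightarrow> 'a \<Rightarrow> nat \<Rightarrow> 'b set" and e :: "nat \<Rightarrow> 'b \<Rightarrow> 'b \<Rightarrow>\<^sub>0 int" and f :: "nat \<Rightarrow> 'a \<Rightarrow> 'b \<Rightarrow>\<^sub>0 int"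
  assumes f: "\<And>n x. x \<in> S n \<Longrightarrow> Poly_Mapping.keys (f n x) \<subseteq> Cr n x n"
    and mono: "\<And>n x y k. x \<in> S (Suc n) \<Longrightarrow> y \<in> Poly_Mapping.keys (d (Suc n) x) \<Longrightarrow> Cr n y k \<subseteq> Cr (Suc n) x k"
    and chain: "\<And>n x. x \<in> S (Suc n) \<Longrightarrow> frag_extend (e (Suc n)) (f (Suc n) x) = frag_extend (f n) (d (Suc n) x)"
    and acyc: "\<And>n x c. \<lbrakk>x \<in> S n; Poly_Mapping.keys c \<subseteq> Cr n x n; frag_extend (e n) c = 0; n = 0 \<Longrightarrow> c = f 0 x\<rbrakk>
      \<Longrightarrow> \<exists>w. Poly_Mapping.keys w \<subseteq> Cr n x (Suc n) \<and> frag_extend (e (Suc n)) w = c"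
    and e_0: "\<And>y. e 0 y = 0"
    and z: "z \<in> chains n" "bd n z = 0"
  shows "\<exists>w. Poly_Mapping.keys w \<subseteq> (\<Union>x\<in>Poly_Mapping.keys z. Cr n x (Suc n)) \<and> frag_extend (e (Suc n)) w = frag_extend (f n) z"
proof -
  let ?E = "\<lambda>n. frag_extend (e n)"
  let ?P = "\<lambda>n h. (\<forall>x\<in>S n. Poly_Mapping.keys (h x) \<subseteq> Cr n x (Suc n)) \<and> (\<forall>x\<in>S (Suc n). ?E (Suc n) (f (Suc n) x - frag_extend h (d (Suc n) x)) = 0)
      \<and> (n = 0 \<longrightarrow> (\<forall>x\<in>S 0. ?E (Suc 0) (h x) = f 0 x))"
  let ?Q = "\<lambda>n h h'. \<forall>x\<in>S (Suc n). ?E (Suc (Suc n)) (h' x) = f (Suc n) x - frag_extend h (d (Suc n) x)"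
  have "\<exists>h. \<forall>n. ?P n (h n) \<and> ?Q n (h n) (h (Suc n))"
  proof (rule dependent_nat_choice)
    \<comment> \<open>In degree 0 the carrier is assumed acyclic only for the chain
      \<open>f 0 x\<close>, which is the one to be filled here. In this way the hypothesis contains
      the condition on augmentations.\<close>
    have "\<exists>w. Poly_Mapping.keys w \<subseteq> Cr 0 x (Suc 0) \<and> ?E (Suc 0) w = f 0 x" if x: "x \<in> S 0" for x
      by (rule acyc[OF x f[OF x]]) (auto intro!: frag_extend_eq_0 e_0)
    then obtain h where h: "\<And>x. x \<in> S 0 \<Longrightarrow> Poly_Mapping.keys (h x) \<subseteq> Cr 0 x (Suc 0) \<and> ?E (Suc 0) (h x) = f 0 x"
      by metis
    have "?E (Suc 0) (f (Suc 0) x - frag_extend h (d (Suc 0) x)) = 0" if x: "x \<in> S (Suc 0)" for x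
    proof -
      have "?E (Suc 0) (frag_extend h (d (Suc 0) x)) = frag_extend (f 0) (d (Suc 0) x)"
        unfolding frag_extend_frag_extend using h by (intro frag_extend_cong_keys[OF keys_d[OF x]]) auto
      then show ?thesis using chain[OF x] by (simp add: frag_extend_diff)
    qed
    with h show "\<exists>h. ?P 0 h" by blast
  next
    fix h n assume P: "?P n h"
    have hk: "Poly_Mapping.keys (f (Suc n) x - frag_extend h (d (Suc n) x)) \<subseteq> Cr (Suc n) x (Suc n)" if x: "x \<in> S (Suc n)" for x
    proof (rule keys_diff_subset[OF f[OF x]])
      show "Poly_Mapping.keys (frag_extend h (d (Suc n) x)) \<subseteq> Cr (Suc n) x (Suc n)"
      proof (rule keys_frag_extend_subset[OF order_refl])
        fix y assume y: "y \<in> Poly_Mapping.keys (d (Suc n) x)"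
        then have "y \<in> S n" using keys_d[OF x] by blast
        then show "Poly_Mapping.keys (h y) \<subseteq> Cr (Suc n) x (Suc n)" using P mono[OF x y] by blast
      qed
    qed
    have "\<exists>w. Poly_Mapping.keys w \<subseteq> Cr (Suc n) x (Suc (Suc n)) \<and> ?E (Suc (Suc n)) w = f (Suc n) x - frag_extend h (d (Suc n) x)"
      if x: "x \<in> S (Suc n)" for x
      by (rule acyc[OF x hk[OF x]]) (use P x in auto)
    then obtain h' where h': "\<And>x. x \<in> S (Suc n) \<Longrightarrow> Poly_Mapping.keys (h' x) \<subseteq> Cr (Suc n) x (Suc (Suc n))
        \<and> ?E (Suc (Suc n)) (h' x) = f (Suc n) x - frag_extend h (d (Suc n) x)"
      by metis
    have "?E (Suc (Suc n)) (f (Suc (Suc n)) x - frag_extend h' (d (Suc (Suc n)) x)) = 0" if x: "x \<in> S (Suc (Suc n))" for x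
    proof -
      have "?E (Suc (Suc n)) (frag_extend h' (d (Suc (Suc n)) x))
          = frag_extend (\<lambda>y. f (Suc n) y - frag_extend h (d (Suc n) y)) (d (Suc (Suc n)) x)"
        unfolding frag_extend_frag_extend using h' by (intro frag_extend_cong_keys[OF keys_d[OF x]]) auto
      also have "\<dots> = frag_extend (f (Suc n)) (d (Suc (Suc n)) x) - frag_extend h (bd (Suc n) (d (Suc (Suc n)) x))"
        by (simp add: frag_extend_diff_fun frag_extend_frag_extend)
      finally show ?thesis using chain[OF x] d_d[OF x] by (simp add: frag_extend_diff)
    qed
    with h' show "\<exists>h'. ?P (Suc n) h' \<and> ?Q n h h'" by (intro exI[of _ h']) auto
  qed
  then obtain h where h: "\<forall>n. ?P n (h n) \<and> ?Q n (h n) (h (Suc n))" ..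
  show ?thesis
  proof (intro exI[of _ "frag_extend (h n) z"] conjI)
    show "Poly_Mapping.keys (frag_extend (h n) z) \<subseteq> (\<Union>x\<in>Poly_Mapping.keys z. Cr n x (Suc n))"
    proof (rule keys_frag_extend_subset[OF order_refl])
      fix x assume x: "x \<in> Poly_Mapping.keys z"
      then have "x \<in> S n" using z by blast
      then have "Poly_Mapping.keys (h n x) \<subseteq> Cr n x (Suc n)" using h[rule_format, of n] by blast
      with x show "Poly_Mapping.keys (h n x) \<subseteq> (\<Union>x\<in>Poly_Mapping.keys z. Cr n x (Suc n))" by blast
    qed
    show "?E (Suc n) (frag_extend (h n) z) = frag_extend (f n) z"
    proof (cases n)
      case 0
      have "\<And>x. x \<in> S 0 \<Longrightarrow> ?E (Suc 0) (h 0 x) = f 0 x" using h[rule_format, of 0] by blast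
      then show ?thesis
        unfolding frag_extend_frag_extend 0 using z 0 by (intro frag_extend_cong_keys[of z "S 0"]) auto
    next
      case (Suc k)
      have "\<And>x. x \<in> S (Suc k) \<Longrightarrow> ?E (Suc (Suc k)) (h (Suc k) x) = f (Suc k) x - frag_extend (h k) (d (Suc k) x)"
        using h[rule_format, of k] by blast
      then have "?E (Suc n) (frag_extend (h n) z) = frag_extend (\<lambda>x. f n x - frag_extend (h k) (d n x)) z"
        unfolding frag_extend_frag_extend Suc using z Suc by (intro frag_extend_cong_keys[of z "S n"]) auto
      also have "\<dots> = frag_extend (f n) z - frag_extend (h k) (bd n z)"
        by (simp add: frag_extend_diff_fun frag_extend_frag_extend)
      finally show ?thesis using z by simp
    qed
  qed
qed

subsection \<open>Small simplices\<close>

text \<open>The vertices of the cube obtained by rounding the points of a simplex \<open>s\<close> lie between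
  \<open>round_all n s\<close> and \<open>round_some n s\<close>.\<close>

definition round_all :: "nat \<Rightarrow> nat \<Rightarrow> ((nat \<Rightarrow> real) \<Rightarrow> nat \<Rightarrow> real) \<Rightarrow> nat set" where
  "round_all m n s = {i \<in> {1..m}. \<forall>x\<in>standard_simplex n. 1 / 2 \<le> s x i}"

definition round_some :: "nat \<Rightarrow> nat \<Rightarrow> ((nat \<Rightarrow> real) \<Rightarrow> nat \<Rightarrow> real) \<Rightarrow> nat set" where
  "round_some m n s = {i \<in> {1..m}. \<exists>x\<in>standard_simplex n. 1 / 2 \<le> s x i}"

text \<open>A point of the simplex may be moved by raising the coordinates that always round to 1,
  lowering those that always round to 0 and changing the others at will. The set contains the image
  of \<open>s\<close> as well as the closed face of the cube spanned by the rounded vertices, and it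
  is star-shaped; so it carries both maps that have to be compared.\<close>

definition star_carrier :: "nat \<Rightarrow> nat \<Rightarrow> ((nat \<Rightarrow> real) \<Rightarrow> nat \<Rightarrow> real) \<Rightarrow> (nat \<Rightarrow> real) set" where
  "star_carrier m n s = {y \<in> topspace (unit_cube m). \<exists>x\<in>standard_simplex n. \<forall>i\<in>{1..m}.
     (i \<in> round_all m n s \<longrightarrow> s x i \<le> y i) \<and> (i \<notin> round_some m n s \<longrightarrow> y i \<le> s x i)}"

text \<open>A coordinate that does not round uniformly on the simplex has to stay off 0 and 1
  throughout. Such coordinates are then free at every point of the simplex, which keeps the rounded
  face and the whole \<open>star_carrier\<close> inside the complex.\<close>

definition small_simplices :: "nat \<Rightarrow> (nat \<Rightarrow> real) topology \<Rightarrow> nat \<Rightarrow> ((nat \<Rightarrow> real) \<Rightarrow> nat \<Rightarrow> real) set" where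
  "small_simplices m X n = {s \<in> singular_simplex_set n X.
     \<forall>i\<in>round_some m n s - round_all m n s. \<forall>x\<in>standard_simplex n. 0 < s x i \<and> s x i < 1}"

lemma round_all_subset: "round_all m n s \<subseteq> round_some m n s" "round_some m n s \<subseteq> {1..m}"
  using nonempty_standard_simplex[of n] by (auto simp: round_all_def round_some_def)

lemma round_face:
  assumes "k \<le> Suc n"
  shows "round_all m (Suc n) s \<subseteq> round_all m n (singular_face (Suc n) k s)"
    and "round_some m n (singular_face (Suc n) k s) \<subseteq> round_some m (Suc n) s"
  using assms by (auto simp: round_all_def round_some_def singular_face_def intro: face_closed)

lemma star_carrier_face:
  assumes "k \<le> Suc n"
  shows "star_carrier m n (singular_face (Suc n) k s) \<subseteq> star_carrier m (Suc n) s"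
proof
  fix y assume "y \<in> star_carrier m n (singular_face (Suc n) k s)"
  then obtain x where x: "y \<in> topspace (unit_cube m)" "x \<in> standard_simplex n"
    "\<forall>i\<in>{1..m}. (i \<in> round_all m n (singular_face (Suc n) k s) \<longrightarrow> singular_face (Suc n) k s x i \<le> y i) \<and>
      (i \<notin> round_some m n (singular_face (Suc n) k s) \<longrightarrow> y i \<le> singular_face (Suc n) k s x i)"
    by (auto simp: star_carrier_def)
  have "singular_face (Suc n) k s x = s (simplical_face k x)" using x(2) by (simp add: singular_face_def)
  then show "y \<in> star_carrier m (Suc n) s"
    unfolding star_carrier_def mem_Collect_eq using x round_face[OF assms, of m s] face_closed[OF x(2) assms]
    by (intro conjI bexI[of _ "simplical_face k x"]) auto
qed

text \<open>The centre is the vertex \<open>round_all m n s\<close>. The witness x of y serves for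
  the whole segment, because the centre is 1 where y may only be above s x and 0 where y may only be
  below.\<close>

lemma star_carrier_star_shaped:
  assumes "y \<in> star_carrier m n s" "0 \<le> t" "t \<le> 1" and s: "s \<in> standard_simplex n \<rightarrow> topspace (unit_cube m)"
  defines "a \<equiv> (\<lambda>i\<in>{1..m}. of_bool (i \<in> round_all m n s))"
  shows "(\<lambda>i\<in>{1..m}. (1 - t) * y i + t * a i) \<in> star_carrier m n s"
proof -
  obtain x where y: "y \<in> topspace (unit_cube m)" and x: "x \<in> standard_simplex n"
    and xy: "\<And>i. i \<in> {1..m} \<Longrightarrow> (i \<in> round_all m n s \<longrightarrow> s x i \<le> y i) \<and> (i \<notin> round_some m n s \<longrightarrow> y i \<le> s x i)"
    using assms(1) unfolding star_carrier_def by blast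
  have sx: "0 \<le> s x i \<and> s x i \<le> 1" if "i \<in> {1..m}" for i using Pi_unit_cube[OF s x] that by blast
  have y01: "0 \<le> y i \<and> y i \<le> 1" if "i \<in> {1..m}" for i using y that by (auto simp: in_unit_cube)
  have a01: "0 \<le> a i \<and> a i \<le> 1" if "i \<in> {1..m}" for i using that by (auto simp: a_def)
  let ?w = "\<lambda>i. (1 - t) * y i + t * a i"
  have "0 \<le> ?w i" if "i \<in> {1..m}" for i
    using y01[OF that] a01[OF that] assms(2,3) by auto
  moreover have "?w i \<le> 1" if "i \<in> {1..m}" for i
    using convex_bound_le[of "y i" 1 "a i" "1 - t" t] y01[OF that] a01[OF that] assms(2,3) by auto
  moreover have "s x i \<le> ?w i" if i: "i \<in> round_all m n s" for i
  proof -
    have i': "i \<in> {1..m}" using i round_all_subset by blast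
    have "- ?w i \<le> - s x i"
      using convex_bound_le[of "- y i" "- s x i" "- a i" "1 - t" t] xy[OF i'] sx[OF i'] i i' assms(2,3)
      by (auto simp: a_def)
    then show ?thesis by simp
  qed
  moreover have "?w i \<le> s x i" if i: "i \<notin> round_some m n s" "i \<in> {1..m}" for i
  proof -
    have "i \<notin> round_all m n s" using i round_all_subset by blast
    then show ?thesis
      using convex_bound_le[of "y i" "s x i" "a i" "1 - t" t] xy[OF i(2)] sx[OF i(2)] i assms(2,3)
      by (auto simp: a_def)
  qed
  ultimately show ?thesis
    unfolding star_carrier_def mem_Collect_eq in_unit_cube using x by (intro conjI bexI[of _ x]) auto
qed

lemma star_carrier_acyclic:
  assumes s: "s \<in> standard_simplex n \<rightarrow> topspace (unit_cube m)"
    and c: "singular_chain n (subtopology (unit_cube m) (star_carrier m n s)) c" "chain_boundary n c = 0"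
    and n: "n = 0 \<Longrightarrow> pairing (\<lambda>_. 1) c = 0"
  shows "\<exists>w. singular_chain (Suc n) (subtopology (unit_cube m) (star_carrier m n s)) w \<and> chain_boundary (Suc n) w = c"
proof (rule star_shaped_acyclic[OF _ _ _ c n])
  let ?a = "\<lambda>i\<in>{1..m}. of_bool (i \<in> round_all m n s) :: real"
  show "star_carrier m n s \<subseteq> topspace (unit_cube m)" by (auto simp: star_carrier_def)
  show "(\<lambda>i\<in>{1..m}. (1 - t) * y i + t * ?a i) \<in> star_carrier m n s"
    if "y \<in> star_carrier m n s" "0 \<le> t" "t \<le> 1" for y t
    using star_carrier_star_shaped[OF that s] .
  obtain x where x: "x \<in> standard_simplex n" using nonempty_standard_simplex by blast
  then have "\<forall>i\<in>{1..m}. 0 \<le> s x i \<and> s x i \<le> 1" using Pi_unit_cube[OF s] by blast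
  then show "?a \<in> star_carrier m n s"
    unfolding star_carrier_def mem_Collect_eq in_unit_cube using x round_all_subset[of m n s]
    by (intro conjI bexI[of _ x]) auto
qed auto

definition closed_cell :: "nat \<Rightarrow> nat set \<Rightarrow> nat set \<Rightarrow> (nat \<Rightarrow> real) set" where
  "closed_cell m A B = {y \<in> topspace (unit_cube m). (\<forall>i\<in>A. y i = 1) \<and> (\<forall>i\<in>{1..m} - B. y i = 0)}"

text \<open>Any point x of the standard simplex is a witness: y is 1 on \<open>round_all\<close> and
  0 off \<open>round_some\<close>, so the inequalities with s x hold automatically.\<close>

lemma closed_cell_subset_star_carrier:
  assumes s: "s \<in> standard_simplex n \<rightarrow> topspace (unit_cube m)"
  shows "closed_cell m (round_all m n s) (round_some m n s) \<subseteq> star_carrier m n s"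
proof
  obtain x where x: "x \<in> standard_simplex n" using nonempty_standard_simplex by blast
  then have "\<forall>i\<in>{1..m}. 0 \<le> s x i \<and> s x i \<le> 1" using Pi_unit_cube[OF s] by blast
  then show "y \<in> star_carrier m n s" if "y \<in> closed_cell m (round_all m n s) (round_some m n s)" for y
    using that x unfolding star_carrier_def closed_cell_def mem_Collect_eq by (intro conjI bexI[of _ x]) auto
qed

lemma singular_simplex_realise:
  assumes l: "length l = Suc n" and v: "\<And>v. v \<in> set l \<Longrightarrow> A \<subseteq> v \<and> v \<subseteq> B" and A: "A \<subseteq> {1..m}"
  shows "singular_simplex n (subtopology (unit_cube m) (closed_cell m A B)) (realise m l)"
proof -
  let ?D = "subtopology (powertop_real UNIV) (standard_simplex n)"
  have nth: "A \<subseteq> l ! j" "l ! j \<subseteq> B" if "j < Suc n" for j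
    using v[of "l ! j"] that l by auto
  have in_cell: "realise m l x \<in> closed_cell m A B" if x: "x \<in> standard_simplex n" for x
  proof -
    have x0: "0 \<le> x j" for j using x by (simp add: standard_simplex_def)
    have x1: "(\<Sum>j<Suc n. x j) = 1" using x by (simp add: standard_simplex_def lessThan_Suc_atMost del: sum.lessThan_Suc)
    have "(\<Sum>j<Suc n. x j * of_bool (i \<in> l ! j)) \<le> (\<Sum>j<Suc n. x j)" for i
      using x0 by (intro sum_mono) auto
    moreover have "(\<Sum>j<Suc n. x j * of_bool (i \<in> l ! j)) = (\<Sum>j<Suc n. x j)" if "i \<in> A" for i
      using nth that by (intro sum.cong) auto
    moreover have "(\<Sum>j<Suc n. x j * of_bool (i \<in> l ! j)) = 0" if "i \<notin> B" for i
      using nth that by (intro sum.neutral) auto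
    moreover have "0 \<le> (\<Sum>j<Suc n. x j * of_bool (i \<in> l ! j))" for i
      using x0 by (intro sum_nonneg) auto
    ultimately show ?thesis
      unfolding realise_apply[OF l x] closed_cell_def mem_Collect_eq in_unit_cube x1
      using A by (auto simp del: sum.lessThan_Suc)
  qed
  have cont: "continuous_map ?D euclideanreal (\<lambda>x. realise m l x i)" if i: "i \<in> {1..m}" for i
  proof -
    have "continuous_map ?D euclideanreal (\<lambda>x. \<Sum>j<Suc n. x j * of_bool (i \<in> l ! j))"
      by (intro continuous_map_sum continuous_map_real_mult continuous_map_from_subtopology
          continuous_map_product_projection) auto
    then show ?thesis
      by (rule continuous_map_eq) (use i in \<open>simp add: realise_apply[OF l] del: sum.lessThan_Suc\<close>)
  qed
  have "realise m l \<in> extensional (standard_simplex n)" using l by (simp add: realise_def)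
  moreover have "continuous_map ?D (subtopology (unit_cube m) (closed_cell m A B)) (realise m l)"
    unfolding continuous_map_in_subtopology continuous_map_unit_cube
    using in_cell cont by (auto simp: closed_cell_def)
  ultimately show ?thesis by (simp add: singular_simplex_def)
qed

lemma singular_chain_cube_chain:
  assumes "\<sigma> \<subseteq> B" "A \<subseteq> E" "E \<subseteq> B" "A \<subseteq> {1..m}"
  shows "singular_chain (card \<sigma>) (subtopology (unit_cube m) (closed_cell m A B)) (cube_chain m (\<sigma>, E))"
  unfolding cube_chain_def case_prod_conv singular_chain_def
proof (rule keys_frag_extend_subset[OF keys_ez])
  fix l assume l: "l \<in> {l. length l = Suc (card \<sigma>) \<and> l \<noteq> [] \<and> hd l = E \<and> (\<forall>v\<in>set l. E \<subseteq> v \<and> v \<subseteq> E \<union> \<sigma>)}"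
  have "A \<subseteq> v \<and> v \<subseteq> B" if "v \<in> set l" for v
  proof -
    have "E \<subseteq> v" "v \<subseteq> E \<union> \<sigma>" using l that by simp_all
    then show ?thesis using assms by (meson Un_least subset_trans)
  qed
  then have "singular_simplex (card \<sigma>) (subtopology (unit_cube m) (closed_cell m A B)) (realise m l)"
    using l assms(4) by (intro singular_simplex_realise) auto
  then show "Poly_Mapping.keys (frag_of (realise m l)) \<subseteq> singular_simplex_set (card \<sigma>) (subtopology (unit_cube m) (closed_cell m A B))"
    by simp
qed

text \<open>\<open>free_complex\<close> demands a degree 0 differential that vanishes on every
  argument, also on pairs that are not vertices, so degree 0 is cut off by hand. On vertices
  \<open>cube_bd\<close> is 0 anyway.\<close>

definition cube_d :: "nat \<Rightarrow> cell \<Rightarrow> cell \<Rightarrow>\<^sub>0 int" where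
  "cube_d n = (if n = 0 then (\<lambda>_. 0) else cube_bd)"

section \<open>The complex inside the cube, its cells and its small simplices\<close>

locale moment_angle_complex =
  fixes m :: nat and K :: "nat set set"
  assumes K: "simplicial_complex_on m K"
begin

lemma K_empty: "{} \<in> K" and K_vertices: "\<sigma> \<in> K \<Longrightarrow> \<sigma> \<subseteq> {1..m}" and K_down: "\<sigma> \<in> K \<Longrightarrow> \<tau> \<subseteq> \<sigma> \<Longrightarrow> \<tau> \<in> K"
  using K by (auto simp: simplicial_complex_on_def)

lemma K_finite: "\<sigma> \<in> K \<Longrightarrow> finite \<sigma>"
  using K_vertices finite_subset by blast

abbreviation X where "X \<equiv> real_moment_angle m K"
abbreviation X_simplices where "X_simplices \<equiv> (\<lambda>n. singular_simplex_set n X)"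

definition X_points :: "(nat \<Rightarrow> real) set" where
  "X_points = {x \<in> topspace (unit_cube m). free_coords m x \<in> K}"

text \<open>As K is closed under subsets, a point lies in the union exactly if its own set of free
  coordinates is in K. The later arguments use this pointwise criterion.\<close>

lemma X_eq: "X = subtopology (unit_cube m) X_points"
proof -
  have "(\<Union>\<sigma>\<in>K. {x \<in> topspace (unit_cube m). \<forall>i\<in>{1..m}. i \<notin> \<sigma> \<longrightarrow> x i \<in> {0, 1}}) = X_points"
  proof (intro equalityI subsetI)
    fix x assume "x \<in> (\<Union>\<sigma>\<in>K. {x \<in> topspace (unit_cube m). \<forall>i\<in>{1..m}. i \<notin> \<sigma> \<longrightarrow> x i \<in> {0, 1}})"
    then obtain \<sigma> where s: "\<sigma> \<in> K" "x \<in> topspace (unit_cube m)" "\<forall>i\<in>{1..m}. i \<notin> \<sigma> \<longrightarrow> x i \<in> {0, 1}" by blast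
    then have "free_coords m x \<subseteq> \<sigma>" by (auto simp: free_coords_def)
    then show "x \<in> X_points" using s K_down by (auto simp: X_points_def)
  next
    fix x assume "x \<in> X_points"
    then show "x \<in> (\<Union>\<sigma>\<in>K. {x \<in> topspace (unit_cube m). \<forall>i\<in>{1..m}. i \<notin> \<sigma> \<longrightarrow> x i \<in> {0, 1}})"
      by (intro UN_I[of "free_coords m x"]) (auto simp: X_points_def free_coords_def)
  qed
  then show ?thesis by (simp add: real_moment_angle_def)
qed

lemma topspace_X: "topspace X = X_points"
  by (auto simp: X_eq X_points_def)

lemma subtopology_X: "V \<subseteq> X_points \<Longrightarrow> subtopology X V = subtopology (unit_cube m) V"
  by (simp add: X_eq subtopology_subtopology Int_absorb1)

lemma closed_cell_X: "B - A \<in> K \<Longrightarrow> closed_cell m A B \<subseteq> X_points"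
proof
  fix x assume B: "B - A \<in> K" and x: "x \<in> closed_cell m A B"
  then have "free_coords m x \<subseteq> B - A" by (auto simp: closed_cell_def free_coords_def)
  with B x show "x \<in> X_points" by (simp add: X_points_def closed_cell_def K_down)
qed

definition cells :: "nat \<Rightarrow> cell set" where
  "cells n = {(\<sigma>, E). \<sigma> \<in> K \<and> E \<subseteq> {1..m} - \<sigma> \<and> card \<sigma> = n}"

lemma box_cells: "B \<subseteq> {1..m} \<Longrightarrow> B - A \<in> K \<Longrightarrow> face_box A B n \<subseteq> cells n"
proof
  fix x assume B: "B \<subseteq> {1..m}" "B - A \<in> K" "x \<in> face_box A B n"
  obtain \<sigma> E where x: "x = (\<sigma>, E)" by fastforce
  have "\<sigma> \<subseteq> B - A" using B by (auto simp: face_box_def x)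
  then have "\<sigma> \<in> K" using B K_down by blast
  then show "x \<in> cells n" using B by (auto simp: face_box_def cells_def x)
qed

lemma cell_box: "(\<sigma>, E) \<in> cells n \<Longrightarrow> (\<sigma>, E) \<in> face_box E (E \<union> \<sigma>) n"
  by (auto simp: cells_def face_box_def)

lemma cells_box_subset: "(\<sigma>, E) \<in> cells k \<Longrightarrow> face_box E (E \<union> \<sigma>) n \<subseteq> cells n"
proof (rule box_cells)
  assume "(\<sigma>, E) \<in> cells k"
  then have c: "\<sigma> \<in> K" "E \<subseteq> {1..m}" by (auto simp: cells_def)
  then show "E \<union> \<sigma> \<subseteq> {1..m}" using K_vertices by blast
  show "E \<union> \<sigma> - E \<in> K" using c(1) by (rule K_down) blast
qed

lemma free_complex_cells: "free_complex cells cube_d"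
proof
  fix x n assume x: "x \<in> cells (Suc n)"
  obtain \<sigma> E where xe: "x = (\<sigma>, E)" by fastforce
  have c: "\<sigma> \<in> K" "E \<subseteq> {1..m}" "\<sigma> \<inter> E = {}" using x xe by (auto simp: cells_def)
  have "finite (E \<union> \<sigma>)" using c K_vertices by (metis Un_subset_iff finite_atLeastAtMost finite_subset)
  then have "Poly_Mapping.keys (cube_bd x) \<subseteq> face_box E (E \<union> \<sigma>) n"
    using keys_cube_bd_box cell_box x xe by blast
  then show "Poly_Mapping.keys (cube_d (Suc n) x) \<subseteq> cells n"
    using cells_box_subset[of \<sigma> E "Suc n" n] x xe by (simp add: cube_d_def)
  show "frag_extend (cube_d n) (cube_d (Suc n) x) = 0"
    using cube_bd_bd[of \<sigma> E] by (simp add: cube_d_def xe)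
qed (simp add: cube_d_def)

lemma singular_chain_cube_chain_X:
  assumes "(\<sigma>, E) \<in> cells n"
  shows "singular_chain n (subtopology X (closed_cell m E (E \<union> \<sigma>))) (cube_chain m (\<sigma>, E))"
proof -
  have c: "E \<union> \<sigma> - E \<in> K" "E \<subseteq> {1..m}" using assms by (auto simp: cells_def intro: K_down)
  show ?thesis
    using singular_chain_cube_chain[of \<sigma> "E \<union> \<sigma>" E E m] c assms
    by (auto simp: subtopology_X[OF closed_cell_X[OF c(1)]] cells_def)
qed

lemma free_chain_map_cube_chain: "free_chain_map cells cube_d X_simplices sing_bd (\<lambda>_. cube_chain m)"
proof (intro free_chain_map.intro free_complex_cells free_complex_singular free_chain_map_axioms.intro)
  fix x n assume x: "x \<in> cells n"
  obtain \<sigma> E where xe: "x = (\<sigma>, E)" by fastforce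
  show "Poly_Mapping.keys (cube_chain m x) \<subseteq> X_simplices n"
    using singular_chain_cube_chain_X[of \<sigma> E n] x unfolding xe by (auto simp: singular_chain_def singular_simplex_subtopology)
next
  fix x n assume x: "x \<in> cells (Suc n)"
  obtain \<sigma> E where xe: "x = (\<sigma>, E)" by fastforce
  show "frag_extend (sing_bd (Suc n)) (cube_chain m x) = frag_extend (cube_chain m) (cube_d (Suc n) x)"
    using sing_bd_cube_chain[of \<sigma> n m E] x K_finite by (auto simp: xe cube_d_def cells_def)
qed

abbreviation small where "small \<equiv> small_simplices m X"

lemma simplex_in_cube: "singular_simplex n X s \<Longrightarrow> s \<in> standard_simplex n \<rightarrow> topspace (unit_cube m)"
  and simplex_in_X: "singular_simplex n X s \<Longrightarrow> s \<in> standard_simplex n \<rightarrow> X_points"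
proof -
  assume "singular_simplex n X s"
  then have "s \<in> standard_simplex n \<rightarrow> topspace X"
    by (auto simp: singular_simplex_def continuous_map_def)
  then show "s \<in> standard_simplex n \<rightarrow> X_points" "s \<in> standard_simplex n \<rightarrow> topspace (unit_cube m)"
    unfolding topspace_X by (auto simp: X_points_def)
qed

lemma small_face:
  assumes "s \<in> small (Suc n)" "k \<le> Suc n"
  shows "singular_face (Suc n) k s \<in> small n"
proof -
  have "singular_simplex n X (singular_face (Suc n) k s)"
    using singular_simplex_singular_face[of "Suc n" X s k] assms by (simp add: small_simplices_def)
  moreover have "0 < singular_face (Suc n) k s x i \<and> singular_face (Suc n) k s x i < 1"
    if "i \<in> round_some m n (singular_face (Suc n) k s) - round_all m n (singular_face (Suc n) k s)" "x \<in> standard_simplex n" for i x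
  proof -
    have "i \<in> round_some m (Suc n) s - round_all m (Suc n) s" using that(1) round_face[OF assms(2), of m s] by blast
    moreover have "simplical_face k x \<in> standard_simplex (Suc n)" using face_closed that(2) assms(2) by blast
    ultimately show ?thesis using assms(1) that(2) by (simp add: small_simplices_def singular_face_def)
  qed
  ultimately show ?thesis by (simp add: small_simplices_def)
qed

lemma keys_sing_bd: "Poly_Mapping.keys (sing_bd (Suc n) s) \<subseteq> (\<lambda>k. singular_face (Suc n) k s) ` {..Suc n}"
  unfolding sing_bd_def chain_boundary_of by (simp del: sum.atMost_Suc) (intro keys_sum_subset keys_cmul_subset, auto)

lemma free_complex_small: "free_complex small sing_bd"
proof -
  interpret X: free_complex X_simplices sing_bd by (rule free_complex_singular)
  show ?thesis
  proof
    show "sing_bd 0 x = 0" for x :: "(nat \<Rightarrow> real) \<Rightarrow> nat \<Rightarrow> real" by (rule X.d_0)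
    fix x n assume x: "x \<in> small (Suc n)"
    show "Poly_Mapping.keys (sing_bd (Suc n) x) \<subseteq> small n"
      using keys_sing_bd small_face[OF x] by blast
    show "frag_extend (sing_bd n) (sing_bd (Suc n) x) = 0"
      using x by (intro X.d_d) (simp add: small_simplices_def)
  qed
qed

text \<open>Moving a point s x within the carrier creates no new free coordinate. Where y stays
  strictly between 0 and 1, so does s x: it is at least 1/2 and at most y i, or below 1/2 and at
  least y i, or strictly between 0 and 1 by smallness.\<close>

lemma star_carrier_X:
  assumes s: "s \<in> small n"
  shows "star_carrier m n s \<subseteq> X_points"
proof
  fix y assume "y \<in> star_carrier m n s"
  then obtain x where y: "y \<in> topspace (unit_cube m)" and x: "x \<in> standard_simplex n"
    and xy: "\<And>i. i \<in> {1..m} \<Longrightarrow> (i \<in> round_all m n s \<longrightarrow> s x i \<le> y i) \<and> (i \<notin> round_some m n s \<longrightarrow> y i \<le> s x i)"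
    unfolding star_carrier_def by blast
  have ss: "singular_simplex n X s" using s by (simp add: small_simplices_def)
  have "free_coords m y \<subseteq> free_coords m (s x)"
  proof
    fix i assume "i \<in> free_coords m y"
    then have i: "i \<in> {1..m}" "y i \<noteq> 0" "y i \<noteq> 1" by (auto simp: free_coords_def)
    then have y01: "0 < y i" "y i < 1" using y unfolding in_unit_cube by force+
    have s01: "0 \<le> s x i" "s x i \<le> 1" using Pi_unit_cube[OF simplex_in_cube[OF ss] x] i by blast+
    have "0 < s x i \<and> s x i < 1"
    proof (cases "i \<in> round_all m n s")
      case True
      then have "1 / 2 \<le> s x i" using x by (simp add: round_all_def)
      then show ?thesis using xy[OF i(1)] True y01 by auto
    next
      case False
      show ?thesis
      proof (cases "i \<in> round_some m n s")
        case True
        then show ?thesis using s False x by (simp add: small_simplices_def)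
      next
        case False
        then have "s x i < 1 / 2" using x i by (force simp: round_some_def)
        then show ?thesis using xy[OF i(1)] False y01 by auto
      qed
    qed
    then show "i \<in> free_coords m (s x)" using i by (simp add: free_coords_def)
  qed
  moreover have "free_coords m (s x) \<in> K" using simplex_in_X[OF ss] x by (auto simp: X_points_def)
  ultimately show "y \<in> X_points" using y K_down by (simp add: X_points_def)
qed

text \<open>By smallness these coordinates are free at any point of the simplex, and the free
  coordinates of a point of the complex form an element of K.\<close>

lemma small_round_K:
  assumes s: "s \<in> small n"
  shows "round_some m n s - round_all m n s \<in> K"
proof -
  have ss: "singular_simplex n X s" using s by (simp add: small_simplices_def)
  obtain x where x: "x \<in> standard_simplex n" using nonempty_standard_simplex by blast
  have "round_some m n s - round_all m n s \<subseteq> free_coords m (s x)"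
  proof
    fix i assume i: "i \<in> round_some m n s - round_all m n s"
    then have "0 < s x i \<and> s x i < 1" using s x unfolding small_simplices_def by blast
    moreover have "i \<in> {1..m}" using i round_all_subset(2) by blast
    ultimately show "i \<in> free_coords m (s x)" by (simp add: free_coords_def)
  qed
  moreover have "free_coords m (s x) \<in> K" using simplex_in_X[OF ss] x by (auto simp: X_points_def)
  ultimately show ?thesis using K_down by blast
qed

abbreviation simplex_box where "simplex_box n s \<equiv> face_box (round_all m n s) (round_some m n s)"

lemma simplex_box_face: "k \<le> Suc n \<Longrightarrow> simplex_box n (singular_face (Suc n) k s) j \<subseteq> simplex_box (Suc n) s j"
  using round_face[of k n m s] by (auto simp: face_box_def)

lemma round_0: "round_some m 0 s = round_all m 0 s"
  by (simp add: round_some_def round_all_def standard_simplex_0)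

text \<open>The chain map to cubical chains is built by acyclic carriers. It starts with rounding
  vertices; the carrier of s is the box between \<open>round_all\<close> and
  \<open>round_some\<close>, which contains the boxes of the faces of s and is acyclic. The carrier
  condition is part of the result because both homotopies below depend on it.\<close>

lemma small_to_cubes:
  obtains g where
    "\<And>n s. s \<in> small n \<Longrightarrow> Poly_Mapping.keys (g n s) \<subseteq> simplex_box n s n"
    "\<And>s. s \<in> small 0 \<Longrightarrow> g 0 s = frag_of ({}, round_all m 0 s)"
    "\<And>n s. s \<in> small (Suc n) \<Longrightarrow> frag_extend cube_bd (g (Suc n) s) = frag_extend (g n) (sing_bd (Suc n) s)"
proof -
  interpret S: free_complex small sing_bd by (rule free_complex_small)
  interpret Q: free_complex cells cube_d by (rule free_complex_cells)
  let ?P = "\<lambda>n g. (\<forall>s\<in>small n. Poly_Mapping.keys (g s) \<subseteq> simplex_box n s n)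
     \<and> (\<forall>s\<in>small (Suc n). frag_extend (cube_d n) (frag_extend g (sing_bd (Suc n) s)) = 0)
     \<and> (n = 0 \<longrightarrow> (\<forall>s\<in>small 0. g s = frag_of ({}, round_all m 0 s)))"
  let ?Q = "\<lambda>n g g'. \<forall>s\<in>small (Suc n). frag_extend cube_bd (g' s) = frag_extend g (sing_bd (Suc n) s)"
  have "\<exists>g. \<forall>n. ?P n (g n) \<and> ?Q n (g n) (g (Suc n))"
  proof (rule dependent_nat_choice)
    show "\<exists>g. ?P 0 g"
      by (rule exI[of _ "\<lambda>s. frag_of ({}, round_all m 0 s)"]) (auto simp: face_box_def cube_d_def round_0)
  next
    fix g n assume P: "?P n g"
    have "\<exists>w. Poly_Mapping.keys w \<subseteq> simplex_box (Suc n) s (Suc n) \<and> frag_extend cube_bd w = frag_extend g (sing_bd (Suc n) s)"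
      if s: "s \<in> small (Suc n)" for s
    proof (rule box_acyclic)
      show "finite (round_some m (Suc n) s)" by (simp add: round_some_def)
      show "round_all m (Suc n) s \<subseteq> round_some m (Suc n) s" by (rule round_all_subset)
      show "Poly_Mapping.keys (frag_extend g (sing_bd (Suc n) s)) \<subseteq> simplex_box (Suc n) s n"
      proof (rule keys_frag_extend_subset[OF keys_sing_bd])
        fix x assume "x \<in> (\<lambda>k. singular_face (Suc n) k s) ` {..Suc n}"
        then obtain k where k: "k \<le> Suc n" "x = singular_face (Suc n) k s" by auto
        then show "Poly_Mapping.keys (g x) \<subseteq> simplex_box (Suc n) s n"
          using P small_face[OF s k(1)] simplex_box_face[OF k(1), of s n] by blast
      qed
      \<comment> \<open>The two differentials agree on the cells at hand: in degree 0 the box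
        contains only cells with no free coordinates.\<close>
      have "cube_d n (\<sigma>, E) = cube_bd (\<sigma>, E)" if "(\<sigma>, E) \<in> simplex_box (Suc n) s n" for \<sigma> E
      proof (cases "n = 0")
        case True
        have "finite \<sigma>" using that by (auto simp: face_box_def round_some_def intro: finite_subset)
        then show ?thesis using that True by (simp add: face_box_def cube_d_def cube_bd_def)
      qed (simp add: cube_d_def)
      then have "frag_extend cube_bd (frag_extend g (sing_bd (Suc n) s)) = frag_extend (cube_d n) (frag_extend g (sing_bd (Suc n) s))"
        using \<open>Poly_Mapping.keys (frag_extend g (sing_bd (Suc n) s)) \<subseteq> simplex_box (Suc n) s n\<close>
        by (intro frag_extend_cong_keys) auto
      then show "frag_extend cube_bd (frag_extend g (sing_bd (Suc n) s)) = 0" using P s by simp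
      assume n: "n = 0"
      \<comment> \<open>Vertices go to vertices, so the augmentation is that of the boundary of an
        edge, 1 - 1.\<close>
      have "pairing (\<lambda>_. 1) (frag_extend g (sing_bd (Suc n) s)) = pairing (\<lambda>_. 1) (sing_bd (Suc n) s)"
        unfolding pairing_frag_extend using P n by (intro pairing_cong_keys[OF S.keys_d[OF s]]) auto
      then show "pairing (\<lambda>_. 1) (frag_extend g (sing_bd (Suc n) s)) = 0"
        by (simp add: n pairing_sing_bd)
    qed
    then obtain g' where g': "\<And>s. s \<in> small (Suc n) \<Longrightarrow> Poly_Mapping.keys (g' s) \<subseteq> simplex_box (Suc n) s (Suc n)
        \<and> frag_extend cube_bd (g' s) = frag_extend g (sing_bd (Suc n) s)"
      by metis
    have "frag_extend (cube_d (Suc n)) (frag_extend g' (sing_bd (Suc (Suc n)) s)) = 0" if s: "s \<in> small (Suc (Suc n))" for s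
    proof -
      have "frag_extend (cube_d (Suc n)) (frag_extend g' (sing_bd (Suc (Suc n)) s))
          = frag_extend (\<lambda>x. frag_extend g (sing_bd (Suc n) x)) (sing_bd (Suc (Suc n)) s)"
        unfolding frag_extend_frag_extend cube_d_def using g' by (intro frag_extend_cong_keys[OF S.keys_d[OF s]]) auto
      also have "\<dots> = frag_extend g (S.bd (Suc n) (sing_bd (Suc (Suc n)) s))"
        by (simp add: frag_extend_frag_extend)
      finally show ?thesis using S.d_d[OF s] by simp
    qed
    with g' show "\<exists>g'. ?P (Suc n) g' \<and> ?Q n g g'" by (intro exI[of _ g']) auto
  qed
  then obtain g where g: "\<forall>n. ?P n (g n) \<and> ?Q n (g n) (g (Suc n))" ..
  show thesis
  proof (rule that[of g])
    show "Poly_Mapping.keys (g n s) \<subseteq> simplex_box n s n" if "s \<in> small n" for n s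
      using g[rule_format, of n] that by blast
    show "g 0 s = frag_of ({}, round_all m 0 s)" if "s \<in> small 0" for s
      using g[rule_format, of 0] that by blast
    show "frag_extend cube_bd (g (Suc n) s) = frag_extend (g n) (sing_bd (Suc n) s)" if "s \<in> small (Suc n)" for n s
      using g[rule_format, of n] that by blast
  qed
qed

end

section \<open>Iterated barycentric subdivision\<close>

abbreviation subdivide :: "nat \<Rightarrow> nat \<Rightarrow> 'a chain \<Rightarrow> 'a chain" where
  "subdivide N n \<equiv> singular_subdivision n ^^ N"

lemma singular_chain_subdivide: "singular_chain n Y c \<Longrightarrow> singular_chain n Y (subdivide N n c)"
  by (induction N) (auto simp: singular_chain_singular_subdivision)

lemma chain_boundary_subdivide:
  "singular_chain (Suc n) Y c \<Longrightarrow> chain_boundary (Suc n) (subdivide N (Suc n) c) = subdivide N n (chain_boundary (Suc n) c)"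
proof (induction N)
  case (Suc N)
  then show ?case
    using chain_boundary_singular_subdivision[OF singular_chain_subdivide[OF Suc.prems, of N]] by simp
qed simp

lemma subdivide_0: "singular_chain 0 Y c \<Longrightarrow> subdivide N 0 c = c"
  by (induction N) (auto simp: singular_subdivision_zero)

lemma subdivide_frag_extend: "subdivide N n (frag_extend f c) = frag_extend (\<lambda>x. subdivide N n (f x)) c"
  using subset_UNIV
  by (induction c rule: frag_induction) (auto simp: frag_extend_diff singular_subdivision_power_diff)

section \<open>The cubical and the singular homology of the complex\<close>

context moment_angle_complex
begin

lemma openin_near: "openin X {y \<in> X_points. \<forall>i\<in>{1..m}. y i \<in> ball (z i) (1 / 4)}"
proof -
  have "continuous_map (unit_cube m) (unit_cube m) id" by simp
  then have "continuous_map (unit_cube m) euclideanreal (\<lambda>y. y i)" if "i \<in> {1..m}" for i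
    using that unfolding continuous_map_unit_cube by auto
  then have "continuous_map X euclideanreal (\<lambda>y. y i)" if "i \<in> {1..m}" for i
    unfolding X_eq using that by (intro continuous_map_from_subtopology)
  then have "openin X {y \<in> topspace X. y i \<in> ball (z i) (1 / 4)}" if "i \<in> {1..m}" for i
    using that by (intro openin_continuous_map_preimage[of X euclideanreal]) auto
  then have "openin X ((\<Inter>i\<in>{1..m}. {y \<in> topspace X. y i \<in> ball (z i) (1 / 4)}) \<inter> topspace X)"
    by (intro openin_INT) auto
  moreover have "(\<Inter>i\<in>{1..m}. {y \<in> topspace X. y i \<in> ball (z i) (1 / 4)}) \<inter> topspace X
      = {y \<in> X_points. \<forall>i\<in>{1..m}. y i \<in> ball (z i) (1 / 4)}"
    by (auto simp: topspace_X)
  ultimately show ?thesis by simp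
qed

text \<open>Radius 1/4 puts any two values of a coordinate less than 1/2 apart. If one value is at
  least 1/2 and another one below 1/2, then every value lies strictly between 0 and 1.\<close>

lemma near_small:
  assumes s: "singular_simplex n X s" and near: "s \<in> standard_simplex n \<rightarrow> {y \<in> X_points. \<forall>i\<in>{1..m}. y i \<in> ball (z i) (1 / 4)}"
  shows "s \<in> small n"
proof -
  have d: "dist (z i) (s x i) < 1 / 4" if "x \<in> standard_simplex n" "i \<in> {1..m}" for x i
    using funcset_mem[OF near that(1)] that(2) by simp
  have "0 < s x i \<and> s x i < 1"
    if i: "i \<in> round_some m n s - round_all m n s" and x: "x \<in> standard_simplex n" for i x
  proof -
    obtain y y' where "y \<in> standard_simplex n" "y' \<in> standard_simplex n" "1 / 2 \<le> s y i" "\<not> 1 / 2 \<le> s y' i" "i \<in> {1..m}"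
      using i by (auto simp: round_some_def round_all_def)
    then show ?thesis using d[of y i] d[of y' i] d[of x i] x unfolding dist_real_def by linarith
  qed
  then show ?thesis using s by (simp add: small_simplices_def)
qed

lemma eventually_small:
  assumes "singular_chain n X c"
  shows "\<exists>N. \<forall>M\<ge>N. Poly_Mapping.keys (subdivide M n c) \<subseteq> small n"
proof -
  let ?C = "(\<lambda>z. {y \<in> X_points. \<forall>i\<in>{1..m}. y i \<in> ball (z i) (1 / 4)}) ` X_points"
  have "topspace X \<subseteq> \<Union> ?C" unfolding topspace_X by fastforce
  then obtain N where N: "\<And>M f. N \<le> M \<Longrightarrow> f \<in> Poly_Mapping.keys (subdivide M n c) \<Longrightarrow> \<exists>V\<in>?C. f \<in> standard_simplex n \<rightarrow> V"
    using sufficient_iterated_singular_subdivision_exists[of ?C X n c] openin_near assms by blast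
  have "Poly_Mapping.keys (subdivide M n c) \<subseteq> small n" if "N \<le> M" for M
  proof
    fix s assume s: "s \<in> Poly_Mapping.keys (subdivide M n c)"
    then have "singular_simplex n X s"
      using singular_chain_subdivide[OF assms, of M] by (auto simp: singular_chain_def)
    then show "s \<in> small n" using N[OF that s] near_small by blast
  qed
  then show ?thesis by blast
qed

text \<open>The complex has finitely many cells, and the bound for a single cell persists for larger
  M, so one bound serves all cells of all dimensions.\<close>

lemma eventually_small_cells:
  "\<exists>N. \<forall>M\<ge>N. \<forall>n. \<forall>x\<in>cells n. Poly_Mapping.keys (subdivide M n (cube_chain m x)) \<subseteq> small n"
proof -
  interpret free_chain_map cells cube_d X_simplices sing_bd "\<lambda>_. cube_chain m" by (rule free_chain_map_cube_chain)
  let ?F = "{x. fst x \<in> K \<and> snd x \<subseteq> {1..m} - fst x}"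
  have F: "x \<in> ?F \<longleftrightarrow> x \<in> cells (card (fst x))" for x by (auto simp: cells_def)
  have "finite ?F"
  proof (rule finite_subset[of _ "Pow {1..m} \<times> Pow {1..m}"])
    show "?F \<subseteq> Pow {1..m} \<times> Pow {1..m}" using K_vertices by force
  qed simp
  moreover have ex: "\<exists>N. \<forall>M\<ge>N. Poly_Mapping.keys (subdivide M (card (fst x)) (cube_chain m x)) \<subseteq> small (card (fst x))"
    if "x \<in> ?F" for x
    using keys_\<theta>[of x "card (fst x)"] that unfolding F by (intro eventually_small) (simp add: singular_chain_def)
  moreover have "\<exists>N. \<forall>M\<ge>N. \<forall>x\<in>G. Poly_Mapping.keys (subdivide M (card (fst x)) (cube_chain m x)) \<subseteq> small (card (fst x))"
    if "finite G" "G \<subseteq> ?F" for G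
    using that
  proof (induction G rule: finite_induct)
    case (insert a G)
    then obtain N1 N2 where "\<forall>M\<ge>N1. \<forall>x\<in>G. Poly_Mapping.keys (subdivide M (card (fst x)) (cube_chain m x)) \<subseteq> small (card (fst x))"
      "\<forall>M\<ge>N2. Poly_Mapping.keys (subdivide M (card (fst a)) (cube_chain m a)) \<subseteq> small (card (fst a))"
      using ex[of a] by auto
    then show ?case by (intro exI[of _ "max N1 N2"]) simp
  qed simp
  ultimately obtain N where N: "\<forall>M\<ge>N. \<forall>x\<in>?F. Poly_Mapping.keys (subdivide M (card (fst x)) (cube_chain m x)) \<subseteq> small (card (fst x))"
    by blast
  show ?thesis
  proof (intro exI allI impI ballI)
    fix M n x assume "N \<le> M" "x \<in> cells n"
    moreover from this have "x \<in> ?F" "card (fst x) = n" by (auto simp: cells_def)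
    ultimately show "Poly_Mapping.keys (subdivide M n (cube_chain m x)) \<subseteq> small n" using N by blast
  qed
qed

text \<open>A cycle is homologous to its subdivision, whose simplices are small. Rounding by
  \<open>g\<close> and triangulating again is homotopic to the identity on small chains, so the
  subdivided cycle is homologous to the triangulation of the cubical cycle
  \<open>?a\<close>.\<close>

lemma cube_chain_surj_homology:
  assumes z: "Poly_Mapping.keys z \<subseteq> X_simplices n" "frag_extend (sing_bd n) z = 0"
  shows "\<exists>a\<in>{c. Poly_Mapping.keys c \<subseteq> cells n}. \<exists>w\<in>{c. Poly_Mapping.keys c \<subseteq> X_simplices (Suc n)}.
    frag_extend (cube_d n) a = 0 \<and> z = frag_extend (cube_chain m) a + frag_extend (sing_bd (Suc n)) w"
proof -
  interpret Q: free_chain_map cells cube_d X_simplices sing_bd "\<lambda>_. cube_chain m" by (rule free_chain_map_cube_chain)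
  interpret S: free_complex small sing_bd by (rule free_complex_small)
  obtain g where g:
    "\<And>n s. s \<in> small n \<Longrightarrow> Poly_Mapping.keys (g n s) \<subseteq> simplex_box n s n"
    "\<And>s. s \<in> small 0 \<Longrightarrow> g 0 s = frag_of ({}, round_all m 0 s)"
    "\<And>n s. s \<in> small (Suc n) \<Longrightarrow> frag_extend cube_bd (g (Suc n) s) = frag_extend (g n) (sing_bd (Suc n) s)"
    by (rule small_to_cubes) blast
  have gc: "Poly_Mapping.keys (g n s) \<subseteq> cells n" if "s \<in> small n" for n s
    using g(1)[OF that] box_cells[OF round_all_subset(2)[of m n s] small_round_K[OF that]] by blast
  have zc: "singular_chain n X z" using z by (simp add: singular_chain_def)
  obtain N where N: "Poly_Mapping.keys (subdivide N n z) \<subseteq> small n" using eventually_small[OF zc] by blast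
  let ?z = "subdivide N n z"
  have bz: "S.bd n ?z = 0"
  proof (cases n)
    case (Suc k)
    then show ?thesis
      using chain_boundary_subdivide[of k X z N] zc z(2) by (simp add: chain_boundary_eq)
  qed (simp add: S.bd_0)
  obtain h where h: "\<And>p. h p 0 = (0 :: (nat \<Rightarrow> real) chain)"
      "\<And>p X c. singular_chain p X c \<Longrightarrow> singular_chain (Suc p) X (h p c)"
      "\<And>p X c. singular_chain p X c \<Longrightarrow> chain_boundary (Suc p) (h p c) + h (p - Suc 0) (chain_boundary p c) = subdivide N p c - c"
    using chain_homotopic_iterated_singular_subdivision[of N] by metis
  have hz: "frag_extend (sing_bd (Suc n)) (h n z) = ?z - z"
    using h(3)[OF zc] z(2) by (simp add: chain_boundary_eq h(1))
  \<comment> \<open>The difference of two chain maps with the common carrier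
    \<open>star_carrier\<close>: it contains the image of \<open>s\<close> and the closed face on
    which \<open>g n s\<close> is supported.\<close>
  let ?f = "\<lambda>n s. frag_of s - frag_extend (cube_chain m) (g n s)"
  let ?Cr = "\<lambda>n s k. singular_simplex_set k (subtopology X (star_carrier m n s))"
  have "\<exists>w. Poly_Mapping.keys w \<subseteq> (\<Union>s\<in>Poly_Mapping.keys ?z. ?Cr n s (Suc n)) \<and> frag_extend (sing_bd (Suc n)) w = frag_extend (?f n) ?z"
  proof (rule S.carrier_null_homotopy[where f = ?f and Cr = ?Cr and e = sing_bd])
    fix n s assume s: "s \<in> small n"
    have ss: "singular_simplex n X s" using s by (simp add: small_simplices_def)
    note cube = simplex_in_cube[OF ss]
    have "s ` standard_simplex n \<subseteq> star_carrier m n s"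
      using cube by (auto simp: star_carrier_def)
    then have "singular_simplex n (subtopology X (star_carrier m n s)) s"
      using ss by (simp add: singular_simplex_subtopology)
    moreover have "Poly_Mapping.keys (frag_extend (cube_chain m) (g n s)) \<subseteq> ?Cr n s n"
    proof (rule keys_frag_extend_subset[OF g(1)[OF s]])
      fix x assume x: "x \<in> simplex_box n s n"
      obtain \<sigma> E where xe: "x = (\<sigma>, E)" by fastforce
      have sub: "round_all m n s \<subseteq> {1..m}" using round_all_subset[of m n s] by blast
      have "singular_chain n (subtopology (unit_cube m) (closed_cell m (round_all m n s) (round_some m n s))) (cube_chain m x)"
        using singular_chain_cube_chain[of \<sigma> "round_some m n s" "round_all m n s" E m] x sub by (auto simp: face_box_def xe)
      then have "singular_chain n (subtopology (unit_cube m) (star_carrier m n s)) (cube_chain m x)"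
        using closed_cell_subset_star_carrier[OF cube] by (rule singular_chain_mono)
      then show "Poly_Mapping.keys (cube_chain m x) \<subseteq> ?Cr n s n"
        unfolding subtopology_X[OF star_carrier_X[OF s]] singular_chain_def .
    qed
    ultimately show "Poly_Mapping.keys (?f n s) \<subseteq> ?Cr n s n"
      by (intro keys_diff_subset) simp_all
    show "\<exists>w. Poly_Mapping.keys w \<subseteq> ?Cr n s (Suc n) \<and> frag_extend (sing_bd (Suc n)) w = c"
      if c: "Poly_Mapping.keys c \<subseteq> ?Cr n s n" "frag_extend (sing_bd n) c = 0" "n = 0 \<Longrightarrow> c = ?f 0 s" for c
      unfolding subtopology_X[OF star_carrier_X[OF s]] singular_chain_def[symmetric] chain_boundary_eq[symmetric]
    proof (rule star_carrier_acyclic[OF cube])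
      show "singular_chain n (subtopology (unit_cube m) (star_carrier m n s)) c"
        using c(1) unfolding subtopology_X[OF star_carrier_X[OF s]] singular_chain_def .
      show "chain_boundary n c = 0" using c(2) by (simp add: chain_boundary_eq)
      \<comment> \<open>The chain to be filled in degree 0 is a point minus a vertex, with
        augmentation 1 - 1.\<close>
      show "pairing (\<lambda>_. 1) c = 0" if "n = 0"
        using c(3)[OF that] g(2)[of s] s that by (simp add: pairing_diff cube_chain_def)
    qed
  next
    fix n s y k assume s: "s \<in> small (Suc n)" and "y \<in> Poly_Mapping.keys (sing_bd (Suc n) s)"
    then obtain j where j: "j \<le> Suc n" "y = singular_face (Suc n) j s" using keys_sing_bd by fastforce
    then show "?Cr n y k \<subseteq> ?Cr (Suc n) s k"
      using star_carrier_face[OF j(1), of m s] singular_simplex_mono by blast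
  next
    fix n s assume s: "s \<in> small (Suc n)"
    have "frag_extend (sing_bd (Suc n)) (frag_extend (cube_chain m) (g (Suc n) s)) = frag_extend (cube_chain m) (frag_extend cube_bd (g (Suc n) s))"
      using Q.bd_\<theta>[of "g (Suc n) s" n] gc[OF s] by (simp add: cube_d_def)
    then show "frag_extend (sing_bd (Suc n)) (?f (Suc n) s) = frag_extend (?f n) (sing_bd (Suc n) s)"
      by (simp add: frag_extend_diff frag_extend_diff_fun g(3)[OF s] frag_extend_frag_extend)
  qed (use N bz in \<open>auto simp: S.d_0\<close>)
  then obtain w where w: "Poly_Mapping.keys w \<subseteq> (\<Union>s\<in>Poly_Mapping.keys ?z. ?Cr n s (Suc n))"
      "frag_extend (sing_bd (Suc n)) w = frag_extend (?f n) ?z"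
    by blast
  have wX: "Poly_Mapping.keys w \<subseteq> X_simplices (Suc n)"
    using w(1) by (auto simp: singular_simplex_subtopology)
  let ?a = "frag_extend (g n) ?z"
  have w2: "frag_extend (sing_bd (Suc n)) w = ?z - frag_extend (cube_chain m) ?a"
    using w(2) by (simp add: frag_extend_diff_fun frag_extend_frag_extend)
  have "frag_extend (cube_d n) ?a = 0"
  proof (cases n)
    case (Suc k)
    have "frag_extend (cube_d n) ?a = frag_extend (\<lambda>s. frag_extend (g k) (sing_bd n s)) ?z"
      unfolding frag_extend_frag_extend using N g(3) Suc by (intro frag_extend_cong_keys[of ?z "small n"]) (auto simp: cube_d_def)
    also have "\<dots> = frag_extend (g k) (S.bd n ?z)" by (simp add: frag_extend_frag_extend)
    finally show ?thesis using bz by simp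
  qed (simp add: cube_d_def)
  moreover have "Poly_Mapping.keys ?a \<subseteq> cells n"
    by (rule keys_frag_extend_subset[OF N gc])
  moreover have "z = frag_extend (cube_chain m) ?a + frag_extend (sing_bd (Suc n)) (w - h n z)"
    by (simp add: frag_extend_diff w2 hz)
  moreover have "Poly_Mapping.keys (w - h n z) \<subseteq> X_simplices (Suc n)"
    using wX h(2)[OF zc] by (intro keys_diff_subset) (simp_all add: singular_chain_def)
  ultimately show ?thesis by blast
qed

text \<open>Triangulating, subdividing and rounding is a chain map of cubical chains that keeps
  every cell in its own closed face; these faces are acyclic, so it is homotopic to the identity.
  Subdividing and rounding the singular filling \<open>b\<close> then gives a cubical filling of
  \<open>z\<close>, up to the correction \<open>w\<close> from the homotopy.\<close>

lemma cube_chain_inj_homology: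
  assumes z: "Poly_Mapping.keys z \<subseteq> cells n" "frag_extend (cube_d n) z = 0"
    and b: "Poly_Mapping.keys b \<subseteq> X_simplices (Suc n)" "frag_extend (cube_chain m) z = frag_extend (sing_bd (Suc n)) b"
  shows "\<exists>v\<in>{c. Poly_Mapping.keys c \<subseteq> cells (Suc n)}. frag_extend (cube_d (Suc n)) v = z"
proof -
  interpret Q: free_chain_map cells cube_d X_simplices sing_bd "\<lambda>_. cube_chain m" by (rule free_chain_map_cube_chain)
  interpret S: free_complex small sing_bd by (rule free_complex_small)
  obtain g where g:
    "\<And>n s. s \<in> small n \<Longrightarrow> Poly_Mapping.keys (g n s) \<subseteq> simplex_box n s n"
    "\<And>s. s \<in> small 0 \<Longrightarrow> g 0 s = frag_of ({}, round_all m 0 s)"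
    "\<And>n s. s \<in> small (Suc n) \<Longrightarrow> frag_extend cube_bd (g (Suc n) s) = frag_extend (g n) (sing_bd (Suc n) s)"
    by (rule small_to_cubes) blast
  have gc: "Poly_Mapping.keys (g n s) \<subseteq> cells n" if "s \<in> small n" for n s
    using g(1)[OF that] box_cells[OF round_all_subset(2)[of m n s] small_round_K[OF that]] by blast
  have bc: "singular_chain (Suc n) X b" using b by (simp add: singular_chain_def)
  obtain N1 where N1: "\<forall>M\<ge>N1. \<forall>n. \<forall>x\<in>cells n. Poly_Mapping.keys (subdivide M n (cube_chain m x)) \<subseteq> small n"
    using eventually_small_cells by blast
  obtain N2 where N2: "\<forall>M\<ge>N2. Poly_Mapping.keys (subdivide M (Suc n) b) \<subseteq> small (Suc n)"
    using eventually_small[OF bc] by blast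
  \<comment> \<open>The number of subdivisions has to be the same in all degrees and for
    \<open>b\<close>; otherwise subdivision would not commute with the boundaries.\<close>
  define N where "N = max N1 N2"
  have Nc: "Poly_Mapping.keys (subdivide N n (cube_chain m x)) \<subseteq> small n" if "x \<in> cells n" for n x
    using N1 that by (simp add: N_def)
  have Nb: "Poly_Mapping.keys (subdivide N (Suc n) b) \<subseteq> small (Suc n)" using N2 by (simp add: N_def)
  have cc: "singular_chain n X (cube_chain m x)" if "x \<in> cells n" for n x
    using Q.keys_\<theta>[OF that] by (simp add: singular_chain_def)
  have g_bd: "frag_extend cube_bd (frag_extend (g (Suc n)) c) = frag_extend (g n) (frag_extend (sing_bd (Suc n)) c)"
    if "Poly_Mapping.keys c \<subseteq> small (Suc n)" for n c
    unfolding frag_extend_frag_extend using that g(3) by (intro frag_extend_cong_keys[of c "small (Suc n)"]) auto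
  let ?f = "\<lambda>n x. frag_extend (g n) (subdivide N n (cube_chain m x)) - frag_of x"
  let ?Cr = "\<lambda>(n::nat) x k. face_box (snd x) (snd x \<union> fst x) k"
  have "\<exists>w. Poly_Mapping.keys w \<subseteq> (\<Union>x\<in>Poly_Mapping.keys z. ?Cr n x (Suc n)) \<and> frag_extend (cube_d (Suc n)) w = frag_extend (?f n) z"
  proof (rule Q.A.carrier_null_homotopy[where f = ?f and Cr = ?Cr and e = cube_d])
    fix n x assume x: "x \<in> cells n"
    obtain \<sigma> E where xe: "x = (\<sigma>, E)" by fastforce
    have E: "E \<subseteq> {1..m}" "\<sigma> \<in> K" "card \<sigma> = n" using x by (auto simp: xe cells_def)
    have "singular_chain n (subtopology X (closed_cell m E (E \<union> \<sigma>))) (subdivide N n (cube_chain m x))"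
      using singular_chain_cube_chain_X x unfolding xe by (blast intro: singular_chain_subdivide)
    then have in_cell: "s \<in> standard_simplex n \<rightarrow> closed_cell m E (E \<union> \<sigma>)"
      if "s \<in> Poly_Mapping.keys (subdivide N n (cube_chain m x))" for s
      using that unfolding singular_chain_subtopology by blast
    have "Poly_Mapping.keys (frag_extend (g n) (subdivide N n (cube_chain m x))) \<subseteq> ?Cr n x n"
    proof (rule keys_frag_extend_subset[OF order_refl])
      fix s assume s: "s \<in> Poly_Mapping.keys (subdivide N n (cube_chain m x))"
      \<comment> \<open>Subdivision does not leave the closed cell of x, where the fixed coordinates
        are exactly 0 or 1; rounding reproduces them.\<close>
      have c: "(\<forall>i\<in>E. s y i = 1) \<and> (\<forall>i\<in>{1..m} - (E \<union> \<sigma>). s y i = 0)" if "y \<in> standard_simplex n" for y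
        using funcset_mem[OF in_cell[OF s] that] by (simp add: closed_cell_def)
      have "E \<subseteq> round_all m n s" using c E by (auto simp: round_all_def)
      moreover have "round_some m n s \<subseteq> E \<union> \<sigma>" using c by (force simp: round_some_def)
      ultimately have "simplex_box n s n \<subseteq> face_box E (E \<union> \<sigma>) n" by (auto simp: face_box_def)
      then show "Poly_Mapping.keys (g n s) \<subseteq> ?Cr n x n" using g(1)[of s n] Nc[OF x] s by (auto simp: xe)
    qed
    then show "Poly_Mapping.keys (?f n x) \<subseteq> ?Cr n x n"
      using cell_box[of \<sigma> E n] x by (intro keys_diff_subset) (simp_all add: xe)
    show "\<exists>w. Poly_Mapping.keys w \<subseteq> ?Cr n x (Suc n) \<and> frag_extend (cube_d (Suc n)) w = c"
      if c: "Poly_Mapping.keys c \<subseteq> ?Cr n x n" "frag_extend (cube_d n) c = 0" "n = 0 \<Longrightarrow> c = ?f 0 x" for c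
    proof -
      have fin: "finite (E \<union> \<sigma>)" using E K_finite finite_subset by blast
      \<comment> \<open>On vertices the composite is the identity: subdivision fixes 0-chains, and
        rounding the vertex E returns E. Hence the chain to be filled in degree 0 is zero.\<close>
      have f0: "?f 0 x = 0" if n: "n = 0"
      proof -
        have [simp]: "\<sigma> = {}" using E n K_finite by auto
        have ch: "cube_chain m x = frag_of (realise m [E])" by (simp add: cube_chain_def xe)
        have sub: "subdivide N 0 (cube_chain m x) = frag_of (realise m [E])"
          using subdivide_0[OF cc[of x 0], of N] x n ch by simp
        have sm: "realise m [E] \<in> small 0" using Nc[of x 0] x n sub by simp
        have "round_all m 0 (realise m [E]) = E"
          using E by (auto simp: round_all_def realise_def standard_simplex_0)
        then show ?thesis using g(2)[OF sm] sub by (simp add: xe)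
      qed
      have "frag_extend cube_bd c = 0"
      proof (cases "n = 0")
        case True
        then show ?thesis using c(3) f0 by simp
      next
        case False
        then show ?thesis using c(2) by (simp add: cube_d_def)
      qed
      then show ?thesis
        using box_acyclic[OF fin, of E c n] c f0 by (auto simp: xe cube_d_def)
    qed
  next
    fix n x y k assume x: "x \<in> cells (Suc n)" and y: "y \<in> Poly_Mapping.keys (cube_d (Suc n) x)"
    obtain \<sigma> E where xe: "x = (\<sigma>, E)" by fastforce
    have s: "finite \<sigma>" "\<sigma> \<inter> E = {}" using x K_finite by (auto simp: xe cells_def)
    have "y \<in> {(\<sigma> - {i}, F) |i F. i \<in> \<sigma> \<and> (F = E \<or> F = insert i E)}"
      using keys_cube_bd[OF s] y by (auto simp: xe cube_d_def)
    then obtain i F where "y = (\<sigma> - {i}, F)" "i \<in> \<sigma>" "F = E \<or> F = insert i E" by blast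
    then show "?Cr n y k \<subseteq> ?Cr (Suc n) x k"
      by (auto simp: xe face_box_def)
  next
    fix n x assume x: "x \<in> cells (Suc n)"
    have "frag_extend cube_bd (frag_extend (g (Suc n)) (subdivide N (Suc n) (cube_chain m x)))
        = frag_extend (g n) (subdivide N n (frag_extend (sing_bd (Suc n)) (cube_chain m x)))"
      using g_bd[OF Nc[OF x]] chain_boundary_subdivide[OF cc[OF x], of N] by (simp add: chain_boundary_eq)
    also have "frag_extend (sing_bd (Suc n)) (cube_chain m x) = frag_extend (cube_chain m) (cube_d (Suc n) x)"
      by (rule Q.d_\<theta>[OF x])
    also have "frag_extend (g n) (subdivide N n \<dots>) = frag_extend (\<lambda>y. frag_extend (g n) (subdivide N n (cube_chain m y))) (cube_d (Suc n) x)"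
      by (simp only: subdivide_frag_extend frag_extend_frag_extend)
    finally show "frag_extend (cube_d (Suc n)) (?f (Suc n) x) = frag_extend (?f n) (cube_d (Suc n) x)"
      by (simp add: frag_extend_diff frag_extend_diff_fun cube_d_def)
  qed (use z in \<open>auto simp: cube_d_def\<close>)
  then obtain w where w: "Poly_Mapping.keys w \<subseteq> (\<Union>x\<in>Poly_Mapping.keys z. ?Cr n x (Suc n))"
      "frag_extend (cube_d (Suc n)) w = frag_extend (?f n) z"
    by blast
  have wc: "Poly_Mapping.keys w \<subseteq> cells (Suc n)"
    using w(1) z(1) cells_box_subset by fastforce
  let ?u = "frag_extend (g (Suc n)) (subdivide N (Suc n) b)"
  have "frag_extend cube_bd ?u = frag_extend (g n) (subdivide N n (frag_extend (sing_bd (Suc n)) b))"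
    using g_bd[OF Nb] chain_boundary_subdivide[OF bc, of N] by (simp add: chain_boundary_eq)
  also have "frag_extend (sing_bd (Suc n)) b = frag_extend (cube_chain m) z" using b(2) by simp
  also have "frag_extend (g n) (subdivide N n \<dots>) = frag_extend (\<lambda>y. frag_extend (g n) (subdivide N n (cube_chain m y))) z"
    by (simp only: subdivide_frag_extend frag_extend_frag_extend)
  finally have u: "frag_extend cube_bd ?u = frag_extend (\<lambda>y. frag_extend (g n) (subdivide N n (cube_chain m y))) z" .
  have "frag_extend (cube_d (Suc n)) (?u - w) = z"
    using w(2) u by (simp add: frag_extend_diff frag_extend_diff_fun cube_d_def)
  moreover have "Poly_Mapping.keys (?u - w) \<subseteq> cells (Suc n)"
    by (intro keys_diff_subset wc keys_frag_extend_subset[OF Nb gc])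
  ultimately show ?thesis by blast
qed

text \<open>Injectivity of restriction to cells on cohomology: a cocycle whose restriction is the
  coboundary of \<alpha> is a coboundary. In degree 0 the conclusion reads \<phi> = 0 on
  simplices.\<close>

lemma singular_dual_inj:
  assumes "\<And>s. s \<in> X_simplices (Suc n) \<Longrightarrow> pairing \<phi> (sing_bd (Suc n) s) = 0"
    and "\<And>x. x \<in> cells n \<Longrightarrow> pairing \<phi> (cube_chain m x) = pairing \<alpha> (cube_d n x)"
  shows "\<exists>\<beta>. \<forall>s\<in>X_simplices n. \<phi> s = pairing \<beta> (sing_bd n s)"
proof -
  interpret Q: free_chain_map cells cube_d X_simplices sing_bd "\<lambda>_. cube_chain m" by (rule free_chain_map_cube_chain)
  show ?thesis
    by (rule Q.quasi_iso_dual_inj[where \<phi> = \<phi> and \<alpha> = \<alpha>])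
       (use assms cube_chain_inj_homology cube_chain_surj_homology in auto)
qed

lemma singular_dual_surj:
  assumes "\<And>x. x \<in> cells (Suc n) \<Longrightarrow> pairing \<alpha> (cube_d (Suc n) x) = 0"
  shows "\<exists>\<beta> \<gamma>. (\<forall>s\<in>X_simplices (Suc n). pairing \<beta> (sing_bd (Suc n) s) = 0) \<and>
    (\<forall>x\<in>cells n. \<alpha> x = pairing \<beta> (cube_chain m x) + pairing \<gamma> (cube_d n x))"
proof -
  interpret Q: free_chain_map cells cube_d X_simplices sing_bd "\<lambda>_. cube_chain m" by (rule free_chain_map_cube_chain)
  show ?thesis
    by (rule Q.quasi_iso_dual_surj[where \<alpha> = \<alpha>])
       (use assms cube_chain_inj_homology cube_chain_surj_homology in auto)
qed

end

section \<open>The ring of cubical cochains\<close>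

definition cell_set :: "nat \<Rightarrow> nat set set \<Rightarrow> cell set" where
  "cell_set m K = {(\<sigma>, E). \<sigma> \<in> K \<and> E \<subseteq> {1..m} - \<sigma>}"

definition cube_cochains :: "nat \<Rightarrow> nat set set \<Rightarrow> (cell \<Rightarrow> int) set" where
  "cube_cochains m K = {a. \<forall>c. a c \<noteq> 0 \<longrightarrow> c \<in> cell_set m K}"

definition qone :: "nat \<Rightarrow> cell \<Rightarrow> int" where
  "qone m = (\<lambda>(\<sigma>, E). of_bool (\<sigma> = {} \<and> E \<subseteq> {1..m}))"

text \<open>Serre's product of cubical cochains: the front face runs from the vertex E in the
  directions S, and the back face runs in the remaining directions from the vertex E \<union> S at
  which the front face ends. The sign is that of the corresponding shuffle.\<close>

definition qmul :: "nat \<Rightarrow> nat set set \<Rightarrow> (cell \<Rightarrow> int) \<Rightarrow> (cell \<Rightarrow> int) \<Rightarrow> cell \<Rightarrow> int" where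
  "qmul m K a b = (\<lambda>(\<sigma>, E). if (\<sigma>, E) \<in> cell_set m K
     then \<Sum>S\<in>Pow \<sigma>. sg2 S (\<sigma> - S) * (a (S, E) * b (\<sigma> - S, E \<union> S)) else 0)"

definition qd :: "nat \<Rightarrow> nat set set \<Rightarrow> (cell \<Rightarrow> int) \<Rightarrow> cell \<Rightarrow> int" where
  "qd m K a = (\<lambda>c. if c \<in> cell_set m K then pairing a (cube_bd c) else 0)"

text \<open>Left multiplication by the cochain that represents a generator.\<close>

fun act :: "nat \<Rightarrow> nat set set \<Rightarrow> gen \<Rightarrow> (cell \<Rightarrow> int) \<Rightarrow> cell \<Rightarrow> int" where
  "act m K (U i) a = (\<lambda>(\<sigma>, E). if (\<sigma>, E) \<in> cell_set m K \<and> i \<in> \<sigma> then sg i \<sigma> * a (\<sigma> - {i}, insert i E) else 0)"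
| "act m K (T i) a = (\<lambda>(\<sigma>, E). if i \<in> E then a (\<sigma>, E) else 0)"

text \<open>A word is evaluated by successive left multiplications, so that its properties follow by
  induction on the word, from properties of a single generator.\<close>

definition ev_word :: "nat \<Rightarrow> nat set set \<Rightarrow> gen list \<Rightarrow> cell \<Rightarrow> int" where
  "ev_word m K w = foldr (act m K) w (qone m)"

definition ev :: "nat \<Rightarrow> nat set set \<Rightarrow> (gen list \<Rightarrow>\<^sub>0 int) \<Rightarrow> cell \<Rightarrow> int" where
  "ev m K a = (\<lambda>c. pairing (\<lambda>w. ev_word m K w c) a)"

lemma ev_of [simp]: "ev m K (frag_of w) = ev_word m K w"
  by (simp add: ev_def)

lemma ev_0 [simp]: "ev m K 0 = (\<lambda>_. 0)"
  by (simp add: ev_def)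

lemma ev_add: "ev m K (a + b) = (\<lambda>c. ev m K a c + ev m K b c)"
  by (simp add: ev_def pairing_add)

lemma ev_diff: "ev m K (a - b) = (\<lambda>c. ev m K a c - ev m K b c)"
  by (simp add: ev_def pairing_diff)

lemma ev_cmul: "ev m K (frag_cmul k a) = (\<lambda>c. k * ev m K a c)"
  by (simp add: ev_def pairing_cmul)

lemma ev_sum: "ev m K (sum f I) = (\<lambda>c. \<Sum>i\<in>I. ev m K (f i) c)"
  by (simp add: ev_def pairing_sum)

lemma ev_word_Nil [simp]: "ev_word m K [] = qone m"
  by (simp add: ev_word_def)

lemma ev_word_Cons [simp]: "ev_word m K (x # w) = act m K x (ev_word m K w)"
  by (simp add: ev_word_def)

lemma pairing_sum_fun: "finite I \<Longrightarrow> pairing (\<lambda>x. \<Sum>i\<in>I. f i x) c = (\<Sum>i\<in>I. pairing (f i) c)"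
  by (induction I rule: finite_induct) (simp_all add: pairing_add_fun)

lemma pairing_eq_0: "(\<And>x. x \<in> Poly_Mapping.keys c \<Longrightarrow> f x = 0) \<Longrightarrow> pairing f c = 0"
  by (simp add: pairing_def)

lemma pairing_cube_bd:
  "pairing a (cube_bd (\<sigma>, E)) = (\<Sum>i\<in>\<sigma>. sg i \<sigma> * (a (\<sigma> - {i}, insert i E) - a (\<sigma> - {i}, E)))"
  by (simp add: cube_bd_def pairing_sum pairing_cmul pairing_diff)

section \<open>Evaluation as a map of differential graded rings\<close>

context moment_angle_complex
begin

abbreviation Q where "Q \<equiv> cube_cochains m K"

lemma cell_set_iff: "(\<sigma>, E) \<in> cell_set m K \<longleftrightarrow> \<sigma> \<in> K \<and> E \<subseteq> {1..m} - \<sigma>"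
  by (simp add: cell_set_def)

lemma cell_finite: "(\<sigma>, E) \<in> cell_set m K \<Longrightarrow> finite \<sigma> \<and> finite E"
  unfolding cell_set_iff using K_finite by (meson finite_Diff finite_atLeastAtMost finite_subset)

lemma cell_set_cells: "(\<sigma>, E) \<in> cell_set m K \<longleftrightarrow> (\<sigma>, E) \<in> cells (card \<sigma>)"
  by (auto simp: cell_set_def cells_def)

lemma cell_front: "(\<sigma>, E) \<in> cell_set m K \<Longrightarrow> S \<subseteq> \<sigma> \<Longrightarrow> (S, E) \<in> cell_set m K"
  unfolding cell_set_iff using K_down by blast

lemma cell_back:
  assumes "(\<sigma>, E) \<in> cell_set m K" "S \<subseteq> \<sigma>"
  shows "(\<sigma> - S, E \<union> S) \<in> cell_set m K"
proof -
  have "\<sigma> \<in> K" "\<sigma> \<subseteq> {1..m}" "E \<subseteq> {1..m} - \<sigma>" using assms K_vertices by (auto simp: cell_set_iff)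
  moreover have "\<sigma> - S \<in> K" by (rule K_down[OF \<open>\<sigma> \<in> K\<close>]) blast
  ultimately show ?thesis unfolding cell_set_iff using assms(2) by blast
qed

lemma cell_back1: "(\<sigma>, E) \<in> cell_set m K \<Longrightarrow> i \<in> \<sigma> \<Longrightarrow> (\<sigma> - {i}, insert i E) \<in> cell_set m K"
  using cell_back[of \<sigma> E "{i}"] by simp

lemma cell_front1: "(\<sigma>, E) \<in> cell_set m K \<Longrightarrow> (\<sigma> - {i}, E) \<in> cell_set m K"
  using cell_front[of \<sigma> E "\<sigma> - {i}"] by blast

lemma Q_outside: "a \<in> Q \<Longrightarrow> c \<notin> cell_set m K \<Longrightarrow> a c = 0"
  unfolding cube_cochains_def by blast

lemma qone_Q: "qone m \<in> Q"
  using K_empty by (auto simp: cube_cochains_def qone_def cell_set_def)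

lemma act_Q: "a \<in> Q \<Longrightarrow> act m K x a \<in> Q"
  by (cases x) (auto simp: cube_cochains_def split: if_splits)

lemma ev_word_Q: "ev_word m K w \<in> Q"
  by (induction w) (simp_all add: qone_Q act_Q)

lemma ev_Q: "ev m K a \<in> Q"
  unfolding cube_cochains_def ev_def
proof (clarify, rule ccontr)
  fix \<sigma> E assume "pairing (\<lambda>w. ev_word m K w (\<sigma>, E)) a \<noteq> 0" "(\<sigma>, E) \<notin> cell_set m K"
  then show False using Q_outside[OF ev_word_Q] by (simp add: pairing_def)
qed

lemma qmul_Q: "qmul m K a b \<in> Q"
  by (auto simp: cube_cochains_def qmul_def)

lemma qd_Q: "qd m K a \<in> Q"
  by (auto simp: cube_cochains_def qd_def)

lemma sg2_empty [simp]: "sg2 {} V = 1" "sg2 S {} = 1"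
  by (simp_all add: sg2_def sg_def)

lemma qmul_one_left: assumes "b \<in> Q" shows "qmul m K (qone m) b = b"
proof (rule ext, clarify)
  fix \<sigma> E
  show "qmul m K (qone m) b (\<sigma>, E) = b (\<sigma>, E)"
  proof (cases "(\<sigma>, E) \<in> cell_set m K")
    case True
    then have "(\<Sum>S\<in>Pow \<sigma>. sg2 S (\<sigma> - S) * (qone m (S, E) * b (\<sigma> - S, E \<union> S))) = (\<Sum>S\<in>Pow \<sigma>. if S = {} then b (\<sigma>, E) else 0)"
      by (intro sum.cong) (auto simp: qone_def cell_set_iff)
    then show ?thesis using True cell_finite by (simp add: qmul_def)
  qed (use Q_outside[OF assms] in \<open>simp add: qmul_def\<close>)
qed

text \<open>Associativity with a generator as the left factor, which is what
  \<open>ev_word_append\<close> requires. For u_i only subsets S containing i contribute; they are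
  written as \<open>insert i S\<close>, and \<open>sg2_shuffle\<close> compares the signs.\<close>

lemma act_qmul: "act m K x (qmul m K a b) = qmul m K (act m K x a) b"
proof (rule ext, clarify)
  fix \<sigma> E
  show "act m K x (qmul m K a b) (\<sigma>, E) = qmul m K (act m K x a) b (\<sigma>, E)"
  proof (cases "(\<sigma>, E) \<in> cell_set m K")
    case c: True
    have fin: "finite \<sigma>" using cell_finite c by blast
    show ?thesis
    proof (cases x)
      case (U i)
      let ?t = "\<lambda>S. sg2 S (\<sigma> - S) * (act m K (U i) a (S, E) * b (\<sigma> - S, E \<union> S))"
      show ?thesis
      proof (cases "i \<in> \<sigma>")
        case True
        have "qmul m K (act m K x a) b (\<sigma>, E) = (\<Sum>S\<in>Pow \<sigma>. ?t S)"
          using c U by (simp add: qmul_def)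
        also have "\<dots> = (\<Sum>S\<in>insert i ` Pow (\<sigma> - {i}). ?t S)"
        proof (rule sum.mono_neutral_right)
          show "\<forall>S\<in>Pow \<sigma> - insert i ` Pow (\<sigma> - {i}). ?t S = 0"
          proof
            fix S assume S: "S \<in> Pow \<sigma> - insert i ` Pow (\<sigma> - {i})"
            have "i \<notin> S"
            proof
              assume "i \<in> S"
              then have "S = insert i (S - {i})" "S - {i} \<in> Pow (\<sigma> - {i})" using S by auto
              then show False using S by blast
            qed
            then show "?t S = 0" by simp
          qed
        qed (use fin True in auto)
        also have "\<dots> = (\<Sum>S\<in>Pow (\<sigma> - {i}). ?t (insert i S))"
          by (subst sum.reindex) (auto simp: inj_on_def)
        also have "\<dots> = (\<Sum>S\<in>Pow (\<sigma> - {i}). sg i \<sigma> * (sg2 S (\<sigma> - {i} - S) * (a (S, insert i E) * b (\<sigma> - {i} - S, insert i E \<union> S))))"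
        proof (rule sum.cong[OF refl])
          fix S assume S: "S \<in> Pow (\<sigma> - {i})"
          then have e: "insert i S - {i} = S" "\<sigma> - insert i S = \<sigma> - {i} - S" "E \<union> insert i S = insert i E \<union> S" by auto
          have iS: "insert i S \<subseteq> \<sigma>" using S True by auto
          have cS: "(insert i S, E) \<in> cell_set m K" using cell_front[OF c iS] .
          have "sg2 (insert i S) (\<sigma> - {i} - S) * sg i (insert i S) = sg i \<sigma> * sg2 S (\<sigma> - {i} - S)"
            using sg2_shuffle[OF fin iS, of i] unfolding e by simp
          then show "?t (insert i S) = sg i \<sigma> * (sg2 S (\<sigma> - {i} - S) * (a (S, insert i E) * b (\<sigma> - {i} - S, insert i E \<union> S)))"
            using cS unfolding e by (simp add: e mult.assoc[symmetric])
        qed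
        also have "\<dots> = sg i \<sigma> * qmul m K a b (\<sigma> - {i}, insert i E)"
          using cell_back1[OF c True] by (simp add: qmul_def sum_distrib_left)
        finally show ?thesis using c U True by simp
      next
        case False
        then have "?t S = 0" if "S \<in> Pow \<sigma>" for S using that by auto
        then have "(\<Sum>S\<in>Pow \<sigma>. ?t S) = 0" by (intro sum.neutral) blast
        then show ?thesis using c U False by (simp add: qmul_def)
      qed
    next
      case (T i)
      then show ?thesis using c by (auto simp: qmul_def)
    qed
  qed (cases x; simp add: qmul_def)
qed

lemma ev_word_append: "ev_word m K (v @ w) = qmul m K (ev_word m K v) (ev_word m K w)"
  by (induction v) (simp_all add: qmul_one_left ev_word_Q act_qmul)

lemma ev_mult: "ev m K (free_mult a b) = qmul m K (ev m K a) (ev m K b)"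
proof (rule ext, clarify)
  fix \<sigma> E
  show "ev m K (free_mult a b) (\<sigma>, E) = qmul m K (ev m K a) (ev m K b) (\<sigma>, E)"
  proof (cases "(\<sigma>, E) \<in> cell_set m K")
    case True
    then have fin: "finite (Pow \<sigma>)" using cell_finite by auto
    have "ev m K (free_mult a b) (\<sigma>, E) = pairing (\<lambda>v. pairing (\<lambda>w. ev_word m K (v @ w) (\<sigma>, E)) b) a"
      by (simp add: ev_def free_mult_def pairing_frag_extend)
    also have "\<dots> = pairing (\<lambda>v. pairing (\<lambda>w. \<Sum>S\<in>Pow \<sigma>. (sg2 S (\<sigma> - S) * ev_word m K v (S, E)) * ev_word m K w (\<sigma> - S, E \<union> S)) b) a"
      using True by (simp add: ev_word_append qmul_def mult.assoc)
    also have "\<dots> = (\<Sum>S\<in>Pow \<sigma>. pairing (\<lambda>v. (sg2 S (\<sigma> - S) * ev_word m K v (S, E)) * pairing (\<lambda>w. ev_word m K w (\<sigma> - S, E \<union> S)) b) a)"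
      by (simp only: pairing_sum_fun[OF fin] pairing_cmul_fun)
    also have "\<dots> = (\<Sum>S\<in>Pow \<sigma>. sg2 S (\<sigma> - S) * (ev m K a (S, E) * ev m K b (\<sigma> - S, E \<union> S)))"
    proof (rule sum.cong[OF refl])
      fix S
      show "pairing (\<lambda>v. (sg2 S (\<sigma> - S) * ev_word m K v (S, E)) * pairing (\<lambda>w. ev_word m K w (\<sigma> - S, E \<union> S)) b) a
          = sg2 S (\<sigma> - S) * (ev m K a (S, E) * ev m K b (\<sigma> - S, E \<union> S))"
        using pairing_cmul_fun[of "sg2 S (\<sigma> - S) * pairing (\<lambda>w. ev_word m K w (\<sigma> - S, E \<union> S)) b" "\<lambda>v. ev_word m K v (S, E)" a]
        by (simp add: ev_def ac_simps)
    qed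
    finally show ?thesis using True by (simp add: qmul_def)
  qed (use Q_outside[OF ev_Q] Q_outside[OF qmul_Q] in simp)
qed

lemma qmul_zero: "qmul m K (\<lambda>_. 0) b = (\<lambda>_. 0)" "qmul m K a (\<lambda>_. 0) = (\<lambda>_. 0)"
  by (auto simp: qmul_def)

text \<open>The Leibniz rule for t_i as the left factor. If x_i = 1 on the cell, the same holds on
  all its faces; otherwise the only face in x_i = 1 is the upper face in direction i, which produces
  the term with u_i.\<close>

lemma qd_act_T: "qd m K (act m K (T i) a) = (\<lambda>c. act m K (U i) a c + act m K (T i) (qd m K a) c)"
proof (rule ext, clarify)
  fix \<sigma> E
  show "qd m K (act m K (T i) a) (\<sigma>, E) = act m K (U i) a (\<sigma>, E) + act m K (T i) (qd m K a) (\<sigma>, E)"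
  proof (cases "(\<sigma>, E) \<in> cell_set m K")
    case c: True
    then have fin: "finite \<sigma>" and disj: "\<sigma> \<inter> E = {}" using cell_finite by (auto simp: cell_set_iff)
    show ?thesis
    proof (cases "i \<in> E")
      case True
      then have "i \<notin> \<sigma>" using disj by auto
      then show ?thesis using c True by (simp add: qd_def pairing_cube_bd)
    next
      case False
      have "pairing (act m K (T i) a) (cube_bd (\<sigma>, E)) = (\<Sum>j\<in>\<sigma>. if j = i then sg i \<sigma> * a (\<sigma> - {i}, insert i E) else 0)"
        unfolding pairing_cube_bd using False by (intro sum.cong) auto
      then show ?thesis using c False fin by (simp add: qd_def)
    qed
  qed (simp add: qd_def)
qed

text \<open>The Leibniz rule for u_i as the left factor. The faces in direction i drop out, since i
  is no longer free on them, and for the other directions the order of removing i and j is exchanged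
  at the cost of a sign.\<close>

lemma qd_act_U: "qd m K (act m K (U i) a) = (\<lambda>c. - act m K (U i) (qd m K a) c)"
proof (rule ext, clarify)
  fix \<sigma> E
  show "qd m K (act m K (U i) a) (\<sigma>, E) = - act m K (U i) (qd m K a) (\<sigma>, E)"
  proof (cases "(\<sigma>, E) \<in> cell_set m K")
    case c: True
    then have fin: "finite \<sigma>" using cell_finite by auto
    show ?thesis
    proof (cases "i \<in> \<sigma>")
      case True
      let ?r = "\<lambda>j. a (\<sigma> - {i} - {j}, insert j (insert i E)) - a (\<sigma> - {i} - {j}, insert i E)"
      have "pairing (act m K (U i) a) (cube_bd (\<sigma>, E))
          = (\<Sum>j\<in>insert i (\<sigma> - {i}). sg j \<sigma> * (act m K (U i) a (\<sigma> - {j}, insert j E) - act m K (U i) a (\<sigma> - {j}, E)))"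
        unfolding pairing_cube_bd using True by (simp add: insert_absorb)
      also have "\<dots> = (\<Sum>j\<in>\<sigma> - {i}. sg j \<sigma> * (act m K (U i) a (\<sigma> - {j}, insert j E) - act m K (U i) a (\<sigma> - {j}, E)))"
        using fin by (subst sum.insert) auto
      also have "\<dots> = (\<Sum>j\<in>\<sigma> - {i}. - (sg i \<sigma> * (sg j (\<sigma> - {i}) * ?r j)))"
      proof (rule sum.cong[OF refl])
        fix j assume j: "j \<in> \<sigma> - {i}"
        have e: "\<sigma> - {j} - {i} = \<sigma> - {i} - {j}" "insert i (insert j E) = insert j (insert i E)" by auto
        have "sg j \<sigma> * sg i (\<sigma> - {j}) = - (sg i \<sigma> * sg j (\<sigma> - {i}))"
          using sg_antisym[OF fin, of j i] j True by auto
        moreover have "(\<sigma> - {j}, insert j E) \<in> cell_set m K" "(\<sigma> - {j}, E) \<in> cell_set m K" "i \<in> \<sigma> - {j}"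
          using cell_back1[OF c] cell_front1[OF c] j True by auto
        ultimately show "sg j \<sigma> * (act m K (U i) a (\<sigma> - {j}, insert j E) - act m K (U i) a (\<sigma> - {j}, E))
            = - (sg i \<sigma> * (sg j (\<sigma> - {i}) * ?r j))"
          by (simp add: e right_diff_distrib mult.assoc[symmetric])
      qed
      also have "\<dots> = - (sg i \<sigma> * pairing a (cube_bd (\<sigma> - {i}, insert i E)))"
        by (simp only: sum_negf sum_distrib_left[symmetric] pairing_cube_bd)
      finally show ?thesis using c True cell_back1[OF c True] by (simp add: qd_def)
    next
      case False
      then show ?thesis using c by (simp add: qd_def pairing_cube_bd)
    qed
  qed (simp add: qd_def)
qed

lemma qd_one: "qd m K (qone m) = (\<lambda>_. 0)"
proof (rule ext, clarify)
  fix \<sigma> E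
  show "qd m K (qone m) (\<sigma>, E) = 0"
  proof (cases "(\<sigma>, E) \<in> cell_set m K")
    case True
    then have "\<sigma> \<subseteq> {1..m}" using K_vertices by (auto simp: cell_set_iff)
    with True show ?thesis
      by (auto simp: qd_def pairing_cube_bd qone_def cell_set_iff intro!: sum.neutral)
  qed (simp add: qd_def)
qed

lemma qd_linear:
  "qd m K (\<lambda>c. a c + b c) = (\<lambda>c. qd m K a c + qd m K b c)"
  "qd m K (\<lambda>c. k * a c) = (\<lambda>c. k * qd m K a c)"
  by (auto simp: qd_def pairing_add_fun pairing_cmul_fun)

lemma ev_word_single: "b \<in> Q \<Longrightarrow> qmul m K (act m K x (qone m)) b = act m K x b"
  by (simp add: qmul_one_left flip: act_qmul)

text \<open>The recursion of \<open>diff_word\<close> is the Leibniz rule for a generator times a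
  word, and \<open>qd\<close> satisfies the same rule.\<close>

lemma ev_diff_word: "ev m K (diff_word w) = qd m K (ev_word m K w)"
proof (induction w)
  case Nil
  then show ?case by (simp add: qd_one)
next
  case (Cons x w)
  show ?case
  proof (cases x)
    case (U i)
    then show ?thesis
      using Cons by (simp add: ev_diff ev_mult ev_word_single qd_Q qd_act_U qmul_zero del: act.simps)
  next
    case (T i)
    then show ?thesis
      using Cons by (simp add: ev_add ev_mult ev_word_single qd_Q ev_word_Q qd_act_T qmul_zero del: act.simps)
  qed
qed

lemma ev_diff_free: "ev m K (diff_free a) = qd m K (ev m K a)"
proof -
  have "qd m K (ev m K a) c = pairing (\<lambda>w. qd m K (ev_word m K w) c) a" for c
  proof -
    obtain \<sigma> E where c: "c = (\<sigma>, E)" by fastforce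
    show ?thesis
    proof (cases "c \<in> cell_set m K")
      case True
      then have "finite \<sigma>" using cell_finite c by blast
      then show ?thesis
        using True unfolding c
        by (simp add: qd_def pairing_cube_bd ev_def pairing_sum_fun pairing_cmul_fun pairing_diff_fun)
    qed (simp add: qd_def)
  qed
  moreover have "ev m K (diff_free a) c = pairing (\<lambda>w. ev m K (diff_word w) c) a" for c
    by (simp add: ev_def diff_free_def pairing_frag_extend)
  ultimately show ?thesis
    by (intro ext) (simp add: ev_diff_word)
qed

text \<open>The asymmetric relations reflect the asymmetry of the Serre product: an edge in
  direction i ends at x_i = 1, where t_i is 1, so u_i t_i = u_i; it starts at x_i = 0, where t_i is
  0, so t_i u_i = 0.\<close>

lemma ev_word_relations:
  shows "ev_word m K [U i, T i] = ev_word m K [U i]" "ev_word m K [T i, U i] = (\<lambda>_. 0)"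
    "ev_word m K [T i, T i] = ev_word m K [T i]" "ev_word m K [U i, U i] = (\<lambda>_. 0)"
    "i \<noteq> j \<Longrightarrow> ev_word m K [U i, T j] = ev_word m K [T j, U i]"
    "i \<noteq> j \<Longrightarrow> ev_word m K [U i, U j] = (\<lambda>c. - ev_word m K [U j, U i] c)"
    "ev_word m K [T i, T j] = ev_word m K [T j, T i]"
proof -
  show "ev_word m K [U i, T i] = ev_word m K [U i]" "ev_word m K [T i, T i] = ev_word m K [T i]"
    "ev_word m K [T i, T j] = ev_word m K [T j, T i]" "ev_word m K [U i, U i] = (\<lambda>_. 0)"
    by (auto simp: fun_eq_iff)
  show "ev_word m K [T i, U i] = (\<lambda>_. 0)"
    by (auto simp: fun_eq_iff cell_set_iff)
  show "i \<noteq> j \<Longrightarrow> ev_word m K [U i, T j] = ev_word m K [T j, U i]"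
    by (auto simp: fun_eq_iff)
  assume ij: "i \<noteq> j"
  show "ev_word m K [U i, U j] = (\<lambda>c. - ev_word m K [U j, U i] c)"
  proof (rule ext, clarify)
    fix \<sigma> E
    have e: "\<sigma> - {j} - {i} = \<sigma> - {i} - {j}" "insert i (insert j E) = insert j (insert i E)" by auto
    show "ev_word m K [U i, U j] (\<sigma>, E) = - ev_word m K [U j, U i] (\<sigma>, E)"
    proof (cases "(\<sigma>, E) \<in> cell_set m K \<and> i \<in> \<sigma> \<and> j \<in> \<sigma>")
      case True
      then have "sg i \<sigma> * sg j (\<sigma> - {i}) = - (sg j \<sigma> * sg i (\<sigma> - {j}))"
        using sg_antisym ij cell_finite by blast
      moreover have "(\<sigma> - {i}, insert i E) \<in> cell_set m K" "(\<sigma> - {j}, insert j E) \<in> cell_set m K" "i \<in> \<sigma> - {j}" "j \<in> \<sigma> - {i}"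
        using True cell_back1 ij by auto
      ultimately show ?thesis using True by (simp only: ev_word_Cons act.simps case_prod_conv e simp_thms if_True) (simp add: mult.assoc[symmetric])
    qed auto
  qed
qed

lemma ev_relations:
  assumes "r \<in> relations m"
  shows "ev m K r = (\<lambda>_. 0)"
proof -
  have 1: "ev m K r = (\<lambda>_. 0)" if "r \<in> {frag_of [U i, T i] - frag_of [U i], frag_of [T i, U i],
      frag_of [T i, T i] - frag_of [T i], frag_of [U i, U i]}" for i
    using that
  proof (elim insertE emptyE)
    assume "r = frag_of [U i, T i] - frag_of [U i]"
    then show ?thesis by (simp only: ev_diff ev_of ev_word_relations(1)) simp
  next
    assume "r = frag_of [T i, U i]"
    then show ?thesis by (simp only: ev_of ev_word_relations(2))
  next
    assume "r = frag_of [T i, T i] - frag_of [T i]"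
    then show ?thesis by (simp only: ev_diff ev_of ev_word_relations(3)) simp
  next
    assume "r = frag_of [U i, U i]"
    then show ?thesis by (simp only: ev_of ev_word_relations(4))
  qed
  have 2: "ev m K r = (\<lambda>_. 0)" if "j \<in> {1..m} - {i}" "r \<in> {frag_of [U i, T j] - frag_of [T j, U i],
      frag_of [U i, U j] + frag_of [U j, U i], frag_of [T i, T j] - frag_of [T j, T i]}" for i j
    using that(2)
  proof (elim insertE emptyE)
    have ij: "i \<noteq> j" using that(1) by auto
    {
      assume "r = frag_of [U i, T j] - frag_of [T j, U i]"
      then show ?thesis by (simp only: ev_diff ev_of ev_word_relations(5)[OF ij]) simp
    next
      assume "r = frag_of [U i, U j] + frag_of [U j, U i]"
      then show ?thesis by (simp only: ev_add ev_of ev_word_relations(6)[OF ij]) simp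
    next
      assume "r = frag_of [T i, T j] - frag_of [T j, T i]"
      then show ?thesis by (simp only: ev_diff ev_of ev_word_relations(7)[of i j]) simp
    }
  qed
  from assms show ?thesis
    unfolding relations_def Un_iff UN_iff by (elim disjE bexE) (erule 1, erule 2)
qed

end

section \<open>Normal forms in the free algebra\<close>

lemma free_mult_add_left: "free_mult (a + b) c = free_mult a c + free_mult b c"
  by (simp add: free_mult_def frag_extend_add)

lemma free_mult_add_right: "free_mult c (a + b) = free_mult c a + free_mult c b"
  by (simp add: free_mult_def frag_extend_add frag_extend_add_fun)

lemma free_mult_of [simp]: "free_mult (frag_of v) (frag_of w) = frag_of (v @ w)"
  by (simp add: free_mult_def)

lemma free_mult_zero [simp]: "free_mult a 0 = 0"
  by (simp add: free_mult_def)

lemma free_mult_assoc: "free_mult (free_mult a b) c = free_mult a (free_mult b c)"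
  by (simp add: free_mult_def frag_extend_frag_extend)

lemma free_mult_one [simp]: "free_mult (frag_of []) a = a" "free_mult a (frag_of []) = a"
  by (simp_all add: free_mult_def)

lemma free_mult_cmul:
  "free_mult (frag_cmul k a) b = frag_cmul k (free_mult a b)"
  "free_mult a (frag_cmul k b) = frag_cmul k (free_mult a b)"
proof -
  show "free_mult (frag_cmul k a) b = frag_cmul k (free_mult a b)"
    by (simp add: free_mult_def frag_extend_cmul)
  have "frag_extend (\<lambda>v. frag_cmul k (f v)) a = frag_cmul k (frag_extend f a)" for f :: "'a list \<Rightarrow> 'a list \<Rightarrow>\<^sub>0 int"
    using subset_UNIV
    by (induction a rule: frag_induction) (auto simp: frag_extend_diff frag_cmul_diff_distrib2)
  then show "free_mult a (frag_cmul k b) = frag_cmul k (free_mult a b)"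
    by (simp add: free_mult_def frag_extend_cmul)
qed

lemma free_mult_diff:
  "free_mult (a - b) c = free_mult a c - free_mult b c"
  "free_mult c (a - b) = free_mult c a - free_mult c b"
  by (simp_all add: free_mult_def frag_extend_diff frag_extend_diff_fun)

lemma keys_free_mult:
  assumes "Poly_Mapping.keys a \<subseteq> lists S" "Poly_Mapping.keys b \<subseteq> lists S"
  shows "Poly_Mapping.keys (free_mult a b) \<subseteq> lists S"
  unfolding free_mult_def
  by (rule keys_frag_extend_subset[OF assms(1)], rule keys_frag_extend_subset[OF assms(2)]) auto

lemma free_algebra_simps [simp]:
  "carrier (free_algebra S) = {a. Poly_Mapping.keys a \<subseteq> lists S}"
  "monoid.mult (free_algebra S) = free_mult" "\<one>\<^bsub>free_algebra S\<^esub> = frag_of []"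
  "\<zero>\<^bsub>free_algebra S\<^esub> = 0" "add (free_algebra S) = (+)"
  by (simp_all add: free_algebra_def)

lemma ring_free_algebra: "ring (free_algebra S)"
proof (rule ringI)
  show "abelian_group (free_algebra S)"
  proof (rule abelian_groupI)
    fix a assume "a \<in> carrier (free_algebra S)"
    then show "\<exists>b\<in>carrier (free_algebra S). b \<oplus>\<^bsub>free_algebra S\<^esub> a = \<zero>\<^bsub>free_algebra S\<^esub>"
      by (intro bexI[of _ "- a"]) auto
  next
    fix a b assume "a \<in> carrier (free_algebra S)" "b \<in> carrier (free_algebra S)"
    then show "a \<oplus>\<^bsub>free_algebra S\<^esub> b \<in> carrier (free_algebra S)" by (simp add: keys_add_subset)
  qed (simp_all add: add.assoc add.commute)
  show "Group.monoid (free_algebra S)"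
    by (rule Group.monoidI) (simp_all add: free_mult_assoc keys_free_mult)
qed (auto simp: free_mult_add_left free_mult_add_right)

lemma minus_free_algebra:
  assumes "a \<in> carrier (free_algebra S)"
  shows "\<ominus>\<^bsub>free_algebra S\<^esub> a = - a"
proof -
  interpret ring "free_algebra S" by (rule ring_free_algebra)
  show ?thesis using assms by (intro minus_equality) auto
qed

lemma diff_free_algebra:
  "a \<in> carrier (free_algebra S) \<Longrightarrow> b \<in> carrier (free_algebra S) \<Longrightarrow> a \<ominus>\<^bsub>free_algebra S\<^esub> b = a - b"
  by (simp add: a_minus_def minus_free_algebra)

text \<open>The scalar covers all three effects of rewriting: 1 for plain equality, -1 for the
  exchange of two letters u, and 0 for a word in the ideal, in which case the right-hand word is
  arbitrary.\<close>

definition word_cong :: "nat \<Rightarrow> gen list \<Rightarrow> int \<Rightarrow> gen list \<Rightarrow> bool" where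
  "word_cong m v k w \<longleftrightarrow> frag_of v - frag_cmul k (frag_of w) \<in> relation_ideal m"

lemma relations_carrier: "relations m \<subseteq> carrier (free_algebra (gens m))"
proof
  have l: "[U i, T j] \<in> lists (gens m)" "[T i, U j] \<in> lists (gens m)" "[U i, U j] \<in> lists (gens m)" "[T i, T j] \<in> lists (gens m)"
     "[U i] \<in> lists (gens m)" "[T i] \<in> lists (gens m)"
    if "i \<in> {1..m}" "j \<in> {1..m}" for i j
    using that by (auto simp: gens_def)
  have d: "frag_of v - frag_of w \<in> carrier (free_algebra (gens m))" "frag_of v + frag_of w \<in> carrier (free_algebra (gens m))"
    if "v \<in> lists (gens m)" "w \<in> lists (gens m)" for v w
    using that keys_diff_subset[of "frag_of v" "lists (gens m)" "frag_of w"] keys_add_subset[of "frag_of v" "lists (gens m)" "frag_of w"]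
    by auto
  have d': "frag_of v \<in> carrier (free_algebra (gens m))" if "v \<in> lists (gens m)" for v
    using that by simp
  fix r assume "r \<in> relations m"
  then show "r \<in> carrier (free_algebra (gens m))"
    unfolding relations_def Un_iff UN_iff
  proof (elim disjE bexE)
    fix i assume i: "i \<in> {1..m}" and "r \<in> {frag_of [U i, T i] - frag_of [U i], frag_of [T i, U i], frag_of [T i, T i] - frag_of [T i], frag_of [U i, U i]}"
    then show ?thesis by (elim insertE emptyE) (simp_all only: d d' l[OF i i])
  next
    fix i j assume i: "i \<in> {1..m}" "j \<in> {1..m} - {i}" and r: "r \<in> {frag_of [U i, T j] - frag_of [T j, U i],
        frag_of [U i, U j] + frag_of [U j, U i], frag_of [T i, T j] - frag_of [T j, T i]}"
    then have j: "j \<in> {1..m}" by blast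
    show ?thesis using r by (elim insertE emptyE) (simp_all only: d l[OF i(1) j] l[OF j i(1)])
  qed
qed

lemma ideal_relation_ideal: "ideal (relation_ideal m) (free_algebra (gens m))"
  unfolding relation_ideal_def by (rule ring.genideal_ideal[OF ring_free_algebra relations_carrier])

lemma relations_in_ideal: "relations m \<subseteq> relation_ideal m"
  unfolding relation_ideal_def by (rule ring.genideal_self[OF ring_free_algebra relations_carrier])

section \<open>Rewriting words modulo the relations\<close>

context
  fixes m :: nat
begin

interpretation I: ideal "relation_ideal m" "free_algebra (gens m)"
  by (rule ideal_relation_ideal)

lemma ideal_zero: "0 \<in> relation_ideal m"
  using additive_subgroup.zero_closed[OF I.additive_subgroup_axioms] by simp

lemma ideal_add: "a \<in> relation_ideal m \<Longrightarrow> b \<in> relation_ideal m \<Longrightarrow> a + b \<in> relation_ideal m"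
  using additive_subgroup.a_closed[OF I.additive_subgroup_axioms, of a b] by simp

lemma ideal_uminus: "a \<in> relation_ideal m \<Longrightarrow> - a \<in> relation_ideal m"
  using I.I_l_closed[of a "- frag_of []"] free_mult_cmul(1)[of "-1" "frag_of []" a] by simp

lemma ideal_diff: "a \<in> relation_ideal m \<Longrightarrow> b \<in> relation_ideal m \<Longrightarrow> a - b \<in> relation_ideal m"
  using ideal_add[of a "- b"] ideal_uminus by simp

lemma ideal_cmul: "a \<in> relation_ideal m \<Longrightarrow> frag_cmul k a \<in> relation_ideal m"
  by (rule frag_closure_minus_cmul) (auto simp: ideal_zero ideal_diff)

lemma ideal_mult: "a \<in> relation_ideal m \<Longrightarrow> v \<in> lists (gens m) \<Longrightarrow> w \<in> lists (gens m)
    \<Longrightarrow> free_mult (frag_of v) (free_mult a (frag_of w)) \<in> relation_ideal m"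
  using I.I_l_closed[of "free_mult a (frag_of w)" "frag_of v"] I.I_r_closed[of a "frag_of w"] by simp

lemma ideal_sum: "(\<And>i. i \<in> J \<Longrightarrow> f i \<in> relation_ideal m) \<Longrightarrow> sum f J \<in> relation_ideal m"
  by (induction J rule: infinite_finite_induct) (auto simp: ideal_zero ideal_add)

lemma word_cong_refl: "word_cong m v 1 v"
  by (simp add: word_cong_def ideal_zero)

lemma word_cong_sym: "word_cong m v 1 w \<Longrightarrow> word_cong m w 1 v"
  using ideal_uminus[of "frag_of v - frag_of w"] by (simp add: word_cong_def)

lemma word_cong_trans: "word_cong m u k v \<Longrightarrow> word_cong m v l w \<Longrightarrow> word_cong m u (k * l) w"
  using ideal_add[of "frag_of u - frag_cmul k (frag_of v)" "frag_cmul k (frag_of v - frag_cmul l (frag_of w))"]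
    ideal_cmul[of "frag_of v - frag_cmul l (frag_of w)" k]
  by (simp only: word_cong_def frag_cmul_diff_distrib2 frag_cmul_cmul add_diff_eq diff_add_cancel simp_thms)

lemma word_cong_0: "word_cong m u 0 v \<Longrightarrow> word_cong m u 0 w"
  by (simp add: word_cong_def)

lemma word_cong_context:
  assumes "word_cong m u k v" "x \<in> lists (gens m)" "y \<in> lists (gens m)"
  shows "word_cong m (x @ u @ y) k (x @ v @ y)"
  using ideal_mult[OF assms(1)[unfolded word_cong_def] assms(2,3)]
  by (simp add: word_cong_def free_mult_diff free_mult_cmul)

lemma word_cong_Cons: "word_cong m u k v \<Longrightarrow> x \<in> gens m \<Longrightarrow> word_cong m (x # u) k (x # v)"
  using word_cong_context[of u k v "[x]" "[]"] by simp

lemma word_cong_append: "word_cong m u k v \<Longrightarrow> y \<in> lists (gens m) \<Longrightarrow> word_cong m (u @ y) k (v @ y)"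
  using word_cong_context[of u k v "[]" y] by simp

lemma word_cong_prepend: "word_cong m u k v \<Longrightarrow> y \<in> lists (gens m) \<Longrightarrow> word_cong m (y @ u) k (y @ v)"
  using word_cong_context[of u k v y "[]"] by simp

lemma word_cong_relations:
  assumes "i \<in> {1..m}"
  shows "word_cong m [U i, T i] 1 [U i]" "word_cong m [T i, U i] 0 []" "word_cong m [T i, T i] 1 [T i]" "word_cong m [U i, U i] 0 []"
    "j \<in> {1..m} \<Longrightarrow> i \<noteq> j \<Longrightarrow> word_cong m [T j, U i] 1 [U i, T j]"
    "j \<in> {1..m} \<Longrightarrow> i \<noteq> j \<Longrightarrow> word_cong m [U i, U j] (-1) [U j, U i]"
    "j \<in> {1..m} \<Longrightarrow> i \<noteq> j \<Longrightarrow> word_cong m [T i, T j] 1 [T j, T i]"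
proof -
  have r: "r \<in> relation_ideal m" if "r \<in> {frag_of [U i, T i] - frag_of [U i], frag_of [T i, U i],
      frag_of [T i, T i] - frag_of [T i], frag_of [U i, U i]}" for r
    using assms that by (intro subsetD[OF relations_in_ideal]) (unfold relations_def, blast)
  show "word_cong m [U i, T i] 1 [U i]" "word_cong m [T i, U i] 0 []" "word_cong m [T i, T i] 1 [T i]" "word_cong m [U i, U i] 0 []"
    unfolding word_cong_def by (simp_all add: r)
  assume j: "j \<in> {1..m}" "i \<noteq> j"
  have r: "r \<in> relation_ideal m" if "r \<in> {frag_of [U i, T j] - frag_of [T j, U i],
      frag_of [U i, U j] + frag_of [U j, U i], frag_of [T i, T j] - frag_of [T j, T i]}" for r
    using assms that j by (intro subsetD[OF relations_in_ideal]) (unfold relations_def, blast)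
  show "word_cong m [T j, U i] 1 [U i, T j]"
    by (rule word_cong_sym) (simp add: word_cong_def r)
  show "word_cong m [U i, U j] (-1) [U j, U i]" "word_cong m [T i, T j] 1 [T j, T i]"
    unfolding word_cong_def by (simp_all add: r)
qed

lemma lists_gens: "set l \<subseteq> {1..m} \<Longrightarrow> map U l \<in> lists (gens m)" "set l \<subseteq> {1..m} \<Longrightarrow> map T l \<in> lists (gens m)"
  by (simp_all add: gens_def in_lists_conv_set) blast+

lemma gen_in: "i \<in> {1..m} \<Longrightarrow> U i \<in> gens m" "i \<in> {1..m} \<Longrightarrow> T i \<in> gens m"
  by (auto simp: gens_def)

lemma word_cong_T_absorb:
  "set l \<subseteq> {1..m} \<Longrightarrow> i \<in> set l \<Longrightarrow> word_cong m (T i # map T l) 1 (map T l)"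
proof (induction l)
  case (Cons j l)
  then have i: "i \<in> {1..m}" and j: "j \<in> {1..m}" and l: "set l \<subseteq> {1..m}" by auto
  show ?case
  proof (cases "i = j")
    case True
    then show ?thesis using word_cong_append[OF word_cong_relations(3)[OF i] lists_gens(2)[OF l]] by simp
  next
    case False
    have "word_cong m (T i # T j # map T l) 1 (T j # T i # map T l)"
      using word_cong_append[OF word_cong_relations(7)[OF i j False] lists_gens(2)[OF l]] by simp
    moreover have "word_cong m (T j # T i # map T l) 1 (T j # map T l)"
      using Cons False by (intro word_cong_Cons gen_in(2) j) auto
    ultimately show ?thesis using word_cong_trans[of _ 1 _ 1] by force
  qed
qed simp

lemma word_cong_T_insort:
  "set l \<subseteq> {1..m} \<Longrightarrow> i \<in> {1..m} \<Longrightarrow> i \<notin> set l \<Longrightarrow> word_cong m (T i # map T l) 1 (map T (insort i l))"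
proof (induction l)
  case Nil
  then show ?case by (simp add: word_cong_refl)
next
  case (Cons j l)
  then have j: "j \<in> {1..m}" and l: "set l \<subseteq> {1..m}" and ij: "i \<noteq> j" by auto
  show ?case
  proof (cases "i \<le> j")
    case True
    then show ?thesis by (simp add: word_cong_refl)
  next
    case False
    have "word_cong m (T i # T j # map T l) 1 (T j # T i # map T l)"
      using word_cong_append[OF word_cong_relations(7)[OF Cons.prems(2) j ij] lists_gens(2)[OF l]] by simp
    moreover have "word_cong m (T j # T i # map T l) 1 (T j # map T (insort i l))"
      using Cons by (intro word_cong_Cons gen_in(2) j) auto
    ultimately show ?thesis using word_cong_trans[of _ 1 _ 1] False by force
  qed
qed

lemma word_cong_U_absorb:
  "set l \<subseteq> {1..m} \<Longrightarrow> i \<in> set l \<Longrightarrow> word_cong m (U i # map U l) 0 w"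
proof (induction l)
  case (Cons j l)
  then have i: "i \<in> {1..m}" and j: "j \<in> {1..m}" and l: "set l \<subseteq> {1..m}" by auto
  show ?case
  proof (cases "i = j")
    case True
    then show ?thesis
      using word_cong_0[OF word_cong_append[OF word_cong_relations(4)[OF i] lists_gens(1)[OF l]]] by simp
  next
    case False
    have "word_cong m (U i # U j # map U l) (-1) (U j # U i # map U l)"
      using word_cong_append[OF word_cong_relations(6)[OF i j False] lists_gens(1)[OF l]] by simp
    moreover have "word_cong m (U j # U i # map U l) 0 (U j # w)"
      using Cons False by (intro word_cong_Cons gen_in(1) j) auto
    ultimately show ?thesis using word_cong_trans[of _ "-1" _ 0] word_cong_0 by force
  qed
qed simp

text \<open>The sign of the sorting is left open: normal forms are used for spanning, while the
  actual coefficients are later determined by evaluation.\<close>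

lemma word_cong_U_insort:
  "set l \<subseteq> {1..m} \<Longrightarrow> i \<in> {1..m} \<Longrightarrow> i \<notin> set l \<Longrightarrow> \<exists>k. word_cong m (U i # map U l) k (map U (insort i l))"
proof (induction l)
  case Nil
  then show ?case using word_cong_refl by auto
next
  case (Cons j l)
  then have j: "j \<in> {1..m}" and l: "set l \<subseteq> {1..m}" and ij: "i \<noteq> j" by auto
  show ?case
  proof (cases "i \<le> j")
    case True
    then show ?thesis using word_cong_refl by auto
  next
    case False
    have 1: "word_cong m (U i # U j # map U l) (-1) (U j # U i # map U l)"
      using word_cong_append[OF word_cong_relations(6)[OF Cons.prems(2) j ij] lists_gens(1)[OF l]] by simp
    obtain k where "word_cong m (U i # map U l) k (map U (insort i l))" using Cons by auto
    then have "word_cong m (U j # U i # map U l) k (U j # map U (insort i l))"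
      by (intro word_cong_Cons gen_in(1) j)
    from word_cong_trans[OF 1 this] show ?thesis using False by auto
  qed
qed

lemma word_cong_T_past_U:
  assumes "w \<in> lists (gens m)" "i \<in> {1..m}"
  shows "set l \<subseteq> {1..m} \<Longrightarrow> i \<notin> set l \<Longrightarrow> word_cong m (T i # map U l @ w) 1 (map U l @ T i # w)"
proof (induction l)
  case Nil
  then show ?case by (simp add: word_cong_refl)
next
  case (Cons j l)
  then have j: "j \<in> {1..m}" and l: "set l \<subseteq> {1..m}" and ij: "j \<noteq> i" by auto
  have "map U l @ w \<in> lists (gens m)" using assms(1) lists_gens(1)[OF l] by auto
  from word_cong_append[OF word_cong_relations(5)[OF j assms(2) ij] this]
  have "word_cong m (T i # U j # map U l @ w) 1 (U j # T i # map U l @ w)" by simp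
  moreover have "word_cong m (U j # T i # map U l @ w) 1 (U j # map U l @ T i # w)"
    using Cons by (intro word_cong_Cons gen_in(1) j) auto
  ultimately show ?case using word_cong_trans[of _ 1 _ 1] by force
qed

lemma word_cong_T_kill_U:
  assumes "w \<in> lists (gens m)"
  shows "set l \<subseteq> {1..m} \<Longrightarrow> i \<in> set l \<Longrightarrow> word_cong m (T i # map U l @ w) 0 v"
proof (induction l)
  case (Cons j l)
  then have i: "i \<in> {1..m}" and j: "j \<in> {1..m}" and l: "set l \<subseteq> {1..m}" by auto
  have lw: "map U l @ w \<in> lists (gens m)" using assms(1) lists_gens(1)[OF l] by auto
  show ?case
  proof (cases "i = j")
    case True
    then show ?thesis using word_cong_0[OF word_cong_append[OF word_cong_relations(2)[OF i] lw]] by simp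
  next
    case False
    have "word_cong m (T i # U j # map U l @ w) 1 (U j # T i # map U l @ w)"
      using word_cong_append[OF word_cong_relations(5)[OF j i] lw] False by simp
    moreover have "word_cong m (U j # T i # map U l @ w) 0 (U j # v)"
      using Cons False by (intro word_cong_Cons gen_in(1) j) auto
    ultimately show ?thesis using word_cong_trans[of _ 1 _ 0] word_cong_0 by force
  qed
qed simp

text \<open>The letter t_i commutes to the left past the letters u_j with j different from i, until
  it meets u_i and is absorbed by u_i t_i = u_i.\<close>

lemma word_cong_U_absorb_T:
  "set l \<subseteq> {1..m} \<Longrightarrow> i \<in> set l \<Longrightarrow> word_cong m (map U l @ [T i]) 1 (map U l)"
proof (induction l)
  case (Cons j l)
  then have i: "i \<in> {1..m}" and j: "j \<in> {1..m}" and l: "set l \<subseteq> {1..m}" by auto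
  show ?case
  proof (cases "i \<in> set l")
    case True
    then show ?thesis using Cons word_cong_Cons[OF _ gen_in(1)[OF j]] by auto
  next
    case False
    then have ij: "i = j" using Cons by auto
    have "word_cong m (map U l @ [T i]) 1 (T i # map U l)"
      using word_cong_sym[OF word_cong_T_past_U[of "[]" i l]] l i False by simp
    then have "word_cong m (U i # map U l @ [T i]) 1 (U i # T i # map U l)"
      by (rule word_cong_Cons[OF _ gen_in(1)[OF i]])
    moreover have "word_cong m (U i # T i # map U l) 1 (U i # map U l)"
      using word_cong_append[OF word_cong_relations(1)[OF i] lists_gens(1)[OF l]] by simp
    ultimately show ?thesis using word_cong_trans[of _ 1 _ 1] ij by force
  qed
qed simp

lemma u_word_insert: "finite \<sigma> \<Longrightarrow> i \<notin> \<sigma> \<Longrightarrow> u_word (insert i \<sigma>) = map U (insort i (sorted_list_of_set \<sigma>))"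
  by (simp add: u_word_def)

lemma t_word_insert: "finite \<sigma> \<Longrightarrow> i \<notin> \<sigma> \<Longrightarrow> t_word (insert i \<sigma>) = map T (insort i (sorted_list_of_set \<sigma>))"
  by (simp add: t_word_def)

lemma word_lists: "\<sigma> \<subseteq> {1..m} \<Longrightarrow> u_word \<sigma> \<in> lists (gens m)" "\<sigma> \<subseteq> {1..m} \<Longrightarrow> t_word \<sigma> \<in> lists (gens m)"
  unfolding u_word_def t_word_def by (intro lists_gens; metis finite_atLeastAtMost finite_subset set_sorted_list_of_set)+

lemma T_normal:
  assumes \<sigma>: "\<sigma> \<subseteq> {1..m}" and \<tau>: "\<tau> \<subseteq> {1..m}" and i: "i \<in> {1..m}" and n: "i \<notin> \<sigma>"
  shows "word_cong m (T i # u_word \<sigma> @ t_word \<tau>) 1 (u_word \<sigma> @ t_word (insert i \<tau>))"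
proof -
  have fin: "finite \<sigma>" "finite \<tau>" using \<sigma> \<tau> finite_subset by auto
  have "word_cong m (T i # t_word \<tau>) 1 (t_word (insert i \<tau>))"
  proof (cases "i \<in> \<tau>")
    case True
    then show ?thesis
      using word_cong_T_absorb[of "sorted_list_of_set \<tau>" i] \<tau> fin by (simp add: t_word_def insert_absorb)
  next
    case False
    then show ?thesis
      using word_cong_T_insort[of "sorted_list_of_set \<tau>" i] \<tau> fin i by (simp add: t_word_insert) (simp add: t_word_def)
  qed
  then have "word_cong m (u_word \<sigma> @ T i # t_word \<tau>) 1 (u_word \<sigma> @ t_word (insert i \<tau>))"
    using word_cong_prepend[OF _ word_lists(1)[OF \<sigma>]] by fastforce
  moreover have "word_cong m (T i # u_word \<sigma> @ t_word \<tau>) 1 (u_word \<sigma> @ T i # t_word \<tau>)"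
    using word_cong_T_past_U[OF word_lists(2)[OF \<tau>] i, of "sorted_list_of_set \<sigma>"] \<sigma> n fin by (simp add: u_word_def)
  ultimately show ?thesis using word_cong_trans[of _ 1 _ 1] by force
qed

text \<open>Induction on the word. A generator multiplied from the left onto a normal form
  annihilates it, is absorbed, or is sorted into place.\<close>

lemma normal_form_exists:
  "w \<in> lists (gens m) \<Longrightarrow> \<exists>k \<sigma> \<tau>. \<sigma> \<subseteq> {1..m} \<and> \<tau> \<subseteq> {1..m} \<and> \<sigma> \<inter> \<tau> = {} \<and> word_cong m w k (u_word \<sigma> @ t_word \<tau>)"
proof (induction w)
  case Nil
  have "word_cong m [] 1 (u_word {} @ t_word {})" by (simp add: u_word_def t_word_def word_cong_refl)
  then show ?case by blast
next
  case (Cons x w)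
  then obtain k \<sigma> \<tau> where \<sigma>: "\<sigma> \<subseteq> {1..m}" and \<tau>: "\<tau> \<subseteq> {1..m}" and d: "\<sigma> \<inter> \<tau> = {}" and c: "word_cong m w k (u_word \<sigma> @ t_word \<tau>)"
    by auto
  have x: "x \<in> gens m" using Cons by auto
  have fin: "finite \<sigma>" "finite \<tau>" using \<sigma> \<tau> finite_subset by auto
  have xc: "word_cong m (x # w) k (x # u_word \<sigma> @ t_word \<tau>)" using word_cong_Cons[OF c x] .
  have "\<exists>k \<sigma>' \<tau>'. \<sigma>' \<subseteq> {1..m} \<and> \<tau>' \<subseteq> {1..m} \<and> \<sigma>' \<inter> \<tau>' = {} \<and> word_cong m (x # u_word \<sigma> @ t_word \<tau>) k (u_word \<sigma>' @ t_word \<tau>')"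
  proof (cases x)
    case (T i)
    then have i: "i \<in> {1..m}" using x by (auto simp: gens_def)
    show ?thesis
    proof (cases "i \<in> \<sigma>")
      case True
      have "word_cong m (x # u_word \<sigma> @ t_word \<tau>) 0 (u_word \<sigma> @ t_word \<tau>)"
        using word_cong_T_kill_U[OF word_lists(2)[OF \<tau>], of "sorted_list_of_set \<sigma>" i] \<sigma> fin True T by (simp add: u_word_def)
      then show ?thesis using \<sigma> \<tau> d by blast
    next
      case False
      have "\<sigma> \<inter> insert i \<tau> = {}" "insert i \<tau> \<subseteq> {1..m}" using d False i \<tau> by auto
      then show ?thesis using T_normal[OF \<sigma> \<tau> i False] \<sigma> T by blast
    qed
  next
    case (U i)
    then have i: "i \<in> {1..m}" using x by (auto simp: gens_def)
    show ?thesis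
    proof (cases "i \<in> \<sigma>")
      case True
      have "word_cong m (x # u_word \<sigma>) 0 (u_word \<sigma>)"
        using word_cong_U_absorb[of "sorted_list_of_set \<sigma>" i] \<sigma> fin True U by (simp add: u_word_def)
      from word_cong_append[OF this word_lists(2)[OF \<tau>]] show ?thesis using \<sigma> \<tau> d by auto
    next
      case False
      let ?\<sigma> = "insert i \<sigma>"
      have \<sigma>': "?\<sigma> \<subseteq> {1..m}" using i \<sigma> by auto
      obtain l where "word_cong m (x # u_word \<sigma>) l (u_word ?\<sigma>)"
        using word_cong_U_insort[of "sorted_list_of_set \<sigma>" i] \<sigma> fin False U i by (auto simp: u_word_insert) (auto simp: u_word_def)
      from word_cong_append[OF this word_lists(2)[OF \<tau>]]
      have 1: "word_cong m (x # u_word \<sigma> @ t_word \<tau>) l (u_word ?\<sigma> @ t_word \<tau>)" by simp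
      have \<tau>': "\<tau> - {i} \<subseteq> {1..m}" using \<tau> by auto
      \<comment> \<open>After the insertion of u_i the t-part may contain t_i. It is absorbed by
        u_i, which restores the disjointness of the two index sets.\<close>
      have 2: "word_cong m (u_word ?\<sigma> @ t_word \<tau>) 1 (u_word ?\<sigma> @ t_word (\<tau> - {i}))"
      proof (cases "i \<in> \<tau>")
        case True
        have "word_cong m (T i # t_word (\<tau> - {i})) 1 (t_word \<tau>)"
          using T_normal[of "{}" "\<tau> - {i}" i] \<tau>' i True by (simp add: u_word_def insert_absorb)
        then have "word_cong m (u_word ?\<sigma> @ t_word \<tau>) 1 (u_word ?\<sigma> @ T i # t_word (\<tau> - {i}))"
          by (intro word_cong_prepend word_cong_sym[of "T i # _"] word_lists \<sigma>')
        moreover have "word_cong m (u_word ?\<sigma> @ [T i]) 1 (u_word ?\<sigma>)"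
          unfolding u_word_def using \<sigma>' fin by (intro word_cong_U_absorb_T) (simp_all only: set_sorted_list_of_set finite_insert insert_iff simp_thms)
        from word_cong_append[OF this word_lists(2)[OF \<tau>']]
        have "word_cong m (u_word ?\<sigma> @ T i # t_word (\<tau> - {i})) 1 (u_word ?\<sigma> @ t_word (\<tau> - {i}))" by simp
        ultimately show ?thesis using word_cong_trans[of _ 1 _ 1] by force
      next
        case False
        then show ?thesis by (simp add: word_cong_refl)
      qed
      have "?\<sigma> \<inter> (\<tau> - {i}) = {}" using d by auto
      then show ?thesis using word_cong_trans[OF 1 2] \<sigma>' \<tau>' by blast
    qed
  qed
  then obtain l \<sigma>' \<tau>' where *: "\<sigma>' \<subseteq> {1..m}" "\<tau>' \<subseteq> {1..m}" "\<sigma>' \<inter> \<tau>' = {}" "word_cong m (x # u_word \<sigma> @ t_word \<tau>) l (u_word \<sigma>' @ t_word \<tau>')"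
    by blast
  show ?case using word_cong_trans[OF xc *(4)] * by blast
qed

end

section \<open>The ring of cubical cochains as a quotient of the free algebra\<close>

definition mono_word :: "nat set \<Rightarrow> nat set \<Rightarrow> gen list" where
  "mono_word \<sigma> \<tau> = u_word \<sigma> @ t_word \<tau>"

text \<open>The coefficient of \<open>u\<^sub>\<sigma> t\<^sub>\<tau>\<close>, read off a function on cells by Moebius inversion.\<close>

definition coef :: "nat set \<Rightarrow> nat set \<Rightarrow> (cell \<Rightarrow> int) \<Rightarrow> int" where
  "coef \<sigma> \<tau> q = (\<Sum>E\<in>Pow \<tau>. (-1) ^ (card \<tau> - card E) * q (\<sigma>, E))"

lemma coef_inversion:
  assumes "finite E"
  shows "q (\<sigma>, E) = (\<Sum>\<tau>\<in>Pow E. coef \<sigma> \<tau> q)"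
proof -
  define g where "g S = (\<Sum>V\<in>Pow S. (-1) ^ card V * q (\<sigma>, V))" for S
  have "q (\<sigma>, E) = (\<Sum>V\<in>Pow E. (-1) ^ card V * g V)"
    by (rule inclusion_exclusion_symmetric[OF g_def assms])
  also have "\<dots> = (\<Sum>\<tau>\<in>Pow E. coef \<sigma> \<tau> q)"
  proof (rule sum.cong[OF refl])
    fix \<tau> assume "\<tau> \<in> Pow E"
    then have fin: "finite \<tau>" using assms finite_subset by blast
    have "(-1) ^ card \<tau> * ((-1) ^ card V * q (\<sigma>, V)) = (-1) ^ (card \<tau> - card V) * q (\<sigma>, V)" if "V \<in> Pow \<tau>" for V
    proof -
      have "card V \<le> card \<tau>" using that fin card_mono by blast
      then have "(-1::int) ^ card \<tau> = (-1) ^ (card \<tau> - card V) * (-1) ^ card V"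
        by (simp flip: power_add)
      then show ?thesis by (simp add: mult.assoc)
    qed
    then show "(-1) ^ card \<tau> * g \<tau> = coef \<sigma> \<tau> q"
      unfolding coef_def g_def sum_distrib_left by (intro sum.cong refl)
  qed
  finally show ?thesis .
qed

lemma coef_0 [simp]: "coef \<sigma> \<tau> (\<lambda>_. 0) = 0"
  by (simp add: coef_def)

lemma coef_add: "coef \<sigma> \<tau> (\<lambda>c. a c + b c) = coef \<sigma> \<tau> a + coef \<sigma> \<tau> b"
  by (simp add: coef_def sum.distrib distrib_left)

text \<open>Moebius inversion on the Boolean lattice turns the indicator function of the sets above
  \<tau> into the delta function at \<tau>.\<close>

lemma coef_mobius:
  assumes "finite \<tau>'" "\<And>E. E \<subseteq> \<tau>' \<Longrightarrow> q (\<sigma>, E) = of_bool (\<tau> \<subseteq> E)"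
  shows "coef \<sigma> \<tau>' q = of_bool (\<tau> = \<tau>')"
proof -
  have "of_bool (\<tau> \<subseteq> E) = (\<Sum>V\<in>Pow E. of_bool (V = \<tau>) :: int)" if "finite E" for E
  proof -
    have "(\<Sum>V\<in>Pow E. of_bool (V = \<tau>) :: int) = (\<Sum>V\<in>Pow E. if V = \<tau> then 1 else 0)"
      by (intro sum.cong) auto
    then show ?thesis using that by simp
  qed
  then have "of_bool (\<tau>' = \<tau>) = (\<Sum>V\<in>Pow \<tau>'. (-1) ^ (card \<tau>' - card V) * (of_bool (\<tau> \<subseteq> V) :: int))"
    by (rule inclusion_exclusion_mobius[OF _ assms(1)])
  also have "\<dots> = coef \<sigma> \<tau>' q"
    unfolding coef_def using assms(2) by (intro sum.cong) auto
  finally show ?thesis by (simp add: eq_commute)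
qed

lemma pairing_of_bool: "pairing (\<lambda>x. of_bool (x = a)) c = Poly_Mapping.lookup c a"
  using subset_UNIV
  by (induction c rule: frag_induction) (auto simp: pairing_diff lookup_minus)

lemma coef_ev: "coef \<sigma> \<tau> (ev m K a) = pairing (\<lambda>w. coef \<sigma> \<tau> (ev_word m K w)) a"
  using subset_UNIV
proof (induction a rule: frag_induction)
  case (diff a b)
  have "coef \<sigma> \<tau> (\<lambda>c. f c - g c) = coef \<sigma> \<tau> f - coef \<sigma> \<tau> g" for f g
    by (simp add: coef_def sum_subtractf right_diff_distrib)
  then show ?case using diff by (simp add: ev_diff pairing_diff)
qed simp_all

section \<open>Monomials and the kernel of evaluation\<close>

context moment_angle_complex
begin

lemma ev_word_T: "ev_word m K (map T l) (\<rho>, E) = of_bool (\<rho> = {} \<and> set l \<subseteq> E \<and> E \<subseteq> {1..m})"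
  by (induction l) (auto simp: qone_def)

text \<open>As k is increasing, every letter u_i removes the least free coordinate, so all signs are
  1. The monomial with index sets \<sigma>, \<tau> therefore becomes the indicator function of the
  cells (\<sigma>, E) with \<tau> \<subseteq> E.\<close>

lemma ev_word_UT:
  "sorted_wrt (<) k \<Longrightarrow> set k \<inter> set l = {} \<Longrightarrow>
    ev_word m K (map U k @ map T l) (\<rho>, E) = of_bool (\<rho> = set k \<and> set l \<subseteq> E \<and> (\<rho>, E) \<in> cell_set m K)"
proof (induction k arbitrary: \<rho> E)
  case Nil
  then show ?case using K_empty by (auto simp: ev_word_T cell_set_iff)
next
  case (Cons i k)
  have ik: "i \<notin> set k" "i \<notin> set l" using Cons.prems by auto
  show ?case
  proof (cases "(\<rho>, E) \<in> cell_set m K \<and> i \<in> \<rho>")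
    case True
    have IH: "ev_word m K (map U k @ map T l) (\<rho> - {i}, insert i E) = of_bool (\<rho> - {i} = set k \<and> set l \<subseteq> insert i E \<and> (\<rho> - {i}, insert i E) \<in> cell_set m K)"
      using Cons by (intro Cons.IH) auto
    have 1: "\<rho> - {i} = set k \<longleftrightarrow> \<rho> = set (i # k)" using True ik by auto
    have "sg i \<rho> = 1" if "\<rho> = set (i # k)"
    proof -
      have "{j \<in> \<rho>. j < i} = {}" using that Cons.prems by auto
      then show ?thesis by (simp only: sg_def card.empty power_0)
    qed
    then show ?thesis
      using True cell_back1[of \<rho> E i] ik IH by (auto simp: 1)
  next
    case False
    then show ?thesis by auto
  qed
qed

lemma ev_mono_word:
  assumes "finite \<sigma>" "finite \<tau>" "\<sigma> \<inter> \<tau> = {}"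
  shows "ev_word m K (mono_word \<sigma> \<tau>) (\<rho>, E) = of_bool (\<rho> = \<sigma> \<and> \<tau> \<subseteq> E \<and> (\<rho>, E) \<in> cell_set m K)"
  using ev_word_UT[of "sorted_list_of_set \<sigma>" "sorted_list_of_set \<tau>"] assms
  by (simp add: mono_word_def u_word_def t_word_def)

text \<open>The functionals \<open>coef\<close> form the dual basis of the monomials with \<sigma>
  in K, which proves these monomials independent.\<close>

lemma coef_mono_word:
  assumes "finite \<sigma>" "finite \<tau>" "\<sigma> \<inter> \<tau> = {}" "(\<sigma>', \<tau>') \<in> cell_set m K"
  shows "coef \<sigma>' \<tau>' (ev_word m K (mono_word \<sigma> \<tau>)) = of_bool (\<sigma> = \<sigma>' \<and> \<tau> = \<tau>')"
proof (cases "\<sigma>' = \<sigma>")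
  case True
  have "coef \<sigma>' \<tau>' (ev_word m K (mono_word \<sigma> \<tau>)) = of_bool (\<tau> = \<tau>')"
  proof (rule coef_mobius)
    show "finite \<tau>'" using assms cell_finite by blast
    fix E assume "E \<subseteq> \<tau>'"
    then have "(\<sigma>', E) \<in> cell_set m K" using assms(4) by (auto simp: cell_set_iff)
    then show "ev_word m K (mono_word \<sigma> \<tau>) (\<sigma>', E) = of_bool (\<tau> \<subseteq> E)"
      using True by (simp add: ev_mono_word[OF assms(1-3)])
  qed
  then show ?thesis using True by simp
next
  case False
  then show ?thesis by (simp add: coef_def ev_mono_word[OF assms(1-3)])
qed

abbreviation F where "F \<equiv> free_algebra (gens m)"

lemma mono_word_F:
  "\<sigma> \<subseteq> {1..m} \<Longrightarrow> \<tau> \<subseteq> {1..m} \<Longrightarrow> mono_word \<sigma> \<tau> \<in> lists (gens m)"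
  using word_lists[of \<sigma> m] word_lists[of \<tau> m] by (auto simp: mono_word_def)

lemma word_deg_mono: "word_deg (mono_word \<sigma> \<tau>) = card \<sigma>"
  by (simp add: word_deg_def mono_word_def u_word_def t_word_def comp_def sum_list_triv)

definition mono_comb :: "(cell \<Rightarrow>\<^sub>0 int) \<Rightarrow> gen list \<Rightarrow>\<^sub>0 int" where
  "mono_comb = frag_extend (\<lambda>(\<sigma>, \<tau>). frag_of (mono_word \<sigma> \<tau>))"

lemma monos_exist:
  assumes "a \<in> carrier F"
  shows "\<exists>c. Poly_Mapping.keys c \<subseteq> cell_set m (Pow {1..m}) \<and> a - mono_comb c \<in> relation_ideal m"
proof -
  have "\<exists>k c. c \<in> cell_set m (Pow {1..m}) \<and> word_cong m w k (mono_word (fst c) (snd c))" if w: "w \<in> lists (gens m)" for w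
  proof -
    obtain k \<sigma> \<tau> where "\<sigma> \<subseteq> {1..m}" "\<tau> \<subseteq> {1..m}" "\<sigma> \<inter> \<tau> = {}" "word_cong m w k (mono_word \<sigma> \<tau>)"
      using normal_form_exists[OF w] unfolding mono_word_def by blast
    then show ?thesis by (intro exI[of _ k] exI[of _ "(\<sigma>, \<tau>)"]) (auto simp: cell_set_def)
  qed
  then obtain k c where kc: "\<And>w. w \<in> lists (gens m) \<Longrightarrow> c w \<in> cell_set m (Pow {1..m}) \<and> word_cong m w (k w) (mono_word (fst (c w)) (snd (c w)))"
    by metis
  let ?c = "frag_extend (\<lambda>w. frag_cmul (k w) (frag_of (c w))) a"
  have a: "Poly_Mapping.keys a \<subseteq> lists (gens m)" using assms by simp
  have "a - mono_comb ?c = frag_extend (\<lambda>w. frag_of w - frag_cmul (k w) (frag_of (mono_word (fst (c w)) (snd (c w))))) a"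
    by (simp add: mono_comb_def frag_extend_frag_extend frag_extend_cmul case_prod_unfold frag_extend_diff_fun)
  also have "\<dots> \<in> relation_ideal m"
    unfolding frag_extend_def
    by (intro ideal_sum ideal_cmul) (use kc a in \<open>auto simp: word_cong_def\<close>)
  finally have "a - mono_comb ?c \<in> relation_ideal m" .
  moreover have "Poly_Mapping.keys ?c \<subseteq> cell_set m (Pow {1..m})"
    by (rule keys_frag_extend_subset[OF a]) (intro keys_cmul_subset, use kc in auto)
  ultimately show ?thesis by blast
qed

lemma subgroup_kernel_ev: "ideal {a \<in> carrier F. ev m K a = (\<lambda>_. 0)} F"
proof (rule idealI[OF ring_free_algebra])
  interpret F: ring F by (rule ring_free_algebra)
  show "subgroup {a \<in> carrier F. ev m K a = (\<lambda>_. 0)} (add_monoid F)"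
  proof (rule subgroup.intro)
    fix a assume a: "a \<in> {a \<in> carrier F. ev m K a = (\<lambda>_. 0)}"
    then have "inv\<^bsub>add_monoid F\<^esub> a = - a"
      using minus_free_algebra[of a "gens m"] by (simp add: a_inv_def)
    moreover have "ev m K (- a) = (\<lambda>_. 0)" using a ev_diff[of m K 0 a] by simp
    ultimately show "inv\<^bsub>add_monoid F\<^esub> a \<in> {a \<in> carrier F. ev m K a = (\<lambda>_. 0)}" using a by simp
  qed (auto simp: ev_add keys_add_subset simp del: free_algebra_simps(1), auto simp: keys_add_subset)
qed (auto simp: ev_mult qmul_zero keys_free_mult simp del: subset_iff)

lemma relation_ideal_ev:
  assumes "a \<in> relation_ideal m"
  shows "ev m K a = (\<lambda>_. 0)"
proof -
  have "relation_ideal m \<subseteq> {a \<in> carrier F. ev m K a = (\<lambda>_. 0)}"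
    unfolding relation_ideal_def
    by (rule ring.genideal_minimal[OF ring_free_algebra subgroup_kernel_ev])
       (use ev_relations relations_carrier in blast)
  then show ?thesis using assms by blast
qed

lemma cell_full_finite: "(\<sigma>, \<tau>) \<in> cell_set m (Pow {1..m}) \<Longrightarrow> finite \<sigma> \<and> finite \<tau> \<and> \<sigma> \<inter> \<tau> = {}"
proof -
  assume "(\<sigma>, \<tau>) \<in> cell_set m (Pow {1..m})"
  then have "\<sigma> \<subseteq> {1..m}" "\<tau> \<subseteq> {1..m} - \<sigma>" by (auto simp: cell_set_def)
  then show ?thesis by (meson Diff_disjoint disjoint_iff finite_Diff finite_atLeastAtMost finite_subset subsetD)
qed

text \<open>Modulo the relations \<open>a\<close> is a combination of monomials. Since
  \<open>a\<close> evaluates to zero, the dual functionals show that every coefficient with \<sigma>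
  in K vanishes.\<close>

lemma kernel_ev_monos:
  assumes a: "a \<in> carrier F" "ev m K a = (\<lambda>_. 0)"
  shows "\<exists>c. Poly_Mapping.keys c \<subseteq> {(\<sigma>, \<tau>). \<sigma> \<subseteq> {1..m} \<and> \<tau> \<subseteq> {1..m} \<and> \<sigma> \<notin> K} \<and> a - mono_comb c \<in> relation_ideal m"
proof -
  obtain c where c: "Poly_Mapping.keys c \<subseteq> cell_set m (Pow {1..m})" "a - mono_comb c \<in> relation_ideal m"
    using monos_exist[OF a(1)] by blast
  have "ev m K (a - mono_comb c) = (\<lambda>_. 0)" using relation_ideal_ev[OF c(2)] .
  then have ev0: "ev m K (mono_comb c) = (\<lambda>_. 0)" using a(2) by (simp add: ev_diff fun_eq_iff)
  have "Poly_Mapping.lookup c (\<sigma>, \<tau>) = 0" if st: "(\<sigma>, \<tau>) \<in> cell_set m K" for \<sigma> \<tau>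
  proof -
    have "0 = coef \<sigma> \<tau> (ev m K (mono_comb c))" unfolding ev0 by simp
    also have "\<dots> = pairing (\<lambda>x. coef \<sigma> \<tau> (ev_word m K (mono_word (fst x) (snd x)))) c"
      by (simp add: coef_ev mono_comb_def pairing_frag_extend case_prod_unfold)
    also have "\<dots> = pairing (\<lambda>x. of_bool (x = (\<sigma>, \<tau>))) c"
    proof (rule pairing_cong_keys[OF c(1)])
      fix x assume "x \<in> cell_set m (Pow {1..m})"
      then have "finite (fst x)" "finite (snd x)" "fst x \<inter> snd x = {}"
        using cell_full_finite[of "fst x" "snd x"] by simp_all
      then show "coef \<sigma> \<tau> (ev_word m K (mono_word (fst x) (snd x))) = of_bool (x = (\<sigma>, \<tau>))"
        using coef_mono_word st by (simp add: prod_eq_iff)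
    qed
    also have "\<dots> = Poly_Mapping.lookup c (\<sigma>, \<tau>)" by (rule pairing_of_bool)
    finally show ?thesis by simp
  qed
  then have "x \<notin> cell_set m K" if "x \<in> Poly_Mapping.keys c" for x
    using that by (cases x) (auto simp: in_keys_iff)
  then have "Poly_Mapping.keys c \<subseteq> {(\<sigma>, \<tau>). \<sigma> \<subseteq> {1..m} \<and> \<tau> \<subseteq> {1..m} \<and> \<sigma> \<notin> K}"
    using c(1) by (fastforce simp: cell_set_def)
  then show ?thesis using c(2) by blast
qed

text \<open>For the full simplex no monomials remain in \<open>kernel_ev_monos\<close>. So
  evaluation on all faces of the cube detects the relations, and R is the cubical cochain ring of
  the cube.\<close>

lemma relation_ideal_iff: "a \<in> carrier F \<Longrightarrow> a \<in> relation_ideal m \<longleftrightarrow> ev m (Pow {1..m}) a = (\<lambda>_. 0)"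
proof -
  interpret full: moment_angle_complex m "Pow {1..m}"
    by unfold_locales (auto simp: simplicial_complex_on_def)
  assume a: "a \<in> carrier F"
  show ?thesis
  proof
    show "ev m (Pow {1..m}) a = (\<lambda>_. 0)" if "a \<in> relation_ideal m" using full.relation_ideal_ev that .
    assume "ev m (Pow {1..m}) a = (\<lambda>_. 0)"
    then obtain c where c: "Poly_Mapping.keys c \<subseteq> {(\<sigma>, \<tau>). \<sigma> \<subseteq> {1..m} \<and> \<tau> \<subseteq> {1..m} \<and> \<sigma> \<notin> Pow {1..m}}" "a - full.mono_comb c \<in> relation_ideal m"
      using full.kernel_ev_monos[OF a] by blast
    then have "Poly_Mapping.keys c = {}" by blast
    then show "a \<in> relation_ideal m" using c(2) by (simp add: full.mono_comb_def)
  qed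
qed

lemma keys_diff_word: "w \<in> lists (gens m) \<Longrightarrow> Poly_Mapping.keys (diff_word w) \<subseteq> lists (gens m)"
proof (induction w)
  case (Cons x w)
  then have x: "x \<in> gens m" and w: "w \<in> lists (gens m)" by auto
  have "Poly_Mapping.keys (diff_gen x) \<subseteq> lists (gens m)" using x by (cases x) (auto simp: gens_def)
  then show ?case
    using Cons.IH[OF w] x w unfolding diff_word.simps
    by (intro keys_add_subset keys_cmul_subset keys_free_mult) auto
qed simp

lemma diff_free_F: "a \<in> carrier F \<Longrightarrow> diff_free a \<in> carrier F"
  unfolding diff_free_def by (simp, erule keys_frag_extend_subset) (rule keys_diff_word)

lemma diff_free_diff: "diff_free (a - b) = diff_free a - diff_free b"
  by (simp add: diff_free_def frag_extend_diff)

subsection \<open>The quotient \<open>R\<close>\<close>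

lemma ring_R: "ring (R_ring m)"
  unfolding R_ring_def by (rule ideal.quotient_is_ring[OF ideal_relation_ideal])

lemma R_proj_hom: "R_proj m \<in> ring_hom F (R_ring m)"
  using ideal.rcos_ring_hom[OF ideal_relation_ideal[of m]] by (simp add: R_proj_def[abs_def] R_ring_def)

lemma carrier_R: "carrier (R_ring m) = R_proj m ` carrier F"
  by (auto simp: R_ring_def FactRing_def A_RCOSETS_def' R_proj_def)

lemma R_proj_eq_iff: "a \<in> carrier F \<Longrightarrow> b \<in> carrier F \<Longrightarrow> R_proj m a = R_proj m b \<longleftrightarrow> a - b \<in> relation_ideal m"
  using ring.quotient_eq_iff_same_a_r_cos[OF ring_free_algebra ideal_relation_ideal, of a m b]
  by (simp add: R_proj_def diff_free_algebra del: free_algebra_simps(1))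

lemma R_proj_minus:
  assumes "a \<in> carrier F" "b \<in> carrier F"
  shows "R_proj m a \<ominus>\<^bsub>R_ring m\<^esub> R_proj m b = R_proj m (a - b)"
proof -
  interpret ring_hom_ring F "R_ring m" "R_proj m"
    by (rule ring_hom_ringI2[OF ring_free_algebra ring_R R_proj_hom])
  have "R_proj m (a \<ominus>\<^bsub>F\<^esub> b) = R_proj m a \<ominus>\<^bsub>R_ring m\<^esub> R_proj m b"
    using assms by (simp only: a_minus_def hom_add hom_a_inv R.a_inv_closed)
  then show ?thesis by (simp only: diff_free_algebra[OF assms])
qed

definition kernel_R :: "R_elem set" where
  "kernel_R = R_proj m ` {a \<in> carrier F. ev m K a = (\<lambda>_. 0)}"

lemma R_proj_kernel_iff: "a \<in> carrier F \<Longrightarrow> R_proj m a \<in> kernel_R \<longleftrightarrow> ev m K a = (\<lambda>_. 0)"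
proof
  assume a: "a \<in> carrier F" and "R_proj m a \<in> kernel_R"
  then obtain b where b: "b \<in> carrier F" "ev m K b = (\<lambda>_. 0)" "R_proj m a = R_proj m b"
    unfolding kernel_R_def by blast
  then have "ev m K (a - b) = (\<lambda>_. 0)" using a R_proj_eq_iff relation_ideal_ev by blast
  then show "ev m K a = (\<lambda>_. 0)" using b(2) by (simp add: ev_diff)
qed (auto simp: kernel_R_def)

lemma SR_gens_R: "{R_proj m (frag_of (u_word \<sigma>)) |\<sigma>. \<sigma> \<subseteq> {1..m} \<and> \<sigma> \<notin> K} \<subseteq> carrier (R_ring m)"
  unfolding carrier_R using word_lists(1)[of _ m] by auto

lemma ideal_SR: "ideal (SR_ideal m K) (R_ring m)"
  unfolding SR_ideal_def by (rule ring.genideal_ideal[OF ring_R SR_gens_R])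

text \<open>One inclusion holds because the generators vanish on all cells with \<sigma> in K and
  the kernel is an ideal. Conversely, an element of the kernel is a combination of monomials whose
  u-part is a nonface.\<close>

lemma SR_ideal_eq: "SR_ideal m K = kernel_R"
proof
  have "ideal kernel_R (R_ring m)"
    using ring.ring_ideal_imp_quot_ideal[OF ring_free_algebra ideal_relation_ideal[of m] subgroup_kernel_ev]
    by (simp add: kernel_R_def R_proj_def[abs_def] R_ring_def)
  moreover have "{R_proj m (frag_of (u_word \<sigma>)) |\<sigma>. \<sigma> \<subseteq> {1..m} \<and> \<sigma> \<notin> K} \<subseteq> kernel_R"
  proof clarify
    fix \<sigma> assume s: "\<sigma> \<subseteq> {1..m}" "\<sigma> \<notin> K"
    have "ev_word m K (u_word \<sigma>) (\<rho>, E) = 0" for \<rho> E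
      using ev_mono_word[of \<sigma> "{}" \<rho> E] s finite_subset[OF s(1)] by (auto simp: mono_word_def t_word_def cell_set_iff)
    then have "ev m K (frag_of (u_word \<sigma>)) = (\<lambda>_. 0)" by (auto simp: fun_eq_iff)
    then show "R_proj m (frag_of (u_word \<sigma>)) \<in> kernel_R"
      using word_lists(1)[OF s(1)] by (subst R_proj_kernel_iff) auto
  qed
  ultimately show "SR_ideal m K \<subseteq> kernel_R"
    unfolding SR_ideal_def by (rule ring.genideal_minimal[OF ring_R])
next
  interpret J: ideal "SR_ideal m K" "R_ring m" by (rule ideal_SR)
  interpret p: ring_hom_ring F "R_ring m" "R_proj m"
    by (rule ring_hom_ringI2[OF ring_free_algebra ring_R R_proj_hom])
  show "kernel_R \<subseteq> SR_ideal m K"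
  proof
    fix x assume "x \<in> kernel_R"
    then obtain a where a: "a \<in> carrier F" "ev m K a = (\<lambda>_. 0)" "x = R_proj m a" unfolding kernel_R_def by blast
    obtain c where c: "Poly_Mapping.keys c \<subseteq> {(\<sigma>, \<tau>). \<sigma> \<subseteq> {1..m} \<and> \<tau> \<subseteq> {1..m} \<and> \<sigma> \<notin> K}" "a - mono_comb c \<in> relation_ideal m"
      using kernel_ev_monos[OF a(1,2)] by blast
    have sub: "additive_subgroup (SR_ideal m K) (R_ring m)" by (rule J.additive_subgroup_axioms)
    have "mono_comb c \<in> carrier F \<and> R_proj m (mono_comb c) \<in> SR_ideal m K"
      using c(1)
    proof (induction c rule: frag_induction)
      case zero
      then show ?case using additive_subgroup.zero_closed[OF sub] p.hom_zero by (simp add: mono_comb_def)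
    next
      case (one x)
      then obtain \<sigma> \<tau> where x: "x = (\<sigma>, \<tau>)" "\<sigma> \<subseteq> {1..m}" "\<tau> \<subseteq> {1..m}" "\<sigma> \<notin> K" by auto
      have F: "frag_of (u_word \<sigma>) \<in> carrier F" "frag_of (t_word \<tau>) \<in> carrier F"
        using word_lists(1)[OF x(2)] word_lists(2)[OF x(3)] by simp_all
      have "R_proj m (frag_of (u_word \<sigma>)) \<in> SR_ideal m K"
        unfolding SR_ideal_def using x by (intro subsetD[OF ring.genideal_self[OF ring_R SR_gens_R]]) blast
      \<comment> \<open>A monomial has its u-part in front, so it is a right multiple of a generator
        of the ideal.\<close>
      then have "R_proj m (frag_of (u_word \<sigma>)) \<otimes>\<^bsub>R_ring m\<^esub> R_proj m (frag_of (t_word \<tau>)) \<in> SR_ideal m K"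
        using F by (intro J.I_r_closed) (auto simp: carrier_R)
      then have "R_proj m (frag_of (mono_word \<sigma> \<tau>)) \<in> SR_ideal m K"
        using p.hom_mult[OF F] by (simp add: mono_word_def)
      then show ?case using mono_word_F[OF x(2,3)] by (simp add: x(1) mono_comb_def)
    next
      case (diff a b)
      then have "R_proj m (mono_comb a) \<ominus>\<^bsub>R_ring m\<^esub> R_proj m (mono_comb b) \<in> SR_ideal m K"
        unfolding a_minus_def
        using additive_subgroup.a_closed[OF sub] additive_subgroup.a_inv_closed[OF sub] by blast
      then show ?case
        using diff R_proj_minus[of "mono_comb a" "mono_comb b"] by (simp add: mono_comb_def frag_extend_diff keys_diff_subset)
    qed
    moreover from this have "R_proj m a = R_proj m (mono_comb c)" using R_proj_eq_iff[OF a(1)] c(2) by blast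
    ultimately show "x \<in> SR_ideal m K" using a(3) by simp
  qed
qed

subsection \<open>The quotient \<open>R / I\<close>\<close>

abbreviation SR where "SR \<equiv> SR_ring m K"
abbreviation \<pi> where "\<pi> \<equiv> SR_proj m K"

lemma ring_SR: "ring SR"
  unfolding SR_ring_def by (rule ideal.quotient_is_ring[OF ideal_SR])

lemma SR_proj_hom: "\<pi> \<in> ring_hom F SR"
proof -
  have "(\<lambda>x. SR_ideal m K +>\<^bsub>R_ring m\<^esub> x) \<in> ring_hom (R_ring m) SR"
    unfolding SR_ring_def by (rule ideal.rcos_ring_hom[OF ideal_SR])
  then have "(\<lambda>x. SR_ideal m K +>\<^bsub>R_ring m\<^esub> x) \<circ> R_proj m \<in> ring_hom F SR"
    by (rule ring_hom_trans[OF R_proj_hom])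
  then show ?thesis by (simp add: SR_proj_def[abs_def] comp_def)
qed

lemma carrier_SR: "carrier SR = \<pi> ` carrier F"
proof -
  have "carrier SR = (\<lambda>x. SR_ideal m K +>\<^bsub>R_ring m\<^esub> x) ` carrier (R_ring m)"
    by (auto simp: SR_ring_def FactRing_def A_RCOSETS_def')
  then show ?thesis unfolding carrier_R by (simp add: SR_proj_def[abs_def] image_image)
qed

lemma SR_proj_eq_iff: "a \<in> carrier F \<Longrightarrow> b \<in> carrier F \<Longrightarrow> \<pi> a = \<pi> b \<longleftrightarrow> ev m K a = ev m K b"
proof -
  assume a: "a \<in> carrier F" and b: "b \<in> carrier F"
  have ab: "a - b \<in> carrier F" using a b by (simp add: keys_diff_subset)
  have "\<pi> a = \<pi> b \<longleftrightarrow> R_proj m a \<ominus>\<^bsub>R_ring m\<^esub> R_proj m b \<in> SR_ideal m K"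
    using ring.quotient_eq_iff_same_a_r_cos[OF ring_R ideal_SR, of "R_proj m a" "R_proj m b"] a b carrier_R
    by (auto simp: SR_proj_def)
  also have "\<dots> \<longleftrightarrow> ev m K (a - b) = (\<lambda>_. 0)"
    unfolding R_proj_minus[OF a b] SR_ideal_eq by (rule R_proj_kernel_iff[OF ab])
  finally show ?thesis by (simp add: ev_diff fun_eq_iff)
qed

lemma SR_proj_simps:
  assumes "a \<in> carrier F" "b \<in> carrier F"
  shows "\<pi> (a + b) = \<pi> a \<oplus>\<^bsub>SR\<^esub> \<pi> b" "\<pi> (free_mult a b) = \<pi> a \<otimes>\<^bsub>SR\<^esub> \<pi> b"
  using SR_proj_hom assms by (auto simp: ring_hom_def)

lemma SR_proj_one: "\<pi> (frag_of []) = \<one>\<^bsub>SR\<^esub>"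
  using SR_proj_hom by (auto simp: ring_hom_def)

lemma SR_proj_zero: "\<pi> 0 = \<zero>\<^bsub>SR\<^esub>"
proof -
  interpret p: ring_hom_ring F SR \<pi>
    by (rule ring_hom_ringI2[OF ring_free_algebra ring_SR SR_proj_hom])
  show ?thesis using p.hom_zero by simp
qed

text \<open>Evaluation on the quotient. The choice of a representative is immaterial by
  \<open>SR_proj_eq_iff\<close>.\<close>

definition evS :: "SR_elem \<Rightarrow> cell \<Rightarrow> int" where
  "evS x = ev m K (SOME a. a \<in> carrier F \<and> \<pi> a = x)"

lemma evS_proj: "a \<in> carrier F \<Longrightarrow> evS (\<pi> a) = ev m K a"
proof -
  assume a: "a \<in> carrier F"
  let ?b = "SOME b. b \<in> carrier F \<and> \<pi> b = \<pi> a"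
  have "?b \<in> carrier F \<and> \<pi> ?b = \<pi> a"
    by (rule someI[of "\<lambda>b. b \<in> carrier F \<and> \<pi> b = \<pi> a" a]) (use a in blast)
  then show ?thesis unfolding evS_def using SR_proj_eq_iff a by blast
qed

lemma evS_simps:
  assumes "x \<in> carrier SR" "y \<in> carrier SR"
  shows "evS (x \<oplus>\<^bsub>SR\<^esub> y) = (\<lambda>c. evS x c + evS y c)" "evS (x \<otimes>\<^bsub>SR\<^esub> y) = qmul m K (evS x) (evS y)"
    "evS x = evS y \<longleftrightarrow> x = y" "evS x \<in> Q"
proof -
  obtain a where a: "x = \<pi> a" "a \<in> carrier F" using assms(1)[unfolded carrier_SR] by (rule imageE)
  obtain b where b: "y = \<pi> b" "b \<in> carrier F" using assms(2)[unfolded carrier_SR] by (rule imageE)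
  note ab = a(2) b(2) a(1) b(1)
  have "a + b \<in> carrier F" "free_mult a b \<in> carrier F"
    using ab(1,2) by (simp_all add: keys_add_subset keys_free_mult)
  then show "evS (x \<oplus>\<^bsub>SR\<^esub> y) = (\<lambda>c. evS x c + evS y c)" "evS (x \<otimes>\<^bsub>SR\<^esub> y) = qmul m K (evS x) (evS y)"
    using ab by (simp_all only: evS_proj SR_proj_simps[symmetric] ev_add ev_mult)
  show "evS x = evS y \<longleftrightarrow> x = y" using ab by (simp only: evS_proj SR_proj_eq_iff)
  show "evS x \<in> Q" using ab by (simp only: evS_proj ev_Q)
qed

lemma evS_one: "evS \<one>\<^bsub>SR\<^esub> = qone m"
proof -
  have "frag_of [] \<in> carrier F" by simp
  from evS_proj[OF this] show ?thesis by (simp add: SR_proj_one)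
qed

lemma evS_zero: "evS \<zero>\<^bsub>SR\<^esub> = (\<lambda>_. 0)"
proof -
  have "0 \<in> carrier F" by simp
  from evS_proj[OF this] show ?thesis by (simp add: SR_proj_zero)
qed

lemma mono_comb_F:
  assumes "Poly_Mapping.keys c \<subseteq> cell_set m K"
  shows "mono_comb c \<in> carrier F"
proof -
  have "Poly_Mapping.keys (frag_of (mono_word \<sigma> \<tau>)) \<subseteq> lists (gens m)" if "(\<sigma>, \<tau>) \<in> cell_set m K" for \<sigma> \<tau>
  proof -
    have "\<sigma> \<subseteq> {1..m}" "\<tau> \<subseteq> {1..m}" using that K_vertices unfolding cell_set_iff by blast+
    then show ?thesis using mono_word_F by simp
  qed
  then have "Poly_Mapping.keys (mono_comb c) \<subseteq> lists (gens m)"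
    unfolding mono_comb_def by (intro keys_frag_extend_subset[OF assms]) (simp only: split_paired_all case_prod_conv)
  then show ?thesis by simp
qed

text \<open>The coefficients are those given by \<open>coef\<close>, and
  \<open>coef_inversion\<close> recovers q from them. The last clause keeps the monomials in the
  dimensions that occur in q, so homogeneous cochains have homogeneous preimages.\<close>

lemma ev_mono_comb:
  assumes q: "q \<in> Q"
  shows "\<exists>c. Poly_Mapping.keys c \<subseteq> cell_set m K \<and> ev m K (mono_comb c) = q \<and> (\<forall>x\<in>Poly_Mapping.keys c. \<exists>E. q (fst x, E) \<noteq> 0)"
proof -
  let ?C = "{c \<in> cell_set m K. coef (fst c) (snd c) q \<noteq> 0}"
  have "cell_set m K \<subseteq> Pow {1..m} \<times> Pow {1..m}" unfolding cell_set_def using K_vertices by blast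
  then have "finite (cell_set m K)" by (rule finite_subset) simp
  then have finC: "finite ?C" by simp
  define a where "a = (\<Sum>c\<in>?C. frag_cmul (coef (fst c) (snd c) q) (frag_of c))"
  have st: "fst c \<inter> snd c = {}" "finite (fst c)" "finite (snd c)" if "c \<in> ?C" for c
  proof -
    have c: "(fst c, snd c) \<in> cell_set m K" using that by simp
    then have "snd c \<subseteq> {1..m} - fst c" by (simp_all only: cell_set_iff)
    then show "fst c \<inter> snd c = {}" by blast
    show "finite (fst c)" "finite (snd c)" using cell_finite[OF c] by simp_all
  qed
  have keys: "Poly_Mapping.keys a \<subseteq> ?C"
    unfolding a_def by (intro keys_sum_subset keys_cmul_subset) auto
  have "ev m K (mono_comb a) (\<rho>, E) = q (\<rho>, E)" for \<rho> E
  proof (cases "(\<rho>, E) \<in> cell_set m K")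
    case True
    have "ev m K (mono_comb a) (\<rho>, E) = (\<Sum>c\<in>?C. coef (fst c) (snd c) q * ev_word m K (mono_word (fst c) (snd c)) (\<rho>, E))"
      unfolding a_def mono_comb_def frag_extend_sum' frag_extend_cmul frag_extend_of ev_sum ev_cmul case_prod_unfold ev_of ..
    also have "\<dots> = (\<Sum>c\<in>?C. coef (fst c) (snd c) q * of_bool (\<rho> = fst c \<and> snd c \<subseteq> E))"
      using st True by (intro sum.cong refl) (simp add: ev_mono_word)
    also have "\<dots> = (\<Sum>c\<in>Pair \<rho> ` Pow E. coef (fst c) (snd c) q)"
    proof (rule sum.mono_neutral_cong)
      show "finite ?C" by (rule finC)
      show "finite (Pair \<rho> ` Pow E)" using cell_finite[OF True] by simp
      have "(\<rho>, V) \<in> cell_set m K" if "V \<subseteq> E" for V using True that by (auto simp: cell_set_iff)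
      then show "coef (fst c) (snd c) q = 0" if "c \<in> Pair \<rho> ` Pow E - ?C" for c using that by auto
    qed auto
    also have "\<dots> = (\<Sum>V\<in>Pow E. coef \<rho> V q)" by (subst sum.reindex) (auto simp: inj_on_def)
    finally show ?thesis using coef_inversion cell_finite[OF True] by simp
  qed (use Q_outside[OF q] Q_outside[OF ev_Q] in simp)
  then have "ev m K (mono_comb a) = q" by (auto simp: fun_eq_iff)
  moreover have "\<exists>E. q (fst x, E) \<noteq> 0" if x: "x \<in> Poly_Mapping.keys a" for x
    using keys x unfolding coef_def by (metis (mono_tags, lifting) mem_Collect_eq mult_zero_right subsetD sum.neutral)
  ultimately show ?thesis using keys by blast
qed

lemma SR_eq_mono_comb:
  assumes "x \<in> carrier SR"
  shows "\<exists>c. Poly_Mapping.keys c \<subseteq> cell_set m K \<and> x = \<pi> (mono_comb c) \<and> (\<forall>y\<in>Poly_Mapping.keys c. \<exists>E. evS x (fst y, E) \<noteq> 0)"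
proof -
  obtain c where c: "Poly_Mapping.keys c \<subseteq> cell_set m K" "ev m K (mono_comb c) = evS x"
      "\<forall>y\<in>Poly_Mapping.keys c. \<exists>E. evS x (fst y, E) \<noteq> 0"
    using ev_mono_comb[OF evS_simps(4)[OF assms assms]] by blast
  have "\<pi> (mono_comb c) \<in> carrier SR" using mono_comb_F[OF c(1)] carrier_SR by blast
  moreover have "evS (\<pi> (mono_comb c)) = evS x" using evS_proj[OF mono_comb_F[OF c(1)]] c(2) by simp
  ultimately have "x = \<pi> (mono_comb c)" using evS_simps(3) assms by blast
  then show ?thesis using c by blast
qed

text \<open>Identifies \<open>R / I_K\<close> with functions on cells; from here on equations in the
  quotient are checked on cells.\<close>

lemma evS_bij: "bij_betw evS (carrier SR) Q"
proof (rule bij_betw_imageI)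
  show "inj_on evS (carrier SR)" by (rule inj_onI) (simp add: evS_simps)
  show "evS ` carrier SR = Q"
  proof (intro equalityI subsetI)
    fix q assume "q \<in> Q"
    then obtain c where "Poly_Mapping.keys c \<subseteq> cell_set m K" "ev m K (mono_comb c) = q" using ev_mono_comb by blast
    then have "mono_comb c \<in> carrier F" "ev m K (mono_comb c) = q" using mono_comb_F by blast+
    then show "q \<in> evS ` carrier SR" using evS_proj carrier_SR by (metis image_eqI)
  qed (auto simp: evS_simps)
qed

text \<open>The relation ideal is the kernel of evaluation for the full simplex, and evaluation
  commutes with the differential; so the differential preserves the ideal and all representatives
  lead to the same coset.\<close>

lemma R_diff_proj:
  assumes a: "a \<in> carrier F"
  shows "R_diff m (R_proj m a) = R_proj m (diff_free a)"
proof -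
  interpret I: ideal "relation_ideal m" F by (rule ideal_relation_ideal)
  interpret full: moment_angle_complex m "Pow {1..m}"
    by unfold_locales (auto simp: simplicial_complex_on_def)
  have "relation_ideal m #>\<^bsub>add_monoid F\<^esub> diff_free b = R_proj m (diff_free a)" if b: "b \<in> R_proj m a" for b
  proof -
    have bF: "b \<in> carrier F" using I.a_elemrcos_carrier[OF a] b unfolding R_proj_def .
    have "b - a \<in> relation_ideal m"
      using I.a_rcos_module_imp[OF a b[unfolded R_proj_def]] diff_free_algebra[OF bF a] by (simp only: a_minus_def)
    then have "a - b \<in> relation_ideal m" using ideal_uminus[of "b - a" m] by simp
    moreover have "a - b \<in> carrier F" using a bF by (simp add: keys_diff_subset)
    ultimately have "ev m (Pow {1..m}) (a - b) = (\<lambda>_. 0)" using relation_ideal_iff by blast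
    then have "ev m (Pow {1..m}) (diff_free (a - b)) = (\<lambda>_. 0)"
      unfolding full.ev_diff_free by (simp only: qd_def pairing_zero_fun if_cancel)
    then have "diff_free a - diff_free b \<in> relation_ideal m"
      using relation_ideal_iff[OF diff_free_F[OF \<open>a - b \<in> carrier F\<close>]] by (simp add: diff_free_diff)
    then have "R_proj m (diff_free a) = R_proj m (diff_free b)"
      using R_proj_eq_iff diff_free_F a bF by blast
    then show ?thesis by (simp add: R_proj_def a_r_coset_def)
  qed
  moreover have "a \<in> R_proj m a" unfolding R_proj_def by (rule I.a_rcos_self[OF a])
  ultimately show ?thesis unfolding R_diff_def coset_map_def by blast
qed

lemma SR_diff_proj:
  assumes a: "a \<in> carrier F"
  shows "SR_diff m K (\<pi> a) = \<pi> (diff_free a)"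
proof -
  interpret J: ideal "SR_ideal m K" "R_ring m" by (rule ideal_SR)
  have aR: "R_proj m a \<in> carrier (R_ring m)" using a carrier_R by blast
  have "SR_ideal m K #>\<^bsub>add_monoid (R_ring m)\<^esub> R_diff m y = \<pi> (diff_free a)" if y: "y \<in> \<pi> a" for y
  proof -
    have "y \<in> carrier (R_ring m)" using J.a_elemrcos_carrier[OF aR] y unfolding SR_proj_def .
    then obtain b where b: "b \<in> carrier F" "y = R_proj m b" using carrier_R by blast
    have "R_proj m b \<ominus>\<^bsub>R_ring m\<^esub> R_proj m a \<in> SR_ideal m K"
      using J.a_rcos_module_imp[OF aR y[unfolded SR_proj_def]] b(2) by (simp only: a_minus_def)
    moreover have "b - a \<in> carrier F" using a b(1) by (simp add: keys_diff_subset)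
    ultimately have "ev m K (b - a) = (\<lambda>_. 0)"
      unfolding R_proj_minus[OF b(1) a] SR_ideal_eq by (simp only: R_proj_kernel_iff)
    then have "ev m K b = ev m K a" by (simp add: ev_diff fun_eq_iff)
    then have "ev m K (diff_free b) = ev m K (diff_free a)" by (simp add: ev_diff_free)
    then have "\<pi> (diff_free b) = \<pi> (diff_free a)" using SR_proj_eq_iff diff_free_F a b by blast
    then show ?thesis using R_diff_proj[OF b(1)] b(2) by (simp add: SR_proj_def a_r_coset_def)
  qed
  moreover have "R_proj m a \<in> \<pi> a" unfolding SR_proj_def by (rule J.a_rcos_self[OF aR])
  ultimately show ?thesis unfolding SR_diff_def coset_map_def by blast
qed

lemma SR_diff_carrier: "x \<in> carrier SR \<Longrightarrow> SR_diff m K x \<in> carrier SR"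
  unfolding carrier_SR using SR_diff_proj diff_free_F by blast

lemma evS_diff: "x \<in> carrier SR \<Longrightarrow> evS (SR_diff m K x) = qd m K (evS x)"
  unfolding carrier_SR using SR_diff_proj diff_free_F evS_proj ev_diff_free by auto

definition Q_deg :: "int \<Rightarrow> (cell \<Rightarrow> int) set" where
  "Q_deg p = {q \<in> Q. \<forall>\<sigma> E. q (\<sigma>, E) \<noteq> 0 \<longrightarrow> int (card \<sigma>) = p}"

lemma ev_word_deg: "ev_word m K w (\<sigma>, E) \<noteq> 0 \<Longrightarrow> card \<sigma> = word_deg w"
proof (induction w arbitrary: \<sigma> E)
  case Nil
  then show ?case by (auto simp: qone_def word_deg_def split: if_splits)
next
  case (Cons x w)
  show ?case
  proof (cases x)
    case (U i)
    then have c: "(\<sigma>, E) \<in> cell_set m K" "i \<in> \<sigma>" "ev_word m K w (\<sigma> - {i}, insert i E) \<noteq> 0"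
      using Cons.prems by (auto split: if_splits)
    then have "card (\<sigma> - {i}) = word_deg w" using Cons.IH by blast
    moreover have "card \<sigma> = Suc (card (\<sigma> - {i}))" using c cell_finite by (metis card.remove)
    ultimately show ?thesis by (simp add: U word_deg_def)
  next
    case (T i)
    then have "ev_word m K w (\<sigma>, E) \<noteq> 0" using Cons.prems by (auto split: if_splits)
    then show ?thesis using Cons.IH by (simp add: T word_deg_def)
  qed
qed

text \<open>A degree in the quotient comes from the degrees of words, the degree of a cochain from
  the dimensions of cells. The support clause of \<open>SR_eq_mono_comb\<close> provides a
  homogeneous representative for a homogeneous cochain.\<close>

lemma SR_part_carrier: "carrier (SR_part m K p) = {x \<in> carrier SR. evS x \<in> Q_deg p}"
proof (intro equalityI subsetI)
  fix x assume "x \<in> carrier (SR_part m K p)"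
  then have "x \<in> \<pi> ` {a \<in> carrier F. \<forall>w\<in>Poly_Mapping.keys a. int (word_deg w) = p}"
    by (simp add: SR_part_def)
  then obtain a where a: "a \<in> carrier F" "\<forall>w\<in>Poly_Mapping.keys a. int (word_deg w) = p" "x = \<pi> a"
    by blast
  have "int (card \<sigma>) = p" if "ev m K a (\<sigma>, E) \<noteq> 0" for \<sigma> E
  proof -
    have "\<not> (\<forall>w\<in>Poly_Mapping.keys a. ev_word m K w (\<sigma>, E) = 0)"
      using that pairing_eq_0[of a "\<lambda>w. ev_word m K w (\<sigma>, E)"] unfolding ev_def by auto
    then obtain w where "w \<in> Poly_Mapping.keys a" "ev_word m K w (\<sigma>, E) \<noteq> 0" by blast
    then show ?thesis using ev_word_deg a(2) by auto
  qed
  then show "x \<in> {x \<in> carrier SR. evS x \<in> Q_deg p}"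
    using a evS_proj carrier_SR by (auto simp: Q_deg_def ev_Q)
next
  fix x assume x: "x \<in> {x \<in> carrier SR. evS x \<in> Q_deg p}"
  then obtain c where c: "Poly_Mapping.keys c \<subseteq> cell_set m K" "x = \<pi> (mono_comb c)"
      "\<forall>y\<in>Poly_Mapping.keys c. \<exists>E. evS x (fst y, E) \<noteq> 0"
    using SR_eq_mono_comb by blast
  have "int (word_deg w) = p" if w: "w \<in> Poly_Mapping.keys (mono_comb c)" for w
  proof -
    have "Poly_Mapping.keys (mono_comb c) \<subseteq> (\<lambda>y. mono_word (fst y) (snd y)) ` Poly_Mapping.keys c"
      unfolding mono_comb_def by (rule keys_frag_extend_subset[OF order_refl]) (auto simp: case_prod_unfold)
    then obtain y where y: "y \<in> Poly_Mapping.keys c" "w = mono_word (fst y) (snd y)" using w by blast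
    then obtain E where "evS x (fst y, E) \<noteq> 0" using c(3) by blast
    then show ?thesis using x y(2) by (auto simp: Q_deg_def word_deg_mono)
  qed
  then have "mono_comb c \<in> {a \<in> carrier F. \<forall>w\<in>Poly_Mapping.keys a. int (word_deg w) = p}"
    using mono_comb_F[OF c(1)] by blast
  then show "x \<in> carrier (SR_part m K p)"
    unfolding SR_part_def c(2) by simp
qed

end

section \<open>The differential graded ring \<open>R / I\<close>\<close>

lemma act_add: "act m K x (\<lambda>c. a c + k * b c) = (\<lambda>c. act m K x a c + k * act m K x b c)"
  by (cases x) (auto simp: fun_eq_iff algebra_simps)

lemma qmul_linear_left: "qmul m K (\<lambda>c. a c + k * a' c) b = (\<lambda>c. qmul m K a b c + k * qmul m K a' b c)"
  by (auto simp: qmul_def fun_eq_iff sum_distrib_left sum.distrib algebra_simps)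

lemma qd_linear': "qd m K (\<lambda>c. a c + k * b c) = (\<lambda>c. qd m K a c + k * qd m K b c)"
  by (auto simp: qd_def pairing_add_fun pairing_cmul_fun)

lemma qd_zero: "qd m K (\<lambda>_. 0) = (\<lambda>_. 0)"
  by (auto simp: qd_def)

section \<open>The Leibniz rule and the grading\<close>

context moment_angle_complex
begin

text \<open>Induction on the word by the Leibniz rules for single generators; the sign flips exactly
  at the letters u_i.\<close>

lemma qd_leibniz_word:
  assumes b: "b \<in> Q"
  shows "qd m K (qmul m K (ev_word m K w) b)
    = (\<lambda>c. qmul m K (qd m K (ev_word m K w)) b c + (-1) ^ word_deg w * qmul m K (ev_word m K w) (qd m K b) c)"
proof (induction w)
  case Nil
  then show ?case using b by (simp add: qd_one qmul_zero qmul_one_left qd_Q word_deg_def)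
next
  case (Cons x w)
  let ?e = "ev_word m K w"
  have ap: "act m K x (\<lambda>c. qmul m K (qd m K ?e) b c + (-1) ^ word_deg w * qmul m K ?e (qd m K b) c)
      = (\<lambda>c. qmul m K (act m K x (qd m K ?e)) b c + (-1) ^ word_deg w * qmul m K (act m K x ?e) (qd m K b) c)"
    unfolding act_add act_qmul ..
  show ?case
  proof (cases x)
    case (U i)
    have "qd m K (qmul m K (ev_word m K (x # w)) b) = (\<lambda>c. - act m K x (qd m K (qmul m K ?e b)) c)"
      unfolding ev_word_Cons act_qmul[symmetric] U qd_act_U ..
    also have "\<dots> = (\<lambda>c. - qmul m K (act m K x (qd m K ?e)) b c + (-1) ^ word_deg (x # w) * qmul m K (act m K x ?e) (qd m K b) c)"
      unfolding Cons.IH ap by (simp add: U word_deg_def)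
    also have "(\<lambda>c. - qmul m K (act m K x (qd m K ?e)) b c) = qmul m K (qd m K (act m K x ?e)) b"
      unfolding U qd_act_U using qmul_linear_left[of m K "\<lambda>_. 0" "-1" "act m K (U i) (qd m K ?e)" b] qmul_zero(1)[of b] by simp
    then have "(\<lambda>c. - qmul m K (act m K x (qd m K ?e)) b c + (-1) ^ word_deg (x # w) * qmul m K (act m K x ?e) (qd m K b) c)
       = (\<lambda>c. qmul m K (qd m K (act m K x ?e)) b c + (-1) ^ word_deg (x # w) * qmul m K (act m K x ?e) (qd m K b) c)"
      by (intro ext arg_cong2[where f = "(+)"] refl) (simp only: fun_eq_iff)
    finally show ?thesis by (simp only: ev_word_Cons)
  next
    case (T i)
    have "qd m K (qmul m K (ev_word m K (x # w)) b) = (\<lambda>c. act m K (U i) (qmul m K ?e b) c + act m K x (qd m K (qmul m K ?e b)) c)"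
      unfolding ev_word_Cons act_qmul[symmetric] T qd_act_T ..
    also have "\<dots> = (\<lambda>c. (qmul m K (act m K (U i) ?e) b c + qmul m K (act m K x (qd m K ?e)) b c)
        + (-1) ^ word_deg (x # w) * qmul m K (act m K x ?e) (qd m K b) c)"
      unfolding Cons.IH ap act_qmul by (simp add: T word_deg_def add.assoc)
    also have "(\<lambda>c. qmul m K (act m K (U i) ?e) b c + qmul m K (act m K x (qd m K ?e)) b c) = qmul m K (qd m K (act m K x ?e)) b"
      unfolding T qd_act_T using qmul_linear_left[of m K "act m K (U i) ?e" 1 "act m K (T i) (qd m K ?e)" b] by simp
    then have "(\<lambda>c. (qmul m K (act m K (U i) ?e) b c + qmul m K (act m K x (qd m K ?e)) b c)
        + (-1) ^ word_deg (x # w) * qmul m K (act m K x ?e) (qd m K b) c)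
       = (\<lambda>c. qmul m K (qd m K (act m K x ?e)) b c + (-1) ^ word_deg (x # w) * qmul m K (act m K x ?e) (qd m K b) c)"
      by (intro ext arg_cong2[where f = "(+)"] refl) (simp only: fun_eq_iff)
    finally show ?thesis by (simp only: ev_word_Cons)
  qed
qed

text \<open>A homogeneous cochain is a combination of monomials of the same degree, so the sign in
  the rule for words is constant and the rule extends linearly.\<close>

lemma qd_leibniz:
  assumes a: "a \<in> Q_deg (int p)" and b: "b \<in> Q"
  shows "qd m K (qmul m K a b) = (\<lambda>c. qmul m K (qd m K a) b c + (-1) ^ p * qmul m K a (qd m K b) c)"
proof -
  obtain c where c: "Poly_Mapping.keys c \<subseteq> cell_set m K" "ev m K (mono_comb c) = a" "\<forall>x\<in>Poly_Mapping.keys c. \<exists>E. a (fst x, E) \<noteq> 0"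
    using ev_mono_comb[of a] a unfolding Q_deg_def by blast
  have "Poly_Mapping.keys c \<subseteq> {x. card (fst x) = p}"
    using c(3) a by (auto simp: Q_deg_def)
  then have "qd m K (qmul m K (ev m K (mono_comb c)) b)
      = (\<lambda>x. qmul m K (qd m K (ev m K (mono_comb c))) b x + (-1) ^ p * qmul m K (ev m K (mono_comb c)) (qd m K b) x)"
  proof (induction c rule: frag_induction)
    case zero
    show ?case by (simp add: mono_comb_def qmul_zero qd_zero)
  next
    case (one x)
    then show ?case using qd_leibniz_word[OF b, of "mono_word (fst x) (snd x)"]
      by (simp add: mono_comb_def case_prod_unfold word_deg_mono)
  next
    case (diff u v)
    have e: "ev m K (mono_comb (u - v)) = (\<lambda>c. ev m K (mono_comb u) c + (-1) * ev m K (mono_comb v) c)"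
      by (simp add: mono_comb_def frag_extend_diff ev_diff)
    show ?case
      unfolding e qmul_linear_left qd_linear' diff.IH by (simp add: algebra_simps)
  qed
  then show ?thesis unfolding c(2) .
qed

lemma qd_qd: "a \<in> Q \<Longrightarrow> qd m K (qd m K a) = (\<lambda>_. 0)"
proof (rule ext, clarify)
  fix \<sigma> E
  show "qd m K (qd m K a) (\<sigma>, E) = 0"
  proof (cases "(\<sigma>, E) \<in> cell_set m K")
    case True
    have fin: "finite \<sigma>" "\<sigma> \<inter> E = {}" using cell_finite[OF True] True by (auto simp: cell_set_iff)
    have "pairing (qd m K a) (cube_bd (\<sigma>, E)) = pairing (\<lambda>c. pairing a (cube_bd c)) (cube_bd (\<sigma>, E))"
    proof (rule pairing_cong_keys[OF keys_cube_bd[OF fin]])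
      fix x assume "x \<in> {(\<sigma> - {i}, F) |i F. i \<in> \<sigma> \<and> (F = E \<or> F = insert i E)}"
      then have "x \<in> cell_set m K" using cell_back1[OF True] cell_front1[OF True] by auto
      then show "qd m K a x = pairing a (cube_bd x)" by (simp add: qd_def)
    qed
    also have "\<dots> = 0" using cube_bd_bd[of \<sigma> E] by (simp flip: pairing_frag_extend)
    finally show ?thesis by (simp add: qd_def)
  qed (simp add: qd_def)
qed

lemma Q_deg_add: "a \<in> Q_deg p \<Longrightarrow> b \<in> Q_deg p \<Longrightarrow> (\<lambda>c. a c + b c) \<in> Q_deg p"
  unfolding Q_deg_def cube_cochains_def mem_Collect_eq by (metis add.right_neutral)

lemma Q_deg_cmul: "a \<in> Q_deg p \<Longrightarrow> (\<lambda>c. k * a c) \<in> Q_deg p"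
  unfolding Q_deg_def cube_cochains_def mem_Collect_eq by (metis mult_zero_right)

lemma Q_deg_zero: "(\<lambda>_. 0) \<in> Q_deg p"
  by (simp add: Q_deg_def cube_cochains_def)

lemma Q_deg_neg: "p < 0 \<Longrightarrow> a \<in> Q_deg p \<Longrightarrow> a = (\<lambda>_. 0)"
  by (rule ext, clarify) (auto simp: Q_deg_def)

lemma Q_deg_Q: "a \<in> Q_deg p \<Longrightarrow> a \<in> Q"
  by (simp add: Q_deg_def)

lemma qd_Q_deg: "a \<in> Q_deg p \<Longrightarrow> qd m K a \<in> Q_deg (p + 1)"
proof -
  assume a: "a \<in> Q_deg p"
  have "int (card \<sigma>) = p + 1" if "qd m K a (\<sigma>, E) \<noteq> 0" for \<sigma> E
  proof -
    have c: "(\<sigma>, E) \<in> cell_set m K" and ne: "pairing a (cube_bd (\<sigma>, E)) \<noteq> 0"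
      using that by (auto simp: qd_def split: if_splits)
    have fin: "finite \<sigma>" "\<sigma> \<inter> E = {}" using cell_finite[OF c] c by (auto simp: cell_set_iff)
    obtain x where x: "x \<in> Poly_Mapping.keys (cube_bd (\<sigma>, E))" "a x \<noteq> 0"
      using ne pairing_eq_0[of "cube_bd (\<sigma>, E)" a] by auto
    then obtain i F where "x = (\<sigma> - {i}, F)" "i \<in> \<sigma>" using keys_cube_bd[OF fin] by blast
    then have "int (card (\<sigma> - {i})) = p" "card \<sigma> = Suc (card (\<sigma> - {i}))"
      using x(2) a card.remove[OF fin(1), of i] by (auto simp: Q_deg_def)
    then show ?thesis by simp
  qed
  then show ?thesis by (auto simp: Q_deg_def qd_Q)
qed

lemma qmul_Q_deg: "a \<in> Q_deg p \<Longrightarrow> b \<in> Q_deg q \<Longrightarrow> qmul m K a b \<in> Q_deg (p + q)"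
proof -
  assume a: "a \<in> Q_deg p" and b: "b \<in> Q_deg q"
  have "int (card \<sigma>) = p + q" if "qmul m K a b (\<sigma>, E) \<noteq> 0" for \<sigma> E
  proof -
    have c: "(\<sigma>, E) \<in> cell_set m K" and ne: "(\<Sum>S\<in>Pow \<sigma>. sg2 S (\<sigma> - S) * (a (S, E) * b (\<sigma> - S, E \<union> S))) \<noteq> 0"
      using that by (auto simp: qmul_def split: if_splits)
    obtain S where S: "S \<subseteq> \<sigma>" "a (S, E) \<noteq> 0" "b (\<sigma> - S, E \<union> S) \<noteq> 0"
      using sum.not_neutral_contains_not_neutral[OF ne] by auto
    then have "int (card S) = p" "int (card (\<sigma> - S)) = q" using a b by (auto simp: Q_deg_def)
    moreover have "card \<sigma> = card S + card (\<sigma> - S)"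
      using S(1) cell_finite[OF c] by (metis card_Un_disjoint Diff_disjoint finite_Diff finite_subset Un_Diff_cancel Un_absorb1)
    ultimately show ?thesis by simp
  qed
  then show ?thesis by (auto simp: Q_deg_def qmul_Q)
qed

lemma qone_Q_deg: "qone m \<in> Q_deg 0"
proof -
  have "card \<sigma> = 0" if "qone m (\<sigma>, E) \<noteq> 0" for \<sigma> E
    using that by (auto simp: qone_def split: if_splits)
  then show ?thesis by (auto simp: Q_deg_def qone_Q)
qed

definition lift :: "(cell \<Rightarrow> int) \<Rightarrow> SR_elem" where
  "lift = inv_into (carrier SR) evS"

lemma lift: assumes "q \<in> Q" shows "lift q \<in> carrier SR" "evS (lift q) = q"
proof -
  have "q \<in> evS ` carrier SR" using assms evS_bij by (simp add: bij_betw_def)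
  then show "lift q \<in> carrier SR" "evS (lift q) = q"
    unfolding lift_def by (rule inv_into_into, rule f_inv_into_f)
qed

lemma SR_closed:
  "x \<in> carrier SR \<Longrightarrow> y \<in> carrier SR \<Longrightarrow> x \<oplus>\<^bsub>SR\<^esub> y \<in> carrier SR"
  "x \<in> carrier SR \<Longrightarrow> y \<in> carrier SR \<Longrightarrow> x \<otimes>\<^bsub>SR\<^esub> y \<in> carrier SR"
  "\<zero>\<^bsub>SR\<^esub> \<in> carrier SR" "\<one>\<^bsub>SR\<^esub> \<in> carrier SR"
proof -
  interpret ring SR by (rule ring_SR)
  show "x \<in> carrier SR \<Longrightarrow> y \<in> carrier SR \<Longrightarrow> x \<oplus>\<^bsub>SR\<^esub> y \<in> carrier SR"
    "x \<in> carrier SR \<Longrightarrow> y \<in> carrier SR \<Longrightarrow> x \<otimes>\<^bsub>SR\<^esub> y \<in> carrier SR"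
    "\<zero>\<^bsub>SR\<^esub> \<in> carrier SR" "\<one>\<^bsub>SR\<^esub> \<in> carrier SR" by auto
qed

abbreviation SRp where "SRp \<equiv> SR_part m K"
abbreviation SRd where "SRd \<equiv> \<lambda>_::int. SR_diff m K"

lemma SRp_simps [simp]: "x \<otimes>\<^bsub>SRp p\<^esub> y = x \<oplus>\<^bsub>SR\<^esub> y" "\<one>\<^bsub>SRp p\<^esub> = \<zero>\<^bsub>SR\<^esub>"
  by (simp_all add: SR_part_def)

lemma SRp_iff: "x \<in> carrier (SRp p) \<longleftrightarrow> x \<in> carrier SR \<and> evS x \<in> Q_deg p"
  by (simp add: SR_part_carrier)

lemma SRp_carrier: "x \<in> carrier (SRp p) \<Longrightarrow> x \<in> carrier SR"
  by (simp add: SRp_iff)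

lemma lift_SRp: "q \<in> Q_deg p \<Longrightarrow> lift q \<in> carrier (SRp p)"
  using lift[OF Q_deg_Q] by (simp add: SRp_iff)

lemma comm_group_SRp: "comm_group (SRp p)"
proof (rule comm_groupI)
  interpret ring SR by (rule ring_SR)
  fix x y z assume x: "x \<in> carrier (SRp p)" and y: "y \<in> carrier (SRp p)"
  note xy = SRp_carrier[OF x] SRp_carrier[OF y]
  show "x \<otimes>\<^bsub>SRp p\<^esub> y \<in> carrier (SRp p)"
    using x y evS_simps(1)[OF xy] Q_deg_add[of "evS x" p "evS y"] SR_closed(1)[OF xy] by (simp add: SRp_iff)
  show "x \<otimes>\<^bsub>SRp p\<^esub> y = y \<otimes>\<^bsub>SRp p\<^esub> x" using a_comm[OF xy] by simp
  show "\<one>\<^bsub>SRp p\<^esub> \<otimes>\<^bsub>SRp p\<^esub> x = x" using l_zero[OF xy(1)] by simp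
  show "x \<otimes>\<^bsub>SRp p\<^esub> y \<otimes>\<^bsub>SRp p\<^esub> z = x \<otimes>\<^bsub>SRp p\<^esub> (y \<otimes>\<^bsub>SRp p\<^esub> z)" if "z \<in> carrier (SRp p)"
    using a_assoc[OF xy SRp_carrier[OF that]] by simp
  let ?y = "lift (\<lambda>c. (-1) * evS x c)"
  have n: "(\<lambda>c. (-1) * evS x c) \<in> Q_deg p" using x by (intro Q_deg_cmul) (simp add: SRp_iff)
  have "evS (?y \<oplus>\<^bsub>SR\<^esub> x) = evS \<zero>\<^bsub>SR\<^esub>"
    using evS_simps(1)[OF lift(1)[OF Q_deg_Q[OF n]] xy(1)] lift(2)[OF Q_deg_Q[OF n]] by (simp add: evS_zero)
  then have "?y \<oplus>\<^bsub>SR\<^esub> x = \<zero>\<^bsub>SR\<^esub>"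
    using evS_simps(3) lift(1)[OF Q_deg_Q[OF n]] xy(1) SR_closed by blast
  then show "\<exists>y\<in>carrier (SRp p). y \<otimes>\<^bsub>SRp p\<^esub> x = \<one>\<^bsub>SRp p\<^esub>"
    using lift_SRp[OF n] by (intro bexI[of _ ?y]) simp_all
next
  show "\<one>\<^bsub>SRp p\<^esub> \<in> carrier (SRp p)" by (simp add: SRp_iff SR_closed evS_zero Q_deg_zero)
qed

lemma SR_eqI: "x \<in> carrier SR \<Longrightarrow> y \<in> carrier SR \<Longrightarrow> evS x = evS y \<Longrightarrow> x = y"
  using evS_simps(3) by blast

lemma cochain_complex_SR: "cochain_complex SRp SRd"
proof (rule cochain_complex.intro)
  show "comm_group (SRp p)" for p by (rule comm_group_SRp)
  show "SR_diff m K \<in> hom (SRp p) (SRp (p + 1))" for p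
  proof (rule homI)
    fix x assume x: "x \<in> carrier (SRp p)"
    then show "SR_diff m K x \<in> carrier (SRp (p + 1))"
      by (simp add: SRp_iff SR_diff_carrier evS_diff qd_Q_deg)
    fix y assume y: "y \<in> carrier (SRp p)"
    note xy = SRp_carrier[OF x] SRp_carrier[OF y]
    show "SR_diff m K (x \<otimes>\<^bsub>SRp p\<^esub> y) = SR_diff m K x \<otimes>\<^bsub>SRp (p + 1)\<^esub> SR_diff m K y"
      unfolding SRp_simps
      by (rule SR_eqI) (simp_all add: SR_closed SR_diff_carrier xy evS_simps(1) evS_diff qd_linear)
  qed
  show "SR_diff m K (SR_diff m K x) = \<one>\<^bsub>SRp (p + 1 + 1)\<^esub>" if "x \<in> carrier (SRp p)" for x p
    unfolding SRp_simps using SRp_carrier[OF that] evS_simps(4)[of x x]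
    by (intro SR_eqI) (simp_all add: SR_closed SR_diff_carrier evS_diff evS_zero qd_qd)
qed

interpretation SR: cochain_complex SRp SRd by (rule cochain_complex_SR)

lemma SR_Z_iff: "x \<in> SR.Z p \<longleftrightarrow> x \<in> carrier SR \<and> evS x \<in> Q_deg p \<and> qd m K (evS x) = (\<lambda>_. 0)"
proof -
  have "SR_diff m K x = \<zero>\<^bsub>SR\<^esub> \<longleftrightarrow> qd m K (evS x) = (\<lambda>_. 0)" if "x \<in> carrier SR"
    using evS_simps(3)[OF SR_diff_carrier[OF that] SR_closed(3)] evS_diff[OF that] evS_zero by auto
  then show ?thesis by (auto simp: SR.Z_iff SRp_iff)
qed

lemma SR_B_iff: "x \<in> SR.B p \<longleftrightarrow> x \<in> carrier SR \<and> (\<exists>q\<in>Q_deg (p - 1). evS x = qd m K q)"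
proof
  assume "x \<in> SR.B p"
  then show "x \<in> carrier SR \<and> (\<exists>q\<in>Q_deg (p - 1). evS x = qd m K q)"
    by (auto simp: SR.B_iff SRp_iff SR_diff_carrier evS_diff)
next
  assume "x \<in> carrier SR \<and> (\<exists>q\<in>Q_deg (p - 1). evS x = qd m K q)"
  then obtain q where q: "x \<in> carrier SR" "q \<in> Q_deg (p - 1)" "evS x = qd m K q" by blast
  have l: "lift q \<in> carrier SR" "evS (lift q) = q" using lift[OF Q_deg_Q[OF q(2)]] by auto
  have "x = SR_diff m K (lift q)"
    using q l by (intro SR_eqI) (simp_all add: SR_diff_carrier evS_diff)
  then show "x \<in> SR.B p" using lift_SRp[OF q(2)] by (auto simp: SR.B_iff)
qed

lemma dg_ring_SR: "dg_ring SRp SRd (\<lambda>_ _ x y. x \<otimes>\<^bsub>SR\<^esub> y) \<one>\<^bsub>SR\<^esub>"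
proof -
  interpret ring SR by (rule ring_SR)
  note cl = SR_closed evS_simps(1,2)
  show ?thesis
  proof
    fix p q :: int and x y assume pq: "0 \<le> p" "0 \<le> q"
    obtain n k where n: "p = int n" "q = int k" using pq nonneg_int_cases by metis
    show "x \<otimes>\<^bsub>SR\<^esub> y \<in> SR.Z (p + q)" if "x \<in> SR.Z p" "y \<in> SR.Z q"
    proof -
      have xy: "x \<in> carrier SR" "evS x \<in> Q_deg (int n)" "qd m K (evS x) = (\<lambda>_. 0)"
          "y \<in> carrier SR" "evS y \<in> Q_deg (int k)" "qd m K (evS y) = (\<lambda>_. 0)"
        using that n by (auto simp: SR_Z_iff)
      show ?thesis
        using qd_leibniz[OF xy(2) Q_deg_Q[OF xy(5)]] xy n by (simp add: SR_Z_iff cl qmul_Q_deg qmul_zero)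
    qed
    show "x \<otimes>\<^bsub>SR\<^esub> y \<in> SR.B (p + q)" if x: "x \<in> SR.B p" and y: "y \<in> SR.Z q"
    proof -
      obtain a where a: "x \<in> carrier SR" "a \<in> Q_deg (p - 1)" "evS x = qd m K a" using x by (auto simp: SR_B_iff)
      have y': "y \<in> carrier SR" "evS y \<in> Q_deg q" "qd m K (evS y) = (\<lambda>_. 0)" using y by (auto simp: SR_Z_iff)
      have "\<exists>b\<in>Q_deg (p + q - 1). evS (x \<otimes>\<^bsub>SR\<^esub> y) = qd m K b"
      proof (cases n)
        case 0
        then have "a = (\<lambda>_. 0)" using a(2) n by (intro Q_deg_neg) auto
        then have "evS (x \<otimes>\<^bsub>SR\<^esub> y) = qd m K (\<lambda>_. 0)" using a y' by (simp add: cl qmul_zero qd_zero)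
        then show ?thesis using Q_deg_zero by blast
      next
        case (Suc j)
        then have "a \<in> Q_deg (int j)" using a(2) n by simp
        then have "evS (x \<otimes>\<^bsub>SR\<^esub> y) = qd m K (qmul m K a (evS y))"
          using qd_leibniz[of a j "evS y"] a y' Q_deg_Q[OF y'(2)] by (simp add: cl qmul_zero)
        moreover have "qmul m K a (evS y) \<in> Q_deg (p + q - 1)"
          using qmul_Q_deg[OF a(2) y'(2)] by (simp add: algebra_simps)
        ultimately show ?thesis by blast
      qed
      then show ?thesis using a y' by (simp add: SR_B_iff cl)
    qed
    show "x \<otimes>\<^bsub>SR\<^esub> y \<in> SR.B (p + q)" if x: "x \<in> SR.Z p" and y: "y \<in> SR.B q"
    proof -
      obtain a where a: "y \<in> carrier SR" "a \<in> Q_deg (q - 1)" "evS y = qd m K a" using y by (auto simp: SR_B_iff)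
      have x': "x \<in> carrier SR" "evS x \<in> Q_deg (int n)" "qd m K (evS x) = (\<lambda>_. 0)" using x n by (auto simp: SR_Z_iff)
      let ?b = "\<lambda>c. (-1) ^ n * qmul m K (evS x) a c"
      have "qd m K ?b = (\<lambda>c. (-1) ^ n * ((-1) ^ n * qmul m K (evS x) (qd m K a) c))"
        unfolding qd_linear(2) qd_leibniz[OF x'(2) Q_deg_Q[OF a(2)]] x'(3) by (simp add: qmul_zero)
      also have "\<dots> = evS (x \<otimes>\<^bsub>SR\<^esub> y)"
        using a x' by (simp add: cl flip: mult.assoc power_mult_distrib)
      finally have "evS (x \<otimes>\<^bsub>SR\<^esub> y) = qd m K ?b" ..
      moreover have "?b \<in> Q_deg (p + q - 1)"
        using Q_deg_cmul[OF qmul_Q_deg[OF x'(2) a(2)]] n by (simp add: algebra_simps)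
      ultimately show ?thesis using a x' by (auto simp: SR_B_iff cl)
    qed
  next
    fix p q :: int and x x' y assume "x \<in> carrier (SRp p)" "x' \<in> carrier (SRp p)" "y \<in> carrier (SRp q)"
    then show "(x \<otimes>\<^bsub>SRp p\<^esub> x') \<otimes>\<^bsub>SR\<^esub> y = (x \<otimes>\<^bsub>SR\<^esub> y) \<otimes>\<^bsub>SRp (p + q)\<^esub> (x' \<otimes>\<^bsub>SR\<^esub> y)"
      by (simp add: SRp_carrier l_distr)
  next
    fix p q :: int and x y y' assume "x \<in> carrier (SRp p)" "y \<in> carrier (SRp q)" "y' \<in> carrier (SRp q)"
    then show "x \<otimes>\<^bsub>SR\<^esub> (y \<otimes>\<^bsub>SRp q\<^esub> y') = (x \<otimes>\<^bsub>SR\<^esub> y) \<otimes>\<^bsub>SRp (p + q)\<^esub> (x \<otimes>\<^bsub>SR\<^esub> y')"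
      by (simp add: SRp_carrier r_distr)
  next
    fix p q r :: int and x y z assume "x \<in> carrier (SRp p)" "y \<in> carrier (SRp q)" "z \<in> carrier (SRp r)"
    then show "x \<otimes>\<^bsub>SR\<^esub> y \<otimes>\<^bsub>SR\<^esub> z = x \<otimes>\<^bsub>SR\<^esub> (y \<otimes>\<^bsub>SR\<^esub> z)"
      by (simp add: SRp_carrier m_assoc)
  next
    show "\<one>\<^bsub>SR\<^esub> \<in> SR.Z 0" by (simp add: SR_Z_iff SR_closed evS_one qone_Q_deg qd_one)
    show "\<one>\<^bsub>SR\<^esub> \<otimes>\<^bsub>SR\<^esub> x = x" "x \<otimes>\<^bsub>SR\<^esub> \<one>\<^bsub>SR\<^esub> = x" if "x \<in> carrier (SRp p)" for x p
      using SRp_carrier[OF that] by simp_all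
  qed
qed

end

section \<open>The map \<open>\<lambda>\<close>\<close>

text \<open>This gives the uniqueness in the definite descriptions of \<open>lambda_on\<close> and
  \<open>lambda_map\<close>.\<close>

lemma hom_eq_on_subgroup_generated:
  assumes G: "group G" and H: "group H"
    and f: "f \<in> hom (subgroup_generated G S) H" and g: "g \<in> hom (subgroup_generated G S) H"
    and eq: "\<And>x. x \<in> S \<Longrightarrow> f x = g x" and x: "x \<in> carrier (subgroup_generated G S)"
  shows "f x = g x"
proof -
  interpret G: group G by fact
  let ?S = "subgroup_generated G S"
  interpret f: group_hom ?S H f by (simp add: group_hom_def group_hom_axioms_def f H)
  interpret g: group_hom ?S H g by (simp add: group_hom_def group_hom_axioms_def g H)
  have inc: "h \<in> carrier ?S" if "h \<in> carrier G \<inter> S" for h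
    using that by (simp add: carrier_subgroup_generated generate.incl)
  have "x \<in> generate G (carrier G \<inter> S)" using x by (simp add: carrier_subgroup_generated)
  then show ?thesis
  proof (induction rule: generate.induct)
    case one
    show ?case using f.hom_one g.hom_one by simp
  next
    case (incl h)
    then show ?case using eq by blast
  next
    case (inv h)
    then have "inv\<^bsub>?S\<^esub> h = inv\<^bsub>G\<^esub> h" using inc by simp
    then show ?case using f.hom_inv[OF inc[OF inv]] g.hom_inv[OF inc[OF inv]] eq[of h] inv by simp
  next
    case (eng h1 h2)
    then have "h1 \<in> carrier ?S" "h2 \<in> carrier ?S" by (simp_all add: carrier_subgroup_generated)
    then show ?case using f.hom_mult[of h1 h2] g.hom_mult[of h1 h2] eng by simp
  qed
qed

text \<open>A Moebius coefficient at a set containing i is a coefficient of the difference in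
  direction i. Such differences are what the cubical coboundary consists of.\<close>

lemma coef_insert:
  assumes "finite \<tau>" "i \<notin> \<tau>"
  shows "coef \<rho> (insert i \<tau>) q = (\<Sum>E\<in>Pow \<tau>. (-1) ^ (card \<tau> - card E) * (q (\<rho>, insert i E) - q (\<rho>, E)))"
proof -
  let ?f = "\<lambda>E. (-1) ^ (card (insert i \<tau>) - card E) * q (\<rho>, E)"
  have "coef \<rho> (insert i \<tau>) q = sum ?f (Pow \<tau>) + sum ?f (insert i ` Pow \<tau>)"
    unfolding coef_def Pow_insert using assms by (intro sum.union_disjoint) auto
  also have "sum ?f (insert i ` Pow \<tau>) = (\<Sum>E\<in>Pow \<tau>. ?f (insert i E))"
    using assms(2) by (intro sum.reindex_cong[of "insert i"]) (auto simp: inj_on_def)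
  also have "sum ?f (Pow \<tau>) + \<dots> = (\<Sum>E\<in>Pow \<tau>. (-1) ^ (card \<tau> - card E) * (q (\<rho>, insert i E) - q (\<rho>, E)))"
    unfolding sum.distrib[symmetric]
  proof (intro sum.cong refl)
    fix E assume "E \<in> Pow \<tau>"
    then have E: "finite E" "i \<notin> E" "card E \<le> card \<tau>" using assms by (auto intro: finite_subset card_mono)
    then have "card (insert i \<tau>) - card E = Suc (card \<tau> - card E)" "card (insert i \<tau>) - card (insert i E) = card \<tau> - card E"
      using assms by auto
    then show "?f E + ?f (insert i E) = (-1) ^ (card \<tau> - card E) * (q (\<rho>, insert i E) - q (\<rho>, E))"
      by (simp add: right_diff_distrib)
  qed
  finally show ?thesis .
qed

lemma coef_sum_fun: "finite I \<Longrightarrow> coef \<sigma> \<tau> (\<lambda>c. \<Sum>i\<in>I. f i c) = (\<Sum>i\<in>I. coef \<sigma> \<tau> (f i))"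
  by (induction I rule: finite_induct) (simp_all add: coef_add)

lemma coef_cmul: "coef \<sigma> \<tau> (\<lambda>c. k * a c) = k * coef \<sigma> \<tau> a"
  by (simp add: coef_def sum_distrib_left mult.left_commute)

lemma group_simplicial_cochains: "group (simplicial_cochains L)"
proof (rule groupI)
  fix c assume "c \<in> carrier (simplicial_cochains L)"
  then show "\<exists>y\<in>carrier (simplicial_cochains L). y \<otimes>\<^bsub>simplicial_cochains L\<^esub> c = \<one>\<^bsub>simplicial_cochains L\<^esub>"
    by (intro bexI[of _ "\<lambda>\<sigma>. - c \<sigma>"]) (auto simp: simplicial_cochains_def)
qed (auto simp: simplicial_cochains_def, (metis add.right_neutral)+)

lemma comm_group_simplicial_cochain_group: "comm_group (simplicial_cochain_group L q)"
proof (rule comm_groupI)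
  fix c assume c: "c \<in> carrier (simplicial_cochain_group L q)"
  then show "\<exists>y\<in>carrier (simplicial_cochain_group L q). y \<otimes>\<^bsub>simplicial_cochain_group L q\<^esub> c = \<one>\<^bsub>simplicial_cochain_group L q\<^esub>"
    by (intro bexI[of _ "\<lambda>\<sigma>. - c \<sigma>"]) (auto simp: simplicial_cochain_group_def simplicial_cochains_def)
qed (auto simp: simplicial_cochain_group_def simplicial_cochains_def, (metis add.right_neutral add_0)+)

section \<open>The map \<lambda> in coordinates\<close>

context moment_angle_complex
begin

declare One_nat_def [simp del]

abbreviation I where "I \<equiv> Pow {1..m}"
abbreviation L where "L \<equiv> full_subcomplex K"

lemma L_iff: "\<sigma> \<in> L \<omega> \<longleftrightarrow> \<sigma> \<in> K \<and> \<sigma> \<subseteq> \<omega>"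
  unfolding full_subcomplex_def using K_down by blast

lemma cell_I: "(\<sigma>, \<tau>) \<in> cell_set m K \<Longrightarrow> \<sigma> \<union> \<tau> \<in> I"
  unfolding cell_set_iff using K_vertices by blast

lemma cell_complement: "\<sigma> \<in> L \<omega> \<Longrightarrow> \<omega> \<in> I \<Longrightarrow> (\<sigma>, \<omega> - \<sigma>) \<in> cell_set m K"
  unfolding cell_set_iff L_iff by blast

text \<open>The component of \<lambda> at \<omega> by a formula valid on all of
  \<open>R / I_K\<close>: the coefficient of the monomial with u-part \<sigma> and t-part \<omega> -
  \<sigma>.\<close>

definition \<Lambda> :: "SR_elem \<Rightarrow> nat set \<Rightarrow> nat set \<Rightarrow> int" where
  "\<Lambda> x \<omega> = (\<lambda>\<sigma>. if \<sigma> \<in> L \<omega> then coef \<sigma> (\<omega> - \<sigma>) (evS x) else 0)"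

lemma \<Lambda>_carrier: "\<Lambda> x \<omega> \<in> carrier (simplicial_cochains (L \<omega>))"
  by (auto simp: \<Lambda>_def simplicial_cochains_def)

lemma \<Lambda>_add: "x \<in> carrier SR \<Longrightarrow> y \<in> carrier SR \<Longrightarrow> \<Lambda> (x \<oplus>\<^bsub>SR\<^esub> y) \<omega> = (\<lambda>\<sigma>. \<Lambda> x \<omega> \<sigma> + \<Lambda> y \<omega> \<sigma>)"
  by (auto simp: \<Lambda>_def evS_simps(1) coef_add)

lemma \<Lambda>_zero: "\<Lambda> \<zero>\<^bsub>SR\<^esub> \<omega> = (\<lambda>_. 0)"
  by (auto simp: \<Lambda>_def evS_zero)

lemma \<Lambda>_hom: "(\<lambda>x. \<Lambda> x \<omega>) \<in> hom (add_monoid SR) (simplicial_cochains (L \<omega>))"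
  by (rule homI) (simp_all add: \<Lambda>_carrier \<Lambda>_add, simp add: simplicial_cochains_def)

lemma SR_monomial:
  assumes "(\<sigma>, \<tau>) \<in> cell_set m K"
  shows "SR_monomial m K \<sigma> \<tau> \<in> carrier SR" "evS (SR_monomial m K \<sigma> \<tau>) = ev_word m K (mono_word \<sigma> \<tau>)"
proof -
  have "\<sigma> \<subseteq> {1..m}" "\<tau> \<subseteq> {1..m}" using assms K_vertices unfolding cell_set_iff by blast+
  then have F: "frag_of (mono_word \<sigma> \<tau>) \<in> carrier F" using mono_word_F by simp
  have M: "SR_monomial m K \<sigma> \<tau> = \<pi> (frag_of (mono_word \<sigma> \<tau>))" by (simp add: SR_monomial_def mono_word_def)
  show "SR_monomial m K \<sigma> \<tau> \<in> carrier SR" unfolding M carrier_SR using F by (rule imageI)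
  show "evS (SR_monomial m K \<sigma> \<tau>) = ev_word m K (mono_word \<sigma> \<tau>)" unfolding M evS_proj[OF F] by simp
qed

lemma \<Lambda>_monomial:
  assumes st: "(\<sigma>, \<tau>) \<in> cell_set m K" and \<omega>: "\<omega> \<in> I"
  shows "\<Lambda> (SR_monomial m K \<sigma> \<tau>) \<omega> = (if \<sigma> \<union> \<tau> = \<omega> then dual_cochain \<sigma> else (\<lambda>_. 0))"
proof (rule ext)
  fix \<rho>
  have fin: "finite \<sigma>" "finite \<tau>" "\<sigma> \<inter> \<tau> = {}" and K: "\<sigma> \<in> K"
    using cell_finite[OF st] st by (auto simp: cell_set_iff)
  show "\<Lambda> (SR_monomial m K \<sigma> \<tau>) \<omega> \<rho> = (if \<sigma> \<union> \<tau> = \<omega> then dual_cochain \<sigma> else (\<lambda>_. 0)) \<rho>"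
  proof (cases "\<rho> \<in> L \<omega>")
    case True
    then have "\<Lambda> (SR_monomial m K \<sigma> \<tau>) \<omega> \<rho> = of_bool (\<sigma> = \<rho> \<and> \<tau> = \<omega> - \<rho>)"
      using coef_mono_word[OF fin cell_complement[OF True \<omega>]] by (simp add: \<Lambda>_def SR_monomial(2)[OF st])
    moreover have "(\<sigma> = \<rho> \<and> \<tau> = \<omega> - \<rho>) \<longleftrightarrow> (\<sigma> = \<rho> \<and> \<sigma> \<union> \<tau> = \<omega>)"
      using fin(3) True unfolding L_iff by blast
    ultimately show ?thesis by (auto simp: dual_cochain_def)
  next
    case False
    then have "\<not> (\<sigma> \<union> \<tau> = \<omega> \<and> \<rho> = \<sigma>)" using K unfolding L_iff by blast
    then show ?thesis using False by (auto simp: \<Lambda>_def dual_cochain_def)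
  qed
qed

abbreviation monomials where
  "monomials \<omega> \<equiv> {SR_monomial m K \<sigma> \<tau> |\<sigma> \<tau>. \<sigma> \<in> K \<and> \<sigma> \<inter> \<tau> = {} \<and> \<sigma> \<union> \<tau> = \<omega>}"

lemma monomial_cell: "\<omega> \<in> I \<Longrightarrow> \<sigma> \<in> K \<and> \<sigma> \<inter> \<tau> = {} \<and> \<sigma> \<union> \<tau> = \<omega> \<Longrightarrow> (\<sigma>, \<tau>) \<in> cell_set m K"
  unfolding cell_set_iff by blast

lemma group_add_SR: "group (add_monoid SR)"
proof -
  interpret ring SR by (rule ring_SR)
  show ?thesis by (rule a_group)
qed

lemma group_SR_restrict: "group (SR_restrict m K \<omega>)"
  unfolding SR_restrict_def by (rule group.group_subgroup_generated[OF group_add_SR])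

lemma SR_restrict_sub: "x \<in> carrier (SR_restrict m K \<omega>) \<Longrightarrow> x \<in> carrier SR"
  unfolding SR_restrict_def using group.carrier_subgroup_generated_subset[OF group_add_SR] by fastforce

lemma hom_SR_restrict:
  assumes "f \<in> hom (add_monoid SR) H"
  shows "f \<in> hom (SR_restrict m K \<omega>) H"
  using assms SR_restrict_sub[of _ \<omega>] by (auto simp: hom_def Pi_iff) (simp add: SR_restrict_def)

lemma \<Lambda>_restrict:
  assumes "\<omega> \<in> I" "\<eta> \<in> I" "\<eta> \<noteq> \<omega>" "x \<in> carrier (SR_restrict m K \<omega>)"
  shows "\<Lambda> x \<eta> = (\<lambda>_. 0)"
proof (rule hom_eq_on_subgroup_generated[OF group_add_SR group_simplicial_cochains[of "L \<eta>"], where f = "\<lambda>x. \<Lambda> x \<eta>" and g = "\<lambda>_. (\<lambda>_. 0)" and S = "monomials \<omega>"])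
  show "(\<lambda>x. \<Lambda> x \<eta>) \<in> hom (subgroup_generated (add_monoid SR) (monomials \<omega>)) (simplicial_cochains (L \<eta>))"
    using hom_SR_restrict[OF \<Lambda>_hom] by (simp add: SR_restrict_def)
  show "(\<lambda>_ _. 0) \<in> hom (subgroup_generated (add_monoid SR) (monomials \<omega>)) (simplicial_cochains (L \<eta>))"
    by (rule homI) (simp_all add: simplicial_cochains_def)
  show "x \<in> carrier (subgroup_generated (add_monoid SR) (monomials \<omega>))" using assms(4) by (simp add: SR_restrict_def)
  fix y assume "y \<in> monomials \<omega>"
  then obtain \<sigma> \<tau> where y: "y = SR_monomial m K \<sigma> \<tau>" "\<sigma> \<in> K \<and> \<sigma> \<inter> \<tau> = {} \<and> \<sigma> \<union> \<tau> = \<omega>" by blast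
  show "\<Lambda> y \<eta> = (\<lambda>_. 0)"
    using \<Lambda>_monomial[OF monomial_cell[OF assms(1) y(2)] assms(2)] y assms(3) by auto
qed

text \<open>The formula is a homomorphism with the prescribed values by
  \<open>\<Lambda>_monomial\<close>, and a homomorphism is determined by its values on the
  generating monomials.\<close>

lemma lambda_on_eq:
  assumes \<omega>: "\<omega> \<in> I"
  shows "lambda_on m K \<omega> = restrict (\<lambda>x. \<Lambda> x \<omega>) (carrier (SR_restrict m K \<omega>))"
  unfolding lambda_on_def
proof (rule the_equality)
  let ?G = "SR_restrict m K \<omega>" and ?H = "simplicial_cochains (L \<omega>)"
  interpret G: group ?G by (rule group_SR_restrict)
  have gen: "SR_monomial m K \<sigma> \<tau> \<in> carrier ?G" if "\<sigma> \<in> K \<and> \<sigma> \<inter> \<tau> = {} \<and> \<sigma> \<union> \<tau> = \<omega>" for \<sigma> \<tau>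
    unfolding SR_restrict_def carrier_subgroup_generated
    using SR_monomial(1)[OF monomial_cell[OF \<omega> that]] that by (intro generate.incl) auto
  have hom: "restrict (\<lambda>x. \<Lambda> x \<omega>) (carrier ?G) \<in> hom ?G ?H"
    using hom_SR_restrict[OF \<Lambda>_hom] by (simp add: hom_def Pi_iff)
  have val: "restrict (\<lambda>x. \<Lambda> x \<omega>) (carrier ?G) (SR_monomial m K \<sigma> \<tau>) = dual_cochain \<sigma>"
    if st: "\<sigma> \<in> K \<and> \<sigma> \<inter> \<tau> = {} \<and> \<sigma> \<union> \<tau> = \<omega>" for \<sigma> \<tau>
    using gen[OF st] \<Lambda>_monomial[OF monomial_cell[OF \<omega> st] \<omega>] st by simp
  show "restrict (\<lambda>x. \<Lambda> x \<omega>) (carrier ?G) \<in> extensional (carrier ?G) \<and>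
      restrict (\<lambda>x. \<Lambda> x \<omega>) (carrier ?G) \<in> hom ?G ?H \<and>
      (\<forall>\<sigma> \<tau>. \<sigma> \<in> K \<longrightarrow> \<sigma> \<inter> \<tau> = {} \<longrightarrow> \<sigma> \<union> \<tau> = \<omega> \<longrightarrow>
         restrict (\<lambda>x. \<Lambda> x \<omega>) (carrier ?G) (SR_monomial m K \<sigma> \<tau>) = dual_cochain \<sigma>)"
    using hom val by blast
  fix f assume f: "f \<in> extensional (carrier ?G) \<and> f \<in> hom ?G ?H \<and>
      (\<forall>\<sigma> \<tau>. \<sigma> \<in> K \<longrightarrow> \<sigma> \<inter> \<tau> = {} \<longrightarrow> \<sigma> \<union> \<tau> = \<omega> \<longrightarrow> f (SR_monomial m K \<sigma> \<tau>) = dual_cochain \<sigma>)"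
  show "f = restrict (\<lambda>x. \<Lambda> x \<omega>) (carrier ?G)"
  proof (rule extensionalityI[of _ "carrier ?G"])
    fix x assume x: "x \<in> carrier ?G"
    show "f x = restrict (\<lambda>x. \<Lambda> x \<omega>) (carrier ?G) x"
    proof (rule hom_eq_on_subgroup_generated[OF group_add_SR group_simplicial_cochains[of "L \<omega>"], where S = "monomials \<omega>"])
      show "y \<in> monomials \<omega> \<Longrightarrow> f y = restrict (\<lambda>x. \<Lambda> x \<omega>) (carrier ?G) y" for y
        using f val by (elim CollectE exE conjE) (simp only: simp_thms)
    qed (use f hom x in \<open>simp_all only: SR_restrict_def\<close>)
  qed (use f in auto)
qed

definition Lam :: "SR_elem \<Rightarrow> nat set \<Rightarrow> nat set \<Rightarrow> int" where
  "Lam x = (\<lambda>\<omega>\<in>I. \<Lambda> x \<omega>)"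

lemma target_carrier: "carrier (lambda_target m K) = (\<Pi>\<^sub>E \<omega>\<in>I. carrier (simplicial_cochains (L \<omega>)))"
  unfolding lambda_target_def by (subst carrier_sum_group) (auto simp: group_simplicial_cochains)

lemma Lam_hom: "Lam \<in> hom (add_monoid SR) (lambda_target m K)"
proof (rule homI)
  show "Lam x \<in> carrier (lambda_target m K)" for x
    unfolding target_carrier Lam_def using \<Lambda>_carrier by (rule restrict_PiE_iff[THEN iffD2, rule_format])
  show "Lam (x \<otimes>\<^bsub>add_monoid SR\<^esub> y) = Lam x \<otimes>\<^bsub>lambda_target m K\<^esub> Lam y"
    if "x \<in> carrier (add_monoid SR)" "y \<in> carrier (add_monoid SR)" for x y
    using that by (auto simp: lambda_target_def Lam_def \<Lambda>_add simplicial_cochains_def cong: restrict_cong)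
qed

text \<open>The summands together contain all monomials, so a homomorphism on \<open>R / I_K\<close>
  is determined by its restrictions to them.\<close>

lemma SR_generated:
  "carrier (subgroup_generated (add_monoid SR) (\<Union>\<omega>\<in>I. carrier (SR_restrict m K \<omega>))) = carrier SR"
proof
  let ?S = "\<Union>\<omega>\<in>I. carrier (SR_restrict m K \<omega>)"
  interpret ring SR by (rule ring_SR)
  have gm: "SR_monomial m K \<sigma> \<tau> \<in> ?S" if "(\<sigma>, \<tau>) \<in> cell_set m K" for \<sigma> \<tau>
  proof
    show "\<sigma> \<union> \<tau> \<in> I" by (rule cell_I[OF that])
    show "SR_monomial m K \<sigma> \<tau> \<in> carrier (SR_restrict m K (\<sigma> \<union> \<tau>))"
      unfolding SR_restrict_def carrier_subgroup_generated
      using SR_monomial(1)[OF that] that by (intro generate.incl) (auto simp: cell_set_iff)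
  qed
  show "carrier (subgroup_generated (add_monoid SR) ?S) \<subseteq> carrier SR"
    using group.carrier_subgroup_generated_subset[OF group_add_SR, of ?S] by simp
  show "carrier SR \<subseteq> carrier (subgroup_generated (add_monoid SR) ?S)"
  proof
    fix x assume "x \<in> carrier SR"
    then obtain c where c: "Poly_Mapping.keys c \<subseteq> cell_set m K" "x = \<pi> (mono_comb c)"
      using SR_eq_mono_comb by blast
    interpret A: subgroup "carrier (subgroup_generated (add_monoid SR) ?S)" "add_monoid SR"
      by (rule group.subgroup_subgroup_generated[OF group_add_SR])
    have "Poly_Mapping.keys c \<subseteq> cell_set m K \<and> \<pi> (mono_comb c) \<in> carrier (subgroup_generated (add_monoid SR) ?S)"
      using c(1)
    proof (induction c rule: frag_induction)
      case zero
      show ?case using A.one_closed by (simp add: mono_comb_def SR_proj_zero)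
    next
      case (one c)
      obtain \<sigma> \<tau> where st: "c = (\<sigma>, \<tau>)" by fastforce
      then show ?case using one gm[of \<sigma> \<tau>] SR_monomial(1)[of \<sigma> \<tau>]
        by (auto simp: mono_comb_def SR_monomial_def mono_word_def carrier_subgroup_generated intro!: generate.incl)
    next
      case (diff a b)
      let ?a = "\<pi> (mono_comb a)" and ?b = "\<pi> (mono_comb b)"
      have k: "Poly_Mapping.keys (a - b) \<subseteq> cell_set m K" using diff keys_diff_subset by blast
      have F: "mono_comb a \<in> carrier F" "mono_comb b \<in> carrier F" "mono_comb (a - b) \<in> carrier F"
        using diff k mono_comb_F by blast+
      then have car: "?a \<in> carrier SR" "?b \<in> carrier SR" "\<pi> (mono_comb (a - b)) \<in> carrier SR"
        by (auto simp: carrier_SR)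
      have "mono_comb (a - b) + mono_comb b = mono_comb a" by (simp add: mono_comb_def frag_extend_diff)
      then have "\<pi> (mono_comb (a - b)) \<oplus>\<^bsub>SR\<^esub> ?b = ?a" using SR_proj_simps(1)[OF F(3,2)] by simp
      then have "\<pi> (mono_comb (a - b)) = ?a \<ominus>\<^bsub>SR\<^esub> ?b"
        using car by (metis a_minus_def add.inv_closed add.inv_solve_right)
      then show ?case using diff A.m_closed A.m_inv_closed k
        by (auto simp: a_minus_def a_inv_def)
    qed
    then show "x \<in> carrier (subgroup_generated (add_monoid SR) ?S)" using c by simp
  qed
qed

text \<open>Existence rests on \<open>\<Lambda>_restrict\<close>: on the summand at \<omega> all
  other components vanish. Uniqueness is generation by the summands.\<close>

lemma lambda_map_eq: "lambda_map m K = restrict Lam (carrier SR)"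
  unfolding lambda_map_def
proof (rule the_equality)
  have hom: "restrict Lam (carrier SR) \<in> hom (add_monoid SR) (lambda_target m K)"
    using Lam_hom SR_closed(1) by (simp add: hom_def Pi_iff)
  have val: "restrict Lam (carrier SR) x = (\<lambda>\<eta>\<in>I. if \<eta> = \<omega> then lambda_on m K \<omega> x else (\<lambda>_. 0))"
    if "\<omega> \<in> I" "x \<in> carrier (SR_restrict m K \<omega>)" for \<omega> x
    using SR_restrict_sub[OF that(2)] \<Lambda>_restrict[OF that(1) _ _ that(2)] that
    by (auto simp: Lam_def lambda_on_eq fun_eq_iff restrict_def)
  show "restrict Lam (carrier SR) \<in> extensional (carrier SR) \<and>
      restrict Lam (carrier SR) \<in> hom (add_monoid SR) (lambda_target m K) \<and>
      (\<forall>\<omega>\<in>I. \<forall>x\<in>carrier (SR_restrict m K \<omega>). restrict Lam (carrier SR) x =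
         (\<lambda>\<eta>\<in>I. if \<eta> = \<omega> then lambda_on m K \<omega> x else (\<lambda>_. 0)))"
    using hom val by blast
  fix f assume f: "f \<in> extensional (carrier SR) \<and> f \<in> hom (add_monoid SR) (lambda_target m K) \<and>
      (\<forall>\<omega>\<in>I. \<forall>x\<in>carrier (SR_restrict m K \<omega>). f x = (\<lambda>\<eta>\<in>I. if \<eta> = \<omega> then lambda_on m K \<omega> x else (\<lambda>_. 0)))"
  have G: "group (lambda_target m K)" unfolding lambda_target_def by (rule sum_group) (rule group_simplicial_cochains)
  have h: "h \<in> hom (subgroup_generated (add_monoid SR) (\<Union>\<omega>\<in>I. carrier (SR_restrict m K \<omega>))) (lambda_target m K)"
    if "h \<in> hom (add_monoid SR) (lambda_target m K)" for h
    using that unfolding hom_def SR_generated by simp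
  show "f = restrict Lam (carrier SR)"
  proof (rule extensionalityI[of _ "carrier SR"])
    fix x assume x: "x \<in> carrier SR"
    show "f x = restrict Lam (carrier SR) x"
    proof (rule hom_eq_on_subgroup_generated[OF group_add_SR G h h[OF hom]])
      fix y assume "y \<in> (\<Union>\<omega>\<in>I. carrier (SR_restrict m K \<omega>))"
      then obtain \<omega> where y: "\<omega> \<in> I" "y \<in> carrier (SR_restrict m K \<omega>)" by blast
      then show "f y = restrict Lam (carrier SR) y" using f val[OF y] by simp
    qed (use f x SR_generated in auto)
  qed (use f in auto)
qed

lemma \<Lambda>_coef: "(\<sigma>, \<tau>) \<in> cell_set m K \<Longrightarrow> \<Lambda> x (\<sigma> \<union> \<tau>) \<sigma> = coef \<sigma> \<tau> (evS x)"
proof -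
  assume c: "(\<sigma>, \<tau>) \<in> cell_set m K"
  then have "\<sigma> \<in> L (\<sigma> \<union> \<tau>)" "\<sigma> \<union> \<tau> - \<sigma> = \<tau>" unfolding cell_set_iff L_iff by blast+
  then show ?thesis by (simp add: \<Lambda>_def)
qed

lemma cell_sub: "(\<sigma>, E) \<in> cell_set m K \<Longrightarrow> \<tau> \<subseteq> E \<Longrightarrow> (\<sigma>, \<tau>) \<in> cell_set m K"
  unfolding cell_set_iff by blast

lemma evS_\<Lambda>:
  assumes "(\<sigma>, E) \<in> cell_set m K"
  shows "evS x (\<sigma>, E) = (\<Sum>\<tau>\<in>Pow E. \<Lambda> x (\<sigma> \<union> \<tau>) \<sigma>)"
proof -
  have "evS x (\<sigma>, E) = (\<Sum>\<tau>\<in>Pow E. coef \<sigma> \<tau> (evS x))" using coef_inversion cell_finite[OF assms] by blast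
  also have "\<dots> = (\<Sum>\<tau>\<in>Pow E. \<Lambda> x (\<sigma> \<union> \<tau>) \<sigma>)"
    using \<Lambda>_coef[OF cell_sub[OF assms]] by (intro sum.cong refl) auto
  finally show ?thesis .
qed

lemma \<Lambda>_inj:
  assumes "x \<in> carrier SR" "y \<in> carrier SR" "\<And>\<omega>. \<omega> \<in> I \<Longrightarrow> \<Lambda> x \<omega> = \<Lambda> y \<omega>"
  shows "x = y"
proof (rule SR_eqI[OF assms(1,2)], rule ext, clarify)
  fix \<sigma> E
  show "evS x (\<sigma>, E) = evS y (\<sigma>, E)"
  proof (cases "(\<sigma>, E) \<in> cell_set m K")
    case True
    then show ?thesis
      using assms(3)[OF cell_I[OF cell_sub[OF True]]] by (auto simp: evS_\<Lambda> intro!: sum.cong)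
  qed (use evS_simps(4) Q_outside assms(1,2) in \<open>metis\<close>)
qed

text \<open>The preimage is the cochain q obtained by reading \<open>evS_\<Lambda>\<close>
  backwards: its value on (\<sigma>, E) is the sum of the prescribed coefficients over the subsets
  of E.\<close>

lemma \<Lambda>_surj:
  assumes a: "\<And>\<omega>. \<omega> \<in> I \<Longrightarrow> a \<omega> \<in> carrier (simplicial_cochains (L \<omega>))"
  shows "\<exists>x\<in>carrier SR. \<forall>\<omega>\<in>I. \<Lambda> x \<omega> = a \<omega>"
proof -
  define q where "q = (\<lambda>(\<sigma>, E). if (\<sigma>, E) \<in> cell_set m K then \<Sum>\<tau>\<in>Pow E. a (\<sigma> \<union> \<tau>) \<sigma> else 0)"
  have "q \<in> Q" by (auto simp: q_def cube_cochains_def)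
  note l = lift[OF this]
  have "\<Lambda> (lift q) \<omega> \<sigma> = a \<omega> \<sigma>" if \<omega>: "\<omega> \<in> I" for \<omega> \<sigma>
  proof (cases "\<sigma> \<in> L \<omega>")
    case True
    define \<tau> where "\<tau> = \<omega> - \<sigma>"
    have c: "(\<sigma>, \<tau>) \<in> cell_set m K" unfolding \<tau>_def by (rule cell_complement[OF True \<omega>])
    have fin: "finite \<tau>" using cell_finite[OF c] by blast
    have "q (\<sigma>, E) = (\<Sum>V\<in>Pow \<tau>. a (\<sigma> \<union> V) \<sigma> * of_bool (V \<subseteq> E))" if E: "E \<in> Pow \<tau>" for E
    proof -
      have "(\<Sum>V\<in>Pow \<tau>. a (\<sigma> \<union> V) \<sigma> * of_bool (V \<subseteq> E)) = (\<Sum>V\<in>Pow E. a (\<sigma> \<union> V) \<sigma> * of_bool (V \<subseteq> E))"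
        using E fin by (intro sum.mono_neutral_right) auto
      also have "\<dots> = q (\<sigma>, E)" using cell_sub[OF c, of E] E by (auto simp: q_def intro!: sum.cong)
      finally show ?thesis ..
    qed
    then have "coef \<sigma> \<tau> q = coef \<sigma> \<tau> (\<lambda>(\<sigma>', E). \<Sum>V\<in>Pow \<tau>. a (\<sigma> \<union> V) \<sigma> * of_bool (V \<subseteq> E))"
      unfolding coef_def by (intro sum.cong refl) simp
    also have "\<dots> = coef \<sigma> \<tau> (\<lambda>c. \<Sum>V\<in>Pow \<tau>. a (\<sigma> \<union> V) \<sigma> * of_bool (V \<subseteq> snd c))"
      by (simp add: case_prod_unfold)
    also have "\<dots> = (\<Sum>V\<in>Pow \<tau>. a (\<sigma> \<union> V) \<sigma> * coef \<sigma> \<tau> (\<lambda>c. of_bool (V \<subseteq> snd c)))"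
      using fin by (simp only: coef_sum_fun coef_cmul finite_Pow_iff)
    also have "\<dots> = (\<Sum>V\<in>Pow \<tau>. if V = \<tau> then a (\<sigma> \<union> V) \<sigma> else 0)"
      by (intro sum.cong refl) (subst coef_mobius[OF fin], auto)
    also have "\<dots> = a (\<sigma> \<union> \<tau>) \<sigma>" using fin by (simp add: sum.delta)
    also have "\<sigma> \<union> \<tau> = \<omega>" using True unfolding \<tau>_def L_iff by blast
    finally show ?thesis using True by (simp add: \<Lambda>_def l \<tau>_def)
  next
    case False
    then have "a \<omega> \<sigma> = 0" using a[OF \<omega>] by (auto simp: simplicial_cochains_def)
    then show ?thesis using False by (simp add: \<Lambda>_def)
  qed
  then show ?thesis using l(1) by blast
qed

text \<open>For fixed \<sigma> the values of \<open>evS x\<close> and the coefficients are signed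
  sums of each other, so both live on the same cardinalities of \<sigma>. The shift by one arises
  because a simplex with p vertices has dimension p - 1.\<close>

lemma \<Lambda>_degree:
  "x \<in> carrier (SRp p) \<longleftrightarrow> x \<in> carrier SR \<and> (\<forall>\<omega>\<in>I. \<Lambda> x \<omega> \<in> carrier (simplicial_cochain_group (L \<omega>) (p - 1)))"
proof -
  have "evS x \<in> Q_deg p \<longleftrightarrow> (\<forall>\<omega>\<in>I. \<Lambda> x \<omega> \<in> carrier (simplicial_cochain_group (L \<omega>) (p - 1)))" if x: "x \<in> carrier SR"
  proof
    assume q: "evS x \<in> Q_deg p"
    have "int (card \<sigma>) = p" if "\<Lambda> x \<omega> \<sigma> \<noteq> 0" for \<omega> \<sigma>
    proof -
      have "coef \<sigma> (\<omega> - \<sigma>) (evS x) \<noteq> 0" using that by (auto simp: \<Lambda>_def split: if_splits)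
      then obtain E where "evS x (\<sigma>, E) \<noteq> 0"
        unfolding coef_def using sum.not_neutral_contains_not_neutral by fastforce
      then show ?thesis using q by (auto simp: Q_deg_def)
    qed
    then show "\<forall>\<omega>\<in>I. \<Lambda> x \<omega> \<in> carrier (simplicial_cochain_group (L \<omega>) (p - 1))"
      using \<Lambda>_carrier[of x] by (simp add: simplicial_cochain_group_def)
  next
    assume l: "\<forall>\<omega>\<in>I. \<Lambda> x \<omega> \<in> carrier (simplicial_cochain_group (L \<omega>) (p - 1))"
    have "int (card \<sigma>) = p" if ne: "evS x (\<sigma>, E) \<noteq> 0" for \<sigma> E
    proof -
      have c: "(\<sigma>, E) \<in> cell_set m K" using Q_outside[OF evS_simps(4)[OF x x]] ne by blast
      obtain \<tau> where t: "\<tau> \<in> Pow E" "\<Lambda> x (\<sigma> \<union> \<tau>) \<sigma> \<noteq> 0"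
        using ne unfolding evS_\<Lambda>[OF c] by (rule sum.not_neutral_contains_not_neutral)
      have "\<sigma> \<union> \<tau> \<in> I" using cell_I[OF cell_sub[OF c]] t by blast
      then have "\<Lambda> x (\<sigma> \<union> \<tau>) \<in> carrier (simplicial_cochain_group (L (\<sigma> \<union> \<tau>)) (p - 1))" using l by blast
      then show ?thesis using t(2) by (simp add: simplicial_cochain_group_def)
    qed
    then show "evS x \<in> Q_deg p" using evS_simps(4)[OF x x] by (auto simp: Q_deg_def)
  qed
  then show ?thesis by (auto simp: SRp_iff)
qed

text \<open>By \<open>coef_insert\<close> the differences in the cubical coboundary become
  coefficients on the faces of \<sigma>. The sign \<open>sg i \<sigma>\<close> is the position sign
  of the vertex i, as in the simplicial coboundary.\<close>

lemma \<Lambda>_diff: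
  assumes x: "x \<in> carrier SR" and \<omega>: "\<omega> \<in> I"
  shows "\<Lambda> (SR_diff m K x) \<omega> = simplicial_coboundary (L \<omega>) (\<Lambda> x \<omega>)"
proof (rule ext)
  fix \<sigma>
  show "\<Lambda> (SR_diff m K x) \<omega> \<sigma> = simplicial_coboundary (L \<omega>) (\<Lambda> x \<omega>) \<sigma>"
  proof (cases "\<sigma> \<in> L \<omega>")
    case True
    define \<tau> where "\<tau> = \<omega> - \<sigma>"
    let ?q = "evS x"
    have c: "(\<sigma>, \<tau>) \<in> cell_set m K" unfolding \<tau>_def by (rule cell_complement[OF True \<omega>])
    have fin: "finite \<tau>" "finite \<sigma>" "\<sigma> \<inter> \<tau> = {}" using cell_finite[OF c] c by (auto simp: cell_set_iff)
    have "coef \<sigma> \<tau> (qd m K ?q)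
      = (\<Sum>E\<in>Pow \<tau>. (-1) ^ (card \<tau> - card E) * (\<Sum>i\<in>\<sigma>. sg i \<sigma> * (?q (\<sigma> - {i}, insert i E) - ?q (\<sigma> - {i}, E))))"
      unfolding coef_def using cell_sub[OF c] by (intro sum.cong refl) (auto simp: qd_def pairing_cube_bd)
    also have "\<dots> = (\<Sum>i\<in>\<sigma>. \<Sum>E\<in>Pow \<tau>. (-1) ^ (card \<tau> - card E) * (sg i \<sigma> * (?q (\<sigma> - {i}, insert i E) - ?q (\<sigma> - {i}, E))))"
      unfolding sum_distrib_left by (rule sum.swap)
    also have "\<dots> = (\<Sum>i\<in>\<sigma>. sg i \<sigma> * coef (\<sigma> - {i}) (insert i \<tau>) ?q)"
    proof (intro sum.cong refl)
      fix i assume "i \<in> \<sigma>"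
      then have "i \<notin> \<tau>" using fin by blast
      then show "(\<Sum>E\<in>Pow \<tau>. (-1) ^ (card \<tau> - card E) * (sg i \<sigma> * (?q (\<sigma> - {i}, insert i E) - ?q (\<sigma> - {i}, E))))
          = sg i \<sigma> * coef (\<sigma> - {i}) (insert i \<tau>) ?q"
        unfolding coef_insert[OF fin(1) \<open>i \<notin> \<tau>\<close>] sum_distrib_left by (intro sum.cong refl) (simp add: mult.left_commute)
    qed
    also have "\<dots> = (\<Sum>i\<in>\<sigma>. sg i \<sigma> * \<Lambda> x \<omega> (\<sigma> - {i}))"
    proof (intro sum.cong refl)
      fix i assume i: "i \<in> \<sigma>"
      \<comment> \<open>Removing i from the u-part adds it to the t-part, so the differential stays
        in the summand at \<omega>.\<close>
      have "\<omega> - (\<sigma> - {i}) = insert i \<tau>" using i True unfolding \<tau>_def L_iff by blast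
      moreover have "\<sigma> - {i} \<in> L \<omega>" using True K_down unfolding L_iff by blast
      ultimately show "sg i \<sigma> * coef (\<sigma> - {i}) (insert i \<tau>) ?q = sg i \<sigma> * \<Lambda> x \<omega> (\<sigma> - {i})" by (simp add: \<Lambda>_def)
    qed
    finally show ?thesis using True x by (simp add: \<Lambda>_def evS_diff simplicial_coboundary_def sg_def \<tau>_def)
  qed (simp add: \<Lambda>_def simplicial_coboundary_def)
qed

end

subsection \<open>The isomorphism in cohomology\<close>

context moment_angle_complex
begin

declare One_nat_def [simp del]

interpretation SR: cochain_complex SRp SRd by (rule cochain_complex_SR)

abbreviation Sg where "Sg \<omega> \<equiv> simplicial_cochain_group (L \<omega>)"
abbreviation Sd where "Sd \<omega> \<equiv> \<lambda>_::int. simplicial_coboundary (L \<omega>)"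
abbreviation SZ where "SZ \<omega> \<equiv> cocycles (Sg \<omega>) (Sd \<omega>)"
abbreviation SB where "SB \<omega> \<equiv> coboundaries (Sg \<omega>) (Sd \<omega>)"
abbreviation scls where "scls \<omega> q c \<equiv> SB \<omega> q #>\<^bsub>Sg \<omega> q\<^esub> c"

lemma Sg_simps [simp]: "a \<otimes>\<^bsub>Sg \<omega> q\<^esub> b = (\<lambda>\<sigma>. a \<sigma> + b \<sigma>)" "\<one>\<^bsub>Sg \<omega> q\<^esub> = (\<lambda>_. 0)"
  by (simp_all add: simplicial_cochain_group_def simplicial_cochains_def)

lemma \<Lambda>_surj_degree:
  assumes "\<And>\<omega>. \<omega> \<in> I \<Longrightarrow> a \<omega> \<in> carrier (Sg \<omega> (p - 1))"
  shows "\<exists>x\<in>carrier (SRp p). \<forall>\<omega>\<in>I. \<Lambda> x \<omega> = a \<omega>"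
proof -
  have "a \<omega> \<in> carrier (simplicial_cochains (L \<omega>))" if "\<omega> \<in> I" for \<omega>
    using assms[OF that] by (simp add: simplicial_cochain_group_def)
  then obtain x where x: "x \<in> carrier SR" "\<forall>\<omega>\<in>I. \<Lambda> x \<omega> = a \<omega>" using \<Lambda>_surj by blast
  then have "x \<in> carrier (SRp p)" unfolding \<Lambda>_degree using assms by simp
  then show ?thesis using x by blast
qed

lemma \<Lambda>_surj_single:
  assumes "\<omega> \<in> I" "c \<in> carrier (Sg \<omega> q)"
  shows "\<exists>x\<in>carrier (SRp (q + 1)). \<Lambda> x \<omega> = c"
proof -
  have "\<exists>x\<in>carrier (SRp (q + 1)). \<forall>\<eta>\<in>I. \<Lambda> x \<eta> = (if \<eta> = \<omega> then c else (\<lambda>_. 0))"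
    by (rule \<Lambda>_surj_degree) (use assms in \<open>auto simp: simplicial_cochain_group_def simplicial_cochains_def\<close>)
  then obtain x where "x \<in> carrier (SRp (q + 1))" "\<forall>\<eta>\<in>I. \<Lambda> x \<eta> = (if \<eta> = \<omega> then c else (\<lambda>_. 0))" by blast
  then show ?thesis using assms(1) by (intro bexI[of _ x]) simp_all
qed

lemma SRp_diff: "x \<in> carrier (SRp p) \<Longrightarrow> SR_diff m K x \<in> carrier (SRp (p + 1))"
  using SR.d_hom by (rule hom_in_carrier)

text \<open>Every cochain is a component of some \<Lambda> x, so the laws of the simplicial
  coboundary, in particular that its square is zero, are inherited from
  \<open>R / I_K\<close>.\<close>

lemma cochain_complex_simplicial: assumes \<omega>: "\<omega> \<in> I" shows "cochain_complex (Sg \<omega>) (Sd \<omega>)"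
proof (rule cochain_complex.intro)
  show "comm_group (Sg \<omega> q)" for q by (rule comm_group_simplicial_cochain_group)
  show "simplicial_coboundary (L \<omega>) \<in> hom (Sg \<omega> q) (Sg \<omega> (q + 1))" for q
  proof (rule homI)
    fix c assume "c \<in> carrier (Sg \<omega> q)"
    then obtain x where x: "x \<in> carrier (SRp (q + 1))" "\<Lambda> x \<omega> = c" using \<Lambda>_surj_single[OF \<omega>] by blast
    have "\<Lambda> (SR_diff m K x) \<omega> \<in> carrier (Sg \<omega> (q + 1 + 1 - 1))"
      using SRp_diff[OF x(1)] \<omega> unfolding \<Lambda>_degree by blast
    then show "simplicial_coboundary (L \<omega>) c \<in> carrier (Sg \<omega> (q + 1))"
      using \<Lambda>_diff[OF SRp_carrier[OF x(1)] \<omega>] x(2) by (simp only: add_diff_cancel_right')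
  qed (auto simp: simplicial_coboundary_def sum.distrib distrib_left)
  show "simplicial_coboundary (L \<omega>) (simplicial_coboundary (L \<omega>) c) = \<one>\<^bsub>Sg \<omega> (q + 1 + 1)\<^esub>" if c: "c \<in> carrier (Sg \<omega> q)" for c q
  proof -
    obtain x where x: "x \<in> carrier (SRp (q + 1))" "\<Lambda> x \<omega> = c" using \<Lambda>_surj_single[OF \<omega> c] by blast
    have "SR_diff m K (SR_diff m K x) = \<zero>\<^bsub>SR\<^esub>" using SR.d_d[OF x(1)] by simp
    then have "\<Lambda> (SR_diff m K (SR_diff m K x)) \<omega> = (\<lambda>_. 0)" by (simp add: \<Lambda>_zero)
    then show ?thesis
      using \<Lambda>_diff[OF SR_diff_carrier[OF SRp_carrier[OF x(1)]] \<omega>] \<Lambda>_diff[OF SRp_carrier[OF x(1)] \<omega>] x(2) by simp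
  qed
qed

lemma comm_group_reduced: "\<omega> \<in> I \<Longrightarrow> comm_group (reduced_cohomology (L \<omega>) q)"
  unfolding reduced_cohomology_def by (rule cochain_complex.comm_group_cohomology[OF cochain_complex_simplicial])

lemma \<Lambda>_Z: "x \<in> SR.Z p \<longleftrightarrow> x \<in> carrier SR \<and> (\<forall>\<omega>\<in>I. \<Lambda> x \<omega> \<in> SZ \<omega> (p - 1))"
proof -
  have d: "SR_diff m K x = \<zero>\<^bsub>SR\<^esub> \<longleftrightarrow> (\<forall>\<omega>\<in>I. simplicial_coboundary (L \<omega>) (\<Lambda> x \<omega>) = (\<lambda>_. 0))" if x: "x \<in> carrier SR"
    using \<Lambda>_inj[OF SR_diff_carrier[OF x] SR_closed(3)] \<Lambda>_diff[OF x] \<Lambda>_zero by metis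
  show ?thesis
    using d by (auto simp: SR.Z_iff \<Lambda>_degree cochain_complex.Z_iff[OF cochain_complex_simplicial])
qed

text \<open>Primitives are chosen for each \<omega> separately and combined into one element by
  surjectivity in degree p - 1.\<close>

lemma \<Lambda>_B: "x \<in> SR.B p \<longleftrightarrow> x \<in> carrier SR \<and> (\<forall>\<omega>\<in>I. \<Lambda> x \<omega> \<in> SB \<omega> (p - 1))"
proof
  assume "x \<in> SR.B p"
  then obtain y where y: "y \<in> carrier (SRp (p - 1))" "x = SR_diff m K y" by (auto simp: SR.B_iff)
  have "\<Lambda> x \<omega> \<in> SB \<omega> (p - 1)" if \<omega>: "\<omega> \<in> I" for \<omega>
    using y \<Lambda>_diff[OF SRp_carrier[OF y(1)] \<omega>] \<omega> by (auto simp: coboundaries_def \<Lambda>_degree)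
  then show "x \<in> carrier SR \<and> (\<forall>\<omega>\<in>I. \<Lambda> x \<omega> \<in> SB \<omega> (p - 1))"
    using y SR_diff_carrier[OF SRp_carrier] by auto
next
  assume x: "x \<in> carrier SR \<and> (\<forall>\<omega>\<in>I. \<Lambda> x \<omega> \<in> SB \<omega> (p - 1))"
  then have "\<forall>\<omega>\<in>I. \<exists>c. c \<in> carrier (Sg \<omega> (p - 1 - 1)) \<and> \<Lambda> x \<omega> = simplicial_coboundary (L \<omega>) c"
    unfolding coboundaries_def by blast
  then obtain a where a: "\<forall>\<omega>\<in>I. a \<omega> \<in> carrier (Sg \<omega> (p - 1 - 1)) \<and> \<Lambda> x \<omega> = simplicial_coboundary (L \<omega>) (a \<omega>)"
    by metis
  then obtain y where y: "y \<in> carrier (SRp (p - 1))" "\<forall>\<omega>\<in>I. \<Lambda> y \<omega> = a \<omega>" using \<Lambda>_surj_degree[of a "p - 1"] by blast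
  have "x = SR_diff m K y"
    using x a y \<Lambda>_diff[OF SRp_carrier[OF y(1)]] by (intro \<Lambda>_inj SR_diff_carrier SRp_carrier[OF y(1)]) auto
  then show "x \<in> SR.B p" using y(1) by (auto simp: SR.B_iff)
qed

lemma reduced_class_Lam: "\<omega> \<in> I \<Longrightarrow> reduced_class m K p (Lam x) \<omega> = scls \<omega> (p - 1) (\<Lambda> x \<omega>)"
  by (simp add: reduced_class_def Lam_def)

lemma in_cls_SR: "z \<in> SR.cls p x \<longleftrightarrow> (\<exists>b\<in>SR.B p. z = b \<oplus>\<^bsub>SR\<^esub> x)"
  by (simp add: SR.in_cls_iff)

lemma scls_eq_iff:
  assumes "\<omega> \<in> I" "c \<in> SZ \<omega> q" "c' \<in> SZ \<omega> q"
  shows "scls \<omega> q c' = scls \<omega> q c \<longleftrightarrow> (\<exists>b\<in>SB \<omega> q. c' = (\<lambda>\<sigma>. b \<sigma> + c \<sigma>))"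
  using cochain_complex.cls_eq_iff[OF cochain_complex_simplicial[OF assms(1)] assms(2,3)]
  by (simp add: cochain_complex.cls_def[OF cochain_complex_simplicial[OF assms(1)]])

lemma lambda_cohomology_cls:
  assumes x: "x \<in> SR.Z p"
  shows "lambda_cohomology m K p (SR.cls p x) = (\<lambda>\<omega>\<in>I. scls \<omega> (p - 1) (\<Lambda> x \<omega>))"
  unfolding lambda_cohomology_def
proof (rule restrict_ext)
  fix \<omega> assume \<omega>: "\<omega> \<in> I"
  have "reduced_class m K p (lambda_map m K z) \<omega> = scls \<omega> (p - 1) (\<Lambda> x \<omega>)" if z: "z \<in> SR.cls p x" for z
  proof -
    obtain b where b: "b \<in> SR.B p" "z = b \<oplus>\<^bsub>SR\<^esub> x" using z in_cls_SR by blast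
    have zZ: "z \<in> SR.Z p" using SR.cls_sub_Z[OF x z] .
    have car: "b \<in> carrier SR" "x \<in> carrier SR" "z \<in> carrier SR" using b x zZ \<Lambda>_B \<Lambda>_Z by blast+
    have "\<Lambda> z \<omega> = (\<lambda>\<sigma>. \<Lambda> b \<omega> \<sigma> + \<Lambda> x \<omega> \<sigma>)" using b car by (simp add: \<Lambda>_add)
    moreover have "\<Lambda> b \<omega> \<in> SB \<omega> (p - 1)" using b \<omega> \<Lambda>_B by blast
    moreover have "\<Lambda> x \<omega> \<in> SZ \<omega> (p - 1)" "\<Lambda> z \<omega> \<in> SZ \<omega> (p - 1)" using x zZ \<omega> \<Lambda>_Z by blast+
    ultimately have "scls \<omega> (p - 1) (\<Lambda> z \<omega>) = scls \<omega> (p - 1) (\<Lambda> x \<omega>)" using scls_eq_iff[OF \<omega>] by blast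
    then show ?thesis using car \<omega> by (simp add: lambda_map_eq reduced_class_Lam)
  qed
  then show "(\<Union>z\<in>SR.cls p x. reduced_class m K p (lambda_map m K z) \<omega>) = scls \<omega> (p - 1) (\<Lambda> x \<omega>)"
    using SR.cls_mem[OF x] by blast
qed

lemma carrier_reduced_sum: "carrier (reduced_sum m K p) = (\<Pi>\<^sub>E \<omega>\<in>I. scls \<omega> (p - 1) ` SZ \<omega> (p - 1))"
proof -
  have "carrier (reduced_sum m K p) = (\<Pi>\<^sub>E \<omega>\<in>I. carrier (reduced_cohomology (L \<omega>) (p - 1)))"
    unfolding reduced_sum_def using comm_group_reduced[THEN comm_group.axioms(2)]
    by (subst carrier_sum_group) auto
  also have "\<dots> = (\<Pi>\<^sub>E \<omega>\<in>I. scls \<omega> (p - 1) ` SZ \<omega> (p - 1))"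
    by (intro PiE_cong) (simp add: reduced_cohomology_def
        cochain_complex.carrier_cohomology[OF cochain_complex_simplicial] cochain_complex.cls_def[OF cochain_complex_simplicial])
  finally show ?thesis .
qed

lemma comm_group_reduced_sum: "comm_group (reduced_sum m K p)"
proof (rule group.group_comm_groupI)
  have G: "group (reduced_cohomology (L \<omega>) (p - 1))" if "\<omega> \<in> I" for \<omega>
    using comm_group_reduced[OF that] by (rule comm_group.axioms(2))
  then show "group (reduced_sum m K p)" unfolding reduced_sum_def by (rule sum_group)
  fix x y assume "x \<in> carrier (reduced_sum m K p)" "y \<in> carrier (reduced_sum m K p)"
  then have "\<And>\<omega>. \<omega> \<in> I \<Longrightarrow> x \<omega> \<in> carrier (reduced_cohomology (L \<omega>) (p - 1)) \<and> y \<omega> \<in> carrier (reduced_cohomology (L \<omega>) (p - 1))"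
    unfolding reduced_sum_def by (subst (asm) (1 2) carrier_sum_group) (auto simp: G)
  then show "x \<otimes>\<^bsub>reduced_sum m K p\<^esub> y = y \<otimes>\<^bsub>reduced_sum m K p\<^esub> x"
    unfolding reduced_sum_def mult_sum_group using comm_group_reduced
    by (intro restrict_ext) (meson comm_groupE(4))
qed

lemma carrier_SR_cohomology: "carrier (SR_cohomology m K p) = SR.cls p ` SR.Z p"
  by (simp add: SR_cohomology_def SR.carrier_cohomology)

text \<open>Being a cocycle or a coboundary is a condition on the components
  (\<open>\<Lambda>_Z\<close>, \<open>\<Lambda>_B\<close>), so taking classes commutes with the sum
  over \<omega>.\<close>

lemma lambda_cohomology_iso: "lambda_cohomology m K p \<in> iso (SR_cohomology m K p) (reduced_sum m K p)"
proof -
  let ?l = "lambda_cohomology m K p"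
  have hom: "?l \<in> hom (SR_cohomology m K p) (reduced_sum m K p)"
  proof (rule homI)
    fix X assume "X \<in> carrier (SR_cohomology m K p)"
    then obtain x where x: "x \<in> SR.Z p" "X = SR.cls p x" by (auto simp: carrier_SR_cohomology)
    then show "?l X \<in> carrier (reduced_sum m K p)"
      unfolding carrier_reduced_sum x(2) lambda_cohomology_cls[OF x(1)] using \<Lambda>_Z[of x p] by auto
    fix Y assume "Y \<in> carrier (SR_cohomology m K p)"
    then obtain y where y: "y \<in> SR.Z p" "Y = SR.cls p y" by (auto simp: carrier_SR_cohomology)
    have "scls \<omega> (p - 1) (\<Lambda> x \<omega>) \<otimes>\<^bsub>reduced_cohomology (L \<omega>) (p - 1)\<^esub> scls \<omega> (p - 1) (\<Lambda> y \<omega>)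
        = scls \<omega> (p - 1) (\<Lambda> (x \<oplus>\<^bsub>SR\<^esub> y) \<omega>)" if \<omega>: "\<omega> \<in> I" for \<omega>
    proof -
      interpret S: cochain_complex "Sg \<omega>" "Sd \<omega>" by (rule cochain_complex_simplicial[OF \<omega>])
      show ?thesis
        using S.cls_mult[of "\<Lambda> x \<omega>" "p - 1" "\<Lambda> y \<omega>"] x y \<omega> \<Lambda>_Z[of x p] \<Lambda>_Z[of y p] \<Lambda>_add[of x y \<omega>]
        by (simp add: S.cls_def reduced_cohomology_def)
    qed
    then show "?l (X \<otimes>\<^bsub>SR_cohomology m K p\<^esub> Y) = ?l X \<otimes>\<^bsub>reduced_sum m K p\<^esub> ?l Y"
      using SR.cls_mult[OF x(1) y(1)] lambda_cohomology_cls[OF x(1)] lambda_cohomology_cls[OF y(1)]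
        lambda_cohomology_cls[OF SR.Z_mult[OF x(1) y(1)]] x y
      by (simp add: SR_cohomology_def reduced_sum_def cong: restrict_cong)
  qed
  have "inj_on ?l (carrier (SR_cohomology m K p))"
  proof (rule inj_onI)
    fix X Y assume "X \<in> carrier (SR_cohomology m K p)" "Y \<in> carrier (SR_cohomology m K p)" and eq: "?l X = ?l Y"
    then obtain x y where xy: "x \<in> SR.Z p" "X = SR.cls p x" "y \<in> SR.Z p" "Y = SR.cls p y"
      by (auto simp: carrier_SR_cohomology)
    have "\<exists>c. c \<in> SB \<omega> (p - 1) \<and> \<Lambda> y \<omega> = (\<lambda>\<sigma>. c \<sigma> + \<Lambda> x \<omega> \<sigma>)" if \<omega>: "\<omega> \<in> I" for \<omega>
    proof -
      have "scls \<omega> (p - 1) (\<Lambda> y \<omega>) = scls \<omega> (p - 1) (\<Lambda> x \<omega>)"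
        using fun_cong[OF eq, of \<omega>] \<omega> xy by (simp add: lambda_cohomology_cls)
      then show ?thesis using scls_eq_iff[OF \<omega>] xy \<omega> \<Lambda>_Z by blast
    qed
    then obtain c where c: "\<forall>\<omega>\<in>I. c \<omega> \<in> SB \<omega> (p - 1) \<and> \<Lambda> y \<omega> = (\<lambda>\<sigma>. c \<omega> \<sigma> + \<Lambda> x \<omega> \<sigma>)" by metis
    then have "c \<omega> \<in> carrier (Sg \<omega> (p - 1))" if "\<omega> \<in> I" for \<omega>
      using that cochain_complex.B_subset_Z[OF cochain_complex_simplicial[OF that]]
        cochain_complex.Z_carrier[OF cochain_complex_simplicial[OF that]] by blast
    then obtain b where b: "b \<in> carrier (SRp p)" "\<forall>\<omega>\<in>I. \<Lambda> b \<omega> = c \<omega>" using \<Lambda>_surj_degree by blast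
    have bB: "b \<in> SR.B p" using b c SRp_carrier[OF b(1)] \<Lambda>_B by auto
    have car: "b \<in> carrier SR" "x \<in> carrier SR" "y \<in> carrier SR" using b SRp_carrier xy \<Lambda>_Z by blast+
    have "y = b \<oplus>\<^bsub>SR\<^esub> x"
      by (rule \<Lambda>_inj[OF car(3) SR_closed(1)[OF car(1,2)]]) (use b c in \<open>simp add: \<Lambda>_add car\<close>)
    then have "y \<in> SR.cls p x" using bB in_cls_SR by blast
    then show "X = Y" using SR.cls_eqI xy by blast
  qed
  moreover have "?l ` carrier (SR_cohomology m K p) = carrier (reduced_sum m K p)"
  proof
    show "?l ` carrier (SR_cohomology m K p) \<subseteq> carrier (reduced_sum m K p)" using hom by (auto simp: hom_def)
    show "carrier (reduced_sum m K p) \<subseteq> ?l ` carrier (SR_cohomology m K p)"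
    proof
      fix Y assume Y: "Y \<in> carrier (reduced_sum m K p)"
      then have "\<forall>\<omega>\<in>I. \<exists>c. c \<in> SZ \<omega> (p - 1) \<and> Y \<omega> = scls \<omega> (p - 1) c" and ext: "Y \<in> extensional I"
        unfolding carrier_reduced_sum PiE_def by blast+
      then obtain a where a: "\<forall>\<omega>\<in>I. a \<omega> \<in> SZ \<omega> (p - 1) \<and> Y \<omega> = scls \<omega> (p - 1) (a \<omega>)" by metis
      then have "a \<omega> \<in> carrier (Sg \<omega> (p - 1))" if "\<omega> \<in> I" for \<omega>
        using that cochain_complex.Z_carrier[OF cochain_complex_simplicial[OF that]] by blast
      then obtain x where x: "x \<in> carrier (SRp p)" "\<forall>\<omega>\<in>I. \<Lambda> x \<omega> = a \<omega>" using \<Lambda>_surj_degree by blast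
      have xZ: "x \<in> SR.Z p" using x a SRp_carrier \<Lambda>_Z by auto
      have "Y = ?l (SR.cls p x)"
        unfolding lambda_cohomology_cls[OF xZ] using ext a x(2) by (intro extensionalityI[of _ I]) auto
      then show "Y \<in> ?l ` carrier (SR_cohomology m K p)" using xZ unfolding carrier_SR_cohomology by blast
    qed
  qed
  ultimately show ?thesis using hom by (simp add: iso_def bij_betw_def)
qed

lemma comm_group_SR_cohomology: "comm_group (SR_cohomology m K p)"
  unfolding SR_cohomology_def by (rule SR.comm_group_cohomology)

lemma lambda_cohomology_inv_iso: "lambda_cohomology_inv m K p \<in> iso (reduced_sum m K p) (SR_cohomology m K p)"
  unfolding lambda_cohomology_inv_def
  by (rule group.iso_set_sym[OF comm_group.axioms(2)[OF comm_group_SR_cohomology] lambda_cohomology_iso])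

text \<open>The cochain families representing the image of a class are exactly the images of its
  representatives: a family of coboundaries is the image of a single coboundary. This gives access
  to the union in \<open>reduced_mult\<close>.\<close>

lemma representatives:
  assumes x: "x \<in> SR.Z p"
  shows "PiE I (lambda_cohomology m K p (SR.cls p x)) = Lam ` SR.cls p x"
proof
  have car: "z \<in> carrier SR" if "z \<in> SR.cls p x" for z using SR.cls_sub_Z[OF x that] \<Lambda>_Z by blast
  have scls: "c \<in> scls \<omega> (p - 1) (\<Lambda> x \<omega>) \<longleftrightarrow> (\<exists>b\<in>SB \<omega> (p - 1). c = (\<lambda>\<sigma>. b \<sigma> + \<Lambda> x \<omega> \<sigma>))" for c \<omega>
    by (auto simp: r_coset_def)
  show "Lam ` SR.cls p x \<subseteq> PiE I (lambda_cohomology m K p (SR.cls p x))"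
  proof clarify
    fix z assume z: "z \<in> SR.cls p x"
    then obtain b where b: "b \<in> SR.B p" "z = b \<oplus>\<^bsub>SR\<^esub> x" using in_cls_SR by blast
    have bx: "b \<in> carrier SR" "x \<in> carrier SR" using b x \<Lambda>_B \<Lambda>_Z by blast+
    have "\<Lambda> z \<omega> \<in> scls \<omega> (p - 1) (\<Lambda> x \<omega>)" if "\<omega> \<in> I" for \<omega>
      unfolding scls using b \<Lambda>_add[OF bx] that \<Lambda>_B[of b p] by auto
    then show "Lam z \<in> PiE I (lambda_cohomology m K p (SR.cls p x))"
      unfolding lambda_cohomology_cls[OF x] Lam_def by auto
  qed
  show "PiE I (lambda_cohomology m K p (SR.cls p x)) \<subseteq> Lam ` SR.cls p x"
  proof
    fix a assume a: "a \<in> PiE I (lambda_cohomology m K p (SR.cls p x))"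
    have "a \<omega> \<in> scls \<omega> (p - 1) (\<Lambda> x \<omega>)" if "\<omega> \<in> I" for \<omega>
      using PiE_mem[OF a that] by (simp only: lambda_cohomology_cls[OF x] restrict_apply'[OF that])
    then have "\<forall>\<omega>\<in>I. \<exists>b. b \<in> SB \<omega> (p - 1) \<and> a \<omega> = (\<lambda>\<sigma>. b \<sigma> + \<Lambda> x \<omega> \<sigma>)" unfolding scls by blast
    then obtain b where b: "\<forall>\<omega>\<in>I. b \<omega> \<in> SB \<omega> (p - 1) \<and> a \<omega> = (\<lambda>\<sigma>. b \<omega> \<sigma> + \<Lambda> x \<omega> \<sigma>)" by metis
    then have "b \<omega> \<in> carrier (Sg \<omega> (p - 1))" if "\<omega> \<in> I" for \<omega>
      using that cochain_complex.B_subset_Z[OF cochain_complex_simplicial[OF that]]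
        cochain_complex.Z_carrier[OF cochain_complex_simplicial[OF that]] by blast
    then obtain y where y: "y \<in> carrier (SRp p)" "\<forall>\<omega>\<in>I. \<Lambda> y \<omega> = b \<omega>" using \<Lambda>_surj_degree by blast
    have yB: "y \<in> SR.B p" using y b SRp_carrier \<Lambda>_B by auto
    have xc: "x \<in> carrier SR" "y \<in> carrier SR" using x y SRp_carrier \<Lambda>_Z by blast+
    have "a = Lam (y \<oplus>\<^bsub>SR\<^esub> x)"
    proof (rule extensionalityI[of _ I])
      show "a \<in> extensional I" using a by (simp add: PiE_def)
      show "Lam (y \<oplus>\<^bsub>SR\<^esub> x) \<in> extensional I" by (simp add: Lam_def)
      fix \<omega> assume "\<omega> \<in> I"
      then show "a \<omega> = Lam (y \<oplus>\<^bsub>SR\<^esub> x) \<omega>" using b y by (simp add: Lam_def \<Lambda>_add xc)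
    qed
    moreover have "y \<oplus>\<^bsub>SR\<^esub> x \<in> SR.cls p x" using yB in_cls_SR by blast
    ultimately show "a \<in> Lam ` SR.cls p x" by blast
  qed
qed

lemma lambda_inv_Lam: "x \<in> carrier SR \<Longrightarrow> lambda_inv m K (Lam x) = x"
proof -
  assume x: "x \<in> carrier SR"
  have "inj_on (lambda_map m K) (carrier SR)"
  proof (rule inj_onI)
    fix y z assume yz: "y \<in> carrier SR" "z \<in> carrier SR" "lambda_map m K y = lambda_map m K z"
    then have "Lam y = Lam z" by (simp add: lambda_map_eq)
    then have "\<Lambda> y \<omega> = \<Lambda> z \<omega>" if "\<omega> \<in> I" for \<omega> using that by (metis Lam_def restrict_apply')
    then show "y = z" by (rule \<Lambda>_inj[OF yz(1,2)])
  qed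
  then have "inv_into (carrier SR) (lambda_map m K) (lambda_map m K x) = x" using x by (rule inv_into_f_f)
  then show ?thesis using x by (simp add: lambda_inv_def lambda_map_eq)
qed

section \<open>The product on the sum of the reduced cohomology groups\<close>

interpretation SRm: dg_ring SRp SRd "\<lambda>_ _ x y. x \<otimes>\<^bsub>SR\<^esub> y" "\<one>\<^bsub>SR\<^esub>" by (rule dg_ring_SR)

abbreviation SRmult where "SRmult \<equiv> cohomology_mult SRp SRd (\<lambda>_ _ x y. x \<otimes>\<^bsub>SR\<^esub> y)"

text \<open>By \<open>representatives\<close> the union over cochain families becomes a union over
  representatives in \<open>R / I_K\<close>, and all their products lie in one class.\<close>

lemma reduced_mult_lambda:
  assumes pq: "0 \<le> p" "0 \<le> q" and V: "V \<in> carrier (SR_cohomology m K p)" and W: "W \<in> carrier (SR_cohomology m K q)"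
  shows "reduced_mult m K p q (lambda_cohomology m K p V) (lambda_cohomology m K q W)
    = lambda_cohomology m K (p + q) (SRmult p q V W)"
proof -
  obtain x y where xy: "x \<in> SR.Z p" "V = SR.cls p x" "y \<in> SR.Z q" "W = SR.cls q y"
    using V W by (auto simp: carrier_SR_cohomology)
  have prod: "SRmult p q V W = SR.cls (p + q) (x \<otimes>\<^bsub>SR\<^esub> y)"
    unfolding xy by (rule SRm.cohomology_mult_cls[OF pq xy(1,3)])
  have Z: "x \<otimes>\<^bsub>SR\<^esub> y \<in> SR.Z (p + q)" by (rule SRm.mul_Z[OF pq xy(1,3)])
  have rep: "reduced_class m K (p + q) (lambda_mult m K a b) \<omega> = scls \<omega> (p + q - 1) (\<Lambda> (x \<otimes>\<^bsub>SR\<^esub> y) \<omega>)"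
    if \<omega>: "\<omega> \<in> I" and a: "a \<in> Lam ` SR.cls p x" and b: "b \<in> Lam ` SR.cls q y" for a b \<omega>
  proof -
    obtain x' y' where xy': "x' \<in> SR.cls p x" "a = Lam x'" "y' \<in> SR.cls q y" "b = Lam y'" using a b by blast
    have Z': "x' \<in> SR.Z p" "y' \<in> SR.Z q" using SR.cls_sub_Z xy xy' by blast+
    then have car: "x' \<in> carrier SR" "y' \<in> carrier SR" using \<Lambda>_Z by blast+
    have pZ: "x' \<otimes>\<^bsub>SR\<^esub> y' \<in> SR.Z (p + q)" by (rule SRm.mul_Z[OF pq Z'])
    have "SR.cls (p + q) (x' \<otimes>\<^bsub>SR\<^esub> y') = SR.cls (p + q) (x \<otimes>\<^bsub>SR\<^esub> y)"
      using SRm.cohomology_mult_cls[OF pq Z'] SR.cls_eqI[OF xy(1) xy'(1)] SR.cls_eqI[OF xy(3) xy'(3)] prod xy by simp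
    then have "scls \<omega> (p + q - 1) (\<Lambda> (x' \<otimes>\<^bsub>SR\<^esub> y') \<omega>) = scls \<omega> (p + q - 1) (\<Lambda> (x \<otimes>\<^bsub>SR\<^esub> y) \<omega>)"
      using fun_cong[of _ _ \<omega>, OF lambda_cohomology_cls[OF pZ]] fun_cong[of _ _ \<omega>, OF lambda_cohomology_cls[OF Z]]
      by (simp only: restrict_apply'[OF \<omega>])
    then show ?thesis
      using car \<omega> SR_closed(2)[OF car] xy' by (simp add: lambda_mult_def lambda_inv_Lam lambda_map_eq reduced_class_Lam)
  qed
  have ne: "Lam x \<in> Lam ` SR.cls p x" "Lam y \<in> Lam ` SR.cls q y" using SR.cls_mem xy by blast+
  show ?thesis
    unfolding reduced_mult_def prod unfolding lambda_cohomology_cls[OF Z] xy representatives[OF xy(1)] representatives[OF xy(3)]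
  proof (rule restrict_ext)
    fix \<omega> assume \<omega>: "\<omega> \<in> I"
    show "(\<Union>a\<in>Lam ` SR.cls p x. \<Union>b\<in>Lam ` SR.cls q y. reduced_class m K (p + q) (lambda_mult m K a b) \<omega>)
        = scls \<omega> (p + q - 1) (\<Lambda> (x \<otimes>\<^bsub>SR\<^esub> y) \<omega>)"
      using rep[OF \<omega>] ne by blast
  qed
qed

lemma lambda_unit: "lambda_cohomology m K 0 (SR.cls 0 \<one>\<^bsub>SR\<^esub>) = reduced_class m K 0 (lambda_map m K \<one>\<^bsub>SR\<^esub>)"
  unfolding lambda_cohomology_cls[OF SRm.e_Z] reduced_class_def
  by (intro restrict_ext) (simp add: lambda_map_eq SR_closed(4) Lam_def)

lemma lambda_inv_lambda: "V \<in> carrier (SR_cohomology m K p) \<Longrightarrow> lambda_cohomology_inv m K p (lambda_cohomology m K p V) = V"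
  unfolding lambda_cohomology_inv_def using lambda_cohomology_iso[of p] by (auto simp: iso_def bij_betw_def)

lemma lambda_lambda_inv: "W \<in> carrier (reduced_sum m K p) \<Longrightarrow> lambda_cohomology m K p (lambda_cohomology_inv m K p W) = W"
  unfolding lambda_cohomology_inv_def
  by (rule f_inv_into_f) (use lambda_cohomology_iso[of p] in \<open>simp add: iso_def bij_betw_def\<close>)

lemma graded_algebra_SR: "graded_algebra (SR_cohomology m K) SRmult (SR.cls 0 \<one>\<^bsub>SR\<^esub>)"
  using SRm.graded_algebra_cohomology by (simp add: SR_cohomology_def[abs_def] SR.cls_def)

lemma lambda_inv_mult:
  assumes pq: "0 \<le> p" "0 \<le> q" and V: "V \<in> carrier (reduced_sum m K p)" and W: "W \<in> carrier (reduced_sum m K q)"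
  shows "reduced_mult m K p q V W \<in> carrier (reduced_sum m K (p + q))"
    and "lambda_cohomology_inv m K (p + q) (reduced_mult m K p q V W)
      = SRmult p q (lambda_cohomology_inv m K p V) (lambda_cohomology_inv m K q W)"
proof -
  let ?x = "lambda_cohomology_inv m K p V" and ?y = "lambda_cohomology_inv m K q W"
  have c: "?x \<in> carrier (SR_cohomology m K p)" "?y \<in> carrier (SR_cohomology m K q)"
    using lambda_cohomology_inv_iso[of p] lambda_cohomology_inv_iso[of q] V W by (auto simp: iso_def hom_def)
  have pc: "SRmult p q ?x ?y \<in> carrier (SR_cohomology m K (p + q))"
    by (rule graded_algebra.M_closed[OF graded_algebra_SR pq c])
  have eq: "reduced_mult m K p q V W = lambda_cohomology m K (p + q) (SRmult p q ?x ?y)"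
    using reduced_mult_lambda[OF pq c] by (simp add: lambda_lambda_inv V W)
  show "reduced_mult m K p q V W \<in> carrier (reduced_sum m K (p + q))"
    unfolding eq using lambda_cohomology_iso pc by (auto simp: iso_def hom_def)
  show "lambda_cohomology_inv m K (p + q) (reduced_mult m K p q V W) = SRmult p q ?x ?y"
    unfolding eq by (rule lambda_inv_lambda[OF pc])
qed

lemma one_cls: "SR.cls 0 \<one>\<^bsub>SR\<^esub> \<in> carrier (SR_cohomology m K 0)"
  unfolding carrier_SR_cohomology using SRm.e_Z by blast

lemma lambda_inv_unit:
  "reduced_class m K 0 (lambda_map m K \<one>\<^bsub>SR\<^esub>) \<in> carrier (reduced_sum m K 0)"
  "lambda_cohomology_inv m K 0 (reduced_class m K 0 (lambda_map m K \<one>\<^bsub>SR\<^esub>)) = SR.cls 0 \<one>\<^bsub>SR\<^esub>"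
  unfolding lambda_unit[symmetric]
  using lambda_cohomology_iso[of 0] one_cls lambda_inv_lambda[OF one_cls] by (auto simp: iso_def hom_def)

text \<open>The ring laws come from \<open>R / I_K\<close> by transport; the product is not computed
  in terms of simplices.\<close>

lemma graded_algebra_reduced:
  "graded_algebra (reduced_sum m K) (reduced_mult m K) (reduced_class m K 0 (lambda_map m K \<one>\<^bsub>SR\<^esub>))"
  by (rule graded_algebra_transport[OF graded_algebra_SR, where f = "lambda_cohomology_inv m K"])
    (use comm_group_reduced_sum lambda_cohomology_inv_iso lambda_inv_mult lambda_inv_unit in blast)+

lemma SR_cohomology_ring_eq: "SR_cohomology_ring m K = graded_ring (SR_cohomology m K) SRmult (SR.cls 0 \<one>\<^bsub>SR\<^esub>)"
  by (simp add: SR_cohomology_ring_def cohomology_ring_def SR_cohomology_def[abs_def] SR.cls_def)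

lemma lambda_inv_ring_iso:
  "graded_map (lambda_cohomology_inv m K) \<in> ring_iso (reduced_sum_ring m K) (SR_cohomology_ring m K)"
  unfolding reduced_sum_ring_def SR_cohomology_ring_eq
  by (rule graded_map_ring_iso[OF graded_algebra_reduced graded_algebra_SR])
    (use lambda_cohomology_inv_iso lambda_inv_mult lambda_inv_unit in blast)+

end

section \<open>Restriction of singular cochains to the cubical cells\<close>

context moment_angle_complex
begin

interpretation SR: cochain_complex SRp SRd by (rule cochain_complex_SR)
interpretation SRm: dg_ring SRp SRd "\<lambda>_ _ x y. x \<otimes>\<^bsub>SR\<^esub> y" "\<one>\<^bsub>SR\<^esub>" by (rule dg_ring_SR)

abbreviation SX where "SX \<equiv> singular_cochain_group X"
abbreviation dX where "dX \<equiv> singular_coboundary X"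

interpretation S: cochain_complex SX dX by (rule cochain_complex_singular)
interpretation Sm: dg_ring SX dX "cup X" "unit_cochain X" by (rule dg_ring_singular)

text \<open>Restriction to triangulated cells. The cut-off by dimension makes the value homogeneous
  for an arbitrary function \<phi>.\<close>

definition \<theta> :: "int \<Rightarrow> (nat \<Rightarrow> real) cochain \<Rightarrow> cell \<Rightarrow> int" where
  "\<theta> p \<phi> = (\<lambda>c. if c \<in> cell_set m K \<and> int (card (fst c)) = p then pairing \<phi> (cube_chain m c) else 0)"

lemma \<theta>_cell: "(\<sigma>, E) \<in> cells n \<Longrightarrow> \<theta> (int n) \<phi> (\<sigma>, E) = pairing \<phi> (cube_chain m (\<sigma>, E))"
  by (simp add: \<theta>_def cells_def cell_set_iff)

lemma \<theta>_Q_deg: "\<theta> p \<phi> \<in> Q_deg p"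
  by (auto simp: \<theta>_def Q_deg_def cube_cochains_def)

lemma \<theta>_add: "\<theta> p (\<lambda>s. \<phi> s + \<psi> s) = (\<lambda>c. \<theta> p \<phi> c + \<theta> p \<psi> c)"
  by (auto simp: \<theta>_def pairing_add_fun)

lemma \<theta>_zero: "\<theta> p (\<lambda>_. 0) = (\<lambda>_. 0)"
  by (auto simp: \<theta>_def pairing_def)

lemma cells_nat: "(\<sigma>, E) \<in> cells n \<Longrightarrow> finite \<sigma> \<and> \<sigma> \<inter> E = {} \<and> card \<sigma> = n \<and> (\<sigma>, E) \<in> cell_set m K"
  using K_finite by (auto simp: cells_def cell_set_iff)

lemma Q_deg_eqI:
  assumes a: "a \<in> Q_deg (int n)" and b: "b \<in> Q_deg (int n)"
    and eq: "\<And>\<sigma> E. (\<sigma>, E) \<in> cells n \<Longrightarrow> a (\<sigma>, E) = b (\<sigma>, E)"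
  shows "a = b"
proof (rule ext, clarify)
  fix \<sigma> E
  show "a (\<sigma>, E) = b (\<sigma>, E)"
  proof (cases "(\<sigma>, E) \<in> cells n")
    case False
    have "q (\<sigma>, E) = 0" if q: "q \<in> Q_deg (int n)" for q
    proof (rule ccontr)
      assume ne: "q (\<sigma>, E) \<noteq> 0"
      then have "(\<sigma>, E) \<in> cell_set m K" "card \<sigma> = n"
        using q Q_outside[OF Q_deg_Q[OF q]] by (auto simp: Q_deg_def)
      then show False using False cell_set_cells by blast
    qed
    from this[OF a] this[OF b] show ?thesis by simp
  qed (rule eq)
qed

lemma keys_cube_chain: "x \<in> cells n \<Longrightarrow> Poly_Mapping.keys (cube_chain m x) \<subseteq> X_simplices n"
  using free_chain_map.keys_\<theta>[OF free_chain_map_cube_chain] .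

lemma pairing_cube_chain_cong:
  assumes "x \<in> cells n" "\<And>s. singular_simplex n X s \<Longrightarrow> f s = g s"
  shows "pairing f (cube_chain m x) = pairing g (cube_chain m x)"
  by (rule pairing_cong_keys[OF keys_cube_chain[OF assms(1)]]) (use assms(2) in simp)

lemma cube_bd_cells: "(\<sigma>, E) \<in> cells (Suc n) \<Longrightarrow> Poly_Mapping.keys (cube_bd (\<sigma>, E)) \<subseteq> cells n"
  using free_complex.keys_d[OF free_complex_cells, of "(\<sigma>, E)" n] by (simp add: cube_d_def)

lemma \<theta>_d:
  assumes "\<phi> \<in> carrier (SX p)"
  shows "qd m K (\<theta> p \<phi>) = \<theta> (p + 1) (dX p \<phi>)"
proof (cases "p < 0")
  case True
  then have "\<phi> = (\<lambda>_. 0)" using SC_neg assms by blast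
  then show ?thesis by (simp add: \<theta>_zero \<delta>_zero qd_zero)
next
  case False
  then obtain n where p: "p = int n" using nonneg_int_cases by (metis not_le)
  have p1: "p + 1 = int (Suc n)" using p by simp
  show ?thesis
  proof (rule Q_deg_eqI[of _ "Suc n"])
    show "qd m K (\<theta> p \<phi>) \<in> Q_deg (int (Suc n))" using qd_Q_deg[OF \<theta>_Q_deg] unfolding p1[symmetric] .
    show "\<theta> (p + 1) (dX p \<phi>) \<in> Q_deg (int (Suc n))" unfolding p1 by (rule \<theta>_Q_deg)
    fix \<sigma> E assume c: "(\<sigma>, E) \<in> cells (Suc n)"
    have fin: "finite \<sigma>" "card \<sigma> = Suc n" and cs: "(\<sigma>, E) \<in> cell_set m K" using cells_nat[OF c] by blast+
    have "qd m K (\<theta> p \<phi>) (\<sigma>, E) = pairing (\<theta> p \<phi>) (cube_bd (\<sigma>, E))" using cs by (simp add: qd_def)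
    also have "\<dots> = pairing (\<lambda>x. pairing \<phi> (cube_chain m x)) (cube_bd (\<sigma>, E))"
      by (rule pairing_cong_keys[OF cube_bd_cells[OF c]]) (auto simp: p \<theta>_cell)
    also have "\<dots> = pairing (\<lambda>s. pairing \<phi> (sing_bd (Suc n) s)) (cube_chain m (\<sigma>, E))"
      by (simp only: pairing_frag_extend[symmetric] sing_bd_cube_chain[OF fin])
    also have "\<dots> = pairing (dX p \<phi>) (cube_chain m (\<sigma>, E))"
      by (rule pairing_cube_chain_cong[OF c]) (simp add: \<delta>_eq p nat_add_distrib)
    also have "\<dots> = \<theta> (p + 1) (dX p \<phi>) (\<sigma>, E)" unfolding p1 by (simp only: \<theta>_cell[OF c])
    finally show "qd m K (\<theta> p \<phi>) (\<sigma>, E) = \<theta> (p + 1) (dX p \<phi>) (\<sigma>, E)" .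
  qed
qed

lemma pairing_cube_chain: "card \<sigma> = n \<Longrightarrow> pairing f (cube_chain m (\<sigma>, E)) = pairing (\<lambda>l. f (realise m l)) (ez n \<sigma> E)"
  by (simp add: cube_chain_def pairing_frag_extend)

text \<open>Front and back faces of a path simplex are the initial and the final part of its vertex
  list, so the identity is \<open>pairing_ez_split\<close> applied to the values of \<phi> and
  \<psi> on realised lists.\<close>

lemma \<theta>_cup:
  assumes "0 \<le> p" "0 \<le> q"
  shows "\<theta> (p + q) (cup X p q \<phi> \<psi>) = qmul m K (\<theta> p \<phi>) (\<theta> q \<psi>)"
proof -
  obtain i j where ij: "p = int i" "q = int j" using assms nonneg_int_cases by metis
  have pq: "p + q = int (i + j)" using ij by simp
  show ?thesis
  proof (rule Q_deg_eqI[of _ "i + j"])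
    show "\<theta> (p + q) (cup X p q \<phi> \<psi>) \<in> Q_deg (int (i + j))" unfolding pq by (rule \<theta>_Q_deg)
    show "qmul m K (\<theta> p \<phi>) (\<theta> q \<psi>) \<in> Q_deg (int (i + j))" using qmul_Q_deg[OF \<theta>_Q_deg \<theta>_Q_deg] unfolding pq[symmetric] .
    fix \<sigma> E assume c: "(\<sigma>, E) \<in> cells (i + j)"
    have fin: "finite \<sigma>" "card \<sigma> = i + j" and cs: "(\<sigma>, E) \<in> cell_set m K" using cells_nat[OF c] by blast+
    have "\<theta> (p + q) (cup X p q \<phi> \<psi>) (\<sigma>, E) = pairing (cup X p q \<phi> \<psi>) (cube_chain m (\<sigma>, E))"
      unfolding pq by (rule \<theta>_cell[OF c])
    also have "\<dots> = pairing (\<lambda>s. \<phi> (front_face i s) * \<psi> (back_face i j s)) (cube_chain m (\<sigma>, E))"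
      by (rule pairing_cube_chain_cong[OF c]) (simp add: cup_def ij nat_add_distrib flip: of_nat_add)
    also have "\<dots> = pairing (\<lambda>l. \<phi> (front_face i (realise m l)) * \<psi> (back_face i j (realise m l))) (ez (i + j) \<sigma> E)"
      by (rule pairing_cube_chain[OF fin(2)])
    also have "\<dots> = pairing (\<lambda>l. \<phi> (realise m (take (Suc i) l)) * \<psi> (realise m (drop i l))) (ez (i + j) \<sigma> E)"
      by (rule pairing_cong_keys[OF keys_ez]) (auto simp: front_face_realise back_face_realise)
    also have "\<dots> = (\<Sum>S\<in>{S. S \<subseteq> \<sigma> \<and> card S = i}. sg2 S (\<sigma> - S) *
        (pairing (\<lambda>l. \<phi> (realise m l)) (ez i S E) * pairing (\<lambda>l. \<psi> (realise m l)) (ez j (\<sigma> - S) (E \<union> S))))"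
      by (rule pairing_ez_split[OF fin])
    also have "\<dots> = (\<Sum>S\<in>{S. S \<subseteq> \<sigma> \<and> card S = i}. sg2 S (\<sigma> - S) * (\<theta> p \<phi> (S, E) * \<theta> q \<psi> (\<sigma> - S, E \<union> S)))"
    proof (intro sum.cong refl)
      fix S assume "S \<in> {S. S \<subseteq> \<sigma> \<and> card S = i}"
      then have S: "S \<subseteq> \<sigma>" "card S = i" by auto
      then have d: "card (\<sigma> - S) = j" using fin by (simp add: card_Diff_subset finite_subset)
      have "(S, E) \<in> cells i" "(\<sigma> - S, E \<union> S) \<in> cells j"
        using cell_front[OF cs S(1)] cell_back[OF cs S(1)] S d cell_set_cells by blast+
      then show "sg2 S (\<sigma> - S) * (pairing (\<lambda>l. \<phi> (realise m l)) (ez i S E) * pairing (\<lambda>l. \<psi> (realise m l)) (ez j (\<sigma> - S) (E \<union> S)))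
          = sg2 S (\<sigma> - S) * (\<theta> p \<phi> (S, E) * \<theta> q \<psi> (\<sigma> - S, E \<union> S))"
        by (simp add: ij \<theta>_cell pairing_cube_chain S d)
    qed
    \<comment> \<open>Subsets of any other cardinality contribute 0 by the cut-off in
      \<theta>.\<close>
    also have "\<dots> = (\<Sum>S\<in>Pow \<sigma>. sg2 S (\<sigma> - S) * (\<theta> p \<phi> (S, E) * \<theta> q \<psi> (\<sigma> - S, E \<union> S)))"
      by (rule sum.mono_neutral_left) (use fin in \<open>auto simp: \<theta>_def ij\<close>)
    also have "\<dots> = qmul m K (\<theta> p \<phi>) (\<theta> q \<psi>) (\<sigma>, E)" using cs by (simp add: qmul_def)
    finally show "\<theta> (p + q) (cup X p q \<phi> \<psi>) (\<sigma>, E) = qmul m K (\<theta> p \<phi>) (\<theta> q \<psi>) (\<sigma>, E)" .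
  qed
qed

lemma \<theta>_unit: "\<theta> 0 (unit_cochain X) = qone m"
proof (rule Q_deg_eqI[of _ 0])
  show "\<theta> 0 (unit_cochain X) \<in> Q_deg (int 0)" "qone m \<in> Q_deg (int 0)" using \<theta>_Q_deg qone_Q_deg by simp_all
  fix \<sigma> E assume c: "(\<sigma>, E) \<in> cells 0"
  have "pairing (unit_cochain X) (cube_chain m (\<sigma>, E)) = pairing (\<lambda>_. 1) (cube_chain m (\<sigma>, E))"
    by (rule pairing_cube_chain_cong[OF c]) (simp add: unit_cochain_def)
  also have "\<dots> = 1" using pairing_cube_chain[of \<sigma> 0] cells_nat[OF c] by simp
  also have "1 = qone m (\<sigma>, E)" using cells_nat[OF c] unfolding cell_set_iff by (auto simp: qone_def)
  finally show "\<theta> 0 (unit_cochain X) (\<sigma>, E) = qone m (\<sigma>, E)" using \<theta>_cell[OF c, of "unit_cochain X"] by simp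
qed

section \<open>The isomorphism in cohomology\<close>

definition to_SR :: "int \<Rightarrow> (nat \<Rightarrow> real) cochain \<Rightarrow> SR_elem" where
  "to_SR p \<phi> = lift (\<theta> p \<phi>)"

lemma to_SR: "to_SR p \<phi> \<in> carrier SR" "evS (to_SR p \<phi>) = \<theta> p \<phi>"
  unfolding to_SR_def using lift[OF Q_deg_Q[OF \<theta>_Q_deg]] by blast+

lemma to_SR_Z: "\<phi> \<in> S.Z p \<Longrightarrow> to_SR p \<phi> \<in> SR.Z p"
  using \<theta>_d[of \<phi> p] by (simp add: S.Z_iff SR_Z_iff to_SR \<theta>_Q_deg \<theta>_zero)

lemma qd_cell: "(\<sigma>, E) \<in> cells n \<Longrightarrow> qd m K a (\<sigma>, E) = pairing a (cube_d n (\<sigma>, E))"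
proof -
  assume c: "(\<sigma>, E) \<in> cells n"
  have "\<sigma> = {}" if "n = 0" using cells_nat[OF c] that by auto
  then show ?thesis using cells_nat[OF c] by (auto simp: qd_def cube_d_def cube_bd_def)
qed

text \<open>The implication from right to left is compatibility with the differentials; the converse
  is \<open>singular_dual_inj\<close>, with a primitive in \<open>R / I_K\<close> as
  \<alpha>.\<close>

lemma to_SR_B:
  assumes p: "0 \<le> p" and \<phi>: "\<phi> \<in> S.Z p"
  shows "to_SR p \<phi> \<in> SR.B p \<longleftrightarrow> \<phi> \<in> S.B p"
proof
  assume "\<phi> \<in> S.B p"
  then obtain \<psi> where "\<psi> \<in> carrier (SX (p - 1))" "\<phi> = dX (p - 1) \<psi>" by (auto simp: S.B_iff)
  then have "\<theta> p \<phi> = qd m K (\<theta> (p - 1) \<psi>)" using \<theta>_d[of \<psi> "p - 1"] by simp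
  then show "to_SR p \<phi> \<in> SR.B p" using \<theta>_Q_deg by (auto simp: SR_B_iff to_SR)
next
  assume "to_SR p \<phi> \<in> SR.B p"
  then obtain q where q: "q \<in> Q_deg (p - 1)" "\<theta> p \<phi> = qd m K q" by (auto simp: SR_B_iff to_SR)
  obtain n where n: "p = int n" using p nonneg_int_cases by metis
  have car: "\<phi> \<in> carrier (SX p)" and cocyc: "dX p \<phi> = (\<lambda>_. 0)" using \<phi> by (auto simp: S.Z_iff)
  have "\<exists>\<beta>. \<forall>s\<in>X_simplices n. \<phi> s = pairing \<beta> (sing_bd n s)"
  proof (rule singular_dual_inj[where \<alpha> = q])
    fix s assume s: "s \<in> X_simplices (Suc n)"
    then show "pairing \<phi> (sing_bd (Suc n) s) = 0"
      using fun_cong[OF cocyc, of s] by (simp add: \<delta>_eq n nat_add_distrib)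
  next
    fix x assume "x \<in> cells n"
    moreover obtain \<sigma> E where "x = (\<sigma>, E)" by fastforce
    ultimately show "pairing \<phi> (cube_chain m x) = pairing q (cube_d n x)"
      using q(2) \<theta>_cell[of \<sigma> E n \<phi>] qd_cell[of \<sigma> E n q] n by simp
  qed
  then obtain \<beta> where b: "\<And>s. singular_simplex n X s \<Longrightarrow> \<phi> s = pairing \<beta> (sing_bd n s)" by auto
  show "\<phi> \<in> S.B p"
  proof (cases n)
    case 0
    \<comment> \<open>In degree 0 boundaries of simplices are 0, so the dual statement already says
      that \<phi> vanishes.\<close>
    have "\<phi> s = 0" for s
      using b[of s] car 0 n by (cases "singular_simplex n X s") (auto simp: SC_carrier sing_bd_def chain_boundary_def)
    then have "\<phi> = dX (p - 1) (\<lambda>_. 0)" by (auto simp: \<delta>_zero)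
    moreover have "(\<lambda>_. 0) \<in> carrier (SX (p - 1))" by (simp add: SC_carrier)
    ultimately show ?thesis unfolding S.B_iff by blast
  next
    case (Suc k)
    \<comment> \<open>The cut-off turns \<beta> into a cochain; on the boundary of a simplex of the
      space it changes nothing.\<close>
    let ?\<psi> = "\<lambda>s. if singular_simplex k X s then \<beta> s else 0"
    have k: "p - 1 = int k" using n Suc by simp
    have "?\<psi> \<in> carrier (SX (p - 1))" unfolding k by (simp add: SC_carrier)
    moreover have "\<phi> s = dX (p - 1) ?\<psi> s" for s
    proof (cases "singular_simplex n X s")
      case True
      have "Poly_Mapping.keys (sing_bd n s) \<subseteq> X_simplices k"
        using free_complex.keys_d[OF free_complex_singular, of s k X] True Suc by simp
      then have "pairing \<beta> (sing_bd n s) = pairing ?\<psi> (sing_bd n s)" by (rule pairing_cong_keys) simp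
      then show ?thesis using b[OF True] True n by (simp add: \<delta>_eq)
    next
      case False
      then show ?thesis using car n by (auto simp: \<delta>_eq SC_carrier)
    qed
    ultimately show ?thesis unfolding S.B_iff by blast
  qed
qed

text \<open>This is \<open>singular_dual_surj\<close> for the cubical cocycle \<open>evS y\<close>,
  followed by cutting \<beta> and \<gamma> off to genuine cochains of the right degree.\<close>

lemma to_SR_surj:
  assumes p: "0 \<le> p" and y: "y \<in> SR.Z p"
  shows "\<exists>\<phi>\<in>S.Z p. \<exists>b\<in>SR.B p. y = b \<oplus>\<^bsub>SR\<^esub> to_SR p \<phi>"
proof -
  obtain n where n: "p = int n" using p nonneg_int_cases by metis
  have y': "y \<in> carrier SR" "evS y \<in> Q_deg p" "qd m K (evS y) = (\<lambda>_. 0)" using y by (auto simp: SR_Z_iff)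
  have "\<exists>\<beta> \<gamma>. (\<forall>s\<in>X_simplices (Suc n). pairing \<beta> (sing_bd (Suc n) s) = 0) \<and>
      (\<forall>x\<in>cells n. evS y x = pairing \<beta> (cube_chain m x) + pairing \<gamma> (cube_d n x))"
  proof (rule singular_dual_surj)
    fix x assume "x \<in> cells (Suc n)"
    moreover obtain \<sigma> E where "x = (\<sigma>, E)" by fastforce
    ultimately show "pairing (evS y) (cube_d (Suc n) x) = 0"
      using qd_cell[of \<sigma> E "Suc n" "evS y"] fun_cong[OF y'(3)] by simp
  qed
  then obtain \<beta> \<gamma> where b: "\<And>s. singular_simplex (Suc n) X s \<Longrightarrow> pairing \<beta> (sing_bd (Suc n) s) = 0"
    and g: "\<And>x. x \<in> cells n \<Longrightarrow> evS y x = pairing \<beta> (cube_chain m x) + pairing \<gamma> (cube_d n x)" by auto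
  let ?\<phi> = "\<lambda>s. if singular_simplex n X s then \<beta> s else 0"
  \<comment> \<open>The cut-off makes \<gamma> homogeneous of degree p - 1; on the boundaries of
    n-cells the values stay the same.\<close>
  let ?g = "\<lambda>c. if c \<in> cell_set m K \<and> int (card (fst c)) = p - 1 then \<gamma> c else 0"
  have gQ: "?g \<in> Q_deg (p - 1)" by (auto simp: Q_deg_def cube_cochains_def)
  have "dX p ?\<phi> s = 0" for s
  proof (cases "singular_simplex (Suc n) X s")
    case True
    have "Poly_Mapping.keys (sing_bd (Suc n) s) \<subseteq> X_simplices n"
      using free_complex.keys_d[OF free_complex_singular, of s n X] True by simp
    then have "pairing \<beta> (sing_bd (Suc n) s) = pairing ?\<phi> (sing_bd (Suc n) s)" by (rule pairing_cong_keys) simp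
    then show ?thesis using b[OF True] by (simp add: \<delta>_eq n nat_add_distrib)
  qed (simp add: \<delta>_eq n nat_add_distrib)
  then have Z: "?\<phi> \<in> S.Z p" by (auto simp: S.Z_iff SC_carrier n)
  have "evS y = (\<lambda>c. qd m K ?g c + \<theta> p ?\<phi> c)"
  proof (rule Q_deg_eqI[of _ n])
    show "evS y \<in> Q_deg (int n)" using y' n by simp
    show "(\<lambda>c. qd m K ?g c + \<theta> p ?\<phi> c) \<in> Q_deg (int n)"
      using Q_deg_add[OF _ \<theta>_Q_deg[of p]] qd_Q_deg[OF gQ] unfolding n by simp
    fix \<sigma> E assume c: "(\<sigma>, E) \<in> cells n"
    have "pairing \<gamma> (cube_d n (\<sigma>, E)) = pairing ?g (cube_d n (\<sigma>, E))"
    proof (cases n)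
      case (Suc k)
      have "Poly_Mapping.keys (cube_d n (\<sigma>, E)) \<subseteq> cells k"
        using free_complex.keys_d[OF free_complex_cells, of "(\<sigma>, E)" k] c unfolding Suc by blast
      then show ?thesis
        by (rule pairing_cong_keys) (use cells_nat n Suc in auto)
    qed (simp add: cube_d_def)
    moreover have "pairing \<beta> (cube_chain m (\<sigma>, E)) = pairing ?\<phi> (cube_chain m (\<sigma>, E))"
      by (rule pairing_cube_chain_cong[OF c]) simp
    ultimately show "evS y (\<sigma>, E) = qd m K ?g (\<sigma>, E) + \<theta> p ?\<phi> (\<sigma>, E)"
      using g[OF c] qd_cell[OF c, of ?g] \<theta>_cell[OF c, of ?\<phi>] n by simp
  qed
  moreover have lq: "lift (qd m K ?g) \<in> carrier SR" "evS (lift (qd m K ?g)) = qd m K ?g" using lift[OF qd_Q] by blast+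
  ultimately have "evS y = evS (lift (qd m K ?g) \<oplus>\<^bsub>SR\<^esub> to_SR p ?\<phi>)"
    using to_SR[of p ?\<phi>] by (simp add: evS_simps(1))
  then have "y = lift (qd m K ?g) \<oplus>\<^bsub>SR\<^esub> to_SR p ?\<phi>"
    using y'(1) lq(1) to_SR(1) SR_closed(1) by (intro SR_eqI) auto
  moreover have "lift (qd m K ?g) \<in> SR.B p" using lq gQ by (auto simp: SR_B_iff)
  ultimately show ?thesis using Z by blast
qed

definition sing_to_SR :: "int \<Rightarrow> (nat \<Rightarrow> real) cochain set \<Rightarrow> SR_elem set" where
  "sing_to_SR p = coset_map (SRp p) (SR.B p) (to_SR p)"

lemma to_SR_mult: "to_SR p (\<phi> \<otimes>\<^bsub>SX p\<^esub> \<psi>) = to_SR p \<phi> \<otimes>\<^bsub>SRp p\<^esub> to_SR p \<psi>"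
  unfolding SRp_simps by (rule SR_eqI) (simp_all add: to_SR SR_closed evS_simps(1) \<theta>_add)

lemma sing_to_SR:
  assumes p: "0 \<le> p"
  shows "sing_to_SR p \<in> iso (singular_cohomology X p) (SR_cohomology m K p)"
    and "\<phi> \<in> S.Z p \<Longrightarrow> sing_to_SR p (S.cls p \<phi>) = SR.cls p (to_SR p \<phi>)"
proof -
  have car: "to_SR p \<phi> \<in> carrier (SRp p)" for \<phi> by (simp add: SRp_iff to_SR \<theta>_Q_deg)
  have surj: "\<exists>\<phi>\<in>S.Z p. \<exists>b\<in>SR.B p. y = b \<otimes>\<^bsub>SRp p\<^esub> to_SR p \<phi>" if "y \<in> SR.Z p" for y
    using to_SR_surj[OF p that] by simp
  note iso = cohomology_iso[OF cochain_complex_singular cochain_complex_SR, where f = "to_SR p",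
      OF car to_SR_mult to_SR_Z to_SR_B[OF p] surj]
  show "sing_to_SR p \<in> iso (singular_cohomology X p) (SR_cohomology m K p)"
    unfolding sing_to_SR_def[abs_def] singular_cohomology_def SR_cohomology_def by (rule iso(1))
  show "\<phi> \<in> S.Z p \<Longrightarrow> sing_to_SR p (S.cls p \<phi>) = SR.cls p (to_SR p \<phi>)"
    unfolding sing_to_SR_def S.cls_def SR.cls_def by (rule iso(2))
qed

abbreviation cupmult where "cupmult \<equiv> cohomology_mult SX dX (cup X)"

lemma carrier_singular_cohomology: "carrier (singular_cohomology X p) = S.cls p ` S.Z p"
  by (simp add: singular_cohomology_def S.carrier_cohomology)

lemma sing_to_SR_mult:
  assumes pq: "0 \<le> p" "0 \<le> q" and V: "V \<in> carrier (singular_cohomology X p)" and W: "W \<in> carrier (singular_cohomology X q)"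
  shows "sing_to_SR (p + q) (cupmult p q V W) = SRmult p q (sing_to_SR p V) (sing_to_SR q W)"
proof -
  obtain \<phi> \<psi> where c: "\<phi> \<in> S.Z p" "V = S.cls p \<phi>" "\<psi> \<in> S.Z q" "W = S.cls q \<psi>"
    using V W by (auto simp: carrier_singular_cohomology)
  have "to_SR (p + q) (cup X p q \<phi> \<psi>) = to_SR p \<phi> \<otimes>\<^bsub>SR\<^esub> to_SR q \<psi>"
    by (rule SR_eqI) (simp_all add: to_SR SR_closed evS_simps(2) \<theta>_cup pq)
  then show ?thesis
    using pq c Sm.mul_Z[OF pq c(1,3)]
    by (simp add: Sm.cohomology_mult_cls SRm.cohomology_mult_cls sing_to_SR(2) to_SR_Z)
qed

lemma sing_to_SR_unit: "sing_to_SR 0 (S.cls 0 (unit_cochain X)) = SR.cls 0 \<one>\<^bsub>SR\<^esub>"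
proof -
  have "to_SR 0 (unit_cochain X) = \<one>\<^bsub>SR\<^esub>"
    by (rule SR_eqI) (simp_all add: to_SR SR_closed \<theta>_unit evS_one)
  then show ?thesis using sing_to_SR(2)[of 0 "unit_cochain X"] Sm.e_Z by simp
qed

lemma graded_algebra_singular: "graded_algebra (singular_cohomology X) cupmult (S.cls 0 (unit_cochain X))"
  using Sm.graded_algebra_cohomology by (simp add: singular_cohomology_def[abs_def] S.cls_def)

lemma singular_cohomology_ring_eq:
  "singular_cohomology_ring X = graded_ring (singular_cohomology X) cupmult (S.cls 0 (unit_cochain X))"
  by (simp add: singular_cohomology_ring_def cohomology_ring_def singular_cohomology_def[abs_def] S.cls_def)

text \<open>The comparison has a cochain formula only out of singular cochains, so this direction is
  an inverse in cohomology; it is multiplicative as the inverse of a multiplicative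
  bijection.\<close>

definition SR_to_sing :: "int \<Rightarrow> SR_elem set \<Rightarrow> (nat \<Rightarrow> real) cochain set" where
  "SR_to_sing p = inv_into (carrier (singular_cohomology X p)) (sing_to_SR p)"

lemma SR_to_sing_iso:
  assumes p: "0 \<le> p"
  shows "SR_to_sing p \<in> iso (SR_cohomology m K p) (singular_cohomology X p)"
proof -
  have "group (singular_cohomology X p)"
    unfolding singular_cohomology_def by (rule comm_group.axioms(2)[OF S.comm_group_cohomology])
  then show ?thesis unfolding SR_to_sing_def by (rule group.iso_set_sym[OF _ sing_to_SR(1)[OF p]])
qed

lemma SR_to_sing_inverse:
  assumes "0 \<le> p"
  shows "V \<in> carrier (singular_cohomology X p) \<Longrightarrow> SR_to_sing p (sing_to_SR p V) = V"
    and "W \<in> carrier (SR_cohomology m K p) \<Longrightarrow> SR_to_sing p W \<in> carrier (singular_cohomology X p) \<and> sing_to_SR p (SR_to_sing p W) = W"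
proof -
  have bij: "bij_betw (sing_to_SR p) (carrier (singular_cohomology X p)) (carrier (SR_cohomology m K p))"
    using sing_to_SR(1)[OF assms] by (simp add: iso_def)
  show "V \<in> carrier (singular_cohomology X p) \<Longrightarrow> SR_to_sing p (sing_to_SR p V) = V"
    unfolding SR_to_sing_def using bij by (rule bij_betw_inv_into_left)
  show "W \<in> carrier (SR_cohomology m K p) \<Longrightarrow> SR_to_sing p W \<in> carrier (singular_cohomology X p) \<and> sing_to_SR p (SR_to_sing p W) = W"
    unfolding SR_to_sing_def using bij bij_betw_inv_into_right[OF bij] bij_betwE[OF bij_betw_inv_into[OF bij]] by blast
qed

lemma SR_to_sing_ring_iso: "graded_map SR_to_sing \<in> ring_iso (SR_cohomology_ring m K) (singular_cohomology_ring X)"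
  unfolding SR_cohomology_ring_eq singular_cohomology_ring_eq
proof (rule graded_map_ring_iso[OF graded_algebra_SR graded_algebra_singular SR_to_sing_iso])
  fix p q :: int and V W
  assume pq: "0 \<le> p" "0 \<le> q" and V: "V \<in> carrier (SR_cohomology m K p)" and W: "W \<in> carrier (SR_cohomology m K q)"
  let ?V = "SR_to_sing p V" and ?W = "SR_to_sing q W"
  note v = SR_to_sing_inverse(2)[OF pq(1) V] and w = SR_to_sing_inverse(2)[OF pq(2) W]
  have "sing_to_SR (p + q) (cupmult p q ?V ?W) = SRmult p q V W"
    using sing_to_SR_mult[OF pq, of ?V ?W] v w by simp
  moreover have "cupmult p q ?V ?W \<in> carrier (singular_cohomology X (p + q))"
    using graded_algebra.M_closed[OF graded_algebra_singular pq] v w by blast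
  ultimately show "SR_to_sing (p + q) (SRmult p q V W) = cupmult p q ?V ?W"
    using SR_to_sing_inverse(1)[of "p + q" "cupmult p q ?V ?W"] pq by simp
next
  have "S.cls 0 (unit_cochain X) \<in> carrier (singular_cohomology X 0)"
    unfolding carrier_singular_cohomology using Sm.e_Z by blast
  then show "SR_to_sing 0 (SR.cls 0 \<one>\<^bsub>SR\<^esub>) = S.cls 0 (unit_cochain X)"
    using SR_to_sing_inverse(1)[of 0] sing_to_SR_unit by fastforce
qed

end

theorem theorem1p6:
  fixes m :: nat and K :: "nat set set"
  assumes "m > 0" and "simplicial_complex_on m K"
  shows "(\<forall>p\<ge>0. lambda_cohomology m K p \<in> iso (SR_cohomology m K p) (reduced_sum m K p) \<and>
                 lambda_cohomology_inv m K p \<in> iso (reduced_sum m K p) (SR_cohomology m K p)) \<and>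
    ring (reduced_sum_ring m K) \<and>
    ring (SR_cohomology_ring m K) \<and>
    ring (singular_cohomology_ring (real_moment_angle m K)) \<and>
    graded_map (lambda_cohomology_inv m K)
      \<in> ring_iso (reduced_sum_ring m K) (SR_cohomology_ring m K) \<and>
    (\<exists>\<phi>. (\<forall>p\<ge>0. \<phi> p \<in> iso (SR_cohomology m K p)
                              (singular_cohomology (real_moment_angle m K) p)) \<and>
         graded_map \<phi> \<in> ring_iso (SR_cohomology_ring m K)
                                  (singular_cohomology_ring (real_moment_angle m K)))"
proof -
  interpret moment_angle_complex m K by unfold_locales (rule assms(2))
  have "ring (reduced_sum_ring m K)" "ring (SR_cohomology_ring m K)" "ring (singular_cohomology_ring X)"
    unfolding reduced_sum_ring_def SR_cohomology_ring_eq singular_cohomology_ring_eq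
    using graded_algebra_reduced graded_algebra_SR graded_algebra_singular
    by (simp_all only: graded_algebra.ring_graded_ring)
  then show ?thesis
    using lambda_cohomology_iso lambda_cohomology_inv_iso lambda_inv_ring_iso SR_to_sing_iso SR_to_sing_ring_iso by blast
qed

end
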